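(* Let $n\ge 2$, $1\le r\le n-1$ and $1\le m\le \binom{n+1}{2}-1$. For a generic flag of linear subspaces $\mathcal V\subset\mathcal U$ of the space of complex symmetric $n\times n$-matrices with $\dim\mathcal V=m-1$ and $\dim\mathcal U=m+1$, the variety $$Z=\{XY=0\}^r\cap\bigl(\mathbb P\mathcal V^\perp\times\mathbb P\mathcal U\bigr)$$ is empty unless Pataki's inequalities $$\binom{n-r+1}{2}\le m\qquad\text{and}\qquad \binom{r+1}{2}\le\binom{n+1}{2}-m$$ hold. If these inequalities hold, then $Z$ is reduced, non-empty and zero-dimensional, and at each point $(X,Y)$ of $Z$ one has $\operatorname{rank}X=n-r$ and $\operatorname{rank}Y=r$. The cardinality of $Z$ depends only on $m,n$ and $r$.
   Context: Let $\mathcal S^n$ be the $\binom{n+1}{2}$-dimensional complex vector space of symmetric $n\times n$-matrices, with dual space $(\mathcal S^n)^*$ identified with symmetric matrices through the pairing $(X,Y)\mapsto \operatorname{trace}(X\cdot Y)$. For a linear subspace $\mathcal W\subset\mathcal S^n$, $\mathcal W^\perp\subset(\mathcal S^n)^*$ is its annihilator, and $\mathbb P\mathcal W$ denotes the complex projective space of lines in $\mathcal W$. The set $\{XY=0\}^r\subset\mathbb P(\mathcal S^n)^*\times\mathbb P\mathcal S^n$ is the variety (with reduced structure) of all pairs $(X,Y)$ of (nonzero, up to scaling) symmetric matrices with matrix product $X\cdot Y=0$, $\operatorname{rank}X\le n-r$ and $\operatorname{rank}Y\le r$. The intersection $Z$ is taken scheme-theoretically. "Generic" means: the statement holds for all flags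 $(\mathcal V\subset\mathcal U)$ in some non-empty Zariski open subset of the variety of flags of subspaces of $\mathcal S^n$ of dimensions $(m-1,m+1)$; "the cardinality depends only on $m,n,r$" means that it is the same for all such generic flags. *)

theory Defs
  imports "HOL-Analysis.Analysis"
begin

section \<open>The complex vector space of symmetric matrices\<close>

definition cscale :: "complex \<Rightarrow> complex^'n^'n \<Rightarrow> complex^'n^'n" where
  "cscale c A = (\<chi> i j. c * A $ i $ j)"

global_interpretation mat: vector_space "cscale :: complex \<Rightarrow> complex^'n^'n \<Rightarrow> complex^'n^'n"
  by unfold_locales (simp_all add: cscale_def vec_eq_iff algebra_simps)

definition Sym :: "(complex^'n^'n) set" where
  "Sym = {A. transpose A = A}"

text \<open>The annihilator, with the dual of \<^term>\<open>Sym\<close> identified with \<^term>\<open>Sym\<close> by the trace pairing.\<close>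

definition annihilator :: "(complex^'n^'n) set \<Rightarrow> (complex^'n^'n) set" where
  "annihilator W = {X \<in> Sym. \<forall>Y\<in>W. trace (X ** Y) = 0}"

section \<open>Polynomial functions and Zariski topologies\<close>

text \<open>The algebra of functions generated by a set \<open>C\<close> of coordinate functions. As the complex
  field is infinite, this is the polynomial ring when \<open>C\<close> consists of all coordinates of an
  affine space.\<close>

inductive_set poly_funs :: "('a \<Rightarrow> complex) set \<Rightarrow> ('a \<Rightarrow> complex) set"
  for C :: "('a \<Rightarrow> complex) set" where
  const: "(\<lambda>x. c) \<in> poly_funs C"
| coord: "f \<in> C \<Longrightarrow> f \<in> poly_funs C"
| add: "f \<in> poly_funs C \<Longrightarrow> g \<in> poly_funs C \<Longrightarrow> (\<lambda>x. f x + g x) \<in> poly_funs C"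
| mult: "f \<in> poly_funs C \<Longrightarrow> g \<in> poly_funs C \<Longrightarrow> (\<lambda>x. f x * g x) \<in> poly_funs C"

text \<open>The Zariski topology on a subset \<open>S\<close> of affine space.\<close>

definition zariski :: "('a \<Rightarrow> complex) set \<Rightarrow> 'a set \<Rightarrow> 'a topology" where
  "zariski C S = topology_generated_by {{x \<in> S. f x \<noteq> 0} | f. f \<in> poly_funs C}"

definition vanishing_ideal :: "('a \<Rightarrow> complex) set \<Rightarrow> 'a set \<Rightarrow> ('a \<Rightarrow> complex) set" where
  "vanishing_ideal C S = {f \<in> poly_funs C. \<forall>x\<in>S. f x = 0}"

definition ideal_sum :: "('a \<Rightarrow> complex) set \<Rightarrow> ('a \<Rightarrow> complex) set \<Rightarrow> ('a \<Rightarrow> complex) set" where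
  "ideal_sum I J = {(\<lambda>x. f x + g x) | f g. f \<in> I \<and> g \<in> J}"

definition radical_ideal :: "('a \<Rightarrow> complex) set \<Rightarrow> ('a \<Rightarrow> complex) set \<Rightarrow> bool" where
  "radical_ideal C J \<longleftrightarrow> (\<forall>f\<in>poly_funs C. \<forall>k::nat. (\<lambda>x. f x ^ k) \<in> J \<longrightarrow> f \<in> J)"

text \<open>Krull dimension of a topological space: the supremum of the lengths of chains of irreducible
  closed subsets (so the empty space has dimension \<open>-\<infinity>\<close>).\<close>

definition irreducible_closed :: "'a topology \<Rightarrow> 'a set \<Rightarrow> bool" where
  "irreducible_closed T S \<longleftrightarrow> closedin T S \<and> S \<noteq> {} \<and>
     (\<forall>A B. closedin T A \<and> closedin T B \<and> S = A \<union> B \<longrightarrow> S = A \<or> S = B)"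

definition krull_dim :: "'a topology \<Rightarrow> ereal" where
  "krull_dim T = Sup {ereal (real k) | k. \<exists>C :: nat \<Rightarrow> 'a set.
     (\<forall>i\<le>k. irreducible_closed T (C i)) \<and> (\<forall>i<k. C i \<subset> C (Suc i))}"

section \<open>Products of projective spaces of symmetric matrices\<close>

text \<open>A point of projective space is the line spanned by a nonzero matrix.\<close>

definition proj :: "(complex^'n^'n) set \<Rightarrow> (complex^'n^'n) set set" where
  "proj W = {mat.span {X} | X. X \<in> W \<and> X \<noteq> 0}"

definition pair_coords :: "((complex^'n^'n) \<times> (complex^'n^'n) \<Rightarrow> complex) set" where
  "pair_coords = (\<Union>i j. {\<lambda>p. fst p $ i $ j, \<lambda>p. snd p $ i $ j})"

definition bihomogeneous :: "((complex^'n^'n) \<times> (complex^'n^'n) \<Rightarrow> complex) \<Rightarrow> bool" where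
  "bihomogeneous f \<longleftrightarrow> f \<in> poly_funs pair_coords \<and>
     (\<exists>d e :: nat. \<forall>s t X Y. f (cscale s X, cscale t Y) = s ^ d * t ^ e * f (X, Y))"

text \<open>The Zariski topology on \<open>proj Sym \<times> proj Sym\<close>; its basic open sets are the complements of
  the zero loci of bihomogeneous polynomials.\<close>

definition biproj_topology ::
    "((complex^'n^'n) set \<times> (complex^'n^'n) set) topology" where
  "biproj_topology = topology_generated_by
     {{(mat.span {X}, mat.span {Y}) | X Y.
         X \<in> Sym - {0} \<and> Y \<in> Sym - {0} \<and> f (X, Y) \<noteq> 0} | f. bihomogeneous f}"

text \<open>The part of a subset \<open>A\<close> of \<open>proj Sym \<times> proj Sym\<close> in the standard affine chart given by
  nonvanishing of the \<open>(i,j)\<close> entry of the first and the \<open>(k,l)\<close> entry of the second matrix,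
  realised by normalising these entries to 1.\<close>

definition affine_part ::
    "'n \<Rightarrow> 'n \<Rightarrow> 'n \<Rightarrow> 'n \<Rightarrow> ((complex^'n^'n) set \<times> (complex^'n^'n) set) set
      \<Rightarrow> ((complex^'n^'n) \<times> (complex^'n^'n)) set" where
  "affine_part i j k l A = {(X, Y). X \<in> Sym \<and> Y \<in> Sym \<and> X $ i $ j = 1 \<and> Y $ k $ l = 1 \<and>
     (mat.span {X}, mat.span {Y}) \<in> A}"

text \<open>Reducedness of the scheme-theoretic intersection of two closed subvarieties \<open>A\<close> and \<open>B\<close>
  (with their reduced structures) of \<open>proj Sym \<times> proj Sym\<close>. On each chart of the standard affine
  cover the intersection is the spectrum of the polynomial ring modulo the sum of the two vanishing
  ideals, and that ring must have no nonzero nilpotents. The equations of the chart itself lie in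
  both vanishing ideals.\<close>

definition reduced_intersection ::
    "((complex^'n^'n) set \<times> (complex^'n^'n) set) set \<Rightarrow>
     ((complex^'n^'n) set \<times> (complex^'n^'n) set) set \<Rightarrow> bool" where
  "reduced_intersection A B \<longleftrightarrow>
     (\<forall>i j k l. radical_ideal pair_coords
        (ideal_sum (vanishing_ideal pair_coords (affine_part i j k l A))
                   (vanishing_ideal pair_coords (affine_part i j k l B))))"

definition XY_zero :: "nat \<Rightarrow> ((complex^'n^'n) set \<times> (complex^'n^'n) set) set" where
  "XY_zero r = {(mat.span {X}, mat.span {Y}) | X Y.
     X \<in> Sym - {0} \<and> Y \<in> Sym - {0} \<and> X ** Y = 0 \<and>
     rank X \<le> CARD('n) - r \<and> rank Y \<le> r}"

definition linear_section ::
    "(complex^'n^'n) set \<Rightarrow> (complex^'n^'n) set \<Rightarrow>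
     ((complex^'n^'n) set \<times> (complex^'n^'n) set) set" where
  "linear_section V U = proj (annihilator V) \<times> proj U"

section \<open>The flag variety\<close>

definition flags :: "nat \<Rightarrow> ((complex^'n^'n) set \<times> (complex^'n^'n) set) set" where
  "flags m = {(V, U). mat.subspace V \<and> mat.subspace U \<and> V \<subseteq> U \<and> U \<subseteq> Sym \<and>
     mat.dim V = m - 1 \<and> mat.dim U = m + 1}"

text \<open>Every flag comes from a frame, i.e. a linearly independent tuple \<open>A 0, \<dots>, A m\<close>. The frames
  form an open subset of the affine space of all tuples of symmetric matrices, and the flag variety
  is the quotient of the frames by the action of a parabolic subgroup of the general linear group;
  it carries the quotient topology.\<close>

definition frames :: "nat \<Rightarrow> (nat \<Rightarrow> complex^'n^'n) set" where
  "frames m = {A \<in> {..m} \<rightarrow>\<^sub>E Sym. inj_on A {..m} \<and> mat.independent (A ` {..m})}"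

definition frame_coords :: "nat \<Rightarrow> ((nat \<Rightarrow> complex^'n^'n) \<Rightarrow> complex) set" where
  "frame_coords m = {\<lambda>A. A q $ i $ j | q i j. q \<le> m}"

definition flag_of :: "nat \<Rightarrow> (nat \<Rightarrow> complex^'n^'n) \<Rightarrow> (complex^'n^'n) set \<times> (complex^'n^'n) set" where
  "flag_of m A = (mat.span (A ` {..<m - 1}), mat.span (A ` {..m}))"

definition zariski_open_flags ::
    "nat \<Rightarrow> ((complex^'n^'n) set \<times> (complex^'n^'n) set) set \<Rightarrow> bool" where
  "zariski_open_flags m G \<longleftrightarrow> G \<subseteq> flags m \<and>
     openin (zariski (frame_coords m) (frames m)) {A \<in> frames m. flag_of m A \<in> G}"

end

theory Submission
  imports Defs "HOL-Computational_Algebra.Fundamental_Theorem_Algebra"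
begin

text \<open>
  Fix a frame \<open>A 0, \<dots>, A m\<close> of a flag. A point of the intersection is a pair of lines spanned by a
  symmetric matrix \<open>X\<close> orthogonal to the first \<open>m - 1\<close> matrices and a combination
  \<open>Y = c 0 A 0 + \<dots> + c m A m\<close>, with \<open>X Y = 0\<close> and bounded ranks (\<open>solution\<close>). The pairs
  \<open>(X, Y)\<close> with product zero are covered by finitely many charts (\<open>chart_cover\<close>), one for each
  coordinate subspace over which a space between the image of \<open>Y\<close> and the kernel of \<open>X\<close> is a graph.

  The proof rests on one parametrisation. The set of all frames together with a solution has the
  same dimension as the set of all frames. Over each chart its points are encoded by tuples of
  symmetric matrices in such a way that the projection to the frames becomes a polynomial map
  \<open>main_map\<close> from the affine space of these tuples to itself: a point of the source stores a
  solution and the free part of the frame, and its value is the frame. Two facts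
  about polynomial maps between spaces of equal dimension then control generic frames:
  the image of a hypersurface is contained in a hypersurface (\<open>image_of_hypersurface\<close>), and so is
  the set of values at points with singular differential (\<open>critical_values\<close>). Both follow from the
  algebraic dependence of too many polynomials. Hence for a generic frame each solution has the
  full ranks, has nonzero trace and nonzero leading coefficient, and comes from a point where the map
  is immersive; such a frame is called \<open>good\<close> (\<open>generic_good\<close>).

  Being immersive amounts to the regularity of the solution: the linearised equations have only the
  solutions that come from rescaling \<open>X\<close> and \<open>Y\<close> (\<open>regular_of_immersive\<close>, \<open>immersive_of_regular\<close>).
  Regularity has three consequences. It forces Pataki's inequalities, because otherwise \<open>X\<close> or \<open>Y\<close>
  alone could be deformed (\<open>regular_imp_pataki\<close>). It makes the intersection reduced, by a Jacobian
  criterion for radical ideals that is derived from the weak Nullstellensatz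
  (\<open>jacobian_criterion_radical\<close>, \<open>reduced_intersection_good\<close>). And it keeps two solutions from
  merging in a limit.

  For the number of solutions, two good frames are joined by a complex line. A nonzero polynomial in
  one variable has finitely many zeros, so the good points of the line form a connected set. Over
  this set the normalised solutions stay bounded, since a limit of rescaled solutions is a
  solution to which goodness applies; they do not merge, by regularity; and they do not disappear,
  because an immersive map is open. So their number is finite and constant
  (\<open>card_normal_solutions_constant\<close>). If Pataki's inequalities hold, an explicit immersive point
  (\<open>immersive_point_exists\<close>) shows that the number is positive.

  Finally the conditions on frames are transported to flags: the frames whose flag also has a frame
  in a principal open set of good frames form a Zariski open set (\<open>zariski_open_flags_image\<close>).
\<close>

section \<open>Polynomial functions\<close>

lemma poly_funs_pullback:
  assumes "f \<in> poly_funs C" "\<And>g. g \<in> C \<Longrightarrow> (\<lambda>y. g (\<phi> y)) \<in> poly_funs D"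
  shows "(\<lambda>y. f (\<phi> y)) \<in> poly_funs D"
  using assms(1) by induction (auto intro: poly_funs.intros assms(2))

lemma poly_funs_cmult: "f \<in> poly_funs C \<Longrightarrow> (\<lambda>x. c * f x) \<in> poly_funs C"
  using poly_funs.mult[OF poly_funs.const] by blast

lemma poly_funs_uminus: "f \<in> poly_funs C \<Longrightarrow> (\<lambda>x. - f x) \<in> poly_funs C"
  using poly_funs_cmult[of f C "-1"] by simp

lemma poly_funs_diff: "f \<in> poly_funs C \<Longrightarrow> g \<in> poly_funs C \<Longrightarrow> (\<lambda>x. f x - g x) \<in> poly_funs C"
  using poly_funs.add[of f C "\<lambda>x. - g x"] poly_funs_uminus[of g C] by simp

lemma poly_funs_sum:
  "(\<And>i. i \<in> I \<Longrightarrow> f i \<in> poly_funs C) \<Longrightarrow> (\<lambda>x. \<Sum>i\<in>I. f i x) \<in> poly_funs C"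
  by (induction I rule: infinite_finite_induct) (auto intro: poly_funs.intros)

lemma poly_funs_prod:
  "(\<And>i. i \<in> I \<Longrightarrow> f i \<in> poly_funs C) \<Longrightarrow> (\<lambda>x. \<Prod>i\<in>I. f i x) \<in> poly_funs C"
  by (induction I rule: infinite_finite_induct) (auto intro: poly_funs.intros)

lemma poly_funs_power: "f \<in> poly_funs C \<Longrightarrow> (\<lambda>x. f x ^ j) \<in> poly_funs C"
  by (induction j) (auto intro: poly_funs.intros)

lemma poly_funs_det:
  assumes "\<And>i j. (\<lambda>x. M x $ i $ j) \<in> poly_funs C"
  shows "(\<lambda>x. det (M x)) \<in> poly_funs C"
  unfolding det_def by (intro poly_funs_sum poly_funs_cmult poly_funs_prod assms)

lemma poly_funs_along_line:
  assumes "f \<in> poly_funs C" "\<And>g. g \<in> C \<Longrightarrow> \<exists>p. \<forall>s. g (\<phi> s) = poly p s"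
  shows "\<exists>p. \<forall>s. f (\<phi> s) = poly p s"
  using assms(1)
proof induction
  case (const c)
  show ?case by (rule exI[of _ "[:c:]"]) simp
next
  case (add f g)
  then show ?case by (metis poly_add)
next
  case (mult f g)
  then show ?case by (metis poly_mult)
qed (use assms(2) in blast)

text \<open>Along a line a polynomial function is a polynomial in one variable, so it has finitely many
  zeros unless it vanishes on the whole line.\<close>

lemma finite_zeros_along_line:
  assumes "f \<in> poly_funs C" "\<And>g. g \<in> C \<Longrightarrow> \<exists>p. \<forall>s. g (\<phi> s) = poly p s" "f (\<phi> s0) \<noteq> 0"
  shows "finite {s. f (\<phi> s) = 0}"
proof -
  obtain p where p: "\<forall>s. f (\<phi> s) = poly p s"
    using poly_funs_along_line[where \<phi> = \<phi>, OF assms(1,2)] by blast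
  with assms(3) have "p \<noteq> 0" by auto
  then show ?thesis using p poly_roots_finite[of p] by simp
qed

text \<open>The ring of polynomial functions has no zero divisors: two nonzero functions can be
  compared on the line that joins points where they do not vanish.\<close>

lemma common_nonzero_on_line:
  assumes "f \<in> poly_funs C" "g \<in> poly_funs C"
    and "\<And>h. h \<in> C \<Longrightarrow> \<exists>p. \<forall>s. h (\<phi> s) = poly p s"
    and "f (\<phi> s0) \<noteq> 0" "g (\<phi> s1) \<noteq> 0"
  shows "\<exists>s. f (\<phi> s) \<noteq> 0 \<and> g (\<phi> s) \<noteq> 0"
proof -
  have "finite ({s. f (\<phi> s) = 0} \<union> {s. g (\<phi> s) = 0})"
    using finite_zeros_along_line[of f C \<phi>] finite_zeros_along_line[of g C \<phi>] assms by blast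
  then have "{s. f (\<phi> s) = 0} \<union> {s. g (\<phi> s) = 0} \<noteq> UNIV"
    using infinite_UNIV_char_0[where 'a = complex] by metis
  then show ?thesis by blast
qed

definition vcoords :: "(complex^'k \<Rightarrow> complex) set" where
  "vcoords = range (\<lambda>k x. x $ k)"

lemma vcoord: "(\<lambda>x. x $ k) \<in> poly_funs vcoords"
  by (rule poly_funs.coord) (simp add: vcoords_def)

lemma vcoords_line: "h \<in> vcoords \<Longrightarrow> \<exists>p. \<forall>s. h (x + s *s v) = poly p s"
proof -
  assume "h \<in> vcoords"
  then obtain k where "h = (\<lambda>x. x $ k)" by (auto simp: vcoords_def)
  then show ?thesis by (intro exI[of _ "[:x $ k, v $ k:]"]) simp
qed

lemma common_nonzero:
  fixes f g :: "complex^'k \<Rightarrow> complex"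
  assumes "f \<in> poly_funs vcoords" "g \<in> poly_funs vcoords" "f x \<noteq> 0" "g y \<noteq> 0"
  shows "\<exists>z. f z \<noteq> 0 \<and> g z \<noteq> 0"
proof -
  have "\<exists>s. f (x + s *s (y - x)) \<noteq> 0 \<and> g (x + s *s (y - x)) \<noteq> 0"
    by (rule common_nonzero_on_line[of f vcoords g _ 0 1, OF assms(1,2) vcoords_line])
      (use assms in auto)
  then show ?thesis by blast
qed

lemma common_nonzero_prod:
  fixes f :: "'b \<Rightarrow> complex^'k \<Rightarrow> complex"
  assumes "finite I" "\<And>i. i \<in> I \<Longrightarrow> f i \<in> poly_funs vcoords" "\<And>i. i \<in> I \<Longrightarrow> \<exists>x. f i x \<noteq> 0"
  shows "\<exists>x. (\<Prod>i\<in>I. f i x) \<noteq> 0"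
  using assms
proof (induction I rule: finite_induct)
  case (insert i I)
  then obtain x y where "f i x \<noteq> 0" "(\<Prod>i\<in>I. f i y) \<noteq> 0" by (meson insertCI)
  moreover have "(\<lambda>y. \<Prod>i\<in>I. f i y) \<in> poly_funs vcoords"
    by (intro poly_funs_prod insert.prems(1)) simp
  ultimately have "\<exists>z. f i z \<noteq> 0 \<and> (\<Prod>i\<in>I. f i z) \<noteq> 0"
    by (intro common_nonzero) (use insert.prems in auto)
  then show ?case using insert.hyps by simp
qed simp

section \<open>Algebraic dependence\<close>

lemma homogeneous_system:
  fixes a :: "'a \<Rightarrow> 'b \<Rightarrow> 'f::field"
  assumes "finite S" "finite T" "card S < card T"
  shows "\<exists>b. (\<exists>\<beta>\<in>T. b \<beta> \<noteq> 0) \<and> (\<forall>\<alpha>\<in>S. (\<Sum>\<beta>\<in>T. b \<beta> * a \<alpha> \<beta>) = 0)"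
  using assms
proof (induction S arbitrary: T a rule: finite_induct)
  case empty
  then have "T \<noteq> {}" by auto
  then show ?case by (intro exI[of _ "\<lambda>_. 1"]) auto
next
  case (insert \<alpha>0 S)
  show ?case
  proof (cases "\<forall>\<beta>\<in>T. a \<alpha>0 \<beta> = 0")
    case True
    obtain b where "\<exists>\<beta>\<in>T. b \<beta> \<noteq> 0" "\<forall>\<alpha>\<in>S. (\<Sum>\<beta>\<in>T. b \<beta> * a \<alpha> \<beta>) = 0"
      using insert.IH[of T a] insert.prems insert.hyps by auto
    then show ?thesis using True by (intro exI[of _ b]) auto
  next
    case False
    then obtain \<beta>0 where \<beta>0: "\<beta>0 \<in> T" "a \<alpha>0 \<beta>0 \<noteq> 0" by blast
    define T' where "T' = T - {\<beta>0}"
    have T': "finite T'" "card S < card T'" "\<beta>0 \<notin> T'" "T = insert \<beta>0 T'"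
      using insert.prems insert.hyps \<beta>0(1) by (auto simp: T'_def)
    obtain b where b: "\<exists>\<beta>\<in>T'. b \<beta> \<noteq> 0"
      "\<forall>\<alpha>\<in>S. (\<Sum>\<beta>\<in>T'. b \<beta> * (a \<alpha> \<beta> - a \<alpha>0 \<beta> / a \<alpha>0 \<beta>0 * a \<alpha> \<beta>0)) = 0"
      using insert.IH[OF T'(1,2), of "\<lambda>\<alpha> \<beta>. a \<alpha> \<beta> - a \<alpha>0 \<beta> / a \<alpha>0 \<beta>0 * a \<alpha> \<beta>0"] by blast
    define b' where "b' = b(\<beta>0 := - (\<Sum>\<beta>\<in>T'. b \<beta> * a \<alpha>0 \<beta>) / a \<alpha>0 \<beta>0)"
    have sum: "(\<Sum>\<beta>\<in>T. b' \<beta> * a \<alpha> \<beta>) = b' \<beta>0 * a \<alpha> \<beta>0 + (\<Sum>\<beta>\<in>T'. b \<beta> * a \<alpha> \<beta>)" for \<alpha>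
    proof -
      have "(\<Sum>\<beta>\<in>T'. b' \<beta> * a \<alpha> \<beta>) = (\<Sum>\<beta>\<in>T'. b \<beta> * a \<alpha> \<beta>)"
        using T'(3) by (intro sum.cong) (auto simp: b'_def)
      then show ?thesis using T' by simp
    qed
    have "(\<Sum>\<beta>\<in>T. b' \<beta> * a \<alpha>0 \<beta>) = 0"
      unfolding sum using \<beta>0 by (simp add: b'_def)
    moreover have "(\<Sum>\<beta>\<in>T. b' \<beta> * a \<alpha> \<beta>) = 0" if "\<alpha> \<in> S" for \<alpha>
    proof -
      have "0 = (\<Sum>\<beta>\<in>T'. b \<beta> * a \<alpha> \<beta>) - (\<Sum>\<beta>\<in>T'. b \<beta> * a \<alpha>0 \<beta>) / a \<alpha>0 \<beta>0 * a \<alpha> \<beta>0"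
        using b(2) that
        by (simp add: algebra_simps sum_subtractf sum_distrib_left sum_distrib_right sum_divide_distrib)
      then show ?thesis unfolding sum using \<beta>0 by (simp add: b'_def)
    qed
    moreover have "\<exists>\<beta>\<in>T. b' \<beta> \<noteq> 0"
      using b(1) T' by (auto simp: b'_def)
    ultimately show ?thesis by (intro exI[of _ b']) auto
  qed
qed

definition monomial :: "('k \<Rightarrow> nat) \<Rightarrow> complex^'k::finite \<Rightarrow> complex" where
  "monomial \<alpha> x = (\<Prod>k\<in>UNIV. x $ k ^ \<alpha> k)"

definition exps :: "nat \<Rightarrow> ('k \<Rightarrow> nat) set" where
  "exps e = {\<alpha>. \<forall>k. \<alpha> k < e}"

lemma exps_PiE: "exps e = PiE UNIV (\<lambda>_. {..<e})"
  by (auto simp: exps_def PiE_def extensional_def)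

lemma finite_exps: "finite (exps e :: ('k::finite \<Rightarrow> nat) set)"
  by (simp add: exps_PiE finite_PiE)

lemma card_exps: "card (exps e :: ('k::finite \<Rightarrow> nat) set) = e ^ CARD('k)"
  by (simp add: exps_PiE card_PiE)

lemma monomial_add: "monomial (\<lambda>k. \<alpha> k + \<beta> k) x = monomial \<alpha> x * monomial \<beta> x"
  by (simp add: monomial_def power_add prod.distrib)

lemma monomial_poly: "monomial \<alpha> \<in> poly_funs vcoords"
  unfolding monomial_def[abs_def] by (intro poly_funs_prod poly_funs_power vcoord)

text \<open>The bound applies to the exponent of each variable separately, which makes the monomials easy to
  count.\<close>

definition degree_below :: "nat \<Rightarrow> (complex^'k::finite \<Rightarrow> complex) \<Rightarrow> bool" where
  "degree_below e f \<longleftrightarrow> (\<exists>a. \<forall>x. f x = (\<Sum>\<alpha>\<in>exps e. a \<alpha> * monomial \<alpha> x))"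

lemma degree_belowI:
  assumes "finite I" "\<gamma> ` I \<subseteq> exps e" "\<And>x. f x = (\<Sum>i\<in>I. c i * monomial (\<gamma> i) x)"
  shows "degree_below e f"
  unfolding degree_below_def
proof (intro exI[of _ "\<lambda>\<alpha>. \<Sum>i\<in>{i \<in> I. \<gamma> i = \<alpha>}. c i"] allI)
  fix x
  have "(\<Sum>\<alpha>\<in>exps e. (\<Sum>i\<in>{i \<in> I. \<gamma> i = \<alpha>}. c i) * monomial \<alpha> x)
      = (\<Sum>\<alpha>\<in>exps e. \<Sum>i\<in>{i \<in> I. \<gamma> i = \<alpha>}. c i * monomial (\<gamma> i) x)"
    by (intro sum.cong) (auto simp: sum_distrib_right)
  also have "\<dots> = f x"
    unfolding assms(3) by (rule sum.group[OF assms(1) finite_exps assms(2)])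
  finally show "f x = (\<Sum>\<alpha>\<in>exps e. (\<Sum>i\<in>{i \<in> I. \<gamma> i = \<alpha>}. c i) * monomial \<alpha> x)" by simp
qed

lemma degree_below_const: "degree_below 1 (\<lambda>x. c)"
  by (rule degree_belowI[where I = "{()}" and \<gamma> = "\<lambda>_ _. 0" and c = "\<lambda>_. c"])
    (auto simp: exps_def monomial_def)

lemma degree_below_coord: "degree_below 2 (\<lambda>x. x $ k)"
proof (rule degree_belowI[where I = "{()}" and \<gamma> = "\<lambda>_ j. if j = k then 1 else 0" and c = "\<lambda>_. 1"])
  fix x :: "complex^'a"
  have "monomial (\<lambda>j. if j = k then 1 else 0) x = (\<Prod>j\<in>UNIV. if j = k then x $ j else 1)"
    unfolding monomial_def by (intro prod.cong) auto
  then show "x $ k = (\<Sum>i\<in>{()}. 1 * monomial (\<lambda>j. if j = k then 1 else 0) x)" by simp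
qed (auto simp: exps_def)

lemma degree_below_mono: "degree_below e f \<Longrightarrow> e \<le> e' \<Longrightarrow> degree_below e' f"
proof -
  assume "degree_below e f" "e \<le> e'"
  then obtain a where "\<And>x. f x = (\<Sum>\<alpha>\<in>exps e. a \<alpha> * monomial \<alpha> x)" by (auto simp: degree_below_def)
  moreover have "(\<lambda>\<alpha>. \<alpha>) ` exps e \<subseteq> exps e'"
    using \<open>e \<le> e'\<close> unfolding exps_def by (auto dest: spec less_le_trans)
  ultimately show ?thesis by (intro degree_belowI[OF finite_exps])
qed

lemma degree_below_add:
  assumes "degree_below e f" "degree_below e g" shows "degree_below e (\<lambda>x. f x + g x)"
proof -
  obtain a b where "\<And>x. f x = (\<Sum>\<alpha>\<in>exps e. a \<alpha> * monomial \<alpha> x)" "\<And>x. g x = (\<Sum>\<alpha>\<in>exps e. b \<alpha> * monomial \<alpha> x)"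
    using assms by (auto simp: degree_below_def)
  then show ?thesis unfolding degree_below_def
    by (intro exI[of _ "\<lambda>\<alpha>. a \<alpha> + b \<alpha>"]) (simp add: sum.distrib algebra_simps)
qed

lemma degree_below_mult:
  assumes "degree_below e f" "degree_below e' g" shows "degree_below (e + e') (\<lambda>x. f x * g x)"
proof -
  obtain a b where f: "\<And>x. f x = (\<Sum>\<alpha>\<in>exps e. a \<alpha> * monomial \<alpha> x)"
    and g: "\<And>x. g x = (\<Sum>\<alpha>\<in>exps e'. b \<alpha> * monomial \<alpha> x)"
    using assms by (auto simp: degree_below_def)
  show ?thesis
  proof (rule degree_belowI[where I = "exps e \<times> exps e'" and \<gamma> = "\<lambda>(\<alpha>, \<beta>) k. \<alpha> k + \<beta> k"
        and c = "\<lambda>(\<alpha>, \<beta>). a \<alpha> * b \<beta>"])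
    show "finite (exps e \<times> exps e' :: (('a \<Rightarrow> nat) \<times> ('a \<Rightarrow> nat)) set)" by (simp add: finite_exps)
    show "(\<lambda>(\<alpha>, \<beta>) k. \<alpha> k + \<beta> k) ` (exps e \<times> exps e') \<subseteq> exps (e + e')"
      by (auto simp: exps_def add_strict_mono)
    fix x
    show "f x * g x = (\<Sum>i\<in>exps e \<times> exps e'. (case i of (\<alpha>, \<beta>) \<Rightarrow> a \<alpha> * b \<beta>)
        * monomial (case i of (\<alpha>, \<beta>) \<Rightarrow> \<lambda>k. \<alpha> k + \<beta> k) x)"
      unfolding f g sum_product sum.cartesian_product
      by (intro sum.cong refl) (auto simp: monomial_add)
  qed
qed

lemma degree_below_power: "degree_below e f \<Longrightarrow> degree_below (j * e + 1) (\<lambda>x. f x ^ j)"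
proof (induction j)
  case 0 then show ?case using degree_below_const[of 1] by simp
next
  case (Suc j)
  then show ?case using degree_below_mult[of e f "j * e + 1" "\<lambda>x. f x ^ j"] by (simp add: algebra_simps)
qed

lemma degree_below_prod:
  assumes "finite I" "\<And>i. i \<in> I \<Longrightarrow> degree_below e (f i)"
  shows "degree_below (card I * e + 1) (\<lambda>x. \<Prod>i\<in>I. f i x)"
  using assms
proof (induction I rule: finite_induct)
  case empty then show ?case using degree_below_const[of 1] by simp
next
  case (insert i I)
  then show ?case using degree_below_mult[of e "f i" "card I * e + 1" "\<lambda>x. \<Prod>i\<in>I. f i x"]
    by (simp add: algebra_simps)
qed

lemma poly_funs_degree_below:
  assumes "f \<in> poly_funs vcoords" shows "\<exists>e. degree_below e f"
  using assms
proof induction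
  case (add f g)
  then obtain e e' where "degree_below e f" "degree_below e' g" by blast
  then have "degree_below (max e e') f" "degree_below (max e e') g" by (auto elim: degree_below_mono)
  then show ?case using degree_below_add by blast
next
  case (mult f g)
  then show ?case using degree_below_mult by blast
qed (use degree_below_const degree_below_coord in \<open>auto simp: vcoords_def\<close>)

text \<open>Induction on the variables: a polynomial in one variable with a coefficient that is nonzero for
  some choice of the other variables is itself nonzero somewhere.\<close>

lemma monomials_independent_aux:
  assumes "finite K" "\<exists>\<beta>\<in>PiE K (\<lambda>_. {..<t}). b \<beta> \<noteq> 0"
  shows "\<exists>y :: 'k \<Rightarrow> complex. (\<Sum>\<beta>\<in>PiE K (\<lambda>_. {..<t}). b \<beta> * (\<Prod>k\<in>K. y k ^ \<beta> k)) \<noteq> 0"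
  using assms
proof (induction K arbitrary: b rule: finite_induct)
  case (insert k K)
  let ?P = "PiE K (\<lambda>_. {..<t::nat})"
  obtain \<beta>0 where \<beta>0: "\<beta>0 \<in> PiE (insert k K) (\<lambda>_. {..<t})" "b \<beta>0 \<noteq> 0" using insert.prems by blast
  define j0 where "j0 = \<beta>0 k"
  have im: "PiE (insert k K) (\<lambda>_. {..<t}) = (\<lambda>(j, \<beta>). \<beta>(k := j)) ` ({..<t} \<times> ?P)"
    by (rule PiE_insert_eq)
  from \<beta>0 obtain \<beta>1 where "\<beta>1 \<in> ?P" "b (\<beta>1(k := j0)) \<noteq> 0" "j0 < t"
    unfolding im j0_def by fastforce
  then obtain y where y: "(\<Sum>\<beta>\<in>?P. b (\<beta>(k := j0)) * (\<Prod>i\<in>K. y i ^ \<beta> i)) \<noteq> 0"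
    using insert.IH[of "\<lambda>\<beta>. b (\<beta>(k := j0))"] by blast
  define c where "c j = (\<Sum>\<beta>\<in>?P. b (\<beta>(k := j)) * (\<Prod>i\<in>K. y i ^ \<beta> i))" for j
  define p where "p = (\<Sum>j<t. monom (c j) j)"
  have "coeff p j0 = c j0" using \<open>j0 < t\<close> by (simp add: p_def coeff_sum)
  then have "p \<noteq> 0" using y by (auto simp: c_def)
  then obtain s where s: "poly p s \<noteq> 0" using poly_all_0_iff_0 by blast
  have "(\<Sum>\<beta>\<in>PiE (insert k K) (\<lambda>_. {..<t}). b \<beta> * (\<Prod>i\<in>insert k K. (y(k := s)) i ^ \<beta> i))
    = (\<Sum>(j, \<beta>)\<in>{..<t} \<times> ?P. b (\<beta>(k := j)) * (\<Prod>i\<in>insert k K. (y(k := s)) i ^ (\<beta>(k := j)) i))"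
    unfolding im by (subst sum.reindex[OF inj_combinator[OF insert.hyps(2)]]) (simp add: case_prod_unfold)
  also have "\<dots> = (\<Sum>(j, \<beta>)\<in>{..<t} \<times> ?P. s ^ j * (b (\<beta>(k := j)) * (\<Prod>i\<in>K. y i ^ \<beta> i)))"
  proof (intro sum.cong refl, clarify)
    fix j \<beta>
    have "(\<Prod>i\<in>K. (y(k := s)) i ^ (\<beta>(k := j)) i) = (\<Prod>i\<in>K. y i ^ \<beta> i)"
      using insert.hyps by (intro prod.cong) auto
    then show "b (\<beta>(k := j)) * (\<Prod>i\<in>insert k K. (y(k := s)) i ^ (\<beta>(k := j)) i)
        = s ^ j * (b (\<beta>(k := j)) * (\<Prod>i\<in>K. y i ^ \<beta> i))"
      using insert.hyps by simp
  qed
  also have "\<dots> = (\<Sum>j<t. s ^ j * c j)"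
    by (simp add: c_def sum.cartesian_product sum_distrib_left)
  also have "\<dots> = poly p s" by (simp add: p_def poly_sum poly_monom mult.commute)
  finally show ?case using s by (intro exI[of _ "y(k := s)"]) metis
qed auto

lemma monomials_independent:
  assumes "\<beta> \<in> exps t" "b \<beta> \<noteq> 0"
  shows "\<exists>y::complex^'k::finite. (\<Sum>\<beta>\<in>exps t. b \<beta> * monomial \<beta> y) \<noteq> 0"
proof -
  obtain y :: "'k \<Rightarrow> complex" where
    "(\<Sum>\<beta>\<in>PiE UNIV (\<lambda>_. {..<t}). b \<beta> * (\<Prod>k\<in>UNIV. y k ^ \<beta> k)) \<noteq> 0"
    using monomials_independent_aux[of UNIV t b] assms by (auto simp: exps_PiE)
  then show ?thesis by (intro exI[of _ "\<chi> k. y k"]) (simp add: exps_PiE monomial_def)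
qed

definition polymap :: "(complex^'k \<Rightarrow> complex^'k) \<Rightarrow> bool" where
  "polymap f \<longleftrightarrow> (\<forall>k. (\<lambda>x. f x $ k) \<in> poly_funs vcoords)"

lemma polymap_comp:
  assumes "g \<in> poly_funs vcoords" "polymap f" shows "(\<lambda>x. g (f x)) \<in> poly_funs vcoords"
  by (rule poly_funs_pullback[OF assms(1)]) (use assms(2) in \<open>auto simp: polymap_def vcoords_def\<close>)

text \<open>A nontrivial relation of degree at most \<open>d\<close> in its first argument between a function and the
  components of a map.\<close>

definition dependence ::
    "(complex^'k \<Rightarrow> complex) \<Rightarrow> (complex^'k \<Rightarrow> complex^'k) \<Rightarrow> nat \<Rightarrow> (nat \<Rightarrow> complex^'k \<Rightarrow> complex) \<Rightarrow> bool" where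
  "dependence h f d Q \<longleftrightarrow> (\<forall>j. Q j \<in> poly_funs vcoords) \<and> (\<exists>j\<le>d. \<exists>y. Q j y \<noteq> 0) \<and>
     (\<forall>x. (\<Sum>j\<le>d. h x ^ j * Q j (f x)) = 0)"

text \<open>\<open>K + 1\<close> polynomials in \<open>K\<close> variables are algebraically dependent: there are \<open>t ^ (K + 1)\<close>
  power products with exponents below \<open>t\<close>, and they lie in a space of dimension \<open>O(t ^ K)\<close>.\<close>

lemma algebraic_dependence:
  fixes f :: "complex^'k \<Rightarrow> complex^'k"
  assumes h: "h \<in> poly_funs vcoords" and f: "polymap f"
  shows "\<exists>d Q. dependence h f d Q"
proof -
  have "\<exists>e. degree_below e (\<lambda>x. f x $ k)" for k
    using f poly_funs_degree_below by (auto simp: polymap_def)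
  then obtain ef where ef: "\<And>k. degree_below (ef k) (\<lambda>x. f x $ k)" by metis
  obtain eh where eh: "degree_below eh h" using h poly_funs_degree_below by blast
  define e where "e = max eh (Max (range ef))"
  have ef: "degree_below e (\<lambda>x. f x $ k)" for k
    by (rule degree_below_mono[OF ef]) (simp add: e_def le_max_iff_disj)
  have eh: "degree_below e h" by (rule degree_below_mono[OF eh]) (simp add: e_def)
  \<comment> \<open>Each product of powers with exponents below \<open>t\<close> has exponents below \<open>t * L\<close>, and \<open>t\<close> is chosen
    such that \<open>(t * L) ^ K < t ^ (K + 1)\<close>.\<close>
  define K where "K = CARD('k)"
  define L where "L = (K + 1) * (e + 1) + 1"
  define t where "t = L ^ K + 1"
  have t: "t \<ge> 1" by (simp add: t_def)
  define g where "g = (\<lambda>(j, \<beta>) x. h x ^ j * (\<Prod>k\<in>UNIV. (f x $ k) ^ \<beta> k))"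
  let ?T = "{..<t} \<times> (exps t :: ('k \<Rightarrow> nat) set)"
  have deg: "degree_below (t * L) (g p)" if "p \<in> ?T" for p
  proof -
    from that have "fst p < t" "snd p \<in> exps t" by (auto simp: mem_Times_iff)
    then obtain j \<beta> where p: "p = (j, \<beta>)" "j < t" "\<And>k. \<beta> k < t"
      by (cases p) (simp add: exps_def)
    have le: "i * e + 1 \<le> t * (e + 1)" if "i < t" for i
    proof -
      have "i * e + 1 \<le> t * e + t" using that by (intro add_mono mult_right_mono) auto
      then show ?thesis by (simp add: algebra_simps)
    qed
    have 1: "degree_below (t * (e + 1)) (\<lambda>x. h x ^ j)"
      using degree_below_mono[OF degree_below_power[OF eh] le] p by blast
    have "degree_below (t * (e + 1)) (\<lambda>x. (f x $ k) ^ \<beta> k)" for k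
      using degree_below_mono[OF degree_below_power[OF ef] le] p by blast
    then have 2: "degree_below (K * (t * (e + 1)) + 1) (\<lambda>x. \<Prod>k\<in>UNIV. (f x $ k) ^ \<beta> k)"
      using degree_below_prod[of "UNIV :: 'k set" _ "\<lambda>k x. (f x $ k) ^ \<beta> k"] by (simp add: K_def)
    have "t * (e + 1) + (K * (t * (e + 1)) + 1) \<le> t * L"
      using t by (simp add: L_def algebra_simps)
    with degree_below_mult[OF 1 2] show ?thesis
      unfolding p(1) g_def using degree_below_mono by fastforce
  qed
  then have "\<forall>p\<in>?T. \<exists>a. \<forall>x. g p x = (\<Sum>\<alpha>\<in>exps (t * L). a \<alpha> * monomial \<alpha> x)"
    by (simp add: degree_below_def)
  then obtain a where a: "\<And>p x. p \<in> ?T \<Longrightarrow> g p x = (\<Sum>\<alpha>\<in>exps (t * L). a p \<alpha> * monomial \<alpha> x)"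
    by metis
  have "(t * L) ^ K < t * t ^ K"
    using t by (simp add: power_mult_distrib mult.commute) (simp add: t_def)
  then have card: "card (exps (t * L) :: ('k \<Rightarrow> nat) set) < card ?T"
    by (simp add: card_exps card_cartesian_product K_def)
  obtain b where b: "\<exists>p\<in>?T. b p \<noteq> 0" "\<And>\<alpha>. \<alpha> \<in> exps (t * L) \<Longrightarrow> (\<Sum>p\<in>?T. b p * a p \<alpha>) = 0"
    using homogeneous_system[OF finite_exps finite_cartesian_product[OF _ finite_exps] card,
        of "\<lambda>\<alpha> p. a p \<alpha>"] by blast
  have zero: "(\<Sum>p\<in>?T. b p * g p x) = 0" for x
  proof -
    have "(\<Sum>p\<in>?T. b p * g p x) = (\<Sum>p\<in>?T. \<Sum>\<alpha>\<in>exps (t * L). b p * a p \<alpha> * monomial \<alpha> x)"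
      by (intro sum.cong) (auto simp: a sum_distrib_left mult.assoc)
    also have "\<dots> = (\<Sum>\<alpha>\<in>exps (t * L). (\<Sum>p\<in>?T. b p * a p \<alpha>) * monomial \<alpha> x)"
      by (subst sum.swap) (simp add: sum_distrib_right)
    finally show ?thesis using b(2) by simp
  qed
  define Q where "Q j y = (\<Sum>\<beta>\<in>exps t. b (j, \<beta>) * monomial \<beta> y)" for j and y :: "complex^'k"
  have "Q j \<in> poly_funs vcoords" for j
    unfolding Q_def by (intro poly_funs_sum poly_funs_cmult monomial_poly)
  moreover have "\<exists>j\<le>t - 1. \<exists>y. Q j y \<noteq> 0"
  proof -
    obtain j \<beta> where "j < t" "\<beta> \<in> exps t" "b (j, \<beta>) \<noteq> 0" using b(1) by auto
    then show ?thesis unfolding Q_def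
      using monomials_independent[of \<beta> t "\<lambda>\<beta>. b (j, \<beta>)"] by (intro exI[of _ j]) auto
  qed
  moreover have "(\<Sum>j\<le>t - 1. h x ^ j * Q j (f x)) = 0" for x
  proof -
    have "{..t - 1} = {..<t}" using t by auto
    then have "(\<Sum>j\<le>t - 1. h x ^ j * Q j (f x)) = (\<Sum>j<t. \<Sum>\<beta>\<in>exps t. b (j, \<beta>) * g (j, \<beta>) x)"
      by (simp add: Q_def g_def monomial_def sum_distrib_left algebra_simps)
    also have "\<dots> = (\<Sum>p\<in>?T. b p * g p x)"
      by (simp add: sum.cartesian_product case_prod_unfold)
    finally show ?thesis using zero by simp
  qed
  ultimately have "dependence h f (t - 1) Q" by (simp add: dependence_def)
  then show ?thesis by blast
qed

section \<open>Images of hypersurfaces and critical values\<close>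

text \<open>Divide a dependence by the highest power of \<open>h\<close>; its constant term then vanishes on the image
  of the zero set of \<open>h\<close>.\<close>

lemma image_of_hypersurface:
  fixes f :: "complex^'k \<Rightarrow> complex^'k"
  assumes h: "h \<in> poly_funs vcoords" "h x0 \<noteq> 0" and f: "polymap f"
  shows "\<exists>R \<in> poly_funs vcoords. (\<exists>y. R y \<noteq> 0) \<and> (\<forall>x. h x = 0 \<longrightarrow> R (f x) = 0)"
proof -
  obtain d Q where dep: "dependence h f d Q" using algebraic_dependence[OF h(1) f] by blast
  define j0 where "j0 = (LEAST j. \<exists>y. Q j y \<noteq> 0)"
  have ex: "\<exists>j\<le>d. \<exists>y. Q j y \<noteq> 0" using dep by (simp add: dependence_def)
  then have j0: "\<exists>y. Q j0 y \<noteq> 0" unfolding j0_def using LeastI_ex[of "\<lambda>j. \<exists>y. Q j y \<noteq> 0"] by blast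
  have "j0 \<le> d" using ex unfolding j0_def using Least_le[of "\<lambda>j. \<exists>y. Q j y \<noteq> 0"] le_trans by blast
  have less: "Q j y = 0" if "j < j0" for j y using not_less_Least[OF that[unfolded j0_def]] by blast
  have Q: "Q j \<in> poly_funs vcoords" for j using dep by (simp add: dependence_def)
  define P where "P x = (\<Sum>j\<in>{j0..d}. h x ^ (j - j0) * Q j (f x))" for x
  have P: "P \<in> poly_funs vcoords" unfolding P_def
    by (intro poly_funs_sum poly_funs.mult poly_funs_power h polymap_comp[OF Q f])
  have hP: "h x ^ j0 * P x = 0" for x
  proof -
    have "h x ^ j0 * P x = (\<Sum>j\<in>{j0..d}. h x ^ j * Q j (f x))"
      unfolding P_def sum_distrib_left
      by (intro sum.cong) (auto simp flip: mult.assoc power_add)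
    also have "\<dots> = (\<Sum>j\<le>d. h x ^ j * Q j (f x))"
      using less by (intro sum.mono_neutral_left) auto
    finally show ?thesis using dep by (simp add: dependence_def)
  qed
  have P0: "P x = 0" for x
  proof (rule ccontr)
    assume "P x \<noteq> 0"
    then obtain z where "h z \<noteq> 0" "P z \<noteq> 0" using common_nonzero[OF h(1) P h(2)] by blast
    then show False using hP[of z] by simp
  qed
  have "Q j0 (f x) = 0" if "h x = 0" for x
  proof -
    have "P x = (\<Sum>j\<in>{j0}. h x ^ (j - j0) * Q j (f x))"
      unfolding P_def using that \<open>j0 \<le> d\<close> by (intro sum.mono_neutral_right) (auto simp: power_0_left)
    then show ?thesis using P0 by simp
  qed
  then show ?thesis using j0 Q by blast
qed

lemma poly_funs_derivative_zero:
  assumes "q \<in> poly_funs C" "\<And>g. g \<in> C \<Longrightarrow> ((\<lambda>s::complex. g (\<gamma> s)) has_field_derivative 0) (at 0)"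
  shows "((\<lambda>s. q (\<gamma> s)) has_field_derivative 0) (at 0)"
  using assms(1)
proof induction
  case (mult f g)
  show ?case using DERIV_mult[OF mult.IH] by simp
next
  case (add f g)
  show ?case using DERIV_add[OF add.IH] by simp
qed (use assms(2) in auto)

text \<open>An algebraic form of Sard's theorem. If the components of \<open>f\<close> are independent, a relation of
  minimal degree between a coordinate \<open>x $ i\<close> and \<open>f x\<close> can be differentiated: its derivative with
  respect to \<open>x $ i\<close> is a nonzero polynomial, and where this polynomial does not vanish, a vector in
  the kernel of the differential of \<open>f\<close> has zero \<open>i\<close>-th entry.\<close>

lemma critical_values:
  fixes f :: "complex^'k \<Rightarrow> complex^'k"
  assumes f: "polymap f"
  shows "\<exists>R \<in> poly_funs vcoords. (\<exists>y. R y \<noteq> 0) \<and> (\<forall>x. R (f x) \<noteq> 0 \<longrightarrow>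
    (\<forall>v. (\<forall>k. ((\<lambda>s. f (x + s *s v) $ k) has_field_derivative 0) (at 0)) \<longrightarrow> v = 0))"
proof (cases "\<exists>R \<in> poly_funs vcoords. (\<exists>y. R y \<noteq> 0) \<and> (\<forall>x. R (f x) = 0)")
  \<comment> \<open>If the components of \<open>f\<close> are dependent, a relation between them vanishes on all values of \<open>f\<close>.\<close>
  case True
  then show ?thesis by blast
next
  case False
  have "\<exists>h \<in> poly_funs vcoords. (\<exists>x. h x \<noteq> 0) \<and> (\<forall>x v. h x \<noteq> 0 \<longrightarrow>
    (\<forall>k. ((\<lambda>s. f (x + s *s v) $ k) has_field_derivative 0) (at 0)) \<longrightarrow> v $ i = 0)" for i
  proof -
    define d where "d = (LEAST d. \<exists>Q. dependence (\<lambda>x. x $ i) f d Q)"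
    have "\<exists>d Q. dependence (\<lambda>x. x $ i) f d Q" by (rule algebraic_dependence[OF vcoord f])
    then have "\<exists>Q. dependence (\<lambda>x. x $ i) f d Q" unfolding d_def by (rule LeastI_ex)
    then obtain Q where Q: "dependence (\<lambda>x. x $ i) f d Q" by blast
    have least: "\<not> dependence (\<lambda>x. x $ i) f d' Q'" if "d' < d" for d' Q'
      using not_less_Least[OF that[unfolded d_def]] by blast
    have Qp: "Q j \<in> poly_funs vcoords" for j using Q by (simp add: dependence_def)
    have rel: "(\<Sum>j\<le>d. (x $ i) ^ j * Q j (f x)) = 0" for x using Q by (simp add: dependence_def)
    \<comment> \<open>Otherwise the relation would be one between the components of \<open>f\<close> alone.\<close>
    have nz: "\<exists>j\<le>d. j \<ge> 1 \<and> (\<exists>y. Q j y \<noteq> 0)"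
    proof (rule ccontr)
      assume *: "\<not> ?thesis"
      then have "Q 0 (f x) = 0" for x
        using rel[of x] by (simp add: sum.atMost_shift)
      moreover have "\<exists>y. Q 0 y \<noteq> 0"
        using Q * unfolding dependence_def by (metis less_one not_le)
      ultimately show False using False Qp by blast
    qed
    \<comment> \<open>The derivative of the relation with respect to \<open>x $ i\<close>; it is nonzero, since a relation with
      these coefficients would have smaller degree.\<close>
    define h where "h x = (\<Sum>j<d. (x $ i) ^ j * (of_nat (Suc j) * Q (Suc j) (f x)))" for x
    have h: "h \<in> poly_funs vcoords" unfolding h_def
      by (intro poly_funs_sum poly_funs.mult poly_funs_power vcoord poly_funs.const
          polymap_comp[OF Qp f])
    moreover have "\<exists>x. h x \<noteq> 0"
    proof (rule ccontr)
      assume *: "\<not> ?thesis"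
      from nz obtain j y where j: "j \<le> d" "j \<ge> 1" "Q j y \<noteq> 0" by blast
      then have set: "{..d - 1} = {..<d}" by auto
      have "\<exists>j\<le>d - 1. \<exists>y. of_nat (Suc j) * Q (Suc j) y \<noteq> 0"
        using j by (intro exI[of _ "j - 1"]) (auto simp flip: of_nat_Suc)
      moreover have "(\<lambda>y. of_nat (Suc j) * Q (Suc j) y) \<in> poly_funs vcoords" for j
        by (intro poly_funs_cmult Qp)
      ultimately have "dependence (\<lambda>x. x $ i) f (d - 1) (\<lambda>j y. of_nat (Suc j) * Q (Suc j) y)"
        using * unfolding dependence_def set h_def by blast
      then show False using least[of "d - 1"] j by auto
    qed
    moreover have "v $ i = 0" if "h x \<noteq> 0"
      and v: "\<And>k. ((\<lambda>s. f (x + s *s v) $ k) has_field_derivative 0) (at 0)" for x v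
    proof -
      have dQ: "((\<lambda>s. Q j (f (x + s *s v))) has_field_derivative 0) (at 0)" for j
        by (rule poly_funs_derivative_zero[OF Qp]) (use v in \<open>auto simp: vcoords_def\<close>)
      have dx: "((\<lambda>s. (x + s *s v) $ i) has_field_derivative v $ i) (at 0)"
        by (auto intro!: derivative_eq_intros)
      have "((\<lambda>s. \<Sum>j\<le>d. ((x + s *s v) $ i) ^ j * Q j (f (x + s *s v))) has_field_derivative
          (\<Sum>j\<le>d. (of_nat j * (v $ i * (x $ i) ^ (j - 1))) * Q j (f x))) (at 0)"
        by (rule DERIV_sum) (use DERIV_mult[OF DERIV_power[OF dx] dQ] in simp)
      moreover have "((\<lambda>s. \<Sum>j\<le>d. ((x + s *s v) $ i) ^ j * Q j (f (x + s *s v))) has_field_derivative 0) (at 0)"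
        unfolding rel by simp
      ultimately have "0 = (\<Sum>j\<le>d. (of_nat j * (v $ i * (x $ i) ^ (j - 1))) * Q j (f x))"
        using DERIV_unique by blast
      also have "\<dots> = v $ i * h x"
        unfolding h_def sum_distrib_left
        by (subst sum.atMost_shift) (simp add: algebra_simps)
      finally show ?thesis using that(1) by simp
    qed
    ultimately show ?thesis by blast
  qed
  then obtain h where h: "\<And>i. h i \<in> poly_funs vcoords" "\<And>i. \<exists>x. h i x \<noteq> 0"
    "\<And>i x v. h i x \<noteq> 0 \<Longrightarrow>
      (\<forall>k. ((\<lambda>s. f (x + s *s v) $ k) has_field_derivative 0) (at 0)) \<Longrightarrow> v $ i = 0"
    by metis
  define H where "H x = (\<Prod>i\<in>UNIV. h i x)" for x
  have "H \<in> poly_funs vcoords" unfolding H_def by (intro poly_funs_prod h)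
  moreover obtain x0 where "H x0 \<noteq> 0"
    unfolding H_def using common_nonzero_prod[of UNIV h] h by auto
  ultimately obtain R where R: "R \<in> poly_funs vcoords" "\<exists>y. R y \<noteq> 0" "\<And>x. H x = 0 \<Longrightarrow> R (f x) = 0"
    using image_of_hypersurface[OF _ _ f, of H] by blast
  have "v = 0" if "R (f x) \<noteq> 0" "\<forall>k. ((\<lambda>s. f (x + s *s v) $ k) has_field_derivative 0) (at 0)" for x v
  proof -
    have "H x \<noteq> 0" using R(3) that(1) by blast
    then have "h i x \<noteq> 0" for i by (simp add: H_def)
    then have "v $ i = 0" for i using h(3)[of i x v] that(2) by blast
    then show ?thesis by (simp add: vec_eq_iff)
  qed
  then show ?thesis using R by blast
qed

section \<open>The weak Nullstellensatz\<close>

definition poly_ideal :: "('a \<Rightarrow> complex) set \<Rightarrow> ('a \<Rightarrow> complex) set \<Rightarrow> bool" where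
  "poly_ideal C J \<longleftrightarrow> J \<subseteq> poly_funs C \<and> (\<lambda>x. 0) \<in> J \<and>
     (\<forall>f\<in>J. \<forall>g\<in>J. (\<lambda>x. f x + g x) \<in> J) \<and> (\<forall>f\<in>J. \<forall>g\<in>poly_funs C. (\<lambda>x. g x * f x) \<in> J)"

lemma poly_ideal_add: "poly_ideal C J \<Longrightarrow> f \<in> J \<Longrightarrow> g \<in> J \<Longrightarrow> (\<lambda>x. f x + g x) \<in> J"
  and poly_ideal_mult: "poly_ideal C J \<Longrightarrow> f \<in> J \<Longrightarrow> g \<in> poly_funs C \<Longrightarrow> (\<lambda>x. g x * f x) \<in> J"
  and poly_ideal_subset: "poly_ideal C J \<Longrightarrow> f \<in> J \<Longrightarrow> f \<in> poly_funs C"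
  by (auto simp: poly_ideal_def)

lemma poly_ideal_cmult: "poly_ideal C J \<Longrightarrow> f \<in> J \<Longrightarrow> (\<lambda>x. c * f x) \<in> J"
  by (rule poly_ideal_mult[where g = "\<lambda>_. c"]) (auto intro: poly_funs.const)

lemma poly_ideal_sum:
  assumes "poly_ideal C J" "\<And>i. i \<in> I \<Longrightarrow> f i \<in> J" shows "(\<lambda>x. \<Sum>i\<in>I. f i x) \<in> J"
  using assms(2)
  by (induction I rule: infinite_finite_induct) (use assms(1) in \<open>auto simp: poly_ideal_def\<close>)

lemma poly_of_poly_fun: "f \<in> poly_funs C \<Longrightarrow> (\<lambda>x. poly q (f x)) \<in> poly_funs C"
  by (induction q) (auto intro: poly_funs.intros)

lemma poly_funs_factor_coords:
  assumes "f \<in> poly_funs (range (crd :: 'k::finite \<Rightarrow> 'a \<Rightarrow> complex))"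
  shows "\<exists>F \<in> poly_funs vcoords. \<forall>x. f x = F (\<chi> k. crd k x)"
  using assms
proof induction
  case (const c)
  show ?case by (rule bexI[of _ "\<lambda>_. c"]) (auto intro: poly_funs.const)
next
  case (coord f)
  then obtain k where "f = crd k" by blast
  then show ?case by (intro bexI[of _ "\<lambda>x. x $ k"]) (auto intro: vcoord)
next
  case (add f g)
  then obtain F G where "F \<in> poly_funs vcoords" "\<forall>x. f x = F (\<chi> k. crd k x)"
    "G \<in> poly_funs vcoords" "\<forall>x. g x = G (\<chi> k. crd k x)" by blast
  then show ?case by (intro bexI[of _ "\<lambda>x. F x + G x"]) (auto intro: poly_funs.add)
next
  case (mult f g)
  then obtain F G where "F \<in> poly_funs vcoords" "\<forall>x. f x = F (\<chi> k. crd k x)"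
    "G \<in> poly_funs vcoords" "\<forall>x. g x = G (\<chi> k. crd k x)" by blast
  then show ?case by (intro bexI[of _ "\<lambda>x. F x * G x"]) (auto intro: poly_funs.mult)
qed

text \<open>Hadamard's lemma: the values at \<open>p\<close> of the cofactors are the partial derivatives of \<open>f\<close>.\<close>

lemma poly_expand_at_point:
  assumes "f \<in> poly_funs (range (crd :: 'k::finite \<Rightarrow> 'a \<Rightarrow> complex))"
  shows "\<exists>a. (\<forall>l. a l \<in> poly_funs (range crd)) \<and>
    (\<forall>x. f x = f p + (\<Sum>l\<in>UNIV. a l x * (crd l x - crd l p)))"
  using assms
proof induction
  case (const c)
  show ?case by (rule exI[of _ "\<lambda>_ _. 0"]) (auto intro: poly_funs.const)
next
  case (coord f)
  then obtain k where k: "f = crd k" by blast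
  have "(\<Sum>l\<in>UNIV. (if l = k then 1 else 0) * (crd l x - crd l p)) = crd k x - crd k p" for x
    by (simp add: mult_delta_left)
  then show ?case unfolding k
    by (intro exI[of _ "\<lambda>l _. if l = k then 1 else 0"]) (auto intro: poly_funs.const)
next
  case (add f g)
  then obtain a b where ab: "\<forall>l. a l \<in> poly_funs (range crd)" "\<forall>l. b l \<in> poly_funs (range crd)"
    and e: "\<And>x. f x = f p + (\<Sum>l\<in>UNIV. a l x * (crd l x - crd l p))"
    "\<And>x. g x = g p + (\<Sum>l\<in>UNIV. b l x * (crd l x - crd l p))" by blast
  have "f x + g x = f p + g p + (\<Sum>l\<in>UNIV. (a l x + b l x) * (crd l x - crd l p))" for x
    unfolding distrib_right sum.distrib using e[of x] by simp
  moreover have "(\<lambda>x. a l x + b l x) \<in> poly_funs (range crd)" for l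
    using ab by (intro poly_funs.add) auto
  ultimately show ?case by (intro exI[of _ "\<lambda>l x. a l x + b l x"] conjI allI)
next
  case (mult f g)
  then obtain a b where ab: "\<forall>l. a l \<in> poly_funs (range crd)" "\<forall>l. b l \<in> poly_funs (range crd)"
    and e: "\<And>x. f x = f p + (\<Sum>l\<in>UNIV. a l x * (crd l x - crd l p))"
    "\<And>x. g x = g p + (\<Sum>l\<in>UNIV. b l x * (crd l x - crd l p))" by blast
  have "f x * g x = f p * g p + (\<Sum>l\<in>UNIV. (a l x * g x + f p * b l x) * (crd l x - crd l p))" for x
  proof -
    have "(\<Sum>l\<in>UNIV. (a l x * g x + f p * b l x) * (crd l x - crd l p))
      = (\<Sum>l\<in>UNIV. a l x * (crd l x - crd l p)) * g x + f p * (\<Sum>l\<in>UNIV. b l x * (crd l x - crd l p))"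
      unfolding sum_distrib_left sum_distrib_right sum.distrib[symmetric]
      by (intro sum.cong refl) (simp add: algebra_simps)
    also have "\<dots> = (f x - f p) * g x + f p * (g x - g p)"
      using e(1)[of x] e(2)[of x] by (simp add: algebra_simps)
    finally show ?thesis by (simp add: algebra_simps)
  qed
  moreover have "(\<lambda>x. a l x * g x + f p * b l x) \<in> poly_funs (range crd)" for l
    using ab mult.hyps by (intro poly_funs.add poly_funs.mult poly_funs_cmult) auto
  ultimately show ?case by (intro exI[of _ "\<lambda>l x. a l x * g x + f p * b l x"] conjI allI)
qed

text \<open>The field of complex numbers is uncountable, while the polynomial functions are spanned by
  countably many monomials. Hence in the quotient by a maximal ideal \<open>M\<close> the inverses of \<open>f - c\<close>,
  for all complex numbers \<open>c\<close>, would be linearly dependent. Clearing denominators, \<open>f\<close> satisfies a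
  polynomial equation modulo \<open>M\<close>, and one of its linear factors lies in the prime ideal \<open>M\<close>.\<close>

lemma weak_nullstellensatz:
  fixes crd :: "'k::finite \<Rightarrow> 'a \<Rightarrow> complex"
  assumes surj: "\<And>v. \<exists>x. \<forall>k. crd k x = v k"
    and J: "poly_ideal (range crd) J" "(\<lambda>x. 1) \<notin> J"
  shows "\<exists>p. \<forall>f\<in>J. f p = 0"
proof -
  let ?P = "poly_funs (range crd)"
  let ?A = "{K. poly_ideal (range crd) K \<and> J \<subseteq> K \<and> (\<lambda>x. 1) \<notin> K}"
  have "\<exists>M\<in>?A. \<forall>K\<in>?A. M \<subseteq> K \<longrightarrow> K = M"
  proof (rule subset_Zorn_nonempty)
    show "?A \<noteq> {}" using J by blast
    fix \<C> assume ne: "\<C> \<noteq> {}" and chain: "subset.chain ?A \<C>"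
    then have sub: "\<C> \<subseteq> ?A" and cmp: "\<And>K L. K \<in> \<C> \<Longrightarrow> L \<in> \<C> \<Longrightarrow> K \<subseteq> L \<or> L \<subseteq> K"
      by (auto simp: subset.chain_def subset_chain_def)
    have "poly_ideal (range crd) (\<Union>\<C>)"
      unfolding poly_ideal_def
    proof (intro conjI ballI)
      show "\<Union>\<C> \<subseteq> ?P" "(\<lambda>x. 0) \<in> \<Union>\<C>" using sub ne by (auto simp: poly_ideal_def)
      fix f assume f: "f \<in> \<Union>\<C>"
      show "(\<lambda>x. g x * f x) \<in> \<Union>\<C>" if g: "g \<in> ?P" for g
      proof -
        obtain K where K: "K \<in> \<C>" "f \<in> K" using f by blast
        then have "poly_ideal (range crd) K" using sub by blast
        from poly_ideal_mult[OF this K(2) g] show ?thesis using K(1) by blast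
      qed
      show "(\<lambda>x. f x + g x) \<in> \<Union>\<C>" if g: "g \<in> \<Union>\<C>" for g
      proof -
        obtain K L where KL: "K \<in> \<C>" "f \<in> K" "L \<in> \<C>" "g \<in> L" using f g by blast
        then obtain N where "N \<in> \<C>" "f \<in> N" "g \<in> N" using cmp[of K L] by blast
        moreover from this have "poly_ideal (range crd) N" using sub by blast
        ultimately show ?thesis using poly_ideal_add[of "range crd" N f g] by (metis UnionI)
      qed
    qed
    then show "\<Union>\<C> \<in> ?A" using sub ne by blast
  qed
  then obtain M where "M \<in> ?A" and max': "\<forall>K\<in>?A. M \<subseteq> K \<longrightarrow> K = M" by (rule bexE)
  then have M: "poly_ideal (range crd) M" "J \<subseteq> M" "(\<lambda>x. 1) \<notin> M" by simp_all
  have max: "K = M" if "poly_ideal (range crd) K" "M \<subseteq> K" "(\<lambda>x. 1) \<notin> K" for K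
  proof -
    have "K \<in> ?A" using that M(2) by auto
    then show ?thesis using max' that(2) by (rule_tac mp[OF bspec[OF max']])
  qed
  have inverse: "\<exists>g\<in>?P. \<exists>h\<in>M. \<forall>x. 1 = g x * f x + h x" if f: "f \<in> ?P" "f \<notin> M" for f
  proof (rule ccontr)
    assume neg: "\<not> ?thesis"
    define K where "K = {(\<lambda>x. g x * f x + h x) | g h. g \<in> ?P \<and> h \<in> M}"
    have KI: "(\<lambda>x. g x * f x + h x) \<in> K" if "g \<in> ?P" "h \<in> M" for g h
      unfolding K_def using that by blast
    have "poly_ideal (range crd) K"
      unfolding poly_ideal_def
    proof (intro conjI ballI subsetI)
      fix u assume "u \<in> K"
      then obtain g h where u: "u = (\<lambda>x. g x * f x + h x)" "g \<in> ?P" "h \<in> M" unfolding K_def by blast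
      then show "u \<in> ?P" using f M(1) by (auto intro!: poly_funs.add poly_funs.mult dest: poly_ideal_subset)
      show "(\<lambda>x. w x * u x) \<in> K" if "w \<in> ?P" for w
      proof -
        have "(\<lambda>x. w x * u x) = (\<lambda>x. (w x * g x) * f x + w x * h x)" by (simp add: u algebra_simps)
        also have "\<dots> \<in> K"
          by (rule KI[OF poly_funs.mult[OF that u(2)] poly_ideal_mult[OF M(1) u(3) that]])
        finally show ?thesis .
      qed
      show "(\<lambda>x. u x + w x) \<in> K" if wK: "w \<in> K" for w
      proof -
        obtain g' h' where w: "w = (\<lambda>x. g' x * f x + h' x)" "g' \<in> ?P" "h' \<in> M"
          using wK unfolding K_def by blast
        have "(\<lambda>x. u x + w x) = (\<lambda>x. (g x + g' x) * f x + (h x + h' x))" by (simp add: u w algebra_simps)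
        also have "\<dots> \<in> K"
          by (rule KI[OF poly_funs.add[OF u(2) w(2)] poly_ideal_add[OF M(1) u(3) w(3)]])
        finally show ?thesis .
      qed
    next
      have "(\<lambda>x. 0) \<in> M" using M(1) by (simp add: poly_ideal_def)
      then have "(\<lambda>x. 0 * f x + 0) \<in> K" by (rule KI[OF poly_funs.const])
      then show "(\<lambda>x. 0) \<in> K" by simp
    qed
    moreover have MK: "M \<subseteq> K"
    proof
      fix h assume "h \<in> M"
      then have "(\<lambda>x. 0 * f x + h x) \<in> K" by (rule KI[OF poly_funs.const])
      then show "h \<in> K" by simp
    qed
    moreover have "(\<lambda>x. 1) \<notin> K"
    proof
      assume "(\<lambda>x. 1) \<in> K"
      then obtain g h where "(\<lambda>x. 1) = (\<lambda>x. g x * f x + h x)" "g \<in> ?P" "h \<in> M" by (auto simp: K_def)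
      moreover from this(1) have "\<forall>x. 1 = g x * f x + h x" by metis
      ultimately show False using neg by blast
    qed
    ultimately have "K = M" by (rule max)
    have zM: "(\<lambda>x. 0) \<in> M" using M(1) by (simp add: poly_ideal_def)
    note \<open>K = M\<close>
    moreover have "(\<lambda>x. 1 * f x + 0) \<in> K" by (rule KI[OF poly_funs.const zM])
    ultimately show False using f by simp
  qed
  have prime: "g \<in> M" if fg: "f \<in> ?P" "g \<in> ?P" "(\<lambda>x. f x * g x) \<in> M" "f \<notin> M" for f g
  proof -
    obtain u h where u: "u \<in> ?P" "h \<in> M" "\<And>x. 1 = u x * f x + h x" using inverse[OF fg(1,4)] by blast
    have eq: "g = (\<lambda>x. u x * (f x * g x) + g x * h x)"
    proof
      fix x show "g x = u x * (f x * g x) + g x * h x"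
        using arg_cong[OF u(3)[of x], of "\<lambda>c. c * g x"] by (simp add: algebra_simps)
    qed
    have "(\<lambda>x. u x * (f x * g x) + g x * h x) \<in> M"
      by (rule poly_ideal_add[OF M(1) poly_ideal_mult[OF M(1) fg(3) u(1)] poly_ideal_mult[OF M(1) u(2) fg(2)]])
    then show ?thesis by (rule ssubst[OF eq])
  qed
  have linear_factor: "\<exists>d. (\<lambda>x. f x - d) \<in> M"
    if fP: "f \<in> ?P" and qM: "q \<noteq> 0" "(\<lambda>x. poly q (f x)) \<in> M" for f and q :: "complex poly"
    using qM
  proof (induction "degree q" arbitrary: q)
    case 0
    then obtain c where c: "q = [:c:]" by (metis degree_eq_zeroE)
    then have "(\<lambda>x. inverse c * c) \<in> M"
      using 0 by (intro poly_ideal_cmult[OF M(1)]) auto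
    then show ?case using M(3) 0 c by simp
  next
    case (Suc n)
    then obtain d where "poly q d = 0"
      using fundamental_theorem_of_algebra constant_degree by (metis Zero_not_Suc)
    then obtain q' where q': "q = [:- d, 1:] * q'" by (metis dvdE poly_eq_0_iff_dvd)
    with Suc.prems(1) have "q' \<noteq> 0" by auto
    then have deg: "n = degree q'" using Suc.hyps(2) unfolding q' by (subst (asm) degree_mult_eq) auto
    have "(\<lambda>x. (f x - d) * poly q' (f x)) \<in> M" using Suc.prems(2) unfolding q' by (simp add: algebra_simps)
    then have "(\<lambda>x. f x - d) \<in> M \<or> (\<lambda>x. poly q' (f x)) \<in> M"
      using prime[OF poly_funs_diff[OF fP poly_funs.const[of d]] poly_of_poly_fun[OF fP]] by blast
    then show ?case using Suc.hyps(1)[OF deg \<open>q' \<noteq> 0\<close>] by blast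
  qed
  have "\<exists>d. (\<lambda>x. crd k x - d) \<in> M" for k
  proof (rule ccontr)
    assume neg: "\<not> ?thesis"
    have cP: "(\<lambda>x. crd k x - c) \<in> ?P" for c
      by (intro poly_funs_diff poly_funs.const poly_funs.coord) simp
    have "\<forall>c. \<exists>g\<in>?P. \<exists>h\<in>M. \<forall>x. 1 = g x * (crd k x - c) + h x"
      using inverse[OF cP] neg by blast
    then obtain g h where gh: "\<And>c. g c \<in> ?P" "\<And>c. h c \<in> M" "\<And>c x. 1 = g c x * (crd k x - c) + h c x"
      by metis
    have "\<forall>c. \<exists>F. (\<exists>e. degree_below e F) \<and> (\<forall>x. g c x = F (\<chi> k. crd k x))"
      using poly_funs_factor_coords[OF gh(1)] poly_funs_degree_below by blast
    then obtain F e where F: "\<And>c. degree_below (e c) (F c)" "\<And>c x. g c x = F c (\<chi> k. crd k x)"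
      by metis
    \<comment> \<open>Uncountably many \<open>c\<close> and countably many degree bounds: some bound is shared by infinitely many
      inverses, and then finitely many of these are linearly dependent.\<close>
    have "\<exists>n. infinite {c. e c = n}"
    proof (rule ccontr)
      assume "\<not> ?thesis"
      then have "countable (\<Union>n. {c::complex. e c = n})" by (intro countable_UN) (auto intro: countable_finite)
      moreover have "(\<Union>n. {c. e c = n}) = UNIV" by blast
      ultimately show False using uncountable_UNIV_complex by simp
    qed
    then obtain n where "infinite {c. e c = n}" by blast
    then obtain T where T: "T \<subseteq> {c. e c = n}" "finite T" "card T = Suc (card (exps n :: ('k \<Rightarrow> nat) set))"
      using infinite_arbitrarily_large by blast
    have "\<forall>c. \<exists>a. \<forall>y. F c y = (\<Sum>\<alpha>\<in>exps (e c). a \<alpha> * monomial \<alpha> y)"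
      using F(1) by (simp add: degree_below_def)
    then obtain a where a: "\<And>c y. F c y = (\<Sum>\<alpha>\<in>exps (e c). a c \<alpha> * monomial \<alpha> y)" by metis
    obtain b where b: "\<exists>c\<in>T. b c \<noteq> 0" "\<And>\<alpha>. \<alpha> \<in> exps n \<Longrightarrow> (\<Sum>c\<in>T. b c * a c \<alpha>) = 0"
      using homogeneous_system[OF finite_exps T(2), of n "\<lambda>\<alpha> c. a c \<alpha>"] T(3) by auto
    have "(\<Sum>c\<in>T. b c * g c x) = 0" for x
    proof -
      have "(\<Sum>c\<in>T. b c * g c x) = (\<Sum>c\<in>T. \<Sum>\<alpha>\<in>exps n. b c * a c \<alpha> * monomial \<alpha> (\<chi> k. crd k x))"
        using T(1) by (intro sum.cong) (auto simp: F a sum_distrib_left mult.assoc)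
      also have "\<dots> = (\<Sum>\<alpha>\<in>exps n. (\<Sum>c\<in>T. b c * a c \<alpha>) * monomial \<alpha> (\<chi> k. crd k x))"
        by (subst sum.swap) (simp add: sum_distrib_right)
      finally show ?thesis using b(2) by simp
    qed
    note rel = this
    \<comment> \<open>The dependence multiplied by the product of all \<open>z - c\<close>, with \<open>g c * (z - c)\<close> replaced by
      \<open>1\<close>, which it equals modulo \<open>M\<close>.\<close>
    define q where "q = (\<Sum>c\<in>T. smult (b c) (\<Prod>c'\<in>T - {c}. [:- c', 1:]))"
    have q: "poly q z = (\<Sum>c\<in>T. b c * (\<Prod>c'\<in>T - {c}. (z - c')))" for z
      by (simp add: q_def poly_sum poly_prod algebra_simps)
    obtain c0 where c0: "c0 \<in> T" "b c0 \<noteq> 0" using b(1) by blast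
    have "poly q c0 = (\<Sum>c\<in>{c0}. b c * (\<Prod>c'\<in>T - {c}. (c0 - c')))"
      unfolding q using c0 T(2) by (intro sum.mono_neutral_right) (auto intro!: prod_zero)
    also have "\<dots> \<noteq> 0" using c0 T(2) by simp
    finally have "q \<noteq> 0" by auto
    have "poly q (crd k x) = (\<Sum>c\<in>T. (b c * (\<Prod>c'\<in>T - {c}. (crd k x - c'))) * h c x)" for x
    proof -
      have "(\<Sum>c\<in>T. b c * (\<Prod>c'\<in>T - {c}. (crd k x - c')) * (g c x * (crd k x - c)))
          = (\<Sum>c\<in>T. (b c * g c x) * (\<Prod>c'\<in>T. (crd k x - c')))"
        using T(2) by (intro sum.cong) (auto simp: prod.remove)
      also have "\<dots> = 0" using rel by (simp flip: sum_distrib_right)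
      finally have z: "(\<Sum>c\<in>T. b c * (\<Prod>c'\<in>T - {c}. (crd k x - c')) * (g c x * (crd k x - c))) = 0" .
      have "poly q (crd k x) = (\<Sum>c\<in>T. b c * (\<Prod>c'\<in>T - {c}. (crd k x - c')) * (g c x * (crd k x - c) + h c x))"
        unfolding q gh(3)[symmetric] by simp
      also have "\<dots> = (\<Sum>c\<in>T. b c * (\<Prod>c'\<in>T - {c}. (crd k x - c')) * h c x)"
        using z by (simp add: distrib_left sum.distrib)
      finally show ?thesis .
    qed
    moreover have "(\<lambda>x. \<Sum>c\<in>T. (b c * (\<Prod>c'\<in>T - {c}. (crd k x - c'))) * h c x) \<in> M"
      by (intro poly_ideal_sum[OF M(1)] poly_ideal_mult[OF M(1) gh(2)] poly_funs_cmult poly_funs_prod cP)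
    ultimately have "(\<lambda>x. poly q (crd k x)) \<in> M" by simp
    then show False
      using linear_factor[of "crd k" q] \<open>q \<noteq> 0\<close> neg poly_funs.coord[of "crd k" "range crd"] by blast
  qed
  then obtain d where d: "\<And>k. (\<lambda>x. crd k x - d k) \<in> M" by metis
  obtain p where p: "\<And>k. crd k p = d k" using surj by blast
  have "f p = 0" if fM: "f \<in> M" for f
  proof (rule ccontr)
    assume nz: "f p \<noteq> 0"
    obtain a where a: "\<And>l. a l \<in> ?P" "\<And>x. f x = f p + (\<Sum>l\<in>UNIV. a l x * (crd l x - crd l p))"
      using poly_expand_at_point[OF poly_ideal_subset[OF M(1) fM], of p] by blast
    have "(\<lambda>x. \<Sum>l\<in>UNIV. a l x * (crd l x - crd l p)) \<in> M"
      unfolding p by (intro poly_ideal_sum[OF M(1)] poly_ideal_mult[OF M(1)] d a)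
    then have "(\<lambda>x. inverse (f p) * (f x + (-1) * (\<Sum>l\<in>UNIV. a l x * (crd l x - crd l p)))) \<in> M"
      using fM by (intro poly_ideal_cmult[OF M(1)] poly_ideal_add[OF M(1)])
    moreover have "f x + (-1) * (\<Sum>l\<in>UNIV. a l x * (crd l x - crd l p)) = f p" for x
      using a(2)[of x] by simp
    ultimately show False using nz M(3) by simp
  qed
  then show ?thesis using M(2) by blast
qed

section \<open>A Jacobian criterion for radical ideals\<close>

lemma proper_subspace_annihilated:
  fixes D :: "(complex^'k) set"
  assumes "vec.subspace D" "D \<noteq> UNIV"
  shows "\<exists>w. w \<noteq> (\<lambda>_. 0) \<and> (\<forall>d\<in>D. (\<Sum>k\<in>UNIV. w k * d $ k) = 0)"
proof -
  obtain B where B: "B \<subseteq> D" "vec.independent B" "D \<subseteq> vec.span B" "card B = vec.dim D"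
    using vec.basis_exists by blast
  have sp: "vec.span B = D" using B assms(1) by (simp add: vec.span_subspace)
  have "vec.dim D < CARD('k)"
  proof (rule ccontr)
    assume "\<not> ?thesis"
    then have "vec.dim (UNIV :: (complex^'k) set) \<le> card B" using B(4) vec_dim_card[where 'a = complex and 'n = 'k] by linarith
    then have "UNIV \<subseteq> vec.span B"
      using vec.card_ge_dim_independent[of B UNIV] B(2) by simp
    then show False using sp assms(2) by blast
  qed
  moreover have "finite B" using B(2) by (rule vec.finiteI_independent)
  ultimately obtain w where w: "\<exists>k\<in>UNIV. w k \<noteq> 0" "\<forall>b\<in>B. (\<Sum>k\<in>UNIV. w k * b $ k) = 0"
    using homogeneous_system[of B "UNIV :: 'k set" "\<lambda>b k. b $ k"] B(4) by auto
  have "(\<Sum>k\<in>UNIV. w k * d $ k) = 0" if "d \<in> vec.span B" for d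
    using that
  proof (induction rule: vec.span_induct_alt)
    case (step c x y)
    have "(\<Sum>k\<in>UNIV. w k * (c *s x + y) $ k) = c * (\<Sum>k\<in>UNIV. w k * x $ k) + (\<Sum>k\<in>UNIV. w k * y $ k)"
      by (simp add: sum_distrib_left sum.distrib algebra_simps)
    then show ?case using w(2) step by simp
  qed simp
  then show ?thesis using w(1) sp by (intro exI[of _ w]) auto
qed

text \<open>If the differentials of the elements of \<open>J\<close> span the cotangent space at every zero of \<open>J\<close>,
  then near such a zero \<open>J\<close> contains, by Cramer's rule, the maximal ideal of the point. So for a
  function \<open>f\<close> that vanishes on the zeros of \<open>J\<close> the ideal of all \<open>h\<close> with \<open>h * f\<close> in \<open>J\<close> has no
  zeros, and the Nullstellensatz shows that it contains \<open>1\<close>.\<close>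

theorem jacobian_criterion_radical:
  fixes crd :: "'k::finite \<Rightarrow> 'a \<Rightarrow> complex"
  assumes line: "\<And>k p w s. crd k (line p w s) = crd k p + s * w k"
    and J: "poly_ideal (range crd) J"
    and tangent: "\<And>p w. (\<And>f. f \<in> J \<Longrightarrow> f p = 0) \<Longrightarrow>
      (\<And>f. f \<in> J \<Longrightarrow> ((\<lambda>s. f (line p w s)) has_field_derivative 0) (at 0)) \<Longrightarrow> w = (\<lambda>_. 0)"
  shows "radical_ideal (range crd) J"
  unfolding radical_ideal_def
proof (intro ballI allI impI)
  let ?P = "poly_funs (range crd)"
  fix f and n :: nat
  assume f: "f \<in> ?P" and fn: "(\<lambda>x. f x ^ n) \<in> J"
  have surj: "\<exists>x. \<forall>k. crd k x = v k" for v
    by (rule exI[of _ "line undefined (\<lambda>k. v k - crd k undefined) 1"]) (simp add: line)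
  have vanish: "f p = 0" if "\<And>g. g \<in> J \<Longrightarrow> g p = 0" for p
  proof -
    have "f p ^ n = 0" using that[OF fn] .
    then show ?thesis by simp
  qed
  define K where "K = {h \<in> ?P. (\<lambda>x. h x * f x) \<in> J}"
  have K: "poly_ideal (range crd) K"
    unfolding poly_ideal_def
  proof (intro conjI ballI)
    show "K \<subseteq> ?P" by (auto simp: K_def)
    show "(\<lambda>x. 0) \<in> K" using J by (auto simp: K_def poly_ideal_def intro: poly_funs.const)
    fix g assume g: "g \<in> K"
    show "(\<lambda>x. g x + h x) \<in> K" if "h \<in> K" for h
      using g that poly_ideal_add[OF J, of "\<lambda>x. g x * f x" "\<lambda>x. h x * f x"]
      by (auto simp: K_def distrib_right intro: poly_funs.add)
    show "(\<lambda>x. h x * g x) \<in> K" if "h \<in> ?P" for h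
      using g that poly_ideal_mult[OF J, of "\<lambda>x. g x * f x" h]
      by (auto simp: K_def mult.assoc intro: poly_funs.mult)
  qed
  have JK: "J \<subseteq> K"
    using poly_ideal_mult[OF J _ f] poly_ideal_subset[OF J] by (auto simp: K_def mult.commute)
  have "(\<lambda>x. 1) \<in> K"
  proof (rule ccontr)
    assume "(\<lambda>x. 1) \<notin> K"
    then obtain p where p: "\<And>h. h \<in> K \<Longrightarrow> h p = 0" using weak_nullstellensatz[OF surj K] by blast
    then have pJ: "\<And>g. g \<in> J \<Longrightarrow> g p = 0" using JK by blast
    \<comment> \<open>The differentials at \<open>p\<close> of elements of \<open>J\<close>, each given with an expansion around \<open>p\<close>.\<close>
    define D where "D = {d :: complex^'k. \<exists>a. (\<forall>l. a l \<in> ?P \<and> d $ l = a l p) \<and>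
      (\<lambda>x. \<Sum>l\<in>UNIV. a l x * (crd l x - crd l p)) \<in> J}"
    have "vec.subspace D"
    proof (rule vec.subspaceI)
      show "0 \<in> D" unfolding D_def using J
        by (auto simp: poly_ideal_def intro!: exI[of _ "\<lambda>_ _. 0"] poly_funs.const)
      fix d assume "d \<in> D"
      then obtain a where a: "\<And>l. a l \<in> ?P" "\<And>l. d $ l = a l p"
        "(\<lambda>x. \<Sum>l\<in>UNIV. a l x * (crd l x - crd l p)) \<in> J" by (auto simp: D_def)
      show "c *s d \<in> D" for c
        unfolding D_def
        using poly_ideal_cmult[OF J a(3), of c] a
        by (auto simp: sum_distrib_left mult.assoc intro!: exI[of _ "\<lambda>l x. c * a l x"] poly_funs_cmult)
      fix d' assume "d' \<in> D"
      then obtain a' where a': "\<And>l. a' l \<in> ?P" "\<And>l. d' $ l = a' l p"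
        "(\<lambda>x. \<Sum>l\<in>UNIV. a' l x * (crd l x - crd l p)) \<in> J" by (auto simp: D_def)
      show "d + d' \<in> D"
        unfolding D_def
        using poly_ideal_add[OF J a(3) a'(3)] a a'
        by (auto simp: distrib_right sum.distrib intro!: exI[of _ "\<lambda>l x. a l x + a' l x"] poly_funs.add)
    qed
    moreover have "w = (\<lambda>_. 0)" if w: "\<forall>d\<in>D. (\<Sum>k\<in>UNIV. w k * d $ k) = 0" for w
    proof (rule tangent[OF pJ])
      fix g assume g: "g \<in> J"
      obtain a where a: "\<And>l. a l \<in> ?P" "\<And>x. g x = g p + (\<Sum>l\<in>UNIV. a l x * (crd l x - crd l p))"
        using poly_expand_at_point[OF poly_ideal_subset[OF J g], of p] by blast
      have gx: "g x = (\<Sum>l\<in>UNIV. a l x * (crd l x - crd l p))" for x using a(2)[of x] pJ[OF g] by simp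
      then have "g = (\<lambda>x. \<Sum>l\<in>UNIV. a l x * (crd l x - crd l p))" by blast
      then have "(\<lambda>x. \<Sum>l\<in>UNIV. a l x * (crd l x - crd l p)) \<in> J" using g by simp
      then have "(\<chi> l. a l p) \<in> D" using a(1) unfolding D_def by (auto intro!: exI[of _ a])
      then have sum0: "(\<Sum>l\<in>UNIV. a l p * w l) = 0" using w by (force simp: mult.commute)
      have "\<exists>q. \<forall>s. a l (line p w s) = poly q s" for l
      proof (rule poly_funs_along_line[OF a(1)])
        fix u assume "u \<in> range crd"
        then obtain k where "u = crd k" by blast
        then show "\<exists>q. \<forall>s. u (line p w s) = poly q s"
          by (intro exI[of _ "[:crd k p, w k:]"]) (simp add: line)
      qed
      then obtain q where q: "\<And>l s. a l (line p w s) = poly (q l) s" by metis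
      have ap: "a l p = poly (q l) 0" for l
      proof -
        obtain G where G: "\<And>x. a l x = G (\<chi> k. crd k x)" using poly_funs_factor_coords[OF a(1)] by blast
        have "a l p = a l (line p w 0)" unfolding G by (simp add: line)
        then show ?thesis by (simp add: q)
      qed
      have "((\<lambda>s. \<Sum>l\<in>UNIV. poly (q l) s * (s * w l)) has_field_derivative
          (\<Sum>l\<in>UNIV. poly (q l) 0 * w l)) (at 0)"
        by (rule DERIV_sum) (auto intro!: derivative_eq_intros poly_DERIV)
      moreover have "(\<lambda>s. g (line p w s)) = (\<lambda>s. \<Sum>l\<in>UNIV. poly (q l) s * (s * w l))"
        unfolding gx by (simp add: q line)
      ultimately show "((\<lambda>s. g (line p w s)) has_field_derivative 0) (at 0)"
        using sum0 unfolding ap by simp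
    qed
    ultimately have "D = UNIV" using proper_subspace_annihilated[of D] by blast
    then have "\<forall>k. axis k 1 \<in> D" by blast
    then have "\<forall>k. \<exists>a. (\<forall>l. a l \<in> ?P \<and> (axis k 1 :: complex^'k) $ l = a l p) \<and>
      (\<lambda>x. \<Sum>l\<in>UNIV. a l x * (crd l x - crd l p)) \<in> J" unfolding D_def by blast
    from choice[OF this] obtain a where "\<forall>k. (\<forall>l. a k l \<in> ?P \<and> (axis k 1 :: complex^'k) $ l = a k l p) \<and>
      (\<lambda>x. \<Sum>l\<in>UNIV. a k l x * (crd l x - crd l p)) \<in> J" by blast
    then have a: "\<And>k l. a k l \<in> ?P" "\<And>k l. (axis k 1 :: complex^'k) $ l = a k l p"
      "\<And>k. (\<lambda>x. \<Sum>l\<in>UNIV. a k l x * (crd l x - crd l p)) \<in> J" by blast+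
    \<comment> \<open>The elements \<open>F k\<close> of \<open>J\<close> have the differentials of the coordinates at \<open>p\<close>, and \<open>h\<close> is the
      determinant of their coefficients.\<close>
    define F where "F k x = (\<Sum>l\<in>UNIV. a k l x * (crd l x - crd l p))" for k x
    have FJ: "F k \<in> J" for k unfolding F_def[abs_def] by (rule a(3))
    define A where "A x = (\<chi> k l. a k l x)" for x
    define h where "h x = det (A x)" for x
    have "A p = mat 1" by (auto simp: A_def mat_def vec_eq_iff axis_def simp flip: a(2))
    then have hp: "h p = 1" by (simp add: h_def)
    have hP: "h \<in> ?P" unfolding h_def by (rule poly_funs_det) (simp add: A_def a)
    have hk: "(\<lambda>x. h x * (crd k x - crd k p)) \<in> J" for k
    proof -
      let ?B = "\<lambda>x. (\<chi> i j. if j = k then F i x else a i j x) :: complex^'k^'k"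
      have "h x * (crd k x - crd k p) = det (?B x)" for x
      proof -
        have Av: "A x *v (\<chi> l. crd l x - crd l p) = (\<chi> i. F i x)"
          by (simp add: A_def matrix_vector_mult_def F_def)
        have "det (\<chi> i j. if j = k then F i x else A x $ i $ j) = (crd k x - crd k p) * h x"
          using cramer_lemma[of k "A x" "\<chi> l. crd l x - crd l p"] unfolding Av h_def vec_lambda_beta .
        moreover have "(\<chi> i j. if j = k then F i x else A x $ i $ j) = ?B x"
          by (simp add: A_def vec_eq_iff)
        ultimately show ?thesis by (simp add: mult.commute)
      qed
      moreover have "(\<lambda>x. det (?B x)) \<in> J"
        unfolding det_def
      proof (intro poly_ideal_sum[OF J] poly_ideal_cmult[OF J])
        fix \<pi> assume "\<pi> \<in> {\<pi>. \<pi> permutes (UNIV :: 'k set)}"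
        then have \<pi>: "\<pi> permutes UNIV" by simp
        then obtain i0 where i0: "\<pi> i0 = k" by (metis permutes_surj surj_def)
        have "(\<Prod>i\<in>UNIV. ?B x $ i $ \<pi> i) = (\<Prod>i\<in>UNIV - {i0}. ?B x $ i $ \<pi> i) * F i0 x" for x
          using i0 by (simp add: prod.remove[of UNIV i0])
        moreover have "(\<lambda>x. (\<Prod>i\<in>UNIV - {i0}. ?B x $ i $ \<pi> i) * F i0 x) \<in> J"
        proof (rule poly_ideal_mult[OF J FJ], rule poly_funs_prod)
          fix i show "(\<lambda>x. ?B x $ i $ \<pi> i) \<in> ?P"
            using a(1) poly_ideal_subset[OF J FJ] by (cases "\<pi> i = k") auto
        qed
        ultimately show "(\<lambda>x. \<Prod>i\<in>UNIV. ?B x $ i $ \<pi> i) \<in> J" by simp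
      qed
      ultimately show ?thesis by simp
    qed
    obtain b where b: "\<And>l. b l \<in> ?P" "\<And>x. f x = f p + (\<Sum>l\<in>UNIV. b l x * (crd l x - crd l p))"
      using poly_expand_at_point[OF f, of p] by blast
    have fp: "f p = 0" by (rule vanish) (rule pJ)
    have "h x * f x = (\<Sum>l\<in>UNIV. b l x * (h x * (crd l x - crd l p)))" for x
      unfolding b(2)[of x] fp by (simp add: sum_distrib_left mult.left_commute)
    moreover have "(\<lambda>x. \<Sum>l\<in>UNIV. b l x * (h x * (crd l x - crd l p))) \<in> J"
      by (intro poly_ideal_sum[OF J] poly_ideal_mult[OF J hk] b)
    ultimately have "h \<in> K" using hP by (simp add: K_def)
    then show False using p hp by fastforce
  qed
  then show "f \<in> J" by (simp add: K_def)
qed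

section \<open>Generic frames\<close>

lemma cscale_nth [simp]: "cscale c A $ i $ j = c * A $ i $ j"
  by (simp add: cscale_def)

lemma Sym_iff: "A \<in> Sym \<longleftrightarrow> (\<forall>i j. A $ i $ j = A $ j $ i)"
  by (auto simp: Sym_def transpose_def vec_eq_iff)

lemma Sym_0: "0 \<in> Sym" and Sym_add: "A \<in> Sym \<Longrightarrow> B \<in> Sym \<Longrightarrow> A + B \<in> Sym"
  and Sym_diff: "A \<in> Sym \<Longrightarrow> B \<in> Sym \<Longrightarrow> A - B \<in> Sym" and Sym_cscale: "A \<in> Sym \<Longrightarrow> cscale c A \<in> Sym"
  by (simp_all add: Sym_iff)

lemma Sym_sum: "(\<And>i. i \<in> I \<Longrightarrow> f i \<in> Sym) \<Longrightarrow> (\<Sum>i\<in>I. f i) \<in> Sym"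
  by (induction I rule: infinite_finite_induct) (auto intro: Sym_0 Sym_add)

lemma subspace_Sym: "mat.subspace Sym"
  by (rule mat.subspaceI) (auto intro: Sym_0 Sym_add Sym_cscale)

definition sym_frame :: "nat \<Rightarrow> (nat \<Rightarrow> complex^'n^'n) \<Rightarrow> bool" where
  "sym_frame m a \<longleftrightarrow> (\<forall>q\<le>m. a q \<in> Sym)"

text \<open>The polynomial \<open>R\<close> is defined on tuples of arbitrary matrices, so it is required to be nonzero at
  some tuple of symmetric matrices.\<close>

definition generic :: "nat \<Rightarrow> ((nat \<Rightarrow> complex^'n^'n) \<Rightarrow> bool) \<Rightarrow> bool" where
  "generic m P \<longleftrightarrow> (\<exists>R \<in> poly_funs (frame_coords m). (\<exists>A. sym_frame m A \<and> R A \<noteq> 0) \<and>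
     (\<forall>A. sym_frame m A \<and> R A \<noteq> 0 \<longrightarrow> P A))"

lemma frame_coord: "q \<le> m \<Longrightarrow> (\<lambda>a. a q $ i $ j) \<in> poly_funs (frame_coords m)"
  by (rule poly_funs.coord) (auto simp: frame_coords_def)

lemma frame_coords_line:
  assumes "h \<in> frame_coords m"
  shows "\<exists>p. \<forall>s. h (\<lambda>q. A q + cscale s (B q)) = poly p s"
proof -
  obtain q i j where "h = (\<lambda>a. a q $ i $ j)" using assms by (auto simp: frame_coords_def)
  then show ?thesis by (intro exI[of _ "[:A q $ i $ j, B q $ i $ j:]"]) simp
qed

lemma poly_funs_frame_cong:
  assumes "f \<in> poly_funs (frame_coords m)" "\<And>q. q \<le> m \<Longrightarrow> a q = b q"
  shows "f a = f b"
  using assms(1)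
proof induction
  case (coord f)
  then obtain q i j where "q \<le> m" "f = (\<lambda>A. A q $ i $ j)" by (auto simp: frame_coords_def)
  then show ?case using assms(2)[of q] by simp
qed simp_all

lemma generic_mono: "generic m P \<Longrightarrow> (\<And>A. sym_frame m A \<Longrightarrow> P A \<Longrightarrow> Q A) \<Longrightarrow> generic m Q"
  unfolding generic_def by blast

lemma generic_True: "generic m (\<lambda>A. True)"
  unfolding generic_def
  by (rule bexI[of _ "\<lambda>_. 1"]) (auto intro!: poly_funs.const exI[of _ "\<lambda>_. 0"] simp: sym_frame_def Sym_0)

lemma generic_conj:
  assumes "generic m P" "generic m Q"
  shows "generic m (\<lambda>A. P A \<and> Q A)"
proof -
  obtain R A where R: "R \<in> poly_funs (frame_coords m)" "sym_frame m A" "R A \<noteq> 0"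
    "\<And>A. sym_frame m A \<Longrightarrow> R A \<noteq> 0 \<Longrightarrow> P A" using assms(1) by (auto simp: generic_def)
  obtain S B where S: "S \<in> poly_funs (frame_coords m)" "sym_frame m B" "S B \<noteq> 0"
    "\<And>A. sym_frame m A \<Longrightarrow> S A \<noteq> 0 \<Longrightarrow> Q A" using assms(2) by (auto simp: generic_def)
  let ?\<phi> = "\<lambda>s q. A q + cscale s (B q - A q)"
  have phi: "?\<phi> 0 = A" "?\<phi> 1 = B" by (auto simp: vec_eq_iff)
  have "R (?\<phi> 0) \<noteq> 0" "S (?\<phi> 1) \<noteq> 0" unfolding phi using R(3) S(3) by auto
  from common_nonzero_on_line[where \<phi> = ?\<phi>, OF R(1) S(1) frame_coords_line this]
  have "\<exists>s. R (?\<phi> s) \<noteq> 0 \<and> S (?\<phi> s) \<noteq> 0" .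
  then obtain s where "R (?\<phi> s) \<noteq> 0" "S (?\<phi> s) \<noteq> 0" by blast
  moreover have "sym_frame m (?\<phi> s)"
    using R(2) S(2) by (auto simp: sym_frame_def intro!: Sym_add Sym_cscale Sym_diff)
  ultimately have "\<exists>C. sym_frame m C \<and> R C * S C \<noteq> 0" by (intro exI[of _ "?\<phi> s"]) simp
  moreover have "\<forall>C. sym_frame m C \<and> R C * S C \<noteq> 0 \<longrightarrow> P C \<and> Q C"
  proof (intro allI impI conjI; elim conjE)
    fix C assume "sym_frame m C" "R C * S C \<noteq> 0"
    then show "P C" "Q C" by (auto intro!: R(4) S(4))
  qed
  ultimately show ?thesis
    unfolding generic_def by (intro bexI[OF _ poly_funs.mult[OF R(1) S(1)]] conjI)
qed

lemma generic_ball: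
  assumes "finite I" "\<And>i. i \<in> I \<Longrightarrow> generic m (P i)"
  shows "generic m (\<lambda>A. \<forall>i\<in>I. P i A)"
  using assms
proof (induction I rule: finite_induct)
  case empty
  show ?case using generic_True by (rule generic_mono) simp
next
  case (insert i I)
  have "generic m (\<lambda>A. P i A \<and> (\<forall>i\<in>I. P i A))"
  proof (rule generic_conj)
    show "generic m (P i)" by (rule insert.prems) simp
    show "generic m (\<lambda>A. \<forall>i\<in>I. P i A)" by (rule insert.IH, rule insert.prems) simp
  qed
  then show ?case by (rule generic_mono) blast
qed

text \<open>A tuple of symmetric matrices as a point of affine space. The coordinate space is larger
  than needed: only the symmetric parts of the blocks with indices in the image of \<open>\<iota>\<close> matter.\<close>

definition decode :: "(nat \<Rightarrow> 'n \<times> 'n) \<Rightarrow> complex^(('n \<times> 'n) \<times> ('n \<times> 'n)) \<Rightarrow> nat \<Rightarrow> complex^'n^'n" where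
  "decode \<iota> x q = (\<chi> i j. (x $ (\<iota> q, (i, j)) + x $ (\<iota> q, (j, i))) / 2)"

definition encode :: "(nat \<Rightarrow> 'n \<times> 'n) \<Rightarrow> nat \<Rightarrow> (nat \<Rightarrow> complex^'n^'n) \<Rightarrow> complex^(('n \<times> 'n) \<times> ('n \<times> 'n))" where
  "encode \<iota> m a = (\<chi> p. if fst p \<in> \<iota> ` {..m}
     then a (inv_into {..m} \<iota> (fst p)) $ fst (snd p) $ snd (snd p) else 0)"

lemma decode_sym: "decode \<iota> x q \<in> Sym"
  by (simp add: Sym_iff decode_def add.commute)

lemma sym_frame_decode: "sym_frame m (decode \<iota> x)"
  by (simp add: sym_frame_def decode_sym)

lemma decode_add: "decode \<iota> (x + y) q = decode \<iota> x q + decode \<iota> y q"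
  and decode_diff: "decode \<iota> (x - y) q = decode \<iota> x q - decode \<iota> y q"
  and decode_scale: "decode \<iota> (c *s x) q = cscale c (decode \<iota> x q)"
  by (simp_all add: decode_def vec_eq_iff field_simps)

lemma decode_0: "decode \<iota> 0 q = 0"
  by (simp add: decode_def vec_eq_iff)

lemma encode_nth: "inj_on \<iota> {..m} \<Longrightarrow> q \<le> m \<Longrightarrow> encode \<iota> m a $ (\<iota> q, (i, j)) = a q $ i $ j"
  by (simp add: encode_def)

lemma encode_nth_outside: "fst p \<notin> \<iota> ` {..m} \<Longrightarrow> encode \<iota> m a $ p = 0"
  by (simp add: encode_def)

lemma encode_cong: "inj_on \<iota> {..m} \<Longrightarrow> (\<And>q. q \<le> m \<Longrightarrow> a q = b q) \<Longrightarrow> encode \<iota> m a = encode \<iota> m b"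
  by (auto simp: encode_def vec_eq_iff)

lemma encode_line: "encode \<iota> m (\<lambda>q. a q + cscale s (b q)) = encode \<iota> m a + s *s encode \<iota> m b"
  by (auto simp: encode_def vec_eq_iff)

lemma decode_encode:
  "inj_on \<iota> {..m} \<Longrightarrow> q \<le> m \<Longrightarrow> a q \<in> Sym \<Longrightarrow> decode \<iota> (encode \<iota> m a) q = a q"
  by (simp add: decode_def vec_eq_iff encode_nth Sym_iff)

lemma poly_funs_decode:
  assumes "f \<in> poly_funs (frame_coords m)" shows "(\<lambda>x. f (decode \<iota> x)) \<in> poly_funs vcoords"
proof (rule poly_funs_pullback[OF assms])
  fix g :: "(nat \<Rightarrow> complex^'a^'a) \<Rightarrow> complex" assume "g \<in> frame_coords m"
  then obtain q i j where g: "g = (\<lambda>A. A q $ i $ j)" by (auto simp: frame_coords_def)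
  show "(\<lambda>y. g (decode \<iota> y)) \<in> poly_funs vcoords"
    unfolding g decode_def vec_lambda_beta divide_inverse mult.commute[of _ "inverse 2"]
    by (intro poly_funs_cmult poly_funs.add vcoord)
qed

lemma poly_funs_encode:
  assumes "R \<in> poly_funs vcoords" "inj_on \<iota> {..m}"
  shows "(\<lambda>A. R (encode \<iota> m A + y)) \<in> poly_funs (frame_coords m)"
proof (rule poly_funs_pullback[OF assms(1)])
  fix g :: "complex^(('a \<times> 'a) \<times> ('a \<times> 'a)) \<Rightarrow> complex" assume "g \<in> vcoords"
  then obtain p where g: "g = (\<lambda>x. x $ p)" by (auto simp: vcoords_def)
  show "(\<lambda>A. g (encode \<iota> m A + y)) \<in> poly_funs (frame_coords m)"
  proof (cases "fst p \<in> \<iota> ` {..m}")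
    case True
    then obtain q where "q \<le> m" "p = (\<iota> q, (fst (snd p), snd (snd p)))" by (metis atMost_iff imageE prod.collapse)
    then have "g (encode \<iota> m A + y) = A q $ fst (snd p) $ snd (snd p) + y $ p" for A
      unfolding g using encode_nth[OF assms(2)] by (metis vector_add_component)
    then show ?thesis using \<open>q \<le> m\<close> by (simp add: poly_funs.add frame_coord poly_funs.const)
  qed (auto simp: g encode_nth_outside intro: poly_funs.const)
qed

definition poly_frame_map :: "nat \<Rightarrow> ((nat \<Rightarrow> complex^'n^'n) \<Rightarrow> nat \<Rightarrow> complex^'n^'n) \<Rightarrow> bool" where
  "poly_frame_map m G \<longleftrightarrow> (\<forall>q\<le>m. \<forall>i j. (\<lambda>a. G a q $ i $ j) \<in> poly_funs (frame_coords m)) \<and>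
     (\<forall>a. sym_frame m a \<longrightarrow> sym_frame m (G a))"

lemma poly_frame_map_cong:
  assumes "poly_frame_map m G" "\<And>q. q \<le> m \<Longrightarrow> a q = b q" "q \<le> m" shows "G a q = G b q"
  unfolding vec_eq_iff
proof (intro allI)
  fix i j
  show "G a q $ i $ j = G b q $ i $ j"
    using poly_funs_frame_cong[of "\<lambda>a. G a q $ i $ j" m a b] assms by (auto simp: poly_frame_map_def)
qed

text \<open>The map on affine space induced by a map of frames; it is the identity in the
  superfluous coordinates.\<close>

definition encoded_map ::
    "(nat \<Rightarrow> 'n \<times> 'n) \<Rightarrow> nat \<Rightarrow> ((nat \<Rightarrow> complex^'n^'n) \<Rightarrow> nat \<Rightarrow> complex^'n^'n)
      \<Rightarrow> complex^(('n \<times> 'n) \<times> ('n \<times> 'n)) \<Rightarrow> complex^(('n \<times> 'n) \<times> ('n \<times> 'n))" where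
  "encoded_map \<iota> m G x = encode \<iota> m (G (decode \<iota> x)) + (x - encode \<iota> m (decode \<iota> x))"

lemma encoded_map_polymap:
  assumes "poly_frame_map m G" "inj_on \<iota> {..m}"
  shows "polymap (encoded_map \<iota> m G)"
  unfolding polymap_def
proof
  fix p
  have *: "(\<lambda>x. encode \<iota> m (H (decode \<iota> x)) $ p) \<in> poly_funs vcoords" if H: "poly_frame_map m H" for H
  proof (cases "fst p \<in> \<iota> ` {..m}")
    case True
    then obtain q where q: "q \<le> m" "p = (\<iota> q, (fst (snd p), snd (snd p)))"
      by (metis atMost_iff imageE prod.collapse)
    then have "encode \<iota> m (H (decode \<iota> x)) $ p = H (decode \<iota> x) q $ fst (snd p) $ snd (snd p)" for x
      using encode_nth[OF assms(2)] by metis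
    then show ?thesis using poly_funs_decode[of "\<lambda>a. H a q $ fst (snd p) $ snd (snd p)" m \<iota>] q(1) H
      by (simp add: poly_frame_map_def)
  qed (auto simp: encode_nth_outside intro: poly_funs.const)
  have "poly_frame_map m (\<lambda>a. a)" by (simp add: poly_frame_map_def frame_coord)
  from *[OF this] *[OF assms(1)] show "(\<lambda>x. encoded_map \<iota> m G x $ p) \<in> poly_funs vcoords"
    unfolding encoded_map_def vector_add_component vector_minus_component
    by (intro poly_funs.add poly_funs_diff vcoord)
qed

lemma encoded_map_encode:
  assumes G: "poly_frame_map m G" and \<iota>: "inj_on \<iota> {..m}" and a: "sym_frame m a"
    and y: "\<forall>q\<le>m. decode \<iota> y q = 0"
  shows "encoded_map \<iota> m G (encode \<iota> m a + y) = encode \<iota> m (G a) + y"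
proof -
  have d: "decode \<iota> (encode \<iota> m a + y) q = a q" if "q \<le> m" for q
    using that a y decode_encode[OF \<iota>] by (simp add: decode_add sym_frame_def)
  have "encode \<iota> m (G (decode \<iota> (encode \<iota> m a + y))) = encode \<iota> m (G a)"
    using poly_frame_map_cong[OF G d] by (intro encode_cong[OF \<iota>]) auto
  moreover have "encode \<iota> m (decode \<iota> (encode \<iota> m a + y)) = encode \<iota> m a"
    using d by (intro encode_cong[OF \<iota>]) auto
  ultimately show ?thesis by (simp add: encoded_map_def)
qed

lemma decode_encoded_map:
  assumes "poly_frame_map m G" "inj_on \<iota> {..m}" "q \<le> m"
  shows "decode \<iota> (encoded_map \<iota> m G x) q = G (decode \<iota> x) q"
  using assms sym_frame_decode[of m \<iota> x]
  by (simp add: encoded_map_def decode_add decode_diff decode_encode decode_sym poly_frame_map_def sym_frame_def)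

lemma frame_index:
  assumes "m < CARD('n::finite) * CARD('n::finite)"
  obtains \<iota> :: "nat \<Rightarrow> 'n::finite \<times> 'n" where "inj_on \<iota> {..m}"
proof -
  have "card {..m} \<le> card (UNIV :: ('n \<times> 'n) set)" using assms by simp
  then show ?thesis using card_le_inj[of "{..m}" "UNIV :: ('n \<times> 'n) set"] that by auto
qed

text \<open>Tuples of symmetric matrices form a linear subspace of the coordinate space. Translating it by
  \<open>y\<close> reaches a point where \<open>R\<close> does not vanish, and \<open>R\<close> restricted to the translate is a nonzero
  polynomial on the tuples.\<close>

lemma generic_from_vector:
  assumes R: "R \<in> poly_funs vcoords" "R y0 \<noteq> 0" and \<iota>: "inj_on \<iota> {..m}"
    and P: "\<And>A y. sym_frame m A \<Longrightarrow> \<forall>q\<le>m. decode \<iota> y q = 0 \<Longrightarrow> R (encode \<iota> m A + y) \<noteq> 0 \<Longrightarrow> P A"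
  shows "generic m P"
proof -
  define y where "y = y0 - encode \<iota> m (decode \<iota> y0)"
  have y: "\<forall>q\<le>m. decode \<iota> y q = 0"
    by (simp add: y_def decode_diff decode_encode[OF \<iota>] decode_sym)
  show ?thesis unfolding generic_def
  proof (intro bexI[of _ "\<lambda>A. R (encode \<iota> m A + y)"] conjI allI impI; (elim conjE)?)
    show "\<exists>A. sym_frame m A \<and> R (encode \<iota> m A + y) \<noteq> 0"
      using R(2) by (intro exI[of _ "decode \<iota> y0"]) (simp add: y_def sym_frame_decode)
    show "P A" if "sym_frame m A" "R (encode \<iota> m A + y) \<noteq> 0" for A
      by (rule P[OF that(1) y that(2)])
    show "(\<lambda>A. R (encode \<iota> m A + y)) \<in> poly_funs (frame_coords m)"
      by (rule poly_funs_encode[OF R(1) \<iota>])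
  qed
qed

text \<open>The image of the hypersurface \<open>h = 0\<close> lies in a hypersurface of the target, which has the same
  dimension as the source.\<close>

lemma generic_avoids_hypersurface:
  fixes G :: "(nat \<Rightarrow> complex^'n^'n) \<Rightarrow> nat \<Rightarrow> complex^'n^'n"
  assumes m: "m < CARD('n) * CARD('n)" and G: "poly_frame_map m G"
    and h: "h \<in> poly_funs (frame_coords m)" "sym_frame m a0" "h a0 \<noteq> 0"
  shows "generic m (\<lambda>A. \<forall>a. sym_frame m a \<longrightarrow> (\<forall>q\<le>m. G a q = A q) \<longrightarrow> h a \<noteq> 0)"
proof -
  obtain \<iota> :: "nat \<Rightarrow> 'n \<times> 'n" where \<iota>: "inj_on \<iota> {..m}" using frame_index[OF m] .
  have h_cong: "h (decode \<iota> (encode \<iota> m a + y)) = h a"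
    if "sym_frame m a" "\<forall>q\<le>m. decode \<iota> y q = 0" for a y
    using that decode_encode[OF \<iota>]
    by (intro poly_funs_frame_cong[OF h(1)]) (auto simp: decode_add sym_frame_def)
  have "h (decode \<iota> (encode \<iota> m a0 + 0)) \<noteq> 0" using h_cong[OF h(2), of 0] h(3) by (simp add: decode_0)
  from image_of_hypersurface[OF poly_funs_decode[OF h(1)] this encoded_map_polymap[OF G \<iota>]]
  obtain R y0 where R: "R \<in> poly_funs vcoords" "R y0 \<noteq> 0"
    "\<forall>x. h (decode \<iota> x) = 0 \<longrightarrow> R (encoded_map \<iota> m G x) = 0"
    by (elim bexE conjE exE) rule
  show ?thesis
  proof (rule generic_from_vector[OF R(1,2) \<iota>], intro allI impI notI)
    fix A a y assume "sym_frame m A" and y: "\<forall>q\<le>m. decode \<iota> y q = 0"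
      and R0: "R (encode \<iota> m A + y) \<noteq> 0" and a: "sym_frame m a" "\<forall>q\<le>m. G a q = A q" and "h a = 0"
    then have "R (encoded_map \<iota> m G (encode \<iota> m a + y)) = 0"
      using spec[OF R(3), of "encode \<iota> m a + y"] unfolding h_cong[OF a(1) y] by simp
    moreover have "encoded_map \<iota> m G (encode \<iota> m a + y) = encode \<iota> m A + y"
      unfolding encoded_map_encode[OF G \<iota> a(1) y] using a(2)
      by (intro arg_cong2[where f = "(+)"] encode_cong[OF \<iota>] refl) simp
    ultimately show False using R0 by simp
  qed
qed

text \<open>Injectivity of the differential, expressed by derivatives along complex lines.\<close>

definition immersive ::
    "nat \<Rightarrow> ((nat \<Rightarrow> complex^'n^'n) \<Rightarrow> nat \<Rightarrow> complex^'n^'n) \<Rightarrow> (nat \<Rightarrow> complex^'n^'n) \<Rightarrow> bool" where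
  "immersive m G a \<longleftrightarrow> (\<forall>v. sym_frame m v \<longrightarrow>
     (\<forall>q\<le>m. \<forall>i j. ((\<lambda>s. G (\<lambda>p. a p + cscale s (v p)) q $ i $ j) has_field_derivative 0) (at 0)) \<longrightarrow>
     (\<forall>q\<le>m. v q = 0))"

lemma generic_immersive:
  fixes G :: "(nat \<Rightarrow> complex^'n^'n) \<Rightarrow> nat \<Rightarrow> complex^'n^'n"
  assumes m: "m < CARD('n) * CARD('n)" and G: "poly_frame_map m G"
  shows "generic m (\<lambda>A. \<forall>a. sym_frame m a \<longrightarrow> (\<forall>q\<le>m. G a q = A q) \<longrightarrow> immersive m G a)"
proof -
  obtain \<iota> :: "nat \<Rightarrow> 'n \<times> 'n" where \<iota>: "inj_on \<iota> {..m}" using frame_index[OF m] .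
  let ?f = "encoded_map \<iota> m G"
  from critical_values[OF encoded_map_polymap[OF G \<iota>]]
  obtain R y0 where R: "R \<in> poly_funs vcoords" "R y0 \<noteq> 0" "\<forall>x. R (?f x) \<noteq> 0 \<longrightarrow>
    (\<forall>v. (\<forall>k. ((\<lambda>s. ?f (x + s *s v) $ k) has_field_derivative 0) (at 0)) \<longrightarrow> v = 0)"
    by (elim bexE conjE exE) rule
  show ?thesis
  proof (rule generic_from_vector[OF R(1,2) \<iota>], intro allI impI)
    fix A a y assume "sym_frame m A" and y: "\<forall>q\<le>m. decode \<iota> y q = 0"
      and R0: "R (encode \<iota> m A + y) \<noteq> 0" and a: "sym_frame m a" "\<forall>q\<le>m. G a q = A q"
    show "immersive m G a"
      unfolding immersive_def
    proof (intro allI impI)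
      fix v q
      assume v: "sym_frame m v" and q: "q \<le> m" and
        d: "\<forall>q\<le>m. \<forall>i j. ((\<lambda>s. G (\<lambda>p. a p + cscale s (v p)) q $ i $ j) has_field_derivative 0) (at 0)"
      have line: "sym_frame m (\<lambda>p. a p + cscale s (v p))" for s
        using a(1) v by (auto simp: sym_frame_def intro: Sym_add Sym_cscale)
      have eq: "?f ((encode \<iota> m a + y) + s *s encode \<iota> m v)
          = encode \<iota> m (G (\<lambda>p. a p + cscale s (v p))) + y" for s
        using encoded_map_encode[OF G \<iota> line y] by (simp add: encode_line add_ac)
      have "?f (encode \<iota> m a + y) = encode \<iota> m A + y"
        unfolding encoded_map_encode[OF G \<iota> a(1) y] using a(2)
        by (intro arg_cong2[where f = "(+)"] encode_cong[OF \<iota>] refl) simp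
      moreover have "((\<lambda>s. ?f ((encode \<iota> m a + y) + s *s encode \<iota> m v) $ k) has_field_derivative 0) (at 0)" for k
      proof (cases "fst k \<in> \<iota> ` {..m}")
        case True
        then obtain p i j where p: "p \<le> m" "k = (\<iota> p, (i, j))" by (metis atMost_iff imageE prod.collapse)
        show ?thesis unfolding eq p(2) vector_add_component encode_nth[OF \<iota> p(1)]
          using d p(1) by (auto intro!: derivative_eq_intros)
      qed (simp add: eq encode_nth_outside)
      ultimately have "encode \<iota> m v = 0"
        using spec[OF R(3), of "encode \<iota> m a + y"] R0 by simp
      then have "decode \<iota> (encode \<iota> m v) q = 0" by (simp add: decode_0)
      then show "v q = 0" using decode_encode[OF \<iota> q, of v] v q by (simp add: sym_frame_def)
    qed
  qed
qed

lemma poly_funs_vcoords_differentiable: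
  assumes "f \<in> poly_funs (vcoords :: (complex^'k \<Rightarrow> complex) set)" shows "f differentiable at x"
  using assms
proof induction
  case (coord f)
  then obtain k where "f = (\<lambda>x. x $ k)" by (auto simp: vcoords_def)
  then show ?case by (simp add: bounded_linear_imp_differentiable bounded_linear_vec_nth)
qed auto

lemma polymap_differentiable:
  fixes f :: "complex^'k \<Rightarrow> complex^'k"
  assumes "polymap f" shows "f differentiable at x"
proof -
  have "linear (axis k :: complex \<Rightarrow> complex^'k)" for k
    by (rule linearI) (auto simp: axis_def vec_eq_iff)
  then have lin: "bounded_linear (axis k :: complex \<Rightarrow> complex^'k)" for k
    by (simp add: linear_conv_bounded_linear)
  have "(\<lambda>x. axis k (f x $ k) :: complex^'k) differentiable at x" for k
  proof -
    have "(\<lambda>x. f x $ k) differentiable at x"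
      using assms by (auto simp: polymap_def intro: poly_funs_vcoords_differentiable)
    then obtain D where "((\<lambda>x. f x $ k) has_derivative D) (at x)" by (auto simp: differentiable_def)
    from bounded_linear.has_derivative[OF lin this] show ?thesis by (auto simp: differentiable_def)
  qed
  then have "(\<lambda>x. \<Sum>k\<in>UNIV. axis k (f x $ k) :: complex^'k) differentiable at x"
    by (intro differentiable_sum) auto
  moreover have "(\<Sum>k\<in>UNIV. axis k (f x $ k)) = f x" for x
    by (simp add: vec_eq_iff axis_def)
  ultimately show ?thesis by simp
qed

lemma norm_entry_le: "norm (M $ i $ j) \<le> norm (M :: complex^'n^'m)"
  by (rule order_trans[OF Finite_Cartesian_Product.norm_nth_le Finite_Cartesian_Product.norm_nth_le])

lemma norm_encode_le:
  assumes "\<And>q. q \<le> m \<Longrightarrow> norm (a q) \<le> e" "0 \<le> e"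
  shows "norm (encode \<iota> m (a :: nat \<Rightarrow> complex^'n^'n)) \<le> of_nat (CARD(('n \<times> 'n) \<times> ('n \<times> 'n))) * e"
proof -
  have "norm (encode \<iota> m a $ p) \<le> e" for p
  proof (cases "fst p \<in> \<iota> ` {..m}")
    case True
    then have q: "inv_into {..m} \<iota> (fst p) \<le> m" using inv_into_into[OF True] by simp
    have "norm (encode \<iota> m a $ p) \<le> norm (a (inv_into {..m} \<iota> (fst p)))"
      using True norm_entry_le by (simp add: encode_def)
    then show ?thesis using assms(1)[OF q] by simp
  qed (simp add: encode_nth_outside assms)
  then have "(\<Sum>p\<in>UNIV. norm (encode \<iota> m a $ p)) \<le> (\<Sum>p\<in>(UNIV :: (('n \<times> 'n) \<times> ('n \<times> 'n)) set). e)"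
    by (intro sum_mono)
  moreover have "norm (encode \<iota> m a) \<le> (\<Sum>p\<in>UNIV. norm (encode \<iota> m a $ p))"
    unfolding norm_vec_def by (rule L2_set_le_sum) simp
  ultimately show ?thesis by simp
qed

text \<open>The differential is injective, hence bijective because source and target have the same dimension,
  so a neighbourhood of the point is mapped onto a neighbourhood of its image.\<close>

lemma immersive_open_image:
  fixes G :: "(nat \<Rightarrow> complex^'n^'n) \<Rightarrow> nat \<Rightarrow> complex^'n^'n"
  assumes m: "m < CARD('n) * CARD('n)" and G: "poly_frame_map m G"
    and a: "sym_frame m a" and imm: "immersive m G a" and "\<epsilon> > 0"
  shows "\<exists>\<delta>>0. \<forall>B. sym_frame m B \<and> (\<forall>q\<le>m. norm (B q - G a q) < \<delta>) \<longrightarrow>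
    (\<exists>b. sym_frame m b \<and> (\<forall>q\<le>m. norm (b q - a q) < \<epsilon>) \<and> (\<forall>q\<le>m. G b q = B q))"
proof -
  obtain \<iota> :: "nat \<Rightarrow> 'n \<times> 'n" where \<iota>: "inj_on \<iota> {..m}" using frame_index[OF m] .
  let ?f = "encoded_map \<iota> m G" and ?x = "encode \<iota> m a"
  have pm: "polymap ?f" by (rule encoded_map_polymap[OF G \<iota>])
  have dx: "decode \<iota> ?x q = a q" if "q \<le> m" for q
    using that a decode_encode[OF \<iota>] by (simp add: sym_frame_def)
  obtain f' where f': "(?f has_derivative f') (at ?x)"
    using polymap_differentiable[OF pm] by (auto simp: differentiable_def)
  then have "linear f'" by (rule has_derivative_linear)
  have inj0: "w = 0" if "f' w = 0" for w
  proof -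
    have real: "((\<lambda>t::real. ?f (?x + complex_of_real t *s w)) has_vector_derivative 0) (at 0)"
    proof -
      have e: "?x + complex_of_real t *s w = ?x + t *\<^sub>R w" for t
        unfolding vec_eq_iff vector_add_component vector_smult_component vector_scaleR_component
        by (simp add: scaleR_conv_of_real[of t "_ :: complex"])
      have "((\<lambda>t::real. ?x + t *\<^sub>R w) has_derivative (\<lambda>t. t *\<^sub>R w)) (at 0)"
        by (auto intro!: derivative_eq_intros)
      moreover have "(?f has_derivative f') (at (?x + 0 *\<^sub>R w))" using f' by simp
      ultimately have "(?f \<circ> (\<lambda>t::real. ?x + t *\<^sub>R w) has_derivative f' \<circ> (\<lambda>t. t *\<^sub>R w)) (at 0)"
        by (rule diff_chain_at)
      moreover have "f' \<circ> (\<lambda>t. t *\<^sub>R w) = (\<lambda>t. t *\<^sub>R 0)"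
        using \<open>linear f'\<close> that by (auto simp: linear_cmul)
      ultimately show ?thesis unfolding has_vector_derivative_def e by (simp add: o_def)
    qed
    have comp: "((\<lambda>s. ?f (?x + s *s w) $ k) has_field_derivative 0) (at 0)" for k
    proof -
      have "\<exists>p. \<forall>s. ?f (?x + s *s w) $ k = poly p s"
        by (rule poly_funs_along_line[OF spec[OF pm[unfolded polymap_def]] vcoords_line])
      then obtain p where p: "\<And>s. ?f (?x + s *s w) $ k = poly p s" by blast
      have D: "((\<lambda>s. ?f (?x + s *s w) $ k) has_field_derivative poly (pderiv p) 0) (at 0)"
        unfolding p by (rule poly_DERIV)
      have "((\<lambda>t::real. ?f (?x + complex_of_real t *s w) $ k) has_vector_derivative poly (pderiv p) 0) (at 0)"
        using has_vector_derivative_real_field[of "\<lambda>s. ?f (?x + s *s w) $ k" _ 0] D by simp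
      moreover have "((\<lambda>t::real. ?f (?x + complex_of_real t *s w) $ k) has_vector_derivative 0) (at 0)"
        using bounded_linear.has_vector_derivative[OF bounded_linear_vec_nth real, of k] by simp
      ultimately have "poly (pderiv p) 0 = 0" by (rule vector_derivative_unique_at)
      then show ?thesis using D by simp
    qed
    have dw: "decode \<iota> w q = 0" if "q \<le> m" for q
    proof -
      have "((\<lambda>s. G (\<lambda>p. a p + cscale s (decode \<iota> w p)) q $ i $ j) has_field_derivative 0) (at 0)"
        if "q \<le> m" for q i j
      proof -
        have "G (\<lambda>p. a p + cscale s (decode \<iota> w p)) q = decode \<iota> (?f (?x + s *s w)) q" for s
          unfolding decode_encoded_map[OF G \<iota> that]
          by (rule poly_frame_map_cong[OF G _ that]) (simp add: decode_add decode_scale dx)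
        then have eq: "G (\<lambda>p. a p + cscale s (decode \<iota> w p)) q $ i $ j
            = (?f (?x + s *s w) $ (\<iota> q, (i, j)) + ?f (?x + s *s w) $ (\<iota> q, (j, i))) / 2" for s
          by (simp add: decode_def)
        show ?thesis unfolding eq using DERIV_cdivide[where c = 2, OF DERIV_add[OF comp comp]] by simp
      qed
      then show ?thesis using imm that sym_frame_decode[of m \<iota> w] by (simp add: immersive_def)
    qed
    have "?f (?x + s *s w) = (encode \<iota> m (G a) + ?x - encode \<iota> m a) + s *s w" for s
    proof -
      have d: "decode \<iota> (?x + s *s w) q = a q" if "q \<le> m" for q
        using that dx dw by (simp add: decode_add decode_scale)
      have "encode \<iota> m (G (decode \<iota> (?x + s *s w))) = encode \<iota> m (G a)"
        using poly_frame_map_cong[OF G d] by (intro encode_cong[OF \<iota>]) auto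
      moreover have "encode \<iota> m (decode \<iota> (?x + s *s w)) = encode \<iota> m a"
        using d by (intro encode_cong[OF \<iota>]) auto
      ultimately show ?thesis by (simp add: encoded_map_def)
    qed
    then have "((\<lambda>s. ?f (?x + s *s w) $ k) has_field_derivative w $ k) (at 0)" for k
      by (auto intro!: derivative_eq_intros)
    then show "w = 0" using comp DERIV_unique by (metis vec_eq_iff zero_index)
  qed
  then have "inj f'" using \<open>linear f'\<close> by (simp add: linear_injective_0)
  then obtain g' where g': "linear g'" "\<And>x. f' (g' x) = x"
    using linear_injective_isomorphism[OF \<open>linear f'\<close>] by blast
  let ?T = "{x. \<forall>q\<le>m. norm (decode \<iota> x q - a q) < \<epsilon>}"
  have "open ?T"
  proof -
    have "continuous_on UNIV (\<lambda>x. norm (decode \<iota> x q - a q))" for q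
      unfolding decode_def by (intro continuous_intros) auto
    then have "open {x. norm (decode \<iota> x q - a q) < \<epsilon>}" for q
      by (simp add: open_Collect_less)
    then have "open (\<Inter>q\<in>{..m}. {x. norm (decode \<iota> x q - a q) < \<epsilon>})" by (intro open_INT) auto
    moreover have "(\<Inter>q\<in>{..m}. {x. norm (decode \<iota> x q - a q) < \<epsilon>}) = ?T" by auto
    ultimately show ?thesis by simp
  qed
  moreover have "?x \<in> ?T" using dx \<open>\<epsilon> > 0\<close> by simp
  ultimately have "?x \<in> interior ?T" by (simp add: interior_open)
  moreover have "continuous_on UNIV ?f"
    using polymap_differentiable[OF pm] differentiable_imp_continuous_within
    by (auto simp: continuous_on_eq_continuous_within)
  ultimately have "?f ?x \<in> interior (?f ` ?T)"
    using f' g' by (intro sussmann_open_mapping[where S = UNIV and f' = f' and g' = g'])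
      (auto simp: linear_conv_bounded_linear)
  then obtain e where e: "e > 0" "ball (?f ?x) e \<subseteq> ?f ` ?T" by (auto simp: mem_interior)
  have fx: "?f ?x = encode \<iota> m (G a)"
    using encoded_map_encode[OF G \<iota> a, of 0] by (simp add: decode_0)
  let ?K = "real (CARD(('n \<times> 'n) \<times> ('n \<times> 'n)))"
  show ?thesis
  proof (intro exI[of _ "e / (?K + 1)"] conjI allI impI)
    show "e / (?K + 1) > 0" using e(1) by (simp add: add_nonneg_pos)
    fix B assume B: "sym_frame m B \<and> (\<forall>q\<le>m. norm (B q - G a q) < e / (?K + 1))"
    have "encode \<iota> m B - encode \<iota> m (G a) = encode \<iota> m (\<lambda>q. B q - G a q)"
      by (auto simp: encode_def vec_eq_iff)
    moreover have "norm (encode \<iota> m (\<lambda>q. B q - G a q)) \<le> ?K * (e / (?K + 1))"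
      using B e(1) by (intro norm_encode_le) (auto intro: less_imp_le)
    moreover have "?K * (e / (?K + 1)) < e"
    proof -
      have "?K \<ge> 0" by simp
      then show ?thesis using e(1) by (simp only: pos_divide_less_eq times_divide_eq_right add_nonneg_pos zero_less_one)
          (simp add: algebra_simps)
    qed
    ultimately have "encode \<iota> m B \<in> ball (?f ?x) e"
      by (simp add: fx dist_norm norm_minus_commute)
    then obtain x where x: "x \<in> ?T" "encode \<iota> m B = ?f x" using e(2) by blast
    have "G (decode \<iota> x) q = B q" if "q \<le> m" for q
      using decode_encoded_map[OF G \<iota> that, of x] decode_encode[OF \<iota> that, of B] B that
      unfolding x(2)[symmetric] by (simp add: sym_frame_def)
    then show "\<exists>b. sym_frame m b \<and> (\<forall>q\<le>m. norm (b q - a q) < \<epsilon>) \<and> (\<forall>q\<le>m. G b q = B q)"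
      using x(1) sym_frame_decode by blast
  qed
qed

lemma poly_funs_frame_tendsto:
  assumes "f \<in> poly_funs (frame_coords m)" "\<And>q. q \<le> m \<Longrightarrow> ((\<lambda>t. A t q) \<longlongrightarrow> a q) F"
  shows "((\<lambda>t. f (A t)) \<longlongrightarrow> f a) F"
  using assms(1)
  by induction (auto simp: frame_coords_def intro!: tendsto_intros assms(2))

section \<open>Ranks of symmetric matrices\<close>

lemma subspace_range_matrix: "vec.subspace (range ((*v) (M :: complex^'n^'m)))"
proof (rule vec.subspaceI)
  show "0 \<in> range ((*v) M)" by (metis matrix_vector_mult_0_right rangeI)
  show "x + y \<in> range ((*v) M)" if "x \<in> range ((*v) M)" "y \<in> range ((*v) M)" for x y
    using that by (auto simp flip: matrix_vector_right_distrib)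
  show "c *s x \<in> range ((*v) M)" if "x \<in> range ((*v) M)" for c x
    using that by (auto simp flip: vec.scale)
qed

lemma subspace_kernel_matrix: "vec.subspace {x. M *v x = (0 :: complex^'m)}"
  by (rule vec.subspaceI) (auto simp: matrix_vector_right_distrib vec.scale)

lemma matrix_vector_axis: "((M :: complex^'n^'m) *v axis j 1) $ k = M $ k $ j"
proof -
  have "(\<Sum>l\<in>UNIV. M $ k $ l * (if l = j then 1 else 0)) = M $ k $ j"
    by (simp add: mult_delta_right)
  then show ?thesis by (simp add: matrix_vector_mult_def axis_def)
qed

lemma rank_symmetric:
  assumes "M \<in> Sym" shows "rank M = vec.dim (range ((*v) M))"
proof -
  have "range ((*v) M) \<subseteq> vec.span (columns M)"
    using matrix_vector_mult_in_columnspace_gen by blast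
  moreover have "columns M \<subseteq> range ((*v) M)"
  proof
    fix x assume "x \<in> columns M"
    then obtain j where "x = column j M" by (auto simp: columns_def)
    then have "x = M *v axis j 1" by (simp add: column_def vec_eq_iff matrix_vector_axis)
    then show "x \<in> range ((*v) M)" by blast
  qed
  ultimately have "vec.span (columns M) = range ((*v) M)"
    using vec.span_minimal[OF _ subspace_range_matrix] by blast
  moreover have "rows M = columns M"
    using assms columns_transpose[of M] by (simp add: Sym_def)
  ultimately show ?thesis unfolding row_rank_def_gen by (metis vec.dim_span)
qed

lemma span_Int_of_independent:
  fixes A B :: "(complex^'n) set"
  assumes "vec.independent (A \<union> B)" "A \<inter> B = {}"
  shows "vec.span A \<inter> vec.span B = {0}"
proof -
  have fin: "finite A" "finite B" using vec.finiteI_independent[OF assms(1)] by auto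
  have ind: "vec.independent A" "vec.independent B" using vec.independent_mono[OF assms(1)] by auto
  have "vec.dim (vec.span (A \<union> B)) = card A + card B"
    using assms fin by (simp add: vec.dim_eq_card_independent card_Un_disjoint)
  moreover have "vec.dim (vec.span A) = card A" "vec.dim (vec.span B) = card B"
    using ind by (simp_all add: vec.dim_eq_card_independent)
  moreover have "vec.dim {x + y |x y. x \<in> vec.span A \<and> y \<in> vec.span B}
      + vec.dim (vec.span A \<inter> vec.span B) = vec.dim (vec.span A) + vec.dim (vec.span B)"
    by (rule vec.dim_sums_Int) auto
  ultimately have "vec.dim (vec.span A \<inter> vec.span B) = 0"
    unfolding vec.span_Un by linarith
  then show ?thesis using vec.span_zero by (auto simp: vec.dim_eq_0)
qed

lemma kernel_basis:
  fixes M :: "complex^'n^'n"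
  obtains B0 B1 where "vec.independent (B0 \<union> B1)" "B0 \<inter> B1 = {}" "vec.span (B0 \<union> B1) = UNIV"
    "vec.span B0 = {x. M *v x = 0}" "card B0 + card B1 = CARD('n)"
    "vec.independent ((*v) M ` B1)" "inj_on ((*v) M) B1" "card B1 = vec.dim (range ((*v) M))"
proof -
  let ?N = "{x. M *v x = 0}"
  obtain B0 where B0: "B0 \<subseteq> ?N" "vec.independent B0" "?N \<subseteq> vec.span B0"
    by (rule vec.maximal_independent_subset[of ?N])
  obtain B where B: "B0 \<subseteq> B" "vec.independent B" "UNIV \<subseteq> vec.span B"
    by (rule vec.maximal_independent_subset_extend[OF subset_UNIV B0(2)])
  define B1 where "B1 = B - B0"
  have B01: "B = B0 \<union> B1" "B0 \<inter> B1 = {}" using B(1) by (auto simp: B1_def)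
  have spB0: "vec.span B0 = ?N" using B0 vec.span_minimal[OF B0(1) subspace_kernel_matrix] by blast
  have fin: "finite B" by (rule vec.finiteI_independent[OF B(2)])
  have "card B = CARD('n)"
  proof -
    have "vec.dim (UNIV :: (complex^'n) set) = card B"
      by (rule vec.dim_unique[of B]) (use B in auto)
    then show ?thesis using vec_dim_card[where 'a = complex and 'n = 'n] by linarith
  qed
  then have card: "card B0 + card B1 = CARD('n)"
    using fin B01 by (metis card_Un_disjoint finite_Un)
  have int: "vec.span B0 \<inter> vec.span B1 = {0}"
    by (rule span_Int_of_independent) (use B(2) B01 in auto)
  have inj: "inj_on ((*v) M) (vec.span B1)"
  proof (rule inj_onI)
    fix x y assume "x \<in> vec.span B1" "y \<in> vec.span B1" "M *v x = M *v y"
    then have "x - y \<in> vec.span B0 \<inter> vec.span B1"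
      unfolding spB0 by (auto intro: vec.span_diff simp: matrix_vector_mult_diff_distrib)
    then show "x = y" unfolding int by simp
  qed
  have "vec.independent B1" using vec.independent_mono[OF B(2)] B01 by blast
  then have indM: "vec.independent ((*v) M ` B1)"
    by (intro vec.independent_injective_image inj)
  have injB: "inj_on ((*v) M) B1" using inj vec.span_superset inj_on_subset by blast
  have "range ((*v) M) \<subseteq> vec.span ((*v) M ` B1)"
  proof
    fix z assume "z \<in> range ((*v) M)"
    then obtain x where z: "z = M *v x" by blast
    have "x \<in> vec.span (B0 \<union> B1)" using B(3) B01 by auto
    then obtain u w where "x = u + w" "u \<in> vec.span B0" "w \<in> vec.span B1"
      unfolding vec.span_Un by blast
    then have "z = M *v w" unfolding z spB0 by (simp add: matrix_vector_right_distrib)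
    then show "z \<in> vec.span ((*v) M ` B1)" using \<open>w \<in> _\<close> by (simp add: vec.span_image)
  qed
  then have "vec.dim (range ((*v) M)) = card ((*v) M ` B1)"
    using indM by (intro vec.dim_unique[of "(*v) M ` B1"]) auto
  then have "card B1 = vec.dim (range ((*v) M))" using injB by (simp add: card_image)
  then show ?thesis using that[of B0 B1] B01 B(2,3) spB0 card indM injB by auto
qed

lemma det_nonzero_surj:
  fixes M :: "complex^'n^'n" shows "det M \<noteq> 0 \<longleftrightarrow> range ((*v) M) = UNIV"
  using matrix_right_invertible_surjective[of M] invertible_right_inverse[of M]
  by (simp add: invertible_det_nz)

lemma range_sum_subset:
  "range ((*v) (A + B)) \<subseteq> {x + y |x y. x \<in> range ((*v) (A :: complex^'n^'n)) \<and> y \<in> range ((*v) B)}"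
  by (auto simp: matrix_vector_mult_add_rdistrib)

lemma dim_range_sum_le:
  "vec.dim (range ((*v) (A + B))) \<le> vec.dim (range ((*v) (A :: complex^'n^'n))) + vec.dim (range ((*v) B))"
proof -
  have "vec.dim (range ((*v) (A + B))) \<le> vec.dim {x + y |x y. x \<in> range ((*v) A) \<and> y \<in> range ((*v) B)}"
    by (rule vec.dim_subset[OF range_sum_subset])
  also have "\<dots> \<le> vec.dim (range ((*v) A)) + vec.dim (range ((*v) B))"
    using vec.dim_sums_Int[OF subspace_range_matrix subspace_range_matrix, of A B] by linarith
  finally show ?thesis .
qed

text \<open>The locus of matrices of bounded rank is closed: for a matrix \<open>M\<close> of rank \<open>k\<close> there is a
  matrix \<open>D\<close> of complementary rank such that \<open>M + D\<close> is invertible, and then \<open>X + D\<close> is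
  singular for all \<open>X\<close> of rank less than \<open>k\<close>.\<close>

lemma rank_detecting_determinant:
  fixes M :: "complex^'n^'n"
  shows "\<exists>D. det (M + D) \<noteq> 0 \<and>
    (\<forall>X. vec.dim (range ((*v) X)) < vec.dim (range ((*v) M)) \<longrightarrow> det (X + D) = 0)"
proof -
  obtain B0 B1 where B: "vec.independent (B0 \<union> B1)" "B0 \<inter> B1 = {}" "vec.span (B0 \<union> B1) = UNIV"
    "vec.span B0 = {x. M *v x = 0}" "card B0 + card B1 = CARD('n)"
    "vec.independent ((*v) M ` B1)" "inj_on ((*v) M) B1" "card B1 = vec.dim (range ((*v) M))"
    by (rule kernel_basis)
  have fin: "finite B0" "finite B1" using vec.finiteI_independent[OF B(1)] by auto
  obtain C where C: "(*v) M ` B1 \<subseteq> C" "vec.independent C" "UNIV \<subseteq> vec.span C"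
    by (rule vec.maximal_independent_subset_extend[OF subset_UNIV B(6)])
  define C' where "C' = C - (*v) M ` B1"
  have finC: "finite C" by (rule vec.finiteI_independent[OF C(2)])
  have "vec.dim (UNIV :: (complex^'n) set) = card C"
    by (rule vec.dim_unique[of C]) (use C in auto)
  then have "card C = CARD('n)" using vec_dim_card[where 'a = complex and 'n = 'n] by linarith
  then have cC': "card C' = card B0"
    using C(1) finC B(5,7) fin by (simp add: C'_def card_Diff_subset card_image)
  then obtain \<pi> where \<pi>: "bij_betw \<pi> B0 C'"
    using finite_same_card_bij[OF fin(1), of C'] finC by (auto simp: C'_def)
  \<comment> \<open>The matrix \<open>D\<close> vanishes on \<open>B1\<close> and maps the kernel of \<open>M\<close> onto a complement of its image.\<close>
  obtain h where h: "Vector_Spaces.linear (*s) (*s) h" "\<forall>x\<in>B0 \<union> B1. h x = (if x \<in> B0 then \<pi> x else 0)"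
    using vec.linear_independent_extend[OF B(1), of "\<lambda>x. if x \<in> B0 then \<pi> x else 0"] by blast
  define D where "D = matrix h"
  have D: "D *v x = h x" for x unfolding D_def by (rule matrix_works[OF h(1)])
  have "C \<subseteq> range ((*v) (M + D))"
  proof
    fix c assume "c \<in> C"
    show "c \<in> range ((*v) (M + D))"
    proof (cases "c \<in> (*v) M ` B1")
      case True
      then obtain b where b: "b \<in> B1" "c = M *v b" by blast
      then have "h b = 0" using h(2) B(2) by auto
      then have "c = (M + D) *v b" by (simp add: matrix_vector_mult_add_rdistrib D b)
      then show ?thesis by blast
    next
      case False
      then have "c \<in> \<pi> ` B0" using \<open>c \<in> C\<close> \<pi> by (auto simp: C'_def bij_betw_def)
      then obtain b where b: "b \<in> B0" "c = \<pi> b" by blast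
      then have "M *v b = 0" using B(4) vec.span_superset[of B0] by blast
      moreover have "h b = c" using h(2) b by auto
      ultimately have "c = (M + D) *v b" by (simp add: matrix_vector_mult_add_rdistrib D)
      then show ?thesis by blast
    qed
  qed
  then have "vec.span C \<subseteq> range ((*v) (M + D))"
    by (rule vec.span_minimal[OF _ subspace_range_matrix])
  then have "det (M + D) \<noteq> 0" using C(3) det_nonzero_surj by blast
  moreover have "det (X + D) = 0" if X: "vec.dim (range ((*v) X)) < vec.dim (range ((*v) M))" for X :: "complex^'n^'n"
  proof (rule ccontr)
    assume "det (X + D) \<noteq> 0"
    then have "CARD('n) = vec.dim (range ((*v) (X + D)))"
      using det_nonzero_surj[of "X + D"] vec_dim_card[where 'a = complex and 'n = 'n] by simp
    also have "\<dots> \<le> vec.dim (range ((*v) X)) + vec.dim (range ((*v) D))" by (rule dim_range_sum_le)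
    also have "vec.dim (range ((*v) D)) \<le> card C'"
    proof (rule vec.dim_le_card)
      show "finite C'" using finC by (simp add: C'_def)
      show "range ((*v) D) \<subseteq> vec.span C'"
      proof
        fix z assume "z \<in> range ((*v) D)"
        then obtain x where z: "z = h x" by (auto simp: D)
        have "x \<in> vec.span (B0 \<union> B1)" using B(3) by simp
        then have "h x \<in> vec.span (h ` (B0 \<union> B1))"
          using vec.linear_span_image[OF h(1), of "B0 \<union> B1"] by blast
        moreover have "h ` (B0 \<union> B1) \<subseteq> vec.span C'"
          using h(2) \<pi> by (auto simp: bij_betw_def intro: vec.span_base vec.span_zero)
        ultimately show "z \<in> vec.span C'" unfolding z
          using vec.span_minimal[OF _ vec.subspace_span] by blast
      qed
    qed
    finally show False using X cC' B(5,8) by linarith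
  qed
  ultimately show ?thesis by blast
qed

section \<open>Charts for pairs of symmetric matrices with product zero\<close>

definition supported :: "'n set \<Rightarrow> 'n set \<Rightarrow> complex^'n^'n \<Rightarrow> bool" where
  "supported P Q M \<longleftrightarrow> (\<forall>k l. M $ k $ l \<noteq> 0 \<longrightarrow> k \<in> P \<and> l \<in> Q)"

text \<open>Congruences by \<open>mat 1 - K\<close> and \<open>mat 1 + K\<close>. If \<open>K\<close> maps the coordinates in \<open>J\<close> to the other ones,
  then \<open>K ** K = 0\<close> and these two matrices are inverse to each other, so the product of
  \<open>chart_X K T\<close> and \<open>chart_Y K S\<close> vanishes if \<open>T\<close> and \<open>S\<close> live on complementary diagonal blocks. The
  columns of \<open>mat 1 + K\<close> with index in \<open>J\<close> span the graph of \<open>K\<close>.\<close>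

definition chart_X :: "complex^'n^'n \<Rightarrow> complex^'n^'n \<Rightarrow> complex^'n^'n" where
  "chart_X K T = transpose (mat 1 - K) ** (T ** (mat 1 - K))"

definition chart_Y :: "complex^'n^'n \<Rightarrow> complex^'n^'n \<Rightarrow> complex^'n^'n" where
  "chart_Y K S = (mat 1 + K) ** (S ** transpose (mat 1 + K))"

lemma matrix_add_rdistrib: "(B + C) ** A = B ** A + C ** (A :: complex^'n^'n)"
  by (simp add: matrix_matrix_mult_def vec_eq_iff sum.distrib algebra_simps)

lemma matrix_diff_ldistrib: "A ** (B - C) = A ** B - A ** (C :: complex^'n^'n)"
  and matrix_diff_rdistrib: "(B - C) ** A = B ** A - C ** (A :: complex^'n^'n)"
  by (simp_all add: matrix_matrix_mult_def vec_eq_iff sum_subtractf algebra_simps)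

lemma matrix_minus_left: "(- B) ** A = - (B ** (A :: complex^'n^'n))"
  and matrix_minus_right: "A ** (- B) = - (A ** (B :: complex^'n^'n))"
  by (simp_all add: matrix_matrix_mult_def vec_eq_iff sum_negf)

lemma matrix_mult_zero [simp]: "A ** 0 = (0 :: complex^'n^'n)" "0 ** A = (0 :: complex^'n^'n)"
  by (simp_all add: matrix_matrix_mult_def vec_eq_iff)

lemma transpose_plus: "transpose (A + B) = transpose A + transpose (B :: complex^'n^'n)"
  and transpose_minus: "transpose (A - B) = transpose A - transpose (B :: complex^'n^'n)"
  and transpose_uminus: "transpose (- A) = - transpose (A :: complex^'n^'n)"
  by (simp_all add: transpose_def vec_eq_iff)

lemma cscale_mult_left: "cscale c A ** B = cscale c (A ** B)"
  and cscale_mult_right: "A ** cscale c B = cscale c (A ** B)"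
  by (simp_all add: cscale_def matrix_matrix_mult_def vec_eq_iff sum_distrib_left mult.assoc mult.left_commute)

lemmas matrix_simps = matrix_mul_assoc[symmetric] matrix_add_ldistrib matrix_add_rdistrib
  matrix_diff_ldistrib matrix_diff_rdistrib matrix_minus_left matrix_minus_right
  transpose_plus transpose_minus transpose_uminus matrix_transpose_mul

lemma supported_mult_zero:
  assumes "supported P Q A" "supported P' Q' B" "Q \<inter> P' = {}"
  shows "A ** B = 0"
proof -
  have "A $ i $ k * B $ k $ j = 0" for i j k
    using assms unfolding supported_def by (metis disjoint_iff mult_eq_0_iff)
  then have "(\<Sum>k\<in>UNIV. A $ i $ k * B $ k $ j) = 0" for i j by (intro sum.neutral) blast
  then show ?thesis by (simp add: matrix_matrix_mult_def vec_eq_iff)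
qed

lemma supported_mult:
  assumes "supported P Q A" "supported P' Q' B" shows "supported P Q' (A ** B)"
  unfolding supported_def
proof (intro allI impI)
  fix k l assume "(A ** B) $ k $ l \<noteq> 0"
  then obtain t where "A $ k $ t * B $ t $ l \<noteq> 0"
    unfolding matrix_matrix_mult_def vec_lambda_beta using sum.not_neutral_contains_not_neutral by blast
  then show "k \<in> P \<and> l \<in> Q'" using assms by (auto simp: supported_def)
qed

lemma supported_transpose: "supported P Q A \<Longrightarrow> supported Q P (transpose A)"
  by (auto simp: supported_def transpose_def)

lemma supported_entry: "supported P Q A \<Longrightarrow> k \<notin> P \<or> l \<notin> Q \<Longrightarrow> A $ k $ l = 0"
  unfolding supported_def by blast

lemma Sym_transpose: "A \<in> Sym \<Longrightarrow> transpose A = A"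
  by (simp add: Sym_def)

lemma Sym_congruence: "A \<in> Sym \<Longrightarrow> transpose B ** (A ** B) \<in> Sym"
  and Sym_congruence': "A \<in> Sym \<Longrightarrow> B ** (A ** transpose B) \<in> Sym"
  by (simp_all add: Sym_def matrix_transpose_mul matrix_mul_assoc)

lemma chart_X_Sym: "T \<in> Sym \<Longrightarrow> chart_X K T \<in> Sym"
  and chart_Y_Sym: "S \<in> Sym \<Longrightarrow> chart_Y K S \<in> Sym"
  unfolding chart_X_def chart_Y_def by (rule Sym_congruence Sym_congruence', assumption)+

lemma card_complement: "card (- J) = CARD('n) - card (J :: 'n::finite set)"
  by (simp add: Compl_eq_Diff_UNIV card_Diff_subset)

context
  fixes J :: "'n::finite set" and K :: "complex^'n^'n"
  assumes K: "supported (- J) J K"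
begin

lemma unipotent_inverse: "(mat 1 + K) ** (mat 1 - K) = mat 1" "(mat 1 - K) ** (mat 1 + K) = mat 1"
proof -
  have "K ** K = 0" by (rule supported_mult_zero[OF K K]) auto
  then show "(mat 1 + K) ** (mat 1 - K) = mat 1" "(mat 1 - K) ** (mat 1 + K) = mat 1"
    by (simp_all add: matrix_simps)
qed

lemma unipotent_inverse': "(mat 1 + K) ** ((mat 1 - K) ** A) = A" "(mat 1 - K) ** ((mat 1 + K) ** A) = A"
  unfolding matrix_mul_assoc unipotent_inverse by simp_all

lemma unipotent_inverse_transpose:
  "transpose (mat 1 + K) ** transpose (mat 1 - K) = mat 1"
  "transpose (mat 1 - K) ** transpose (mat 1 + K) = mat 1"
  using unipotent_inverse by (simp_all flip: matrix_transpose_mul)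

lemma unipotent_inverse_transpose':
  "transpose (mat 1 + K) ** (transpose (mat 1 - K) ** A) = A"
  "transpose (mat 1 - K) ** (transpose (mat 1 + K) ** A) = A"
  unfolding matrix_mul_assoc unipotent_inverse_transpose by simp_all

lemma chart_product_zero:
  assumes "supported (- J) (- J) T" "supported J J S"
  shows "chart_X K T ** chart_Y K S = 0"
proof -
  have "T ** (S ** A) = 0" for A :: "complex^'n^'n"
    using supported_mult_zero[OF assms] by (simp add: matrix_mul_assoc)
  then show ?thesis unfolding chart_X_def chart_Y_def
    by (simp add: unipotent_inverse' flip: matrix_mul_assoc)
qed

lemma chart_X_entry:
  assumes kl: "k \<notin> J" "l \<notin> J"
  shows "chart_X K T $ k $ l = T $ k $ l"
proof -
  have "chart_X K T = T - T ** K - transpose K ** T + transpose K ** (T ** K)"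
    by (simp add: chart_X_def matrix_simps)
  moreover have all: "supported UNIV UNIV A" for A :: "complex^'n^'n" by (simp add: supported_def)
  have "(T ** K) $ k $ l = 0"
    using supported_entry[OF supported_mult[OF all K]] kl by blast
  moreover have "(transpose K ** T) $ k $ l = 0" "(transpose K ** (T ** K)) $ k $ l = 0"
    using supported_entry[OF supported_mult[OF supported_transpose[OF K] all]] kl by blast+
  ultimately show ?thesis by simp
qed

lemma dim_range_supported:
  assumes "supported P Q (A :: complex^'n^'n)" shows "vec.dim (range ((*v) A)) \<le> card P"
proof -
  have "range ((*v) A) \<subseteq> {x. \<forall>i. i \<notin> P \<longrightarrow> x $ i = 0}"
    using supported_entry[OF assms] by (auto simp: matrix_vector_mult_def)
  then have "vec.dim (range ((*v) A)) \<le> vec.dim {x :: complex^'n. \<forall>i. i \<notin> P \<longrightarrow> x $ i = 0}"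
    by (rule vec.dim_subset)
  then show ?thesis unfolding dim_substandard_cart .
qed

lemma dim_range_mult_le:
  "vec.dim (range ((*v) ((A :: complex^'n^'n) ** (B ** C)))) \<le> vec.dim (range ((*v) B))"
proof -
  have "range ((*v) (A ** (B ** C))) \<subseteq> (*v) A ` range ((*v) B)"
    by (auto simp flip: matrix_vector_mul_assoc)
  then have "vec.dim (range ((*v) (A ** (B ** C)))) \<le> vec.dim ((*v) A ` range ((*v) B))"
    by (rule vec.dim_subset)
  also have "\<dots> \<le> vec.dim (range ((*v) B))" by (rule vec.dim_image_le[OF matrix_vector_mul_linear_gen])
  finally show ?thesis .
qed

lemma rank_chart_le:
  assumes "supported (- J) (- J) T" "supported J J S" "T \<in> Sym" "S \<in> Sym"
  shows "rank (chart_X K T) \<le> card (- J)" "rank (chart_Y K S) \<le> card J"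
  unfolding rank_symmetric[OF chart_X_Sym[OF assms(3)]] rank_symmetric[OF chart_Y_Sym[OF assms(4)]]
  unfolding chart_X_def chart_Y_def
  by (rule order_trans[OF dim_range_mult_le dim_range_supported[OF assms(1)]],
      rule order_trans[OF dim_range_mult_le dim_range_supported[OF assms(2)]])

text \<open>If \<open>S + T\<close> is invertible, the ranks of its two diagonal blocks add up to the size of the matrix.\<close>

lemma rank_chart_eq:
  assumes T: "supported (- J) (- J) T" "T \<in> Sym" and S: "supported J J S" "S \<in> Sym" and "det (S + T) \<noteq> 0"
  shows "rank (chart_X K T) = card (- J)" "rank (chart_Y K S) = card J"
proof -
  let ?r = "\<lambda>A :: complex^'n^'n. vec.dim (range ((*v) A))"
  have "CARD('n) = ?r (S + T)"
    using det_nonzero_surj[of "S + T"] assms(5) vec_dim_card[where 'a = complex and 'n = 'n] by simp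
  also have "\<dots> \<le> ?r S + ?r T" by (rule dim_range_sum_le)
  finally have 1: "card J + card (- J) \<le> ?r S + ?r T"
    by (simp add: card_complement card_mono)
  have "T = transpose (mat 1 + K) ** (chart_X K T ** (mat 1 + K))"
    unfolding chart_X_def by (simp add: unipotent_inverse unipotent_inverse_transpose' flip: matrix_mul_assoc)
  then have "?r T \<le> ?r (chart_X K T)"
    using dim_range_mult_le[of "transpose (mat 1 + K)" "chart_X K T" "mat 1 + K"] by simp
  moreover have "S = (mat 1 - K) ** (chart_Y K S ** transpose (mat 1 - K))"
    unfolding chart_Y_def by (simp add: unipotent_inverse' unipotent_inverse_transpose flip: matrix_mul_assoc)
  then have "?r S \<le> ?r (chart_Y K S)"
    using dim_range_mult_le[of "mat 1 - K" "chart_Y K S" "transpose (mat 1 - K)"] by simp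
  ultimately show "rank (chart_X K T) = card (- J)" "rank (chart_Y K S) = card J"
    using 1 rank_chart_le[OF T(1) S(1) T(2) S(2)]
    unfolding rank_symmetric[OF chart_X_Sym[OF T(2)]] rank_symmetric[OF chart_Y_Sym[OF S(2)]] by linarith+
qed

end

text \<open>Choose a space \<open>W\<close> of dimension \<open>r\<close> between the image of \<open>Y\<close> and the kernel of \<open>X\<close>. It is
  the graph of a linear map over some coordinate subspace of dimension \<open>r\<close>; the matrix \<open>K\<close> of this
  map makes both matrices block diagonal.\<close>

lemma chart_cover:
  fixes X Y :: "complex^'n^'n"
  assumes X: "X \<in> Sym" "rank X \<le> CARD('n) - r" and Y: "Y \<in> Sym" "rank Y \<le> r" and XY: "X ** Y = 0"
    and r: "r \<le> CARD('n)"
  shows "\<exists>J K S T. card J = r \<and> supported (- J) J K \<and> supported J J S \<and> S \<in> Sym \<and>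
    supported (- J) (- J) T \<and> T \<in> Sym \<and> X = chart_X K T \<and> Y = chart_Y K S"
proof -
  obtain B0 B1 where B: "vec.independent (B0 \<union> B1)" "vec.span B0 = {x. X *v x = 0}"
    "card B0 + card B1 = CARD('n)" "card B1 = vec.dim (range ((*v) X))"
    by (rule kernel_basis[of X])
  have "r \<le> card B0" using B(3,4) X r rank_symmetric[OF X(1)] by linarith
  have "vec.independent B0" using vec.independent_mono[OF B(1)] by blast
  then have dimker: "vec.dim {x. X *v x = 0} = card B0"
    using B(2) vec.dim_eq_card_independent[of B0] by (metis vec.dim_span)
  obtain BY where BY: "BY \<subseteq> range ((*v) Y)" "vec.independent BY" "range ((*v) Y) \<subseteq> vec.span BY"
    "card BY = vec.dim (range ((*v) Y))"
    by (rule vec.basis_exists)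
  have "BY \<subseteq> {x. X *v x = 0}"
    using BY(1) XY by (auto simp: matrix_vector_mul_assoc)
  then obtain C where C: "BY \<subseteq> C" "C \<subseteq> {x. X *v x = 0}" "vec.independent C" "{x. X *v x = 0} \<subseteq> vec.span C"
    by (rule vec.maximal_independent_subset_extend[OF _ BY(2)])
  have finC: "finite C" by (rule vec.finiteI_independent[OF C(3)])
  have "card C = card B0"
    using vec.dim_unique[OF C(2,4,3) refl] dimker by simp
  then have "r \<le> card C" using \<open>r \<le> card B0\<close> by simp
  moreover have "card BY \<le> r" using BY(4) Y(2) rank_symmetric[OF Y(1)] by simp
  ultimately obtain A where A: "BY \<subseteq> A" "A \<subseteq> C" "card A = r"
    using exists_subset_between[OF _ _ C(1) finC] by metis
  let ?W = "vec.span A"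
  have indA: "vec.independent A" using vec.independent_mono[OF C(3) A(2)] .
  have finA: "finite A" using finC A(2) finite_subset by blast
  have YW: "Y *v x \<in> ?W" for x using BY(3) vec.span_mono[OF A(1)] by blast
  have WX: "X *v w = 0" if "w \<in> ?W" for w
    using vec.span_minimal[OF _ subspace_kernel_matrix, of A X] A(2) C(2) that by blast
  obtain E where E: "A \<subseteq> E" "E \<subseteq> A \<union> cart_basis" "vec.independent E" "A \<union> cart_basis \<subseteq> vec.span E"
    by (rule vec.maximal_independent_subset_extend[OF Un_upper1 indA])
  have finE: "finite E" by (rule vec.finiteI_independent[OF E(3)])
  have "vec.span (A \<union> cart_basis) \<subseteq> vec.span E" by (rule vec.span_minimal[OF E(4) vec.subspace_span])
  then have spE: "vec.span E = UNIV"
    using vec.span_mono[of cart_basis "A \<union> cart_basis"] by auto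
  have "vec.dim (UNIV :: (complex^'n) set) = card E"
    by (rule vec.dim_unique[of E]) (use E(3) spE in auto)
  then have cardE: "card E = CARD('n)" using vec_dim_card[where 'a = complex and 'n = 'n] by linarith
  define E0 where "E0 = E - A"
  have E0: "E = A \<union> E0" "A \<inter> E0 = {}" "E0 \<subseteq> cart_basis" using E(1,2) by (auto simp: E0_def)
  define J where "J = {k. axis k 1 \<notin> E0}"
  have E0_eq: "E0 = (\<lambda>k. axis k 1) ` (- J)" using E0(3) by (auto simp: J_def cart_basis_def)
  have "inj_on (\<lambda>k. axis k 1 :: complex^'n) (- J)" by (auto simp: inj_on_def axis_eq_axis)
  then have cJ: "card (- J) = card E0" unfolding E0_eq by (simp add: card_image)
  have "card E0 = CARD('n) - r" unfolding E0_def card_Diff_subset[OF finA E(1)] cardE A(3) ..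
  then have cardJ: "card J = r"
    using cJ r card_complement[of J] card_mono[of UNIV J] by simp
  have int: "vec.span A \<inter> vec.span E0 = {0}"
    by (rule span_Int_of_independent) (use E(3) E0 in auto)
  have spE0: "x \<in> vec.span E0 \<longleftrightarrow> (\<forall>k\<in>J. x $ k = 0)" for x
  proof
    have "vec.subspace {x :: complex^'n. \<forall>k\<in>J. x $ k = 0}" by (rule vec.subspaceI) auto
    moreover have "E0 \<subseteq> {x. \<forall>k\<in>J. x $ k = 0}"
      using E0(3) by (auto simp: J_def cart_basis_def axis_def)
    ultimately have "vec.span E0 \<subseteq> {x. \<forall>k\<in>J. x $ k = 0}" by (intro vec.span_minimal)
    then show "x \<in> vec.span E0 \<Longrightarrow> \<forall>k\<in>J. x $ k = 0" by blast
    assume x: "\<forall>k\<in>J. x $ k = 0"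
    have "x = (\<Sum>k\<in>UNIV. x $ k *s axis k 1)" by (simp add: basis_expansion)
    also have "\<dots> = (\<Sum>k\<in>- J. x $ k *s axis k 1)"
      using x by (intro sum.mono_neutral_right) auto
    also have "\<dots> \<in> vec.span E0"
      by (intro vec.span_sum vec.span_scale vec.span_base) (auto simp: J_def)
    finally show "x \<in> vec.span E0" .
  qed
  have "\<exists>w u. axis l 1 = w + u \<and> w \<in> ?W \<and> u \<in> vec.span E0" for l
  proof -
    have "axis l 1 \<in> vec.span (A \<union> E0)" using spE E0(1) by auto
    then show ?thesis unfolding vec.span_Un by blast
  qed
  then obtain w u where wu: "\<And>l. axis l 1 = w l + u l" "\<And>l. w l \<in> ?W" "\<And>l. u l \<in> vec.span E0" by metis
  define K where "K = (\<chi> k l. if k \<notin> J \<and> l \<in> J then w l $ k else 0)"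
  have K: "supported (- J) J K" by (auto simp: K_def supported_def)
  have wJ: "w l $ k = (if k = l then 1 else 0)" if "k \<in> J" for k l
  proof -
    have "u l $ k = 0" using wu(3) spE0 that by blast
    then have "w l $ k = axis l 1 $ k" using wu(1)[of l] by simp
    then show ?thesis by (simp add: axis_def)
  qed
  have W_graph: "((mat 1 - K) *v x) $ k = 0" if x: "x \<in> ?W" and k: "k \<notin> J" for x k
  proof -
    define y where "y = x - (\<Sum>l\<in>J. x $ l *s w l)"
    have "y \<in> ?W" unfolding y_def by (intro vec.span_diff x vec.span_sum vec.span_scale wu)
    moreover have "y $ i = 0" if "i \<in> J" for i
      using that by (simp add: y_def wJ mult_delta_right)
    then have "y \<in> vec.span E0" using spE0 by blast
    ultimately have "y = 0" using int by blast
    then have "y $ k = 0" by simp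
    then have "x $ k = (\<Sum>l\<in>J. x $ l * w l $ k)" unfolding y_def by simp
    also have "\<dots> = (\<Sum>l\<in>UNIV. K $ k $ l * x $ l)"
      using k by (intro sum.mono_neutral_cong_left) (auto simp: K_def)
    also have "\<dots> = (K *v x) $ k" by (simp add: matrix_vector_mult_def)
    finally show ?thesis by (simp add: matrix_vector_mult_diff_rdistrib)
  qed
  have W_col: "(mat 1 + K) *v axis l 1 \<in> ?W" if l: "l \<in> J" for l
  proof -
    have "(mat 1 + K) *v axis l 1 = w l"
    proof -
      have "((mat 1 + K) *v axis l 1) $ k = w l $ k" for k
        using l wJ[of k l] by (cases "k \<in> J")
          (auto simp: matrix_vector_axis K_def mat_def)
      then show ?thesis by (simp add: vec_eq_iff)
    qed
    then show ?thesis using wu by simp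
  qed
  define S where "S = (mat 1 - K) ** (Y ** transpose (mat 1 - K))"
  define T where "T = transpose (mat 1 + K) ** (X ** (mat 1 + K))"
  have Ssym: "S \<in> Sym" and Tsym: "T \<in> Sym" unfolding S_def T_def
    by (rule Sym_congruence'[OF Y(1)], rule Sym_congruence[OF X(1)])
  have S0: "S $ k $ l = 0" if "k \<notin> J" for k l
  proof -
    have "S *v axis l 1 = (mat 1 - K) *v (Y *v (transpose (mat 1 - K) *v axis l 1))"
      by (simp only: S_def matrix_vector_mul_assoc matrix_mul_assoc)
    then have "(S *v axis l 1) $ k = 0" using W_graph[OF YW that] by simp
    then show ?thesis by (simp add: matrix_vector_axis)
  qed
  have "S $ k $ l = 0" if "l \<notin> J" for k l using S0[OF that] Ssym by (metis Sym_iff)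
  with S0 have S: "supported J J S" unfolding supported_def by blast
  have T0: "T $ k $ l = 0" if "l \<in> J" for k l
  proof -
    have "T *v axis l 1 = transpose (mat 1 + K) *v (X *v ((mat 1 + K) *v axis l 1))"
      by (simp only: T_def matrix_vector_mul_assoc matrix_mul_assoc)
    then have "T *v axis l 1 = 0" using WX[OF W_col[OF that]] by (simp del: transpose_matrix_vector)
    then have "(T *v axis l 1) $ k = 0" by simp
    then show ?thesis by (simp add: matrix_vector_axis)
  qed
  have "T $ k $ l = 0" if "k \<in> J" for k l using T0[OF that] Tsym by (metis Sym_iff)
  with T0 have T: "supported (- J) (- J) T" unfolding supported_def by blast
  have "X = chart_X K T" "Y = chart_Y K S"
    unfolding chart_X_def chart_Y_def S_def T_def
    by (simp_all add: unipotent_inverse[OF K] unipotent_inverse'[OF K] unipotent_inverse_transpose[OF K]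
        unipotent_inverse_transpose'[OF K] flip: matrix_mul_assoc)
  then show ?thesis using cardJ K S Ssym T Tsym by blast
qed

section \<open>Parametrising the frames that admit a solution\<close>

definition block :: "'n set \<Rightarrow> 'n set \<Rightarrow> complex^'n^'n \<Rightarrow> complex^'n^'n" where
  "block P Q M = (\<chi> k l. if k \<in> P \<and> l \<in> Q then M $ k $ l else 0)"

text \<open>The block of \<open>M\<close> outside \<open>J\<close>, with the entries at \<open>(i, j)\<close> and \<open>(j, i)\<close> replaced
  by \<open>t\<close>.\<close>

definition block_T :: "'n set \<Rightarrow> 'n \<Rightarrow> 'n \<Rightarrow> complex \<Rightarrow> complex^'n^'n \<Rightarrow> complex^'n^'n" where
  "block_T J i j t M = (\<chi> k l. if k \<notin> J \<and> l \<notin> J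
     then (if k = i \<and> l = j \<or> k = j \<and> l = i then t else M $ k $ l) else 0)"

definition elem_sym :: "'n \<Rightarrow> 'n \<Rightarrow> complex^'n^'n" where
  "elem_sym i j = (\<chi> k l. (if k = i then (if l = j then 1 else 0) else 0)
     + (if k = j then (if l = i then 1 else 0) else 0))"

text \<open>One symmetric matrix \<open>B\<close> encodes a pair with product zero: its off-diagonal block is \<open>K\<close>, and its
  diagonal blocks are \<open>S\<close> and \<open>T\<close>. The entry of \<open>T\<close> at \<open>(i, j)\<close> is normalised to \<open>1\<close>, so the
  corresponding entry of \<open>B\<close> is free to carry other information.\<close>

definition pair_X :: "'n set \<Rightarrow> 'n \<Rightarrow> 'n \<Rightarrow> complex^'n^'n \<Rightarrow> complex^'n^'n" where
  "pair_X J i j B = chart_X (block (- J) J B) (block_T J i j 1 B)"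

definition pair_Y :: "'n set \<Rightarrow> complex^'n^'n \<Rightarrow> complex^'n^'n" where
  "pair_Y J B = chart_Y (block (- J) J B) (block J J B)"

definition project_perp :: "complex^'n^'n \<Rightarrow> 'n \<Rightarrow> 'n \<Rightarrow> complex^'n^'n \<Rightarrow> complex^'n^'n" where
  "project_perp X i j M = M - cscale (trace (X ** M) / 2) (elem_sym i j)"

text \<open>The parametrisation. The matrix \<open>a p\<close> encodes the pair \<open>(X, Y)\<close>, with \<open>X\<close> normalised to
  have entry \<open>1\<close> at \<open>(i, j)\<close>. The matrices with index in \<open>P\<close> are projected to the hyperplane
  orthogonal to \<open>X\<close> along the \<open>(i, j)\<close> entry. This leaves these entries free to store the
  coefficients of \<open>Y\<close> with respect to the frame; the coefficient with index in \<open>Q\<close> is stored in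
  the \<open>(i, j)\<close> entry of \<open>a p\<close>. So source and target of the map have the same dimension.\<close>

definition frame_map :: "'n set \<Rightarrow> 'n \<Rightarrow> 'n \<Rightarrow> nat \<Rightarrow> nat set \<Rightarrow> nat set
    \<Rightarrow> (nat \<Rightarrow> complex^'n^'n) \<Rightarrow> nat \<Rightarrow> complex^'n^'n" where
  "frame_map J i j p P Q a q =
    (if q \<in> P then project_perp (pair_X J i j (a p)) i j (a q)
     else if q = p then pair_Y J (a p)
       - (\<Sum>q'\<in>P. cscale (a q' $ i $ j) (project_perp (pair_X J i j (a p)) i j (a q')))
       - (\<Sum>q'\<in>Q. cscale (a p $ i $ j) (a q'))
     else a q)"

definition combination :: "nat \<Rightarrow> (nat \<Rightarrow> complex^'n^'n) \<Rightarrow> (nat \<Rightarrow> complex) \<Rightarrow> complex^'n^'n" where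
  "combination m A c = (\<Sum>q\<le>m. cscale (c q) (A q))"

text \<open>The matrix \<open>Y\<close> is represented by its coefficients with respect to the frame.\<close>

definition solution :: "nat \<Rightarrow> nat \<Rightarrow> (nat \<Rightarrow> complex^'n^'n) \<Rightarrow> complex^'n^'n \<Rightarrow> (nat \<Rightarrow> complex) \<Rightarrow> bool" where
  "solution m r A X c \<longleftrightarrow> X \<in> Sym \<and> (\<forall>q<m - 1. trace (X ** A q) = 0) \<and> X ** combination m A c = 0 \<and>
     rank X \<le> CARD('n) - r \<and> rank (combination m A c) \<le> r"

lemma supported_block: "supported P Q (block P Q M)"
  by (auto simp: supported_def block_def)

lemma supported_block_T: "supported (- J) (- J) (block_T J i j t M)"
  by (auto simp: supported_def block_T_def)

lemma block_Sym: "M \<in> Sym \<Longrightarrow> block P P M \<in> Sym"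
  by (auto simp: block_def Sym_iff)

lemma block_T_Sym: "M \<in> Sym \<Longrightarrow> block_T J i j t M \<in> Sym"
  by (auto simp: block_T_def Sym_iff)

lemma elem_sym_Sym: "elem_sym i j \<in> Sym"
  by (auto simp: elem_sym_def Sym_iff)

lemma elem_sym_entry: "elem_sym i j $ i $ j \<noteq> 0"
  by (simp add: elem_sym_def)

lemma trace_elem_sym: "trace (X ** elem_sym i j) = X $ i $ j + X $ j $ i"
  by (simp add: trace_def matrix_matrix_mult_def elem_sym_def distrib_left sum.distrib mult_delta_right
      sum.delta sum.delta' add.commute)

lemma trace_cscale: "trace (cscale c A) = c * trace A"
  by (simp add: trace_def sum_distrib_left)

lemma pair_X_Sym: "B \<in> Sym \<Longrightarrow> pair_X J i j B \<in> Sym"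
  unfolding pair_X_def by (intro chart_X_Sym block_T_Sym)

lemma pair_Y_Sym: "B \<in> Sym \<Longrightarrow> pair_Y J B \<in> Sym"
  unfolding pair_Y_def by (intro chart_Y_Sym block_Sym)

lemma pair_product_zero: "pair_X J i j B ** pair_Y J B = 0"
  unfolding pair_X_def pair_Y_def
  by (rule chart_product_zero) (rule supported_block supported_block_T)+

lemma pair_X_entry: "i \<notin> J \<Longrightarrow> j \<notin> J \<Longrightarrow> pair_X J i j B $ i $ j = 1"
  unfolding pair_X_def by (subst chart_X_entry[OF supported_block]) (auto simp: block_T_def)

lemma trace_project_perp:
  assumes "X \<in> Sym" "X $ i $ j = 1" shows "trace (X ** project_perp X i j M) = 0"
proof -
  have "X $ j $ i = 1" using assms by (simp add: Sym_iff)
  then show ?thesis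
    by (simp add: project_perp_def matrix_diff_ldistrib trace_sub cscale_mult_right trace_cscale trace_elem_sym assms)
qed

lemma project_perp_Sym: "M \<in> Sym \<Longrightarrow> project_perp X i j M \<in> Sym"
  unfolding project_perp_def by (intro Sym_diff Sym_cscale elem_sym_Sym)

subsection \<open>Matrices of polynomial functions\<close>

definition poly_matrix :: "('a \<Rightarrow> complex) set \<Rightarrow> ('a \<Rightarrow> complex^'n^'n) \<Rightarrow> bool" where
  "poly_matrix C M \<longleftrightarrow> (\<forall>k l. (\<lambda>a. M a $ k $ l) \<in> poly_funs C)"

lemma poly_matrix_const: "poly_matrix C (\<lambda>a. A)"
  by (simp add: poly_matrix_def poly_funs.const)

lemma poly_matrix_add: "poly_matrix C M \<Longrightarrow> poly_matrix C N \<Longrightarrow> poly_matrix C (\<lambda>a. M a + N a)"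
  by (simp add: poly_matrix_def poly_funs.add)

lemma poly_matrix_diff: "poly_matrix C M \<Longrightarrow> poly_matrix C N \<Longrightarrow> poly_matrix C (\<lambda>a. M a - N a)"
  by (simp add: poly_matrix_def poly_funs_diff)

lemma poly_matrix_mult: "poly_matrix C M \<Longrightarrow> poly_matrix C N \<Longrightarrow> poly_matrix C (\<lambda>a. M a ** N a)"
  unfolding poly_matrix_def matrix_matrix_mult_def vec_lambda_beta
  by (intro allI poly_funs_sum poly_funs.mult) blast+

lemma poly_matrix_transpose: "poly_matrix C M \<Longrightarrow> poly_matrix C (\<lambda>a. transpose (M a))"
  by (simp add: poly_matrix_def transpose_def)

lemma poly_matrix_cscale: "f \<in> poly_funs C \<Longrightarrow> poly_matrix C M \<Longrightarrow> poly_matrix C (\<lambda>a. cscale (f a) (M a))"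
  by (simp add: poly_matrix_def poly_funs.mult)

lemma poly_matrix_sum: "(\<And>i. i \<in> I \<Longrightarrow> poly_matrix C (M i)) \<Longrightarrow> poly_matrix C (\<lambda>a. \<Sum>i\<in>I. M i a)"
  by (induction I rule: infinite_finite_induct)
    (auto intro: poly_matrix_const[of _ 0] poly_matrix_add)

lemma poly_matrix_trace: "poly_matrix C M \<Longrightarrow> (\<lambda>a. trace (M a)) \<in> poly_funs C"
  unfolding poly_matrix_def trace_def by (intro poly_funs_sum) blast

lemma poly_matrix_block: "poly_matrix C M \<Longrightarrow> poly_matrix C (\<lambda>a. block P Q (M a))"
  unfolding poly_matrix_def
proof (intro allI)
  fix k l assume "\<forall>k l. (\<lambda>a. M a $ k $ l) \<in> poly_funs C"
  then show "(\<lambda>a. block P Q (M a) $ k $ l) \<in> poly_funs C"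
    by (cases "k \<in> P \<and> l \<in> Q") (auto simp: block_def intro: poly_funs.const)
qed

lemma poly_matrix_block_T: "poly_matrix C M \<Longrightarrow> poly_matrix C (\<lambda>a. block_T J i j t (M a))"
  unfolding poly_matrix_def
proof (intro allI)
  fix k l assume "\<forall>k l. (\<lambda>a. M a $ k $ l) \<in> poly_funs C"
  then show "(\<lambda>a. block_T J i j t (M a) $ k $ l) \<in> poly_funs C"
    by (cases "k \<notin> J \<and> l \<notin> J"; cases "k = i \<and> l = j \<or> k = j \<and> l = i")
      (auto simp: block_T_def intro: poly_funs.const)
qed

lemma poly_matrix_entry: "poly_matrix C M \<Longrightarrow> (\<lambda>a. M a $ k $ l) \<in> poly_funs C"
  by (simp add: poly_matrix_def)

lemma poly_matrix_det: "poly_matrix C M \<Longrightarrow> (\<lambda>a. det (M a)) \<in> poly_funs C"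
  by (rule poly_funs_det) (simp add: poly_matrix_def)

lemma poly_matrix_frame: "q \<le> m \<Longrightarrow> poly_matrix (frame_coords m) (\<lambda>a. a q)"
  by (simp add: poly_matrix_def frame_coord)

lemma poly_matrix_pair:
  assumes "poly_matrix C M"
  shows "poly_matrix C (\<lambda>a. pair_X J i j (M a))" "poly_matrix C (\<lambda>a. pair_Y J (M a))"
  unfolding pair_X_def pair_Y_def chart_X_def chart_Y_def
  by (intro poly_matrix_mult poly_matrix_transpose poly_matrix_diff poly_matrix_add poly_matrix_const
      poly_matrix_block poly_matrix_block_T assms)+

lemma poly_matrix_project_perp:
  assumes "poly_matrix C M" "poly_matrix C X"
  shows "poly_matrix C (\<lambda>a. project_perp (X a) i j (M a))"
proof -
  have "(\<lambda>a. (1/2) * trace (X a ** M a)) \<in> poly_funs C"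
    by (intro poly_funs_cmult poly_matrix_trace poly_matrix_mult assms)
  then have "(\<lambda>a. trace (X a ** M a) / 2) \<in> poly_funs C" by simp
  then show ?thesis unfolding project_perp_def
    by (intro poly_matrix_diff poly_matrix_cscale poly_matrix_const assms)
qed

lemma poly_frame_map_frame_map:
  fixes J :: "'n::finite set"
  assumes "p \<le> m" "P \<subseteq> {..m}" "Q \<subseteq> {..m}"
  shows "poly_frame_map m (frame_map J i j p P Q)"
  unfolding poly_frame_map_def
proof (intro conjI allI impI)
  fix q k l assume q: "q \<le> m"
  let ?C = "frame_coords m :: ((nat \<Rightarrow> complex^'n^'n) \<Rightarrow> complex) set"
  have proj: "poly_matrix ?C (\<lambda>a. project_perp (pair_X J i j (a p)) i j (a q'))" if "q' \<le> m" for q'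
    by (intro poly_matrix_project_perp poly_matrix_pair poly_matrix_frame that assms)
  have "poly_matrix ?C (\<lambda>a. pair_Y J (a p)
      - (\<Sum>q'\<in>P. cscale (a q' $ i $ j) (project_perp (pair_X J i j (a p)) i j (a q')))
      - (\<Sum>q'\<in>Q. cscale (a p $ i $ j) (a q')))"
    using assms
    by (intro poly_matrix_diff poly_matrix_sum poly_matrix_cscale proj poly_matrix_pair poly_matrix_frame
        frame_coord) auto
  then have "poly_matrix ?C (\<lambda>a. frame_map J i j p P Q a q)"
    unfolding frame_map_def using proj[OF q] poly_matrix_frame[OF q] by (cases "q \<in> P"; cases "q = p") simp_all
  then show "(\<lambda>a. frame_map J i j p P Q a q $ k $ l) \<in> poly_funs ?C" by (rule poly_matrix_entry)
next
  fix a :: "nat \<Rightarrow> complex^'n^'n" assume a: "sym_frame m a"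
  then have s: "a q \<in> Sym" if "q \<le> m" for q using that by (simp add: sym_frame_def)
  have "pair_Y J (a p) - (\<Sum>q'\<in>P. cscale (a q' $ i $ j) (project_perp (pair_X J i j (a p)) i j (a q')))
      - (\<Sum>q'\<in>Q. cscale (a p $ i $ j) (a q')) \<in> Sym"
    using assms by (intro Sym_diff Sym_sum Sym_cscale pair_Y_Sym project_perp_Sym s) auto
  then show "sym_frame m (frame_map J i j p P Q a)"
    using s by (auto simp: sym_frame_def frame_map_def project_perp_Sym)
qed

subsection \<open>Every solution lies in the image of a chart\<close>

lemma chart_X_cscale: "chart_X K (cscale c T) = cscale c (chart_X K T)"
  by (simp add: chart_X_def cscale_mult_left cscale_mult_right)

lemma chart_Y_cscale: "chart_Y K (cscale c S) = cscale c (chart_Y K S)"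
  by (simp add: chart_Y_def cscale_mult_left cscale_mult_right)

lemma cscale_cscale: "cscale c (cscale d A) = cscale (c * d) A"
  by (simp add: vec_eq_iff)

lemma cscale_sum: "cscale c (\<Sum>i\<in>I. f i) = (\<Sum>i\<in>I. cscale c (f i))"
  by (simp add: vec_eq_iff sum_distrib_left)

text \<open>The chart is the one of \<open>chart_cover\<close>, rescaled such that an entry of \<open>T\<close> becomes \<open>1\<close> and the
  coefficient of \<open>A p\<close> becomes \<open>1\<close>. As \<open>X\<close> is orthogonal to the matrices with index in \<open>P\<close>, adding
  to them a multiple of \<open>elem_sym i j\<close> changes neither their projection nor \<open>X\<close>, and it sets
  their \<open>(i, j)\<close> entries to the coefficients to be stored.\<close>

lemma solution_in_chart:
  fixes A :: "nat \<Rightarrow> complex^'n^'n"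
  assumes sol: "solution m r A X c" "X \<noteq> 0" and A: "sym_frame m A" and r: "r \<le> CARD('n)"
    and p: "p \<le> m" "p \<notin> P" "p \<notin> Q" and PQ: "P \<subseteq> {..<m - 1}" "Q \<subseteq> {q0}" "Q \<subseteq> {..m}" "Q \<inter> P = {}"
    and c: "c p \<noteq> 0" "\<And>q. q \<le> m \<Longrightarrow> q \<notin> P \<Longrightarrow> q \<notin> Q \<Longrightarrow> q \<noteq> p \<Longrightarrow> c q = 0"
  shows "\<exists>J i j a s. card J = r \<and> i \<notin> J \<and> j \<notin> J \<and> s \<noteq> 0 \<and> sym_frame m a \<and>
    (\<forall>q\<le>m. frame_map J i j p P Q a q = A q) \<and> pair_X J i j (a p) = cscale s X \<and>
    (\<forall>q\<in>P. a q $ i $ j = c q / c p) \<and> a p $ i $ j = (\<Sum>q\<in>Q. c q) / c p"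
proof -
  let ?Y = "combination m A c"
  have X: "X \<in> Sym" "rank X \<le> CARD('n) - r" "X ** ?Y = 0" "rank ?Y \<le> r"
    and perp: "\<And>q. q < m - 1 \<Longrightarrow> trace (X ** A q) = 0" using sol by (auto simp: solution_def)
  have Y: "?Y \<in> Sym" using A by (auto simp: combination_def sym_frame_def intro!: Sym_sum Sym_cscale)
  obtain J K S T where J: "card J = r" and K: "supported (- J) J K" and S: "supported J J S" "S \<in> Sym"
    and T: "supported (- J) (- J) T" "T \<in> Sym" and XY: "X = chart_X K T" "?Y = chart_Y K S"
    using chart_cover[OF X(1,2) Y X(4,3) r] by blast
  have "T \<noteq> 0" using sol(2) XY(1) by (auto simp: chart_X_def)
  then obtain i j where ij: "T $ i $ j \<noteq> 0" by (auto simp: vec_eq_iff)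
  then have iJ: "i \<notin> J" "j \<notin> J" using T(1) by (auto simp: supported_def)
  define s where "s = 1 / T $ i $ j"
  have s: "s \<noteq> 0" using ij by (simp add: s_def)
  define \<gamma> where "\<gamma> = (\<Sum>q\<in>Q. c q) / c p"
  define B where "B = K + transpose K + cscale (1 / c p) S + block_T J i j \<gamma> (cscale s T)"
  have B_Sym: "B \<in> Sym"
  proof -
    have "K + transpose K \<in> Sym" by (auto simp: Sym_iff transpose_def)
    moreover have "cscale (1 / c p) S \<in> Sym" "block_T J i j \<gamma> (cscale s T) \<in> Sym"
      by (intro Sym_cscale S block_T_Sym T)+
    ultimately show ?thesis unfolding B_def by (intro Sym_add[OF Sym_add])
  qed
  have K0: "K $ k $ l = 0" if "k \<in> J \<or> l \<notin> J" for k l using supported_entry[OF K] that by blast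
  have S0: "S $ k $ l = 0" if "k \<notin> J \<or> l \<notin> J" for k l using supported_entry[OF S(1)] that by blast
  have T0: "T $ k $ l = 0" if "k \<in> J \<or> l \<in> J" for k l using supported_entry[OF T(1)] that by blast
  have BK: "block (- J) J B = K"
    by (auto simp: B_def block_def block_T_def transpose_def vec_eq_iff K0 S0)
  have BS: "block J J B = cscale (1 / c p) S"
    by (auto simp: B_def block_def block_T_def transpose_def vec_eq_iff K0 S0)
  have Tji: "T $ j $ i = T $ i $ j" using T(2) by (simp add: Sym_iff)
  have BT: "block_T J i j 1 B = cscale s T"
    using Tji ij by (auto simp: B_def block_T_def transpose_def vec_eq_iff K0 S0 T0 s_def)
  have Bij: "B $ i $ j = \<gamma>"
    using iJ by (simp add: B_def block_T_def transpose_def K0 S0)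
  have pX: "pair_X J i j B = cscale s X"
    unfolding pair_X_def BK BT XY(1) by (rule chart_X_cscale)
  have pY: "pair_Y J B = cscale (1 / c p) ?Y"
    unfolding pair_Y_def BK BS XY(2) by (rule chart_Y_cscale)
  define t where "t q = (c q / c p - A q $ i $ j) / elem_sym i j $ i $ j" for q
  define a where "a q = (if q = p then B else if q \<in> P then A q + cscale (t q) (elem_sym i j) else A q)" for q
  have ap: "a p = B" by (simp add: a_def)
  have aP: "a q = A q + cscale (t q) (elem_sym i j)" if "q \<in> P" for q using that p by (auto simp: a_def)
  have aQ: "a q = A q" if "q \<notin> P" "q \<noteq> p" for q using that by (simp add: a_def)
  have "sym_frame m a"
    using A B_Sym by (auto simp: sym_frame_def a_def intro!: Sym_add Sym_cscale elem_sym_Sym)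
  moreover have aij: "a q $ i $ j = c q / c p" if "q \<in> P" for q
    using elem_sym_entry[of i j] by (simp add: aP[OF that] t_def)
  moreover have proj: "project_perp (pair_X J i j (a p)) i j (a q) = A q" if "q \<in> P" for q
  proof -
    have "q < m - 1" using that PQ(1) by auto
    then have "trace (cscale s X ** A q) = 0" by (simp add: cscale_mult_left trace_cscale perp)
    moreover have "trace (cscale s X ** elem_sym i j) = 2"
    proof -
      have "cscale s X $ i $ j = 1" using pair_X_entry[OF iJ, of B] pX by simp
      moreover have "cscale s X $ j $ i = cscale s X $ i $ j" using Sym_cscale[OF X(1), of s] by (metis Sym_iff)
      ultimately show ?thesis by (simp add: trace_elem_sym)
    qed
    ultimately have "trace (cscale s X ** a q) = 2 * t q"
      by (simp add: aP[OF that] matrix_add_ldistrib trace_add cscale_mult_right trace_cscale)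
    then show ?thesis by (simp add: project_perp_def ap pX aP[OF that])
  qed
  moreover have "frame_map J i j p P Q a q = A q" if "q \<le> m" for q
  proof (cases "q \<in> P \<or> q \<noteq> p")
    case True
    then show ?thesis using proj by (auto simp: frame_map_def aQ)
  next
    case False
    have fin: "finite P" "finite Q" using PQ finite_subset by blast+
    have "?Y = (\<Sum>q\<in>{p} \<union> P \<union> Q. cscale (c q) (A q))"
      unfolding combination_def
    proof (rule sum.mono_neutral_right)
      show "{p} \<union> P \<union> Q \<subseteq> {..m}" using p PQ by force
      show "\<forall>q\<in>{..m} - ({p} \<union> P \<union> Q). cscale (c q) (A q) = 0" using c(2) by (auto simp: vec_eq_iff)
    qed simp
    also have "\<dots> = cscale (c p) (A p) + (\<Sum>q\<in>P. cscale (c q) (A q)) + (\<Sum>q\<in>Q. cscale (c q) (A q))"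
      using fin p PQ(4) by (subst sum.union_disjoint; auto)+
    finally have Ysum: "?Y = \<dots>" .
    have "(\<Sum>q\<in>P. cscale (a q $ i $ j) (project_perp (pair_X J i j (a p)) i j (a q)))
        = cscale (1 / c p) (\<Sum>q\<in>P. cscale (c q) (A q))"
      unfolding cscale_sum by (intro sum.cong refl) (simp add: aij proj cscale_cscale)
    moreover have "(\<Sum>q\<in>Q. cscale (a p $ i $ j) (a q)) = cscale (1 / c p) (\<Sum>q\<in>Q. cscale (c q) (A q))"
      unfolding cscale_sum
    proof (intro sum.cong refl)
      fix q assume q: "q \<in> Q"
      then have "Q = {q}" using PQ(2) by auto
      moreover have "a q = A q" using q p(3) PQ(4) by (intro aQ) auto
      ultimately show "cscale (a p $ i $ j) (a q) = cscale (1 / c p) (cscale (c q) (A q))"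
        by (simp add: ap Bij \<gamma>_def cscale_cscale)
    qed
    ultimately have "frame_map J i j p P Q a p = cscale (1 / c p) (cscale (c p) (A p))"
      using p(2) by (simp add: frame_map_def ap pY Ysum) (simp add: vec_eq_iff algebra_simps)
    then show ?thesis using False c(1) by (simp add: vec_eq_iff)
  qed
  ultimately show ?thesis
    using J iJ s pX ap Bij unfolding \<gamma>_def by metis
qed

subsection \<open>Generic frames have only nondegenerate solutions\<close>

lemma nonzero_entry_frame: "\<exists>a. sym_frame m a \<and> a p $ i $ j \<noteq> (0 :: complex)"
  using elem_sym_entry[of i j] elem_sym_Sym[of i j]
  by (intro exI[of _ "\<lambda>_. elem_sym i j"]) (simp add: sym_frame_def)

text \<open>If the leading coefficient of \<open>Y\<close> vanishes, there is one coefficient less to store, and the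
  solution is encoded by a point of the hypersurface where the entry reserved for it is zero.\<close>

lemma generic_leading_coefficient:
  fixes r :: nat
  assumes m: "m < CARD('n) * CARD('n)" and r: "r \<le> CARD('n)"
  shows "generic m (\<lambda>A :: nat \<Rightarrow> complex^'n^'n. \<forall>X c. solution m r A X c \<longrightarrow> X \<noteq> 0 \<longrightarrow>
    (\<exists>q\<le>m. c q \<noteq> 0) \<longrightarrow> c m \<noteq> 0)"
proof -
  let ?P = "\<lambda>p. {..<m - 1} - {p}"
  let ?bad = "\<lambda>(J, i, j, p) A. \<forall>a. sym_frame m a \<longrightarrow> (\<forall>q\<le>m. frame_map J i j p (?P p) {} a q = A q) \<longrightarrow>
    a p $ i $ j \<noteq> (0 :: complex)"
  have "generic m (\<lambda>A :: nat \<Rightarrow> complex^'n^'n. \<forall>x\<in>UNIV \<times> UNIV \<times> UNIV \<times> {..m}. ?bad x A)"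
  proof (rule generic_ball)
    fix x :: "'n set \<times> 'n \<times> 'n \<times> nat" assume "x \<in> UNIV \<times> UNIV \<times> UNIV \<times> {..m}"
    then obtain J i j p where x: "x = (J, i, j, p)" "p \<le> m" by auto
    obtain a0 :: "nat \<Rightarrow> complex^'n^'n" where "sym_frame m a0" "a0 p $ i $ j \<noteq> 0"
      using nonzero_entry_frame by blast
    then show "generic m (?bad x)"
      unfolding x(1) prod.case
      by (intro generic_avoids_hypersurface[OF m] poly_frame_map_frame_map frame_coord) (use x(2) in auto)
  qed simp
  then show ?thesis
  proof (rule generic_mono, intro allI impI notI)
    fix A :: "nat \<Rightarrow> complex^'n^'n" and X c
    assume A: "sym_frame m A" and bad: "\<forall>x\<in>UNIV \<times> UNIV \<times> UNIV \<times> {..m}. ?bad x A"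
      and sol: "solution m r A X c" "X \<noteq> 0" and nz: "\<exists>q\<le>m. c q \<noteq> 0" and cm: "c m = 0"
    \<comment> \<open>With this choice every nonzero coefficient other than that of \<open>A p\<close> has an index below \<open>m - 1\<close>,
      so with \<open>Q = {}\<close> the entry of \<open>a p\<close> at \<open>(i, j)\<close> is an empty sum.\<close>
    define p where "p = (if c (m - 1) \<noteq> 0 then m - 1 else (SOME q. q \<le> m \<and> c q \<noteq> 0))"
    have p: "p \<le> m" "c p \<noteq> 0"
      using someI_ex[of "\<lambda>q. q \<le> m \<and> c q \<noteq> 0"] nz by (auto simp: p_def)
    have z: "c q = 0" if "q \<le> m" "q \<notin> ?P p" "q \<noteq> p" for q
    proof -
      have "q = m - 1 \<or> q = m" using that by auto
      then show ?thesis using cm that(3) by (auto simp: p_def split: if_splits)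
    qed
    obtain J i j a where a: "sym_frame m a" "\<forall>q\<le>m. frame_map J i j p (?P p) {} a q = A q" "a p $ i $ j = 0"
      using solution_in_chart[OF sol A r p(1), of "?P p" "{}" 0] p z by auto
    then show False using bad p(1) by auto
  qed
qed

lemma block_mat_1: "block (- J) J (mat 1) = 0"
  by (auto simp: block_def mat_def vec_eq_iff)

lemma trace_pair_X_mat_1:
  assumes "i \<notin> J" "j \<notin> J" shows "trace (pair_X J i j (mat 1)) = of_nat (card (- J))"
proof -
  have "pair_X J i j (mat 1) = block_T J i j 1 (mat 1)"
    by (simp add: pair_X_def chart_X_def block_mat_1)
  moreover have "block_T J i j 1 (mat 1) $ k $ k = (if k \<in> - J then 1 else 0)" for k :: 'a
    by (auto simp: block_T_def mat_def)
  ultimately show ?thesis by (simp add: trace_def sum.If_cases Compl_eq)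
qed

text \<open>A permutation matrix exchanging \<open>i\<close> and \<open>j\<close> satisfies the normalisation at \<open>(i, j)\<close>.\<close>

lemma nondegenerate_block_example:
  assumes "i \<notin> J" "j \<notin> (J :: 'n::finite set)"
  shows "\<exists>B \<in> Sym. det (block J J B + block_T J i j 1 B) \<noteq> 0"
proof -
  let ?\<sigma> = "\<lambda>k. if k = i then j else if k = j then i else k"
  define B :: "complex^'n^'n" where "B = (\<chi> k l. if l = ?\<sigma> k then 1 else 0)"
  have "B \<in> Sym" by (auto simp: B_def Sym_iff)
  have "block J J B + block_T J i j 1 B = B"
    using assms by (auto simp: B_def block_def block_T_def vec_eq_iff)
  moreover have "B ** B = mat 1"
  proof -
    have "(B ** B) $ k $ l = (if l = ?\<sigma> (?\<sigma> k) then 1 else 0)" for k l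
      by (simp add: matrix_matrix_mult_def B_def mult_delta_left)
    then show ?thesis by (auto simp: vec_eq_iff mat_def)
  qed
  then have "det B * det B = 1" by (metis det_mul det_I)
  ultimately show ?thesis using \<open>B \<in> Sym\<close> by (metis mult_zero_left zero_neq_one)
qed

text \<open>The parametrisation of the solutions with nonzero leading coefficient.\<close>

abbreviation main_map :: "nat \<Rightarrow> 'n set \<Rightarrow> 'n \<Rightarrow> 'n \<Rightarrow> (nat \<Rightarrow> complex^'n^'n) \<Rightarrow> nat \<Rightarrow> complex^'n^'n" where
  "main_map m J i j \<equiv> frame_map J i j m {..<m - 1} {m - 1}"

lemma poly_frame_map_main: "1 \<le> m \<Longrightarrow> poly_frame_map m (main_map m J i j)"
  by (rule poly_frame_map_frame_map) auto

text \<open>There are finitely many charts. In each of them the determinant and the trace do not vanish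
  identically, so the points where one of them vanishes lie on a hypersurface, and the frames that
  are critical values lie on a hypersurface as well.\<close>

lemma generic_nondegenerate:
  fixes r :: nat
  assumes m: "m < CARD('n) * CARD('n)" "1 \<le> m" and r: "r < CARD('n)"
  shows "generic m (\<lambda>A :: nat \<Rightarrow> complex^'n^'n. \<forall>J i j a. card J = r \<longrightarrow> i \<notin> J \<longrightarrow> j \<notin> J \<longrightarrow> sym_frame m a \<longrightarrow>
    (\<forall>q\<le>m. main_map m J i j a q = A q) \<longrightarrow>
    det (block J J (a m) + block_T J i j 1 (a m)) \<noteq> 0 \<and> trace (pair_X J i j (a m)) \<noteq> 0 \<and>
    immersive m (main_map m J i j) a)"
proof -
  let ?I = "{(J :: 'n set, i, j). card J = r \<and> i \<notin> J \<and> j \<notin> J}"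
  let ?h1 = "\<lambda>(J, i, j) a. det (block J J (a m) + block_T J i j 1 (a m))"
  let ?h2 = "\<lambda>(J, i, j) a. trace (pair_X J i j (a m))"
  let ?G = "\<lambda>(J, i, j) A a. sym_frame m a \<longrightarrow> (\<forall>q\<le>m. main_map m J i j a q = A q)"
  have "generic m (\<lambda>A :: nat \<Rightarrow> complex^'n^'n. \<forall>x\<in>?I. case x of (J, i, j) \<Rightarrow>
    (\<forall>a. sym_frame m a \<longrightarrow> (\<forall>q\<le>m. main_map m J i j a q = A q) \<longrightarrow>
      det (block J J (a m) + block_T J i j 1 (a m)) \<noteq> 0) \<and>
    (\<forall>a. sym_frame m a \<longrightarrow> (\<forall>q\<le>m. main_map m J i j a q = A q) \<longrightarrow> trace (pair_X J i j (a m)) \<noteq> 0) \<and>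
    (\<forall>a. sym_frame m a \<longrightarrow> (\<forall>q\<le>m. main_map m J i j a q = A q) \<longrightarrow> immersive m (main_map m J i j) a))"
  proof (rule generic_ball)
    show "finite ?I" by simp
    fix x assume "x \<in> ?I"
    then obtain J i j where x: "x = (J, i, j)" "card J = r" "i \<notin> J" "j \<notin> J" by auto
    note G = poly_frame_map_main[OF m(2), of J i j]
    obtain B :: "complex^'n^'n" where B: "B \<in> Sym" "det (block J J B + block_T J i j 1 B) \<noteq> 0"
      using nondegenerate_block_example[OF x(3,4)] by blast
    have 1: "generic m (\<lambda>A. \<forall>a. sym_frame m a \<longrightarrow> (\<forall>q\<le>m. main_map m J i j a q = A q) \<longrightarrow>
      det (block J J (a m) + block_T J i j 1 (a m)) \<noteq> 0)"
    proof (rule generic_avoids_hypersurface[OF m(1) G])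
      show "(\<lambda>a. det (block J J (a m) + block_T J i j 1 (a m))) \<in> poly_funs (frame_coords m)"
        by (intro poly_matrix_det poly_matrix_add poly_matrix_block poly_matrix_block_T poly_matrix_frame) simp_all
      show "sym_frame m (\<lambda>_. B)" using B by (simp add: sym_frame_def)
    qed (rule B(2))
    have "card (- J) \<noteq> 0" using x(2) r by (simp add: card_complement)
    then have "trace (pair_X J i j (mat 1)) \<noteq> 0" using trace_pair_X_mat_1[OF x(3,4)] by simp
    then have 2: "generic m (\<lambda>A. \<forall>a. sym_frame m a \<longrightarrow> (\<forall>q\<le>m. main_map m J i j a q = A q) \<longrightarrow>
      trace (pair_X J i j (a m)) \<noteq> 0)"
    proof (intro generic_avoids_hypersurface[OF m(1) G])
      show "(\<lambda>a. trace (pair_X J i j (a m))) \<in> poly_funs (frame_coords m)"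
        by (intro poly_matrix_trace poly_matrix_pair poly_matrix_frame) simp
      show "sym_frame m (\<lambda>_. mat 1)" by (simp add: sym_frame_def Sym_def)
    qed
    have 3: "generic m (\<lambda>A. \<forall>a. sym_frame m a \<longrightarrow> (\<forall>q\<le>m. main_map m J i j a q = A q) \<longrightarrow>
      immersive m (main_map m J i j) a)"
      by (rule generic_immersive[OF m(1) G])
    show "generic m (\<lambda>A. case x of (J, i, j) \<Rightarrow>
      (\<forall>a. sym_frame m a \<longrightarrow> (\<forall>q\<le>m. main_map m J i j a q = A q) \<longrightarrow>
        det (block J J (a m) + block_T J i j 1 (a m)) \<noteq> 0) \<and>
      (\<forall>a. sym_frame m a \<longrightarrow> (\<forall>q\<le>m. main_map m J i j a q = A q) \<longrightarrow> trace (pair_X J i j (a m)) \<noteq> 0) \<and>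
      (\<forall>a. sym_frame m a \<longrightarrow> (\<forall>q\<le>m. main_map m J i j a q = A q) \<longrightarrow> immersive m (main_map m J i j) a))"
      unfolding x(1) prod.case by (rule generic_conj[OF 1 generic_conj[OF 2 3]])
  qed
  then show ?thesis by (rule generic_mono) fastforce
qed

section \<open>Tangent vectors\<close>

text \<open>For a zero \<open>(X, Y)\<close> with \<open>Y = combination m A c\<close>, the equations of the intersection cut out
  only the tangent directions that come from rescaling \<open>X\<close> and \<open>Y\<close>.\<close>

definition regular :: "nat \<Rightarrow> (nat \<Rightarrow> complex^'n^'n) \<Rightarrow> complex^'n^'n \<Rightarrow> (nat \<Rightarrow> complex) \<Rightarrow> bool" where
  "regular m A X c \<longleftrightarrow> (\<forall>X' b. X' \<in> Sym \<longrightarrow> (\<forall>q<m - 1. trace (X' ** A q) = 0) \<longrightarrow>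
     X' ** combination m A c + X ** combination m A b = 0 \<longrightarrow>
     (\<exists>s u. X' = cscale s X \<and> (\<forall>q\<le>m. b q = u * c q)))"

definition diag_proj :: "'n set \<Rightarrow> complex^'n^'n" where
  "diag_proj P = (\<chi> k l. if k = l \<and> k \<in> P then 1 else 0)"

lemma transpose_zero [simp]: "transpose 0 = (0 :: complex^'n^'m)"
  by (simp add: transpose_def vec_eq_iff)

lemma supported_diag_proj: "supported P P (diag_proj P)"
  by (auto simp: supported_def diag_proj_def split: if_splits)

lemma diag_proj_complement: "diag_proj J + diag_proj (- J) = mat 1"
  by (auto simp: diag_proj_def mat_def vec_eq_iff)

lemma diag_proj_Sym: "transpose (diag_proj P) = diag_proj P"
  by (auto simp: diag_proj_def transpose_def vec_eq_iff)

lemma diag_proj_left: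
  assumes "supported P Q A" shows "diag_proj P ** A = A"
proof -
  have "diag_proj (- P) ** A = 0" by (rule supported_mult_zero[OF supported_diag_proj assms]) auto
  moreover have "(diag_proj P + diag_proj (- P)) ** A = A" by (simp add: diag_proj_complement)
  ultimately show ?thesis by (simp add: matrix_add_rdistrib)
qed

lemma diag_proj_right:
  assumes "supported P Q A" shows "A ** diag_proj Q = A"
proof -
  have "A ** diag_proj (- Q) = 0" by (rule supported_mult_zero[OF assms supported_diag_proj]) auto
  moreover have "A ** (diag_proj Q + diag_proj (- Q)) = A" by (simp add: diag_proj_complement)
  ultimately show ?thesis by (simp add: matrix_add_ldistrib)
qed

context
  fixes J :: "'n::finite set" and S T :: "complex^'n^'n"
  assumes S: "supported J J S" "S \<in> Sym" and T: "supported (- J) (- J) T" "T \<in> Sym"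
    and nd: "det (S + T) \<noteq> 0"
begin

lemma block_inverse:
  obtains L where "S ** L = diag_proj J" "L ** S = diag_proj J"
    "T ** L = diag_proj (- J)" "L ** T = diag_proj (- J)"
proof -
  obtain L where L: "(S + T) ** L = mat 1" "L ** (S + T) = mat 1"
    using nd unfolding invertible_det_nz[symmetric] invertible_def by blast
  have ES: "diag_proj J ** S = S" "S ** diag_proj J = S" "diag_proj (- J) ** T = T" "T ** diag_proj (- J) = T"
    by (rule diag_proj_left[OF S(1)] diag_proj_right[OF S(1)] diag_proj_left[OF T(1)] diag_proj_right[OF T(1)])+
  have zero: "diag_proj J ** T = 0" "T ** diag_proj J = 0" "diag_proj (- J) ** S = 0" "S ** diag_proj (- J) = 0"
    by (rule supported_mult_zero[OF supported_diag_proj T(1)] supported_mult_zero[OF T(1) supported_diag_proj]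
        supported_mult_zero[OF supported_diag_proj S(1)] supported_mult_zero[OF S(1) supported_diag_proj]; blast)+
  have "diag_proj J ** (S + T) = S" "(S + T) ** diag_proj J = S"
    "diag_proj (- J) ** (S + T) = T" "(S + T) ** diag_proj (- J) = T"
    by (simp_all add: matrix_add_ldistrib matrix_add_rdistrib ES zero)
  note N = this
  have "S ** L = diag_proj J ** ((S + T) ** L)" by (simp only: matrix_mul_assoc N)
  moreover have "L ** S = (L ** (S + T)) ** diag_proj J" by (simp only: matrix_mul_assoc[symmetric] N)
  moreover have "T ** L = diag_proj (- J) ** ((S + T) ** L)" by (simp only: matrix_mul_assoc N)
  moreover have "L ** T = (L ** (S + T)) ** diag_proj (- J)" by (simp only: matrix_mul_assoc[symmetric] N)
  ultimately show ?thesis using that[of L] by (simp add: L)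
qed

text \<open>In block form: the tangent space of the variety of pairs with product zero, at a pair of
  complementary ranks, is the image of the differential of the chart.\<close>

lemma tangent_lift:
  assumes X1: "X1 \<in> Sym" and Y1: "Y1 \<in> Sym" and eq: "X1 ** S + T ** Y1 = 0"
  shows "\<exists>dK dS dT. supported (- J) J dK \<and> supported J J dS \<and> dS \<in> Sym \<and> supported (- J) (- J) dT \<and>
    dT \<in> Sym \<and> X1 = dT - transpose dK ** T - T ** dK \<and> Y1 = dS + dK ** S + S ** transpose dK"
proof -
  obtain L where L: "S ** L = diag_proj J" "L ** S = diag_proj J"
    "T ** L = diag_proj (- J)" "L ** T = diag_proj (- J)" by (rule block_inverse)
  let ?E = "diag_proj J" and ?F = "diag_proj (- J)"
  have sE: "supported J J ?E" and sF: "supported (- J) (- J) ?F" by (rule supported_diag_proj)+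
  have EE: "?E ** ?E = ?E" by (rule diag_proj_left[OF sE])
  have ET: "?E ** T = 0" by (rule supported_mult_zero[OF sE T(1)]) auto
  have SF: "S ** ?F = 0" by (rule supported_mult_zero[OF S(1) sF]) auto
  have TY: "T ** Y1 = - (X1 ** S)" using eq by (simp add: add_eq_0_iff)
  have EXE: "?E ** (X1 ** ?E) = 0"
  proof -
    have "?E ** (X1 ** S) = - ((?E ** T) ** Y1)"
      unfolding matrix_mul_assoc[symmetric] TY by (simp add: matrix_minus_right)
    then have "?E ** (X1 ** S) = 0" by (simp add: ET)
    then have "(?E ** (X1 ** S)) ** L = 0" by simp
    then show ?thesis by (simp only: matrix_mul_assoc[symmetric] L)
  qed
  have FYF: "?F ** (Y1 ** ?F) = 0"
  proof -
    have "(T ** Y1) ** ?F = - (X1 ** (S ** ?F))" unfolding TY by (simp add: matrix_minus_left matrix_mul_assoc)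
    then have "L ** ((T ** Y1) ** ?F) = 0" by (simp add: SF)
    then show ?thesis by (simp only: matrix_mul_assoc L)
  qed
  have decomp: "A = ?E ** (A ** ?E) + ?E ** (A ** ?F) + ?F ** (A ** ?E) + ?F ** (A ** ?F)" for A
  proof -
    have "A = (?E + ?F) ** (A ** (?E + ?F))" by (simp add: diag_proj_complement)
    also have "\<dots> = ?E ** (A ** ?E) + ?E ** (A ** ?F) + ?F ** (A ** ?E) + ?F ** (A ** ?F)"
      unfolding matrix_add_ldistrib matrix_add_rdistrib by simp
    finally show ?thesis .
  qed
  define dK where "dK = ?F ** (Y1 ** (L ** ?E))"
  define dT where "dT = ?F ** (X1 ** ?F)"
  define dS where "dS = ?E ** (Y1 ** ?E)"
  have all: "supported UNIV UNIV A" for A :: "complex^'n^'n" by (simp add: supported_def)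
  have sup: "supported (- J) J dK" "supported J J dS" "supported (- J) (- J) dT"
    unfolding dK_def dS_def dT_def
    by (rule supported_mult[OF sF supported_mult[OF all supported_mult[OF all sE]]]
        supported_mult[OF sE supported_mult[OF all sE]] supported_mult[OF sF supported_mult[OF all sF]])+
  have sym: "dS \<in> Sym" "dT \<in> Sym"
    using X1 Y1 unfolding dS_def dT_def Sym_def
    by (simp_all add: matrix_transpose_mul diag_proj_Sym matrix_mul_assoc)
  have TdK: "T ** dK = - (X1 ** ?E)"
  proof -
    have "T ** dK = (T ** ?F) ** (Y1 ** (L ** ?E))" by (simp only: dK_def matrix_mul_assoc)
    also have "\<dots> = (T ** Y1) ** (L ** ?E)"
      unfolding diag_proj_right[OF T(1)] by (simp only: matrix_mul_assoc)
    also have "\<dots> = - (X1 ** ((S ** L) ** ?E))"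
      unfolding TY matrix_minus_left by (simp only: matrix_mul_assoc)
    finally show ?thesis by (simp only: L EE)
  qed
  have dKS: "dK ** S = ?F ** (Y1 ** ?E)"
  proof -
    have "dK ** S = ?F ** (Y1 ** (L ** (?E ** S)))" by (simp only: dK_def matrix_mul_assoc)
    then show ?thesis unfolding diag_proj_left[OF S(1)] by (simp only: L)
  qed
  have "transpose dK ** T = transpose (T ** dK)"
    by (simp add: matrix_transpose_mul Sym_transpose[OF T(2)])
  also have "\<dots> = - (?E ** X1)"
    unfolding TdK by (simp add: transpose_uminus matrix_transpose_mul diag_proj_Sym Sym_transpose[OF X1])
  finally have dKT: "transpose dK ** T = - (?E ** X1)" .
  have EX: "?E ** X1 = ?E ** (X1 ** ?F)"
  proof -
    have "?E ** X1 = ?E ** (X1 ** (?E + ?F))" by (simp add: diag_proj_complement)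
    then show ?thesis by (simp add: matrix_add_ldistrib EXE)
  qed
  have XE: "X1 ** ?E = ?F ** (X1 ** ?E)"
  proof -
    have "X1 ** ?E = (?E + ?F) ** (X1 ** ?E)" by (simp add: diag_proj_complement)
    then show ?thesis by (simp add: matrix_add_rdistrib EXE)
  qed
  have "X1 = dT - transpose dK ** T - T ** dK"
  proof -
    have "dT - transpose dK ** T - T ** dK = ?F ** (X1 ** ?F) + ?E ** (X1 ** ?F) + ?F ** (X1 ** ?E)"
      unfolding dKT TdK dT_def using EX XE by simp
    then show ?thesis using decomp[of X1] EXE by (simp add: add_ac)
  qed
  moreover have "Y1 = dS + dK ** S + S ** transpose dK"
  proof -
    have "S ** transpose dK = transpose (dK ** S)"
      by (simp add: matrix_transpose_mul Sym_transpose[OF S(2)])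
    also have "\<dots> = ?E ** (Y1 ** ?F)"
      unfolding dKS by (simp add: matrix_transpose_mul diag_proj_Sym Sym_transpose[OF Y1] matrix_mul_assoc)
    finally show ?thesis unfolding dKS dS_def using decomp[of Y1] FYF by (simp add: add_ac)
  qed
  ultimately show ?thesis using sup sym by blast
qed

text \<open>In block form: the differential of the chart is injective at such a pair.\<close>

lemma tangent_injective:
  assumes dK: "supported (- J) J dK" and dT: "supported (- J) (- J) dT"
    and X0: "dT - transpose dK ** T - T ** dK = 0" and Y0: "dS + dK ** S + S ** transpose dK = 0"
  shows "dK = 0" "dS = 0" "dT = 0"
proof -
  obtain L where L: "L ** T = diag_proj (- J)" by (rule block_inverse)
  let ?F = "diag_proj (- J)"
  have FdK: "?F ** (transpose dK ** A) = 0" for A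
  proof -
    have "?F ** transpose dK = 0"
      by (rule supported_mult_zero[OF supported_diag_proj supported_transpose[OF dK]]) auto
    then show ?thesis by (simp add: matrix_mul_assoc)
  qed
  have dKF: "dK ** ?F = 0" by (rule supported_mult_zero[OF dK supported_diag_proj]) auto
  have "?F ** ((dT - transpose dK ** T - T ** dK) ** ?F) = 0" by (simp add: X0)
  then have "?F ** (dT ** ?F) = 0"
    by (simp add: matrix_simps FdK dKF)
  then show dT0: "dT = 0" by (simp add: diag_proj_left[OF dT] diag_proj_right[OF dT])
  have "?F ** (dT - transpose dK ** T - T ** dK) = 0" by (simp add: X0)
  then have "?F ** (T ** dK) = 0" by (simp add: dT0 matrix_simps FdK)
  then have "T ** dK = 0" by (simp add: matrix_mul_assoc diag_proj_left[OF T(1)])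
  then have "L ** (T ** dK) = 0" by simp
  then show "dK = 0" by (simp add: matrix_mul_assoc L diag_proj_left[OF dK])
  then show "dS = 0" using Y0 by simp
qed

end

subsection \<open>Derivatives of matrix functions\<close>

definition mat_deriv :: "(complex \<Rightarrow> complex^'n^'n) \<Rightarrow> complex^'n^'n \<Rightarrow> bool" where
  "mat_deriv M M' \<longleftrightarrow> (\<forall>k l. ((\<lambda>s. M s $ k $ l) has_field_derivative M' $ k $ l) (at 0))"

lemma mat_deriv_unique: "mat_deriv M A \<Longrightarrow> mat_deriv M B \<Longrightarrow> A = B"
  unfolding mat_deriv_def vec_eq_iff using DERIV_unique by blast

lemma mat_deriv_zero_iff: "mat_deriv M M' \<Longrightarrow> mat_deriv M 0 \<longleftrightarrow> M' = 0"
  using mat_deriv_unique by blast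

lemma mat_deriv_const: "mat_deriv (\<lambda>s. A) 0"
  by (simp add: mat_deriv_def)

lemma mat_deriv_line: "mat_deriv (\<lambda>s. A + cscale s B) B"
  by (auto simp: mat_deriv_def intro!: derivative_eq_intros)

lemma mat_deriv_add: "mat_deriv M M' \<Longrightarrow> mat_deriv N N' \<Longrightarrow> mat_deriv (\<lambda>s. M s + N s) (M' + N')"
  by (simp add: mat_deriv_def DERIV_add)

lemma mat_deriv_diff: "mat_deriv M M' \<Longrightarrow> mat_deriv N N' \<Longrightarrow> mat_deriv (\<lambda>s. M s - N s) (M' - N')"
  by (simp add: mat_deriv_def DERIV_diff)

lemma mat_deriv_mult:
  assumes "mat_deriv M M'" "mat_deriv N N'"
  shows "mat_deriv (\<lambda>s. M s ** N s) (M' ** N 0 + M 0 ** N')"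
  unfolding mat_deriv_def
proof (intro allI)
  fix k l
  have "((\<lambda>s. \<Sum>t\<in>UNIV. M s $ k $ t * N s $ t $ l) has_field_derivative
      (\<Sum>t\<in>UNIV. M' $ k $ t * N 0 $ t $ l + N' $ t $ l * M 0 $ k $ t)) (at 0)"
    using assms unfolding mat_deriv_def by (intro DERIV_sum DERIV_mult) blast+
  then show "((\<lambda>s. (M s ** N s) $ k $ l) has_field_derivative (M' ** N 0 + M 0 ** N') $ k $ l) (at 0)"
    by (simp add: matrix_matrix_mult_def sum.distrib mult.commute)
qed

lemma mat_deriv_transpose: "mat_deriv M M' \<Longrightarrow> mat_deriv (\<lambda>s. transpose (M s)) (transpose M')"
  by (simp add: mat_deriv_def transpose_def)

lemma mat_deriv_trace: "mat_deriv M M' \<Longrightarrow> ((\<lambda>s. trace (M s)) has_field_derivative trace M') (at 0)"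
  unfolding trace_def mat_deriv_def by (rule DERIV_sum) blast

lemma mat_deriv_cscale:
  assumes "(f has_field_derivative f') (at 0)" "mat_deriv M M'"
  shows "mat_deriv (\<lambda>s. cscale (f s) (M s)) (cscale f' (M 0) + cscale (f 0) M')"
  unfolding mat_deriv_def
proof (intro allI)
  fix k l
  have "((\<lambda>s. f s * M s $ k $ l) has_field_derivative f' * M 0 $ k $ l + M' $ k $ l * f 0) (at 0)"
    using assms unfolding mat_deriv_def by (intro DERIV_mult) blast+
  then show "((\<lambda>s. cscale (f s) (M s) $ k $ l) has_field_derivative
      (cscale f' (M 0) + cscale (f 0) M') $ k $ l) (at 0)"
    by (simp add: mult.commute)
qed

lemma mat_deriv_sum:
  "(\<And>i. i \<in> I \<Longrightarrow> mat_deriv (M i) (M' i)) \<Longrightarrow> mat_deriv (\<lambda>s. \<Sum>i\<in>I. M i s) (\<Sum>i\<in>I. M' i)"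
proof (induction I rule: infinite_finite_induct)
  case (insert i I)
  then show ?case by (simp add: mat_deriv_add)
qed (simp_all add: mat_deriv_const)

lemma chart_X_deriv:
  assumes "supported (- J) J K" "supported (- J) J dK"
  shows "mat_deriv (\<lambda>s. chart_X (K + cscale s dK) (T + cscale s dT))
    (chart_X K (dT - transpose dK ** T - T ** dK))"
proof -
  have "dK ** K = 0" by (rule supported_mult_zero[OF assms(2,1)]) auto
  moreover from this have "transpose K ** transpose dK = 0" by (simp flip: matrix_transpose_mul)
  ultimately have z: "dK ** K = 0" "transpose K ** transpose dK = 0" "transpose K ** (transpose dK ** A) = 0"
    for A :: "complex^'a^'a" by (simp_all add: matrix_mul_assoc)
  have g: "mat_deriv (\<lambda>s. mat 1 - (K + cscale s dK)) (0 - dK)"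
    by (intro mat_deriv_diff mat_deriv_const mat_deriv_line)
  have "mat_deriv (\<lambda>s. chart_X (K + cscale s dK) (T + cscale s dT))
    (transpose (0 - dK) ** ((T + cscale 0 dT) ** (mat 1 - (K + cscale 0 dK)))
     + transpose (mat 1 - (K + cscale 0 dK)) **
       (dT ** (mat 1 - (K + cscale 0 dK)) + (T + cscale 0 dT) ** (0 - dK)))"
    unfolding chart_X_def by (intro mat_deriv_mult mat_deriv_transpose g mat_deriv_line)
  moreover have "cscale 0 A = 0" for A :: "complex^'a^'a" by (simp add: vec_eq_iff)
  ultimately have "mat_deriv (\<lambda>s. chart_X (K + cscale s dK) (T + cscale s dT))
    (transpose (- dK) ** (T ** (mat 1 - K)) + transpose (mat 1 - K) ** (dT ** (mat 1 - K) + T ** (- dK)))"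
    by simp
  moreover have "transpose (- dK) ** (T ** (mat 1 - K)) + transpose (mat 1 - K) ** (dT ** (mat 1 - K) + T ** (- dK))
    = chart_X K (dT - transpose dK ** T - T ** dK)"
    unfolding chart_X_def by (simp add: matrix_simps z)
  ultimately show ?thesis by simp
qed

lemma chart_Y_deriv:
  assumes "supported (- J) J K" "supported (- J) J dK"
  shows "mat_deriv (\<lambda>s. chart_Y (K + cscale s dK) (S + cscale s dS))
    (chart_Y K (dS + dK ** S + S ** transpose dK))"
proof -
  have "K ** dK = 0" by (rule supported_mult_zero[OF assms]) auto
  moreover from this have "transpose dK ** transpose K = 0" by (simp flip: matrix_transpose_mul)
  ultimately have z: "K ** dK = 0" "K ** (dK ** A) = 0" "transpose dK ** transpose K = 0"
    for A :: "complex^'a^'a" by (simp_all add: matrix_mul_assoc)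
  have "mat_deriv (\<lambda>s. mat 1 + (K + cscale s dK)) (0 + dK)"
    by (intro mat_deriv_add mat_deriv_const mat_deriv_line)
  then have g: "mat_deriv (\<lambda>s. mat 1 + (K + cscale s dK)) dK" by simp
  have "mat_deriv (\<lambda>s. chart_Y (K + cscale s dK) (S + cscale s dS))
    (dK ** ((S + cscale 0 dS) ** transpose (mat 1 + (K + cscale 0 dK)))
     + (mat 1 + (K + cscale 0 dK)) **
       (dS ** transpose (mat 1 + (K + cscale 0 dK)) + (S + cscale 0 dS) ** transpose dK))"
    unfolding chart_Y_def by (intro mat_deriv_mult mat_deriv_transpose g mat_deriv_line)
  moreover have "cscale 0 A = 0" for A :: "complex^'a^'a" by (simp add: vec_eq_iff)
  ultimately have "mat_deriv (\<lambda>s. chart_Y (K + cscale s dK) (S + cscale s dS))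
    (dK ** (S ** transpose (mat 1 + K)) + (mat 1 + K) ** (dS ** transpose (mat 1 + K) + S ** transpose dK))"
    by simp
  moreover have "dK ** (S ** transpose (mat 1 + K)) + (mat 1 + K) ** (dS ** transpose (mat 1 + K) + S ** transpose dK)
    = chart_Y K (dS + dK ** S + S ** transpose dK)"
    unfolding chart_Y_def by (simp add: matrix_simps z add_ac)
  ultimately show ?thesis by simp
qed

definition tangent_X :: "'n set \<Rightarrow> 'n \<Rightarrow> 'n \<Rightarrow> complex^'n^'n \<Rightarrow> complex^'n^'n \<Rightarrow> complex^'n^'n" where
  "tangent_X J i j B V = chart_X (block (- J) J B)
     (block_T J i j 0 V - transpose (block (- J) J V) ** block_T J i j 1 B - block_T J i j 1 B ** block (- J) J V)"

definition tangent_Y :: "'n set \<Rightarrow> complex^'n^'n \<Rightarrow> complex^'n^'n \<Rightarrow> complex^'n^'n" where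
  "tangent_Y J B V = chart_Y (block (- J) J B)
     (block J J V + block (- J) J V ** block J J B + block J J B ** transpose (block (- J) J V))"

lemma block_line: "block P Q (B + cscale s V) = block P Q B + cscale s (block P Q V)"
  by (simp add: block_def vec_eq_iff)

lemma block_T_line: "block_T J i j 1 (B + cscale s V) = block_T J i j 1 B + cscale s (block_T J i j 0 V)"
proof -
  have "(if c then (if d then 1 else a + s * v) else 0)
    = (if c then (if d then 1 else a) else 0) + s * (if c then (if d then 0 else v) else 0)"
    for c d and a v :: complex by simp
  then show ?thesis
    unfolding vec_eq_iff block_T_def vec_lambda_beta vector_add_component cscale_nth by blast
qed

lemma pair_X_deriv: "mat_deriv (\<lambda>s. pair_X J i j (B + cscale s V)) (tangent_X J i j B V)"
proof -
  have "pair_X J i j (B + cscale s V) = chart_X (block (- J) J B + cscale s (block (- J) J V))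
      (block_T J i j 1 B + cscale s (block_T J i j 0 V))" for s
    unfolding pair_X_def block_line block_T_line ..
  then show ?thesis unfolding tangent_X_def
    using chart_X_deriv[OF supported_block supported_block] by simp
qed

lemma pair_Y_deriv: "mat_deriv (\<lambda>s. pair_Y J (B + cscale s V)) (tangent_Y J B V)"
proof -
  have "pair_Y J (B + cscale s V) = chart_Y (block (- J) J B + cscale s (block (- J) J V))
      (block J J B + cscale s (block J J V))" for s
    unfolding pair_Y_def block_line ..
  then show ?thesis unfolding tangent_Y_def
    using chart_Y_deriv[OF supported_block supported_block] by simp
qed

lemma tangent_product: "tangent_X J i j B V ** pair_Y J B + pair_X J i j B ** tangent_Y J B V = 0"
proof -
  have "mat_deriv (\<lambda>s. pair_X J i j (B + cscale s V) ** pair_Y J (B + cscale s V))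
    (tangent_X J i j B V ** pair_Y J (B + cscale 0 V) + pair_X J i j (B + cscale 0 V) ** tangent_Y J B V)"
    by (rule mat_deriv_mult[OF pair_X_deriv pair_Y_deriv])
  moreover have z: "B + cscale 0 V = B" by (simp add: vec_eq_iff)
  ultimately have "mat_deriv (\<lambda>s. 0 :: complex^'a^'a)
    (tangent_X J i j B V ** pair_Y J B + pair_X J i j B ** tangent_Y J B V)"
    unfolding pair_product_zero z by simp
  then show ?thesis by (rule mat_deriv_unique[OF _ mat_deriv_const])
qed

lemma tangent_X_Sym: "B \<in> Sym \<Longrightarrow> V \<in> Sym \<Longrightarrow> tangent_X J i j B V \<in> Sym"
proof -
  assume B: "B \<in> Sym" and V: "V \<in> Sym"
  have T: "transpose (block_T J i j t M) = block_T J i j t M" if "M \<in> Sym" for t M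
    by (rule Sym_transpose[OF block_T_Sym[OF that]])
  show ?thesis unfolding tangent_X_def
    by (rule chart_X_Sym) (simp add: Sym_def transpose_minus matrix_transpose_mul T[OF B] T[OF V] diff_right_commute)
qed

lemma tangent_X_entry:
  assumes "i \<notin> J" "j \<notin> J" shows "tangent_X J i j B V $ i $ j = 0"
proof -
  have "((\<lambda>s. pair_X J i j (B + cscale s V) $ i $ j) has_field_derivative tangent_X J i j B V $ i $ j) (at 0)"
    using pair_X_deriv[of J i j B V] unfolding mat_deriv_def by blast
  then show ?thesis unfolding pair_X_entry[OF assms] by (rule DERIV_unique[OF _ DERIV_const])
qed

subsection \<open>Regular solutions and immersive points\<close>

text \<open>The coefficients of \<open>Y\<close> that the parametrisation stores in \<open>(i, j)\<close> entries.\<close>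

definition chart_coefficient :: "nat \<Rightarrow> 'n \<Rightarrow> 'n \<Rightarrow> (nat \<Rightarrow> complex^'n^'n) \<Rightarrow> nat \<Rightarrow> complex" where
  "chart_coefficient m i j a q = (if q < m - 1 then a q $ i $ j else if q < m then a m $ i $ j else 1)"

lemma combination_split:
  assumes "1 \<le> m"
  shows "combination m A b = (\<Sum>q<m - 1. cscale (b q) (A q)) + cscale (b (m - 1)) (A (m - 1)) + cscale (b m) (A m)"
proof -
  have "{..m} = insert m (insert (m - 1) {..<m - 1})" "m \<noteq> m - 1" using assms by auto
  then show ?thesis by (simp add: combination_def add_ac)
qed

lemma main_map_simps:
  assumes "1 \<le> m"
  shows "q < m - 1 \<Longrightarrow> main_map m J i j a q = project_perp (pair_X J i j (a m)) i j (a q)"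
    "main_map m J i j a (m - 1) = a (m - 1)"
    "main_map m J i j a m = pair_Y J (a m)
       - (\<Sum>q<m - 1. cscale (a q $ i $ j) (project_perp (pair_X J i j (a m)) i j (a q)))
       - cscale (a m $ i $ j) (a (m - 1))"
  using assms by (auto simp: frame_map_def)

lemma combination_main_map:
  assumes m: "1 \<le> m" and A: "\<forall>q\<le>m. main_map m J i j a q = A q"
  shows "combination m A (chart_coefficient m i j a) = pair_Y J (a m)"
proof -
  have s1: "(\<Sum>q<m - 1. cscale (chart_coefficient m i j a q) (A q))
      = (\<Sum>q<m - 1. cscale (a q $ i $ j) (project_perp (pair_X J i j (a m)) i j (a q)))"
  proof (intro sum.cong refl)
    fix q assume "q \<in> {..<m - 1}"
    moreover from this have "A q = project_perp (pair_X J i j (a m)) i j (a q)"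
      using A main_map_simps(1)[OF m, of q J i j a] by auto
    ultimately show "cscale (chart_coefficient m i j a q) (A q)
        = cscale (a q $ i $ j) (project_perp (pair_X J i j (a m)) i j (a q))"
      by (simp add: chart_coefficient_def)
  qed
  have s2: "A (m - 1) = a (m - 1)" using A main_map_simps(2)[OF m, of J i j a] by simp
  have "A m = main_map m J i j a m" using A by simp
  note s3 = this[unfolded main_map_simps(3)[OF m]]
  have s4: "chart_coefficient m i j a (m - 1) = a m $ i $ j" "chart_coefficient m i j a m = 1"
    using m by (auto simp: chart_coefficient_def)
  have s5: "cscale 1 B = B" for B :: "complex^'a^'a" by (simp add: vec_eq_iff)
  show ?thesis
    unfolding combination_split[OF m] s1 s2 s3 s4 s5 by simp
qed

lemma project_perp_deriv:
  "mat_deriv (\<lambda>s. project_perp (pair_X J i j (B + cscale s V)) i j (M + cscale s W))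
    (W - cscale ((trace (tangent_X J i j B V ** M) + trace (pair_X J i j B ** W)) / 2) (elem_sym i j))"
proof -
  have "mat_deriv (\<lambda>s. pair_X J i j (B + cscale s V) ** (M + cscale s W))
    (tangent_X J i j B V ** (M + cscale 0 W) + pair_X J i j (B + cscale 0 V) ** W)"
    by (rule mat_deriv_mult[OF pair_X_deriv mat_deriv_line])
  moreover have z: "A + cscale 0 C = A" for A C :: "complex^'a^'a" by (simp add: vec_eq_iff)
  ultimately have "((\<lambda>s. trace (pair_X J i j (B + cscale s V) ** (M + cscale s W)) / 2) has_field_derivative
      (trace (tangent_X J i j B V ** M) + trace (pair_X J i j B ** W)) / 2) (at 0)"
    unfolding trace_add[symmetric] by (intro DERIV_cdivide mat_deriv_trace) simp
  from mat_deriv_cscale[OF this mat_deriv_const[of "elem_sym i j"]]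
  have "mat_deriv (\<lambda>s. cscale (trace (pair_X J i j (B + cscale s V) ** (M + cscale s W)) / 2) (elem_sym i j))
    (cscale ((trace (tangent_X J i j B V ** M) + trace (pair_X J i j B ** W)) / 2) (elem_sym i j))"
    by (simp add: cscale_def zero_vec_def[symmetric])
  then show ?thesis unfolding project_perp_def by (intro mat_deriv_diff mat_deriv_line)
qed

text \<open>The differential of the parametrisation, evaluated on a vector that it kills.\<close>

lemma immersive_main_map_iff:
  assumes m: "1 \<le> m"
  shows "immersive m (main_map m J i j) a \<longleftrightarrow> (\<forall>v. sym_frame m v \<longrightarrow>
    (\<forall>q<m - 1. v q = cscale ((trace (tangent_X J i j (a m) (v m) ** a q)
       + trace (pair_X J i j (a m) ** v q)) / 2) (elem_sym i j)) \<longrightarrow> v (m - 1) = 0 \<longrightarrow>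
    tangent_Y J (a m) (v m) = (\<Sum>q<m - 1. cscale (v q $ i $ j) (main_map m J i j a q))
      + cscale (v m $ i $ j) (a (m - 1)) \<longrightarrow> (\<forall>q\<le>m. v q = 0))"
proof -
  have "(\<forall>q\<le>m. \<forall>k l. ((\<lambda>s. main_map m J i j (\<lambda>p. a p + cscale s (v p)) q $ k $ l) has_field_derivative 0) (at 0))
    \<longleftrightarrow> (\<forall>q<m - 1. v q = cscale ((trace (tangent_X J i j (a m) (v m) ** a q)
       + trace (pair_X J i j (a m) ** v q)) / 2) (elem_sym i j)) \<and> v (m - 1) = 0 \<and>
    tangent_Y J (a m) (v m) = (\<Sum>q<m - 1. cscale (v q $ i $ j) (main_map m J i j a q))
      + cscale (v m $ i $ j) (a (m - 1))" (is "?L \<longleftrightarrow> ?R1 \<and> ?R2 \<and> ?R3") for v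
  proof -
    let ?a = "\<lambda>s p. a p + cscale s (v p)"
    let ?D = "\<lambda>q. v q - cscale ((trace (tangent_X J i j (a m) (v m) ** a q)
       + trace (pair_X J i j (a m) ** v q)) / 2) (elem_sym i j)"
    have L: "?L \<longleftrightarrow> (\<forall>q\<le>m. mat_deriv (\<lambda>s. main_map m J i j (?a s) q) 0)"
      by (simp add: mat_deriv_def)
    have d1: "mat_deriv (\<lambda>s. main_map m J i j (?a s) q) (?D q)" if "q < m - 1" for q
      unfolding main_map_simps(1)[OF m that] by (rule project_perp_deriv)
    have d2: "mat_deriv (\<lambda>s. main_map m J i j (?a s) (m - 1)) (v (m - 1))"
      unfolding main_map_simps(2)[OF m] by (rule mat_deriv_line)
    have entry: "((\<lambda>s. ?a s q $ i $ j) has_field_derivative v q $ i $ j) (at 0)" for q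
      using mat_deriv_line[of "a q" "v q"] by (simp add: mat_deriv_def)
    have z: "?a 0 = a" by (auto simp: vec_eq_iff)
    have z': "a q + cscale 0 (v q) = a q" for q by (simp add: vec_eq_iff)
    have "mat_deriv (\<lambda>s. main_map m J i j (?a s) m)
      (tangent_Y J (a m) (v m)
       - (\<Sum>q<m - 1. cscale (v q $ i $ j) (main_map m J i j (?a 0) q) + cscale (?a 0 q $ i $ j) (?D q))
       - (cscale (v m $ i $ j) (?a 0 (m - 1)) + cscale (?a 0 m $ i $ j) (v (m - 1))))"
      unfolding main_map_simps(3)[OF m]
    proof (intro mat_deriv_diff pair_Y_deriv mat_deriv_sum mat_deriv_cscale entry mat_deriv_line)
      fix q assume q: "q \<in> {..<m - 1}"
      have "mat_deriv (\<lambda>s. cscale (?a s q $ i $ j) (main_map m J i j (?a s) q))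
        (cscale (v q $ i $ j) (main_map m J i j (?a 0) q) + cscale (?a 0 q $ i $ j) (?D q))"
        by (rule mat_deriv_cscale[OF entry d1]) (use q in simp)
      moreover have "main_map m J i j (?a s) q = project_perp (pair_X J i j (?a s m)) i j (?a s q)" for s
        by (rule main_map_simps(1)[OF m]) (use q in simp)
      ultimately show "mat_deriv (\<lambda>s. cscale (?a s q $ i $ j)
          (project_perp (pair_X J i j (?a s m)) i j (?a s q)))
        (cscale (v q $ i $ j) (main_map m J i j (?a 0) q) + cscale (?a 0 q $ i $ j) (?D q))"
        by (simp only:)
    qed
    then have d3: "mat_deriv (\<lambda>s. main_map m J i j (?a s) m)
      (tangent_Y J (a m) (v m)
       - (\<Sum>q<m - 1. cscale (v q $ i $ j) (main_map m J i j a q) + cscale (a q $ i $ j) (?D q))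
       - (cscale (v m $ i $ j) (a (m - 1)) + cscale (a m $ i $ j) (v (m - 1))))"
      unfolding z z' .
    have "(\<forall>q\<le>m. mat_deriv (\<lambda>s. main_map m J i j (?a s) q) 0) \<longleftrightarrow>
      (\<forall>q<m - 1. mat_deriv (\<lambda>s. main_map m J i j (?a s) q) 0) \<and>
      mat_deriv (\<lambda>s. main_map m J i j (?a s) (m - 1)) 0 \<and> mat_deriv (\<lambda>s. main_map m J i j (?a s) m) 0"
    proof -
      have "q \<le> m \<longleftrightarrow> q < m - 1 \<or> q = m - 1 \<or> q = m" for q using m by auto
      then show ?thesis by auto
    qed
    also have "\<dots> \<longleftrightarrow> (\<forall>q<m - 1. ?D q = 0) \<and> v (m - 1) = 0 \<and>
      tangent_Y J (a m) (v m)
       - (\<Sum>q<m - 1. cscale (v q $ i $ j) (main_map m J i j a q) + cscale (a q $ i $ j) (?D q))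
       - (cscale (v m $ i $ j) (a (m - 1)) + cscale (a m $ i $ j) (v (m - 1))) = 0"
      unfolding mat_deriv_zero_iff[OF d2] mat_deriv_zero_iff[OF d3]
      using mat_deriv_zero_iff[OF d1] by blast
    also have "\<dots> \<longleftrightarrow> ?R1 \<and> ?R2 \<and> ?R3"
    proof -
      have "cscale c 0 = 0" for c by (simp add: vec_eq_iff)
      then show ?thesis by (auto simp: sum.distrib diff_eq_eq add_ac)
    qed
    finally show ?thesis using L by blast
  qed
  then show ?thesis unfolding immersive_def by (simp add: imp_conjL)
qed

lemma cscale_zero [simp]: "cscale 0 A = 0" "cscale c 0 = 0" "cscale 1 A = A"
  by (simp_all add: vec_eq_iff)

lemma cscale_eq_0_iff: "cscale c A = 0 \<longleftrightarrow> c = 0 \<or> A = 0"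
  by (auto simp: vec_eq_iff)

lemma combination_cong: "(\<And>q. q \<le> m \<Longrightarrow> b q = c q) \<Longrightarrow> combination m A b = combination m A c"
  by (simp add: combination_def)

lemma combination_diff_scale:
  "combination m A (\<lambda>q. b q - u * c q) = combination m A b - cscale u (combination m A c)"
  by (simp add: combination_def cscale_sum cscale_cscale flip: sum_subtractf)
    (intro sum.cong refl, simp add: vec_eq_iff left_diff_distrib)

lemma combination_scale: "combination m A (\<lambda>q. u * c q) = cscale u (combination m A c)"
  by (simp add: combination_def cscale_sum cscale_cscale)

lemma block_self_supported:
  fixes t :: complex
  assumes "supported (- J) J dK" "supported J J dS" "supported (- J) (- J) dT" "i \<notin> J" "j \<notin> J" "dT $ i $ j = 0" "dT \<in> Sym"
  defines "V \<equiv> dK + transpose dK + dS + dT + cscale t (elem_sym i j)"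
  shows "block (- J) J V = dK" "block J J V = dS" "block_T J i j 0 V = dT" "V $ i $ j = t * elem_sym i j $ i $ j"
proof -
  have K0: "dK $ k $ l = 0" if "k \<in> J \<or> l \<notin> J" for k l using supported_entry[OF assms(1)] that by blast
  have S0: "dS $ k $ l = 0" if "k \<notin> J \<or> l \<notin> J" for k l using supported_entry[OF assms(2)] that by blast
  have T0: "dT $ k $ l = 0" if "k \<in> J \<or> l \<in> J" for k l using supported_entry[OF assms(3)] that by blast
  have E0: "elem_sym i j $ k $ l = (0 :: complex)" if "\<not> (k = i \<and> l = j \<or> k = j \<and> l = i)" for k l
    using that by (auto simp: elem_sym_def)
  have Tji: "dT $ j $ i = 0" using assms(6,7) by (metis Sym_iff)
  have V: "V $ k $ l = dK $ k $ l + dK $ l $ k + dS $ k $ l + dT $ k $ l + t * elem_sym i j $ k $ l" for k l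
    by (simp add: V_def transpose_def)
  have ne: "\<not> (k = i \<and> l = j \<or> k = j \<and> l = i)" if "k \<in> J \<or> l \<in> J" for k l using that assms(4,5) by auto
  show "block (- J) J V = dK"
    unfolding vec_eq_iff block_def vec_lambda_beta
  proof (intro allI)
    fix k l show "(if k \<in> - J \<and> l \<in> J then V $ k $ l else 0) = dK $ k $ l"
      using K0[of k l] K0[of l k] S0[of k l] T0[of k l] E0[OF ne[of k l]] by (auto simp: V)
  qed
  show "block J J V = dS"
    unfolding vec_eq_iff block_def vec_lambda_beta
  proof (intro allI)
    fix k l show "(if k \<in> J \<and> l \<in> J then V $ k $ l else 0) = dS $ k $ l"
      using K0[of k l] K0[of l k] S0[of k l] T0[of k l] E0[OF ne[of k l]] by (auto simp: V)
  qed
  show "block_T J i j 0 V = dT"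
    unfolding vec_eq_iff block_T_def vec_lambda_beta
  proof (intro allI)
    fix k l
    show "(if k \<notin> J \<and> l \<notin> J then (if k = i \<and> l = j \<or> k = j \<and> l = i then 0 else V $ k $ l) else 0) = dT $ k $ l"
    proof (cases "k = i \<and> l = j \<or> k = j \<and> l = i")
      case True
      then have "dT $ k $ l = 0" using assms(6) Tji by auto
      then show ?thesis using True by simp
    next
      case False
      then show ?thesis using K0[of k l] K0[of l k] S0[of k l] T0[of k l] E0[OF False] by (auto simp: V)
    qed
  qed
  show "V $ i $ j = t * elem_sym i j $ i $ j"
    using K0[of i j] K0[of j i] S0[of i j] assms(4-6) by (simp add: V)
qed

text \<open>A common setting for the comparison of the two notions: a point \<open>a\<close> of the main chart, the
  frame \<open>A\<close> that it parametrises, and the solution \<open>(X, c)\<close> that it encodes.\<close>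

context
  fixes J :: "'n::finite set" and i j :: 'n and m :: nat and a A :: "nat \<Rightarrow> complex^'n^'n"
  assumes m: "1 \<le> m" and iJ: "i \<notin> J" "j \<notin> J" and a: "sym_frame m a"
    and A: "\<forall>q\<le>m. main_map m J i j a q = A q"
    and nd: "det (block J J (a m) + block_T J i j 1 (a m)) \<noteq> 0"
begin

private abbreviation "B \<equiv> a m"
private abbreviation "X \<equiv> pair_X J i j B"
private abbreviation "Y \<equiv> pair_Y J B"
private abbreviation "c \<equiv> chart_coefficient m i j a"

lemma chart_B_Sym: "a m \<in> Sym"
  using a by (simp add: sym_frame_def)

lemma chart_A_perp:
  assumes "q < m - 1"
  shows "A q = a q - cscale (trace (X ** a q) / 2) (elem_sym i j)" "trace (X ** A q) = 0"
proof -
  have "q \<le> m" using assms by simp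
  then have Aq: "A q = project_perp X i j (a q)" using A main_map_simps(1)[OF m assms] by metis
  then show "A q = a q - cscale (trace (X ** a q) / 2) (elem_sym i j)" by (simp add: project_perp_def)
  show "trace (X ** A q) = 0"
    unfolding Aq by (rule trace_project_perp[OF pair_X_Sym[OF chart_B_Sym] pair_X_entry[OF iJ]])
qed

lemma chart_coefficient_last: "c m = 1" "c (m - 1) = B $ i $ j" "q < m - 1 \<Longrightarrow> c q = a q $ i $ j"
  using m by (auto simp: chart_coefficient_def)

lemma trace_tangent:
  assumes "M \<in> Sym" "M $ i $ j = 0" "q < m - 1"
  shows "trace (M ** a q) = trace (M ** A q)"
proof -
  have "M $ j $ i = 0" using assms by (metis Sym_iff)
  then show ?thesis unfolding chart_A_perp(1)[OF assms(3)]
    using assms(2) by (simp add: matrix_diff_ldistrib trace_sub cscale_mult_right trace_cscale trace_elem_sym)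
qed

lemma trace_X_elem: "trace (X ** elem_sym i j) = 2"
proof -
  have "X $ j $ i = X $ i $ j" using pair_X_Sym[OF chart_B_Sym] by (metis Sym_iff)
  then show ?thesis using pair_X_entry[OF iJ] by (simp add: trace_elem_sym)
qed

text \<open>Subtracting a multiple of the scaling directions, a tangent vector may be assumed to respect the
  normalisations. The unipotent congruence brings it into block form, and \<open>tangent_lift\<close> presents it
  as the derivative of the chart along a vector \<open>v\<close>. The remaining linear equations state that the
  differential of the parametrisation kills \<open>v\<close>.\<close>

lemma regular_of_immersive:
  assumes imm: "immersive m (main_map m J i j) a"
  shows "regular m A X c"
  unfolding regular_def
proof (intro allI impI)
  fix X' b
  assume X': "X' \<in> Sym" "\<forall>q<m - 1. trace (X' ** A q) = 0"
    and eq: "X' ** combination m A c + X ** combination m A b = 0"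
  let ?K = "block (- J) J B" and ?S = "block J J B" and ?T = "block_T J i j 1 B"
  let ?g = "mat 1 + ?K" and ?g' = "mat 1 - ?K"
  note K = supported_block[of "- J" J B]
  note inv = unipotent_inverse[OF K] unipotent_inverse'[OF K] unipotent_inverse_transpose[OF K]
    unipotent_inverse_transpose'[OF K]
  have Xc: "combination m A c = Y" by (rule combination_main_map[OF m A])
  define s where "s = X' $ i $ j"
  define u where "u = b m"
  define X'' where "X'' = X' - cscale s X"
  define b'' where "b'' = (\<lambda>q. b q - u * c q)"
  define Y'' where "Y'' = combination m A b''"
  have XS: "X \<in> Sym" by (rule pair_X_Sym[OF chart_B_Sym])
  have X''S: "X'' \<in> Sym" unfolding X''_def by (intro Sym_diff X' Sym_cscale XS)
  have X''ij: "X'' $ i $ j = 0" by (simp add: X''_def s_def pair_X_entry[OF iJ])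
  have tr: "trace (X'' ** A q) = 0" if "q < m - 1" for q
    using X'(2) that chart_A_perp(2)[OF that]
    by (simp add: X''_def matrix_diff_rdistrib trace_sub cscale_mult_left trace_cscale)
  have b''m: "b'' m = 0" by (simp add: b''_def u_def chart_coefficient_last)
  have Y''S: "Y'' \<in> Sym"
  proof -
    have "sym_frame m A" using poly_frame_map_main[OF m, of J i j] a A unfolding poly_frame_map_def sym_frame_def by metis
    then show ?thesis unfolding Y''_def combination_def by (auto simp: sym_frame_def intro!: Sym_sum Sym_cscale)
  qed
  have eq'': "X'' ** Y + X ** Y'' = 0"
    using eq pair_product_zero[of J i j B]
    by (simp add: X''_def Y''_def b''_def combination_diff_scale Xc matrix_diff_rdistrib matrix_diff_ldistrib
        cscale_mult_left cscale_mult_right)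
  define X1 where "X1 = transpose ?g ** (X'' ** ?g)"
  define Y1 where "Y1 = ?g' ** (Y'' ** transpose ?g')"
  have X1S: "X1 \<in> Sym" and Y1S: "Y1 \<in> Sym" unfolding X1_def Y1_def
    by (rule Sym_congruence[OF X''S], rule Sym_congruence'[OF Y''S])
  have X'': "X'' = chart_X ?K X1" and Y'': "Y'' = chart_Y ?K Y1"
    unfolding chart_X_def chart_Y_def X1_def Y1_def by (simp_all add: inv flip: matrix_mul_assoc)
  have "X1 ** ?S = transpose ?g ** ((X'' ** Y) ** transpose ?g')"
    unfolding X'' pair_Y_def chart_X_def chart_Y_def by (simp add: inv flip: matrix_mul_assoc)
  moreover have "?T ** Y1 = transpose ?g ** ((X ** Y'') ** transpose ?g')"
    unfolding Y'' pair_X_def chart_X_def chart_Y_def by (simp add: inv flip: matrix_mul_assoc)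
  moreover have "M ** (P ** N) + M ** (Q ** N) = M ** ((P + Q) ** N)" for M N P Q :: "complex^'n^'n"
    by (simp add: matrix_add_ldistrib matrix_add_rdistrib)
  ultimately have "X1 ** ?S + ?T ** Y1 = 0" by (simp only: eq'' matrix_mult_zero)
  then obtain dK dS dT where d: "supported (- J) J dK" "supported J J dS" "dS \<in> Sym"
    "supported (- J) (- J) dT" "dT \<in> Sym" "X1 = dT - transpose dK ** ?T - ?T ** dK"
    "Y1 = dS + dK ** ?S + ?S ** transpose dK"
    using tangent_lift[OF supported_block block_Sym[OF chart_B_Sym] supported_block_T
        block_T_Sym[OF chart_B_Sym] nd X1S Y1S] by blast
  have all: "supported UNIV UNIV M" for M :: "complex^'n^'n" by (simp add: supported_def)
  have dTij: "dT $ i $ j = 0"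
  proof -
    have "X1 $ i $ j = 0" using X''ij unfolding X'' chart_X_entry[OF K iJ] .
    moreover have "(transpose dK ** ?T) $ i $ j = 0"
      using supported_entry[OF supported_mult[OF supported_transpose[OF d(1)] all]] iJ by blast
    moreover have "(?T ** dK) $ i $ j = 0"
      using supported_entry[OF supported_mult[OF all d(1)]] iJ by blast
    ultimately show ?thesis by (simp add: d(6))
  qed
  let ?D = "elem_sym i j :: complex^'n^'n"
  let ?t = "b'' (m - 1) / ?D $ i $ j"
  define V where "V = dK + transpose dK + dS + dT + cscale ?t ?D"
  note V = block_self_supported[OF d(1,2,4) iJ dTij d(5), of ?t, folded V_def]
  have Vij: "V $ i $ j = b'' (m - 1)" using V(4) elem_sym_entry[of i j] by simp
  define v where "v q = (if q < m - 1 then cscale (b'' q / ?D $ i $ j) ?D else if q = m then V else 0)" for q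
  have vm: "v m = V" using m by (auto simp: v_def)
  have vq: "v q = cscale (b'' q / ?D $ i $ j) ?D" if "q < m - 1" for q using that by (simp add: v_def)
  have vqij: "v q $ i $ j = b'' q" if "q < m - 1" for q
    using elem_sym_entry[of i j] by (simp add: vq[OF that])
  have tX: "tangent_X J i j B V = X''" unfolding tangent_X_def V(1,3) X'' d(6) ..
  have tY: "tangent_Y J B V = Y''" unfolding tangent_Y_def V(1,2) Y'' d(7) ..
  have "V \<in> Sym"
  proof -
    have "dK + transpose dK \<in> Sym" by (auto simp: Sym_iff transpose_def)
    then show ?thesis unfolding V_def by (intro Sym_add[OF Sym_add[OF Sym_add]] d Sym_cscale elem_sym_Sym)
  qed
  then have "sym_frame m v" by (auto simp: sym_frame_def v_def Sym_0 intro!: Sym_cscale elem_sym_Sym)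
  moreover have "v q = cscale ((trace (tangent_X J i j B (v m) ** a q) + trace (X ** v q)) / 2) ?D"
    if "q < m - 1" for q
  proof -
    have "trace (X'' ** a q) = 0" using trace_tangent[OF X''S X''ij that] tr[OF that] by simp
    moreover have "trace (X ** v q) = 2 * (b'' q / ?D $ i $ j)"
      using trace_X_elem by (simp add: vq[OF that] cscale_mult_right trace_cscale)
    ultimately show ?thesis unfolding vm tX by (simp add: vq[OF that])
  qed
  moreover have "v (m - 1) = 0" using m by (simp add: v_def)
  moreover have "tangent_Y J B (v m) = (\<Sum>q<m - 1. cscale (v q $ i $ j) (main_map m J i j a q))
      + cscale (v m $ i $ j) (a (m - 1))"
  proof -
    have "(\<Sum>q<m - 1. cscale (v q $ i $ j) (main_map m J i j a q)) = (\<Sum>q<m - 1. cscale (b'' q) (A q))"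
      using A by (intro sum.cong refl) (simp add: vqij)
    moreover have "A (m - 1) = a (m - 1)" using A main_map_simps(2)[OF m, of J i j a] by simp
    ultimately show ?thesis
      unfolding vm tY Vij Y''_def combination_split[OF m] by (simp add: b''m)
  qed
  ultimately have v0: "\<forall>q\<le>m. v q = 0"
    using imm unfolding immersive_main_map_iff[OF m] by blast
  then have "V = 0" using vm by simp
  moreover have "block P Q 0 = 0" "block_T J i j 0 0 = 0" for P Q by (simp_all add: block_def block_T_def vec_eq_iff)
  ultimately have "dK = 0" "dS = 0" "dT = 0" using V(1-3) by metis+
  then have "X'' = 0" unfolding X'' d(6) by (simp add: chart_X_def)
  then have "X' = cscale s X" by (simp add: X''_def)
  moreover have "b q = u * c q" if qm: "q \<le> m" for q
  proof -
    have "b'' q = 0"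
    proof -
      consider "q < m - 1" | "q = m - 1" | "q = m" using qm by linarith
      then show ?thesis
      proof cases
        case 1 then show ?thesis using vqij[OF 1] v0 by simp
      next
        case 2 then show ?thesis using Vij \<open>V = 0\<close> by simp
      qed (simp add: b''m)
    qed
    then show ?thesis by (simp add: b''_def)
  qed
  ultimately show "\<exists>s u. X' = cscale s X \<and> (\<forall>q\<le>m. b q = u * c q)" by blast
qed

text \<open>The derivative of the encoded solution along a vector that the differential kills is a tangent
  vector with \<open>(i, j)\<close> entry and leading coefficient zero, so regularity makes it vanish; and the chart
  is injective on tangent vectors.\<close>

lemma immersive_of_regular:
  assumes reg: "regular m A X c"
  shows "immersive m (main_map m J i j) a"
  unfolding immersive_main_map_iff[OF m]
proof (intro allI impI)
  fix v :: "nat \<Rightarrow> complex^'n^'n" and q0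
  let ?D = "elem_sym i j :: complex^'n^'n"
  let ?V = "v m"
  assume v: "sym_frame m v"
    and P1: "\<forall>q<m - 1. v q = cscale ((trace (tangent_X J i j B ?V ** a q) + trace (X ** v q)) / 2) ?D"
    and P2: "v (m - 1) = 0"
    and P3: "tangent_Y J B ?V = (\<Sum>q<m - 1. cscale (v q $ i $ j) (main_map m J i j a q))
      + cscale (?V $ i $ j) (a (m - 1))" and q0: "q0 \<le> m"
  have VS: "?V \<in> Sym" using v by (simp add: sym_frame_def)
  let ?dX = "tangent_X J i j B ?V"
  have dXS: "?dX \<in> Sym" by (rule tangent_X_Sym[OF chart_B_Sym VS])
  have dXij: "?dX $ i $ j = 0" by (rule tangent_X_entry[OF iJ])
  define b where "b q = (if q < m - 1 then v q $ i $ j else if q < m then ?V $ i $ j else 0)" for q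
  have b: "b m = 0" "b (m - 1) = ?V $ i $ j" "\<And>q. q < m - 1 \<Longrightarrow> b q = v q $ i $ j"
    using m by (auto simp: b_def)
  have "combination m A b = tangent_Y J B ?V"
  proof -
    have "(\<Sum>q<m - 1. cscale (v q $ i $ j) (main_map m J i j a q)) = (\<Sum>q<m - 1. cscale (b q) (A q))"
      using A by (intro sum.cong refl) (simp add: b)
    moreover have "A (m - 1) = a (m - 1)" using A main_map_simps(2)[OF m, of J i j a] by simp
    ultimately show ?thesis unfolding P3 combination_split[OF m] b by simp
  qed
  then have eq: "?dX ** combination m A c + X ** combination m A b = 0"
    by (simp add: combination_main_map[OF m A] tangent_product)
  have "trace (?dX ** A q) = 0" if q: "q < m - 1" for q
  proof -
    let ?\<mu> = "(trace (?dX ** a q) + trace (X ** v q)) / 2"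
    have "v q = cscale ?\<mu> ?D" using P1 q by blast
    then have "trace (X ** v q) = trace (X ** cscale ?\<mu> ?D)" by (rule arg_cong)
    then have "trace (X ** v q) = 2 * ?\<mu>"
      using trace_X_elem by (simp add: cscale_mult_right trace_cscale)
    then have "trace (?dX ** a q) = 0" by simp
    then show ?thesis using trace_tangent[OF dXS dXij q] by simp
  qed
  then obtain s u where su: "?dX = cscale s X" "\<forall>q\<le>m. b q = u * c q"
    using reg dXS eq unfolding regular_def by blast
  have "u = 0" using su(2) b(1) chart_coefficient_last(1) by force
  then have b0: "b q = 0" if "q \<le> m" for q using su(2) that by simp
  have "s = 0" using dXij pair_X_entry[OF iJ, of B] unfolding su(1) by simp
  then have dX0: "?dX = 0" using su(1) by simp
  have "combination m A b = combination m A (\<lambda>_. 0)" by (rule combination_cong) (rule b0)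
  then have dY0: "tangent_Y J B ?V = 0"
    using \<open>combination m A b = tangent_Y J B ?V\<close> by (simp add: combination_def)
  let ?K = "block (- J) J B" and ?S = "block J J B" and ?T = "block_T J i j 1 B"
  note K = supported_block[of "- J" J B]
  have inj: "M = 0" if "chart_X ?K M = 0 \<or> chart_Y ?K M = 0" for M
  proof -
    have "M = transpose (mat 1 + ?K) ** (chart_X ?K M ** (mat 1 + ?K))"
      "M = (mat 1 - ?K) ** (chart_Y ?K M ** transpose (mat 1 - ?K))"
      unfolding chart_X_def chart_Y_def
      by (simp_all add: unipotent_inverse[OF K] unipotent_inverse'[OF K] unipotent_inverse_transpose[OF K]
        unipotent_inverse_transpose'[OF K] flip: matrix_mul_assoc)
    then show ?thesis using that by auto
  qed
  have X0: "block_T J i j 0 ?V - transpose (block (- J) J ?V) ** ?T - ?T ** block (- J) J ?V = 0"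
    using inj dX0 unfolding tangent_X_def by blast
  have Y0: "block J J ?V + block (- J) J ?V ** ?S + ?S ** transpose (block (- J) J ?V) = 0"
    using inj dY0 unfolding tangent_Y_def by blast
  note blocks = tangent_injective[OF supported_block block_Sym[OF chart_B_Sym] supported_block_T
        block_T_Sym[OF chart_B_Sym] nd supported_block supported_block_T X0 Y0]
  have V0: "?V = 0"
  proof -
    have "?V $ k $ l = 0" for k l
    proof -
      have sym: "?V $ l $ k = ?V $ k $ l" using VS by (metis Sym_iff)
      have e: "block (- J) J ?V $ k $ l = 0" "block (- J) J ?V $ l $ k = 0" "block J J ?V $ k $ l = 0"
        "block_T J i j 0 ?V $ k $ l = 0" unfolding blocks by simp_all
      show ?thesis
      proof (cases "k = i \<and> l = j \<or> k = j \<and> l = i")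
        case True
        then show ?thesis using sym b(2) b0[of "m - 1"] by auto
      next
        case False
        then show ?thesis using e sym by (cases "k \<in> J"; cases "l \<in> J") (auto simp: block_def block_T_def)
      qed
    qed
    then show ?thesis by (simp add: vec_eq_iff)
  qed
  consider "q0 < m - 1" | "q0 = m - 1" | "q0 = m" using q0 by linarith
  then show "v q0 = 0"
  proof cases
    case 1
    then obtain \<mu> where mu: "v q0 = cscale \<mu> ?D" using P1 by blast
    then have "\<mu> * ?D $ i $ j = 0" using b(3)[OF 1] b0[OF q0] by simp
    then show ?thesis using mu elem_sym_entry[of i j] by simp
  qed (use P2 V0 in auto)
qed

end

lemma regular_scale:
  assumes "regular m A X c" "s \<noteq> 0" "u \<noteq> 0" "\<And>q. q \<le> m \<Longrightarrow> d q = u * c q"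
  shows "regular m A (cscale s X) d"
  unfolding regular_def
proof (intro allI impI)
  fix X' b
  assume X': "X' \<in> Sym" "\<forall>q<m - 1. trace (X' ** A q) = 0"
    and eq: "X' ** combination m A d + cscale s X ** combination m A b = 0"
  have "combination m A d = cscale u (combination m A c)"
    using assms(4) unfolding combination_scale[symmetric] by (rule combination_cong)
  then have "cscale u (X' ** combination m A c) + cscale s (X ** combination m A b) = 0"
    using eq by (simp add: cscale_mult_left cscale_mult_right)
  then have "X' ** combination m A c + cscale (s / u) (X ** combination m A b) = 0"
    using assms(3) by (simp add: vec_eq_iff field_simps)
  then have "X' ** combination m A c + X ** combination m A (\<lambda>q. s / u * b q) = 0"
    by (simp only: combination_scale cscale_mult_right)
  then obtain t w where "X' = cscale t X" "\<forall>q\<le>m. s / u * b q = w * c q"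
    using assms(1) X' unfolding regular_def by blast
  then have "X' = cscale (t / s) (cscale s X)" "\<forall>q\<le>m. b q = w / s * d q"
    using assms by (auto simp: cscale_cscale field_simps)
  then show "\<exists>s' u. X' = cscale s' (cscale s X) \<and> (\<forall>q\<le>m. b q = u * d q)" by blast
qed

section \<open>Pataki's inequalities\<close>

text \<open>The positions of a symmetric matrix on or above the diagonal, restricted to a block.\<close>

definition upper :: "'n::finite set \<Rightarrow> ('n \<times> 'n) set" where
  "upper P = {(k, l). k \<in> P \<and> l \<in> P \<and> to_nat k \<le> to_nat l}"

lemma card_upper: "card (upper (P :: 'n::finite set)) = (card P + 1) choose 2"
proof -
  let ?U = "upper P"
  have fin: "finite ?U" by simp
  have un: "?U \<union> prod.swap ` ?U = P \<times> P" by (auto simp: upper_def image_iff) 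
  have int: "?U \<inter> prod.swap ` ?U = (\<lambda>k. (k, k)) ` P"
    by (auto simp: upper_def image_iff) 
  have "card (P \<times> P) + card ((\<lambda>k. (k, k)) ` P) = card ?U + card (prod.swap ` ?U)"
    unfolding un[symmetric] int[symmetric] by (rule card_Un_Int[symmetric]) (use fin in auto)
  moreover have "card (prod.swap ` ?U) = card ?U" by (rule card_image) (simp add: inj_on_def prod_eq_iff)
  moreover have "card ((\<lambda>k. (k, k)) ` P) = card P" by (rule card_image) (simp add: inj_on_def)
  ultimately have "2 * card ?U = card P * (card P + 1)" by (simp add: card_cartesian_product)
  then show ?thesis by (simp add: choose_two)
qed

lemma elem_sym_upper:
  assumes "(k, l) \<in> upper P" "(k', l') \<in> upper P'" "(k, l) \<noteq> (k', l')"
  shows "elem_sym k l $ k' $ l' = (0 :: complex)"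
  using assms by (auto simp: upper_def elem_sym_def)

lemma sum_elem_sym_entry:
  fixes U :: "('n::finite \<times> 'n) set"
  assumes "U \<subseteq> upper P" "(k, l) \<in> U"
  shows "(\<Sum>(k', l')\<in>U. cscale (\<beta> (k', l')) (elem_sym k' l')) $ k $ l = \<beta> (k, l) * elem_sym k l $ k $ l"
proof -
  have "(\<Sum>p\<in>U. (case p of (k', l') \<Rightarrow> cscale (\<beta> (k', l')) (elem_sym k' l') $ k $ l))
    = (\<Sum>p\<in>{(k, l)}. (case p of (k', l') \<Rightarrow> cscale (\<beta> (k', l')) (elem_sym k' l') $ k $ l))"
  proof (rule sum.mono_neutral_right)
    show "\<forall>p\<in>U - {(k, l)}. (case p of (k', l') \<Rightarrow> cscale (\<beta> (k', l')) (elem_sym k' l') $ k $ l) = 0"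
    proof
      fix p assume p: "p \<in> U - {(k, l)}"
      obtain k' l' where p': "p = (k', l')" by (cases p)
      have "elem_sym k' l' $ k $ l = (0 :: complex)"
        by (rule elem_sym_upper[of k' l' P k l P]) (use p p' assms in auto)
      then show "(case p of (k', l') \<Rightarrow> cscale (\<beta> (k', l')) (elem_sym k' l') $ k $ l) = 0" by (simp add: p')
    qed
  qed (use assms in auto)
  then show ?thesis by (simp add: case_prod_unfold)
qed

lemma supported_elem_sym: "(k, l) \<in> upper P \<Longrightarrow> supported P P (elem_sym k l)"
  by (auto simp: supported_def elem_sym_def upper_def split: if_splits)

lemma supported_sum_elem_sym:
  assumes "U \<subseteq> upper P" shows "supported P P (\<Sum>(k, l)\<in>U. cscale (\<beta> (k, l)) (elem_sym k l))"
proof -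
  have "(\<Sum>(k, l)\<in>U. cscale (\<beta> (k, l)) (elem_sym k l)) $ k' $ l' = 0" if "\<not> (k' \<in> P \<and> l' \<in> P)" for k' l'
    unfolding sum_component
  proof (intro sum.neutral ballI)
    fix p assume p: "p \<in> U"
    obtain k l where kl: "p = (k, l)" by (cases p)
    have "supported P P (elem_sym k l)" using p kl assms by (intro supported_elem_sym) auto
    then have "elem_sym k l $ k' $ l' = 0" by (rule supported_entry) (use that in blast)
    then show "(case p of (k, l) \<Rightarrow> cscale (\<beta> (k, l)) (elem_sym k l)) $ k' $ l' = 0" by (simp add: kl)
  qed
  then show ?thesis unfolding supported_def by blast
qed

lemma sum_elem_sym_Sym: "(\<Sum>(k, l)\<in>U. cscale (\<beta> (k, l)) (elem_sym k l)) \<in> Sym"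
  by (rule Sym_sum) (auto intro: Sym_cscale elem_sym_Sym)

text \<open>If one of the inequalities fails, one of the two factors of a solution can be deformed alone,
  which is impossible at a regular solution.\<close>

lemma regular_imp_pataki:
  fixes A :: "nat \<Rightarrow> complex^'n^'n"
  assumes m: "1 \<le> m" and A: "sym_frame m A" and J: "card J = r"
    and K: "supported (- J) J K" and S: "supported J J S" and T: "supported (- J) (- J) T" "T \<noteq> 0"
    and Y: "combination m A c = chart_Y K S" and c: "c m \<noteq> 0"
    and reg: "regular m A (chart_X K T) c"
  shows "(CARD('n) - r + 1) choose 2 \<le> m" "(r + 1) choose 2 \<le> ((CARD('n) + 1) choose 2) - m"
proof -
  have cardJ: "card (- J) = CARD('n) - r" using J by (simp add: card_complement)
  show "(CARD('n) - r + 1) choose 2 \<le> m"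
  proof (rule ccontr)
    assume "\<not> ?thesis"
    then have card: "card {..<m} < card (upper (- J))" by (simp add: card_upper cardJ)
    obtain i j where ij: "T $ i $ j \<noteq> 0" using T(2) by (auto simp: vec_eq_iff)
    let ?e = "\<lambda>(k, l). elem_sym k l :: complex^'n^'n"
    \<comment> \<open>There are \<open>m\<close> linear conditions on \<open>T'\<close>: orthogonality to \<open>m - 1\<close> matrices, and a vanishing entry
      at \<open>(i, j)\<close> that excludes multiples of \<open>T\<close>.\<close>
    obtain \<beta> where \<beta>: "\<exists>p\<in>upper (- J). \<beta> p \<noteq> 0" "\<forall>\<alpha>\<in>{..<m}. (\<Sum>p\<in>upper (- J).
      \<beta> p * (if \<alpha> < m - 1 then trace (chart_X K (?e p) ** A \<alpha>) else ?e p $ i $ j)) = 0"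
      using homogeneous_system[OF _ _ card,
        of "\<lambda>\<alpha> p. if \<alpha> < m - 1 then trace (chart_X K (?e p) ** A \<alpha>) else ?e p $ i $ j"] by auto
    define T' where "T' = (\<Sum>p\<in>upper (- J). cscale (\<beta> p) (?e p))"
    have T'_alt: "T' = (\<Sum>(k, l)\<in>upper (- J). cscale (\<beta> (k, l)) (elem_sym k l))"
      unfolding T'_def by (intro sum.cong) auto
    have T'sup: "supported (- J) (- J) T'" unfolding T'_alt by (rule supported_sum_elem_sym) simp
    have T'S: "T' \<in> Sym" unfolding T'_alt by (rule sum_elem_sym_Sym)
    have "T' $ i $ j = 0"
      using bspec[OF \<beta>(2), of "m - 1"] m by (simp add: T'_def)
    have trace_T': "trace (chart_X K T' ** A q) = (\<Sum>p\<in>upper (- J). \<beta> p * trace (chart_X K (?e p) ** A q))" for q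
    proof -
      have "chart_X K (\<Sum>p\<in>U. cscale (\<beta> p) (?e p)) = (\<Sum>p\<in>U. cscale (\<beta> p) (chart_X K (?e p)))" if "finite U" for U
        using that
        by induction (simp_all add: chart_X_def matrix_add_ldistrib matrix_add_rdistrib cscale_mult_left cscale_mult_right)
      moreover have "trace ((\<Sum>p\<in>U. cscale (\<beta> p) (chart_X K (?e p))) ** A q)
          = (\<Sum>p\<in>U. \<beta> p * trace (chart_X K (?e p) ** A q))" if "finite U" for U
        using that
        by induction (simp_all add: matrix_add_rdistrib trace_add cscale_mult_left trace_cscale,
            simp add: trace_def)
      ultimately show ?thesis unfolding T'_def by simp
    qed
    have tr: "trace (chart_X K T' ** A q) = 0" if "q < m - 1" for q
      using bspec[OF \<beta>(2), of q] that by (simp add: trace_T')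
    have "chart_X K T' ** chart_Y K S = 0" by (rule chart_product_zero[OF K T'sup S])
    moreover have "combination m A (\<lambda>_. 0) = 0" by (simp add: combination_def)
    ultimately have "chart_X K T' ** combination m A c + chart_X K T ** combination m A (\<lambda>_. 0) = 0"
      by (simp add: Y)
    then obtain s where "chart_X K T' = cscale s (chart_X K T)"
      using reg chart_X_Sym[OF T'S] tr unfolding regular_def by blast
    then have eq: "chart_X K T' = chart_X K (cscale s T)" by (simp add: chart_X_cscale)
    have "M = transpose (mat 1 + K) ** (chart_X K M ** (mat 1 + K))" for M
      unfolding chart_X_def by (simp add: unipotent_inverse[OF K] unipotent_inverse_transpose'[OF K] flip: matrix_mul_assoc)
    then have "T' = cscale s T" using eq by metis
    then have "T' = 0" using \<open>T' $ i $ j = 0\<close> ij by (auto simp: cscale_eq_0_iff)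
    moreover obtain k l where kl: "(k, l) \<in> upper (- J)" "\<beta> (k, l) \<noteq> 0" using \<beta>(1) by auto
    moreover have "T' $ k $ l = \<beta> (k, l) * elem_sym k l $ k $ l"
      unfolding T'_alt by (rule sum_elem_sym_entry[OF subset_refl kl(1)])
    ultimately show False using elem_sym_entry[of k l] by simp
  qed
  show "(r + 1) choose 2 \<le> ((CARD('n) + 1) choose 2) - m"
  proof (rule ccontr)
    assume neg: "\<not> ?thesis"
    let ?U = "upper J <+> {..m}" and ?O = "upper (UNIV :: 'n set) <+> {()}"
    have fin: "finite (upper J)" "finite (upper (UNIV :: 'n set))" by simp_all
    have card: "card ?O < card ?U"
      using neg by (simp add: card_Plus card_upper J)
    define e :: "'n \<times> 'n + nat \<Rightarrow> complex^'n^'n" where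
      "e x = (case x of Inl p \<Rightarrow> chart_Y K (elem_sym (fst p) (snd p)) | Inr q \<Rightarrow> - A q)" for x
    \<comment> \<open>The unknowns are the entries of \<open>S'\<close> and the \<open>m + 1\<close> coefficients \<open>b\<close>; the conditions are the
      entries of \<open>chart_Y K S' = combination m A b\<close> and \<open>b m = 0\<close>, which excludes multiples of \<open>c\<close>.\<close>
    obtain \<beta> where \<beta>: "\<exists>x\<in>?U. \<beta> x \<noteq> 0" "\<forall>\<alpha>\<in>?O. (\<Sum>x\<in>?U. \<beta> x * (case \<alpha> of Inl (k, l) \<Rightarrow> e x $ k $ l
        | Inr _ \<Rightarrow> if x = Inr m then 1 else 0)) = 0"
      using homogeneous_system[OF _ _ card, of "\<lambda>\<alpha> x. case \<alpha> of Inl (k, l) \<Rightarrow> e x $ k $ l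
        | Inr _ \<Rightarrow> if x = Inr m then 1 else 0"] by auto
    define S' where "S' = (\<Sum>(k, l)\<in>upper J. cscale (\<beta> (Inl (k, l))) (elem_sym k l))"
    define b where "b q = \<beta> (Inr q)" for q
    have S'sup: "supported J J S'" unfolding S'_def by (rule supported_sum_elem_sym) simp
    have S'S: "S' \<in> Sym" unfolding S'_def by (rule sum_elem_sym_Sym)
    have "(\<Sum>x\<in>?U. \<beta> x * (if x = Inr m then 1 else 0)) = 0"
      using bspec[OF \<beta>(2), of "Inr ()"] by (simp add: InrI)
    moreover have "Inr m \<in> ?U" by (rule InrI) simp
    ultimately have bm: "b m = 0" by (simp add: b_def mult_delta_right fin sum.delta)
    have chart_sum: "chart_Y K (\<Sum>(k, l)\<in>U. cscale (\<beta> (Inl (k, l))) (elem_sym k l))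
        = (\<Sum>(k, l)\<in>U. cscale (\<beta> (Inl (k, l))) (chart_Y K (elem_sym k l)))" if "finite U" for U
      using that
      by induction (simp_all add: chart_Y_def matrix_add_ldistrib matrix_add_rdistrib cscale_mult_left
          cscale_mult_right case_prod_unfold)
    have sum_e: "(\<Sum>x\<in>?U. \<beta> x * e x $ k $ l) = (chart_Y K S' - combination m A b) $ k $ l" for k l
    proof -
      have SC: "chart_Y K S' = (\<Sum>p\<in>upper J. cscale (\<beta> (Inl p)) (chart_Y K (elem_sym (fst p) (snd p))))"
        using chart_sum[OF fin(1)] by (simp add: S'_def case_prod_unfold)
      show ?thesis unfolding SC
        by (simp add: sum.Plus fin combination_def b_def e_def sum_negf)
    qed
    have "chart_Y K S' - combination m A b = 0"
    proof -
      let ?D = "chart_Y K S' - combination m A b"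
      have D: "?D \<in> Sym"
        using A S'S by (auto simp: combination_def sym_frame_def intro!: Sym_diff chart_Y_Sym Sym_sum Sym_cscale)
      have "?D $ k $ l = 0" if "to_nat k \<le> to_nat l" for k l
      proof -
        have "Inl (k, l) \<in> ?O" using that by (intro InlI) (simp add: upper_def)
        from bspec[OF \<beta>(2) this] show ?thesis unfolding sum_e[symmetric] by simp
      qed
      then have "?D $ k $ l = 0" for k l
        using D unfolding Sym_iff by (metis nle_le)
      then show ?thesis by (simp add: vec_eq_iff)
    qed
    then have Yb: "combination m A b = chart_Y K S'" by simp
    have "chart_X K T ** chart_Y K S' = 0" by (rule chart_product_zero[OF K T(1) S'sup])
    then have "0 ** combination m A c + chart_X K T ** combination m A b = 0"
      by (simp add: Yb)
    moreover have "\<forall>q<m - 1. trace (0 ** A q) = 0" by (simp add: trace_def)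
    ultimately obtain u where u: "\<forall>q\<le>m. b q = u * c q"
      using reg Sym_0 unfolding regular_def by blast
    then have "u = 0" using bm c by force
    then have b0: "b q = 0" if "q \<le> m" for q using u that by simp
    then have "combination m A b = 0" by (simp add: combination_def)
    then have "chart_Y K S' = 0" using Yb by simp
    moreover have "S' = (mat 1 - K) ** (chart_Y K S' ** transpose (mat 1 - K))"
      unfolding chart_Y_def by (simp add: unipotent_inverse'[OF K] unipotent_inverse_transpose[OF K] flip: matrix_mul_assoc)
    ultimately have S'0: "S' = 0" by simp
    have "\<beta> x = 0" if xU: "x \<in> ?U" for x
    proof (cases x)
      case (Inl p)
      then obtain k l where kl: "x = Inl (k, l)" "(k, l) \<in> upper J" using xU by (cases p) auto
      have "S' $ k $ l = \<beta> (Inl (k, l)) * elem_sym k l $ k $ l"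
        unfolding S'_def using sum_elem_sym_entry[OF subset_refl kl(2), of "\<lambda>p. \<beta> (Inl p)"] by simp
      then show ?thesis using S'0 elem_sym_entry[of k l] kl(1) by simp
    next
      case (Inr q)
      then show ?thesis using b0[of q] xU by (auto simp: b_def)
    qed
    then show False using \<beta>(1) by blast
  qed
qed

text \<open>Conversely, the inequalities leave room for an explicit immersive point. Here \<open>X\<close> and \<open>Y\<close> are
  complementary diagonal projections, and \<open>V\<close> is spanned by the matrices in the block of \<open>X\<close> that
  are orthogonal to \<open>X\<close> and by coordinate vectors of the off-diagonal block.\<close>

lemma immersive_point_exists:
  fixes r m :: nat
  assumes r: "1 \<le> r" "r < CARD('n)" and m: "1 \<le> m" "m < (CARD('n) + 1) choose 2"
    and pataki: "(CARD('n) - r + 1) choose 2 \<le> m" "(r + 1) choose 2 \<le> ((CARD('n) + 1) choose 2) - m"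
  shows "\<exists>(J :: 'n::finite set) i a. card J = r \<and> i \<notin> J \<and> sym_frame m a \<and> immersive m (main_map m J i i) a"
proof -
  obtain J :: "'n set" where J: "card J = r"
    using obtain_subset_with_card_n[of r "UNIV :: 'n set"] r by auto
  have "J \<noteq> UNIV" using J r by auto
  then obtain i where i: "i \<notin> J" by blast
  have cJ: "card (- J) = CARD('n) - r" using J by (simp add: card_complement)
  let ?Q = "upper UNIV - upper J - upper (- J)"
  have fin: "finite (upper P)" for P :: "'n set" by simp
  have disj: "upper J \<inter> upper (- J) = {}" by (auto simp: upper_def)
  have sub: "upper J \<subseteq> upper UNIV" "upper (- J) \<subseteq> upper UNIV" by (auto simp: upper_def)
  have cQ: "card ?Q = ((CARD('n) + 1) choose 2) - ((r + 1) choose 2) - ((CARD('n) - r + 1) choose 2)"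
  proof -
    have "card ?Q = card (upper (UNIV :: 'n set)) - card (upper J) - card (upper (- J))"
      using sub disj fin by (subst card_Diff_subset; auto simp: card_Diff_subset)
    then show ?thesis by (simp add: card_upper J cJ)
  qed
  have "m - (CARD('n) - r + 1 choose 2) \<le> card ?Q" using pataki m(2) unfolding cQ by linarith
  then obtain Q where Q: "Q \<subseteq> ?Q" "card Q = m - (CARD('n) - r + 1 choose 2)"
    using obtain_subset_with_card_n by metis
  define U where "U = (upper (- J) - {(i, i)}) \<union> Q"
  have finQ: "finite Q" using Q(1) finite_subset[OF _ fin] by blast
  have iU: "(i, i) \<in> upper (- J)" using i by (simp add: upper_def)
  have "card U = m - 1"
  proof -
    have "card U = card (upper (- J) - {(i, i)}) + card Q"
      unfolding U_def using Q(1) finQ by (intro card_Un_disjoint) auto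
    also have "card (upper (- J) - {(i, i)}) = (CARD('n) - r + 1 choose 2) - 1"
      using iU by (simp add: card_upper cJ)
    finally have "card U = (CARD('n) - r + 1 choose 2) - 1 + card Q" .
    moreover have "card (upper (- J)) > 0" using iU fin card_gt_0_iff by blast
    then have "(CARD('n) - r + 1 choose 2) > 0" unfolding card_upper cJ .
    ultimately show ?thesis using Q(2) pataki(1) by linarith
  qed
  moreover have finU: "finite U" using finQ fin by (simp add: U_def)
  ultimately obtain \<omega> where \<omega>: "bij_betw \<omega> {..<m - 1} U"
    using finite_same_card_bij[of "{..<m - 1}" U] by auto
  have Uup: "U \<subseteq> upper UNIV" using sub Q(1) by (auto simp: U_def)
  have iU': "(i, i) \<notin> U" using Q(1) iU by (auto simp: U_def)
  define B :: "complex^'n^'n" where "B = (\<chi> k l. if k = l \<and> k \<noteq> i then 1 else 0)"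
  define a where "a q = (if q < m - 1 then elem_sym (fst (\<omega> q)) (snd (\<omega> q)) else if q < m then elem_sym i i else B)" for q
  have am: "a m = B" "a (m - 1) = elem_sym i i" "\<And>q. q < m - 1 \<Longrightarrow> a q = elem_sym (fst (\<omega> q)) (snd (\<omega> q))"
    using m by (auto simp: a_def)
  have BS: "B \<in> Sym" by (auto simp: B_def Sym_iff)
  have aS: "sym_frame m a" using BS by (auto simp: sym_frame_def a_def elem_sym_Sym)
  have bK: "block (- J) J B = 0" by (auto simp: block_def B_def vec_eq_iff)
  have bS: "block J J B = diag_proj J" using i by (auto simp: block_def B_def diag_proj_def vec_eq_iff)
  have bT: "block_T J i i 1 B = diag_proj (- J)" using i by (auto simp: block_T_def B_def diag_proj_def vec_eq_iff)
  have X: "pair_X J i i B = diag_proj (- J)" unfolding pair_X_def bK bT by (simp add: chart_X_def)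
  have Y: "pair_Y J B = diag_proj J" unfolding pair_Y_def bK bS by (simp add: chart_Y_def)
  have nd: "det (block J J (a m) + block_T J i i 1 (a m)) \<noteq> 0"
    unfolding am bS bT diag_proj_complement by simp
  define A where "A = main_map m J i i a"
  have A: "\<forall>q\<le>m. main_map m J i i a q = A q" by (simp add: A_def)
  have trX: "trace (M ** elem_sym k l) = M $ k $ l + M $ l $ k" for M :: "complex^'n^'n" and k l
    by (rule trace_elem_sym)
  have Aq: "A q = elem_sym (fst (\<omega> q)) (snd (\<omega> q))
      - (if fst (\<omega> q) = snd (\<omega> q) \<and> fst (\<omega> q) \<notin> J then elem_sym i i else 0)" if q: "q < m - 1" for q
    unfolding A_def main_map_simps(1)[OF m(1) q] am(1) X project_perp_def am(3)[OF q] trX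
    by (auto simp: diag_proj_def)
  have Am1: "A (m - 1) = elem_sym i i" unfolding A_def main_map_simps(2)[OF m(1)] am ..
  let ?c = "chart_coefficient m i i a"
  have \<omega>U: "\<omega> q \<in> U" if "q < m - 1" for q using \<omega> that by (auto simp: bij_betw_def)
  have \<omega>_inj: "\<omega> q = \<omega> q' \<longleftrightarrow> q = q'" if "q < m - 1" "q' < m - 1" for q q'
    using \<omega> that by (auto simp: bij_betw_def inj_on_def)
  have elem_\<omega>: "elem_sym (fst (\<omega> q)) (snd (\<omega> q)) $ k $ l = (0 :: complex)"
    if "q < m - 1" "(k, l) \<in> upper UNIV" "\<omega> q \<noteq> (k, l)" for q k l
    using elem_sym_upper[of "fst (\<omega> q)" "snd (\<omega> q)" UNIV k l UNIV] \<omega>U[OF that(1)] Uup that by auto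
  have ii: "(i, i) \<in> upper UNIV" by (simp add: upper_def)
  have cq: "?c q = 0" if "q < m" for q
  proof (cases "q < m - 1")
    case True
    then have "\<omega> q \<noteq> (i, i)" using \<omega>U iU' by metis
    then show ?thesis using True elem_\<omega>[OF True ii] by (simp add: chart_coefficient_def am)
  next
    case False
    then show ?thesis using that by (simp add: chart_coefficient_def am B_def)
  qed
  have cm: "?c m = 1" using m by (simp add: chart_coefficient_def)
  have Yc: "combination m A ?c = diag_proj J"
    unfolding combination_main_map[OF m(1) A] am Y ..
  have Am: "A m = diag_proj J"
  proof -
    have "combination m A ?c = (\<Sum>q\<in>{m}. cscale (?c q) (A q))"
      unfolding combination_def using cq by (intro sum.mono_neutral_right) auto
    then show ?thesis using Yc cm by simp
  qed
  have "regular m A (pair_X J i i (a m)) ?c"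
    unfolding regular_def am X Yc
  proof (intro allI impI)
    fix X' b
    assume X': "X' \<in> Sym" and tr: "\<forall>q<m - 1. trace (X' ** A q) = 0"
      and eq: "X' ** diag_proj J + diag_proj (- J) ** combination m A b = 0"
    define W where "W = combination m A b"
    have sym: "X' $ k $ l = X' $ l $ k" for k l using X' by (metis Sym_iff)
    have right: "(M ** diag_proj P) $ k $ l = (if l \<in> P then M $ k $ l else 0)"
      and left: "(diag_proj P ** M) $ k $ l = (if k \<in> P then M $ k $ l else 0)"
      for M :: "complex^'n^'n" and P k l
    proof -
      have "M $ k $ t * diag_proj P $ t $ l = (if t = l then (if l \<in> P then M $ k $ l else 0) else 0)" for t
        by (auto simp: diag_proj_def)
      then show "(M ** diag_proj P) $ k $ l = (if l \<in> P then M $ k $ l else 0)"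
        by (simp add: matrix_matrix_mult_def)
      have "diag_proj P $ k $ t * M $ t $ l = (if t = k then (if k \<in> P then M $ k $ l else 0) else 0)" for t
        by (auto simp: diag_proj_def)
      then show "(diag_proj P ** M) $ k $ l = (if k \<in> P then M $ k $ l else 0)"
        by (simp add: matrix_matrix_mult_def)
    qed
    have E: "(if l \<in> J then X' $ k $ l else 0) + (if k \<notin> J then W $ k $ l else 0) = 0" for k l
    proof -
      have "(X' ** diag_proj J + diag_proj (- J) ** W) $ k $ l = 0" using eq by (simp add: W_def)
      then show ?thesis by (simp add: right left)
    qed
    have W: "W = (\<Sum>q<m - 1. cscale (b q) (A q)) + cscale (b (m - 1)) (elem_sym i i) + cscale (b m) (diag_proj J)"
      unfolding W_def combination_split[OF m(1)] Am1 Am ..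
    have WS: "W $ k $ l = W $ l $ k" for k l
    proof -
      have "W \<in> Sym" unfolding W
      proof (intro Sym_add Sym_sum Sym_cscale elem_sym_Sym)
        show "diag_proj J \<in> Sym" by (simp add: Sym_def diag_proj_Sym)
        show "A q \<in> Sym" if "q \<in> {..<m - 1}" for q
          using that by (auto simp: Aq intro!: Sym_diff elem_sym_Sym)
      qed
      then show ?thesis by (metis Sym_iff)
    qed
    have Aq_entry: "A q $ k $ l = (if \<omega> q = (k, l) then elem_sym k l $ k $ l else 0)"
      if q: "q < m - 1" and kl: "(k, l) \<in> U" for q k l
    proof -
      have "(k, l) \<noteq> (i, i)" using kl iU' by metis
      then have z: "elem_sym i i $ k $ l = (0 :: complex)" by (auto simp: elem_sym_def)
      have "A q $ k $ l = elem_sym (fst (\<omega> q)) (snd (\<omega> q)) $ k $ l" unfolding Aq[OF q] by (simp add: z)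
      then show ?thesis using elem_\<omega>[OF q, of k l] kl Uup by (cases "\<omega> q = (k, l)") auto
    qed
    have W_entry: "W $ k $ l = b q * elem_sym k l $ k $ l" if q: "q < m - 1" and kl: "\<omega> q = (k, l)" for q k l
    proof -
      have klU: "(k, l) \<in> U" using \<omega>U[OF q] kl by simp
      have "(\<Sum>q'<m - 1. cscale (b q') (A q')) $ k $ l = (\<Sum>q'<m - 1. b q' * A q' $ k $ l)" by simp
      also have "\<dots> = (\<Sum>q'<m - 1. if q' = q then b q * elem_sym k l $ k $ l else 0)"
        using Aq_entry[OF _ klU] \<omega>_inj[OF _ q] kl by (intro sum.cong refl) auto
      also have "\<dots> = b q * elem_sym k l $ k $ l" using q by simp
      finally have 1: "(\<Sum>q'<m - 1. cscale (b q') (A q')) $ k $ l = b q * elem_sym k l $ k $ l" .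
      have "(k, l) \<noteq> (i, i)" using klU iU' by metis
      then have 2: "elem_sym i i $ k $ l = (0 :: complex)" by (auto simp: elem_sym_def)
      have "(k, l) \<notin> upper J" using klU Q(1) disj by (auto simp: U_def)
      then have 3: "diag_proj J $ k $ l = (0 :: complex)" by (auto simp: diag_proj_def upper_def)
      show ?thesis unfolding W vector_add_component 1 cscale_nth 2 3 by simp
    qed
    have bq: "b q = 0" if q: "q < m - 1" for q
    proof -
      obtain k l where kl: "\<omega> q = (k, l)" by (cases "\<omega> q")
      then have klU: "(k, l) \<in> U" using \<omega>U[OF q] by simp
      have "W $ k $ l = 0"
      proof (cases "k \<notin> J \<and> l \<notin> J")
        case True
        then show ?thesis using E[of l k] by simp
      next
        case False
        have notJ: "(k, l) \<notin> upper J" using klU Q(1) disj by (auto simp: U_def)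
        have up: "to_nat k \<le> to_nat l" using klU Uup by (auto simp: upper_def)
        then have one: "k \<in> J \<and> l \<notin> J \<or> k \<notin> J \<and> l \<in> J" using False notJ by (auto simp: upper_def)
        then have "A q = elem_sym k l" using Aq[OF q] kl by auto
        then have "X' $ k $ l + X' $ l $ k = 0" using tr q trX by metis
        then have "X' $ k $ l = 0" "X' $ l $ k = 0" using sym[of k l] by auto
        then show ?thesis using one E[of k l] E[of l k] WS[of k l] by auto
      qed
      then show ?thesis using W_entry[OF q kl] elem_sym_entry[of k l] by simp
    qed
    have W': "W = cscale (b (m - 1)) (elem_sym i i) + cscale (b m) (diag_proj J)"
      unfolding W using bq by simp
    have "W $ i $ i = 0" using E[of i i] i by simp
    then have bm1: "b (m - 1) = 0" unfolding W' using i elem_sym_entry[of i i] by (simp add: diag_proj_def)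
    have W'': "W $ k $ l = 0" if "k \<notin> J" for k l
      unfolding W' bm1 using that by (simp add: diag_proj_def)
    have X'J: "X' $ k $ l = 0" if "l \<in> J" for k l
      using E[of l k] that W''[of k l] by (cases "k \<in> J") simp_all
    have X'up: "X' $ k $ l = (if k = l then X' $ i $ i else 0)"
      if "k \<notin> J" "l \<notin> J" "to_nat k \<le> to_nat l" for k l
    proof (cases "(k, l) = (i, i)")
      case False
      then have "(k, l) \<in> U" using that by (simp add: U_def upper_def)
      then obtain q where q: "q < m - 1" "\<omega> q = (k, l)" using \<omega> by (auto simp: bij_betw_def image_iff) 
      then have Aq': "A q = elem_sym k l - (if k = l then elem_sym i i else 0)" using Aq[OF q(1)] that by auto
      have t0: "trace (0 :: complex^'n^'n) = 0" by (simp add: trace_def)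
      have "trace (X' ** A q) = 0" using tr q(1) by blast
      then have "X' $ k $ l + X' $ l $ k - (if k = l then 2 * X' $ i $ i else 0) = 0"
        unfolding Aq' by (auto simp: matrix_diff_ldistrib trace_sub trX t0 split: if_splits)
      then show ?thesis using sym[of k l] by (auto split: if_splits)
    qed auto
    have "X' = cscale (X' $ i $ i) (diag_proj (- J))"
    proof -
      have "X' $ k $ l = X' $ i $ i * diag_proj (- J) $ k $ l" for k l
      proof (cases "k \<in> J \<or> l \<in> J")
        case True
        then show ?thesis using X'J[of l k] X'J[of k l] sym[of k l] by (auto simp: diag_proj_def)
      next
        case False
        then show ?thesis
          using X'up[of k l] X'up[of l k] sym[of k l] by (cases "to_nat k \<le> to_nat l") (auto simp: diag_proj_def)
      qed
      then show ?thesis unfolding vec_eq_iff cscale_nth by blast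
    qed
    moreover have "b q = b m * ?c q" if qm: "q \<le> m" for q
    proof -
      consider "q < m - 1" | "q = m - 1" | "q = m" using qm by linarith
      then show ?thesis using bq bm1 cq[of q] cm m by cases auto
    qed
    ultimately show "\<exists>s u. X' = cscale s (diag_proj (- J)) \<and> (\<forall>q\<le>m. b q = u * ?c q)" by blast
  qed
  then have "immersive m (main_map m J i i) a"
    by (rule immersive_of_regular[OF m(1) i i aS A nd])
  then show ?thesis using J i aS by blast
qed

section \<open>Generic frames are good\<close>

lemma range_cscale:
  assumes "s \<noteq> 0" shows "range ((*v) (cscale s M)) = range ((*v) (M :: complex^'n^'n))"
proof -
  have e: "cscale s M *v x = M *v (s *s x)" for s and M :: "complex^'n^'n" and x
    by (simp add: matrix_vector_mult_def vec_eq_iff mult_ac)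
  have inv: "M *v x = cscale s M *v (inverse s *s x)" for x
    unfolding e using assms by (simp add: vector_smult_assoc)
  show ?thesis
  proof
    show "range ((*v) (cscale s M)) \<subseteq> range ((*v) M)" unfolding e by blast
    show "range ((*v) M) \<subseteq> range ((*v) (cscale s M))"
      by (rule image_subsetI, subst inv) (rule rangeI)
  qed
qed

lemma rank_cscale:
  assumes "M \<in> Sym" "s \<noteq> 0" shows "rank (cscale s M) = rank M"
  using rank_symmetric[OF assms(1)] rank_symmetric[OF Sym_cscale[OF assms(1)]] range_cscale[OF assms(2)]
  by metis

lemma combination_Sym: "sym_frame m A \<Longrightarrow> combination m A c \<in> Sym"
  by (auto simp: combination_def sym_frame_def intro!: Sym_sum Sym_cscale)

lemma solution_scale:
  assumes "solution m r A X c" "sym_frame m A" "s \<noteq> 0" "u \<noteq> 0"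
  shows "solution m r A (cscale s X) (\<lambda>q. u * c q)"
  using assms rank_cscale[OF combination_Sym[OF assms(2)] assms(4)]
  by (auto simp: solution_def combination_scale cscale_mult_left cscale_mult_right trace_cscale rank_cscale
      intro: Sym_cscale)

text \<open>Every solution is nondegenerate and is parametrised, up to scaling, by an immersive point of a
  chart. Pataki's inequalities are included as a consequence of the existence of a solution.\<close>

definition good :: "nat \<Rightarrow> nat \<Rightarrow> (nat \<Rightarrow> complex^'n^'n) \<Rightarrow> bool" where
  "good m r A \<longleftrightarrow> (\<forall>X c. solution m r A X c \<longrightarrow> X \<noteq> 0 \<longrightarrow> (\<exists>q\<le>m. c q \<noteq> 0) \<longrightarrow>
     c m \<noteq> 0 \<and> trace X \<noteq> 0 \<and> rank X = CARD('n) - r \<and> rank (combination m A c) = r \<and> regular m A X c \<and>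
     (CARD('n) - r + 1) choose 2 \<le> m \<and> (r + 1) choose 2 \<le> ((CARD('n) + 1) choose 2) - m \<and>
     (\<exists>J i j a s. i \<notin> J \<and> j \<notin> J \<and> card J = r \<and> s \<noteq> 0 \<and> sym_frame m a \<and> (\<forall>q\<le>m. main_map m J i j a q = A q) \<and>
        immersive m (main_map m J i j) a \<and> pair_X J i j (a m) = cscale s X \<and>
        (\<forall>q\<le>m. chart_coefficient m i j a q = c q / c m)))"

text \<open>Since the leading coefficient is nonzero, every solution lies in the image of a parametrisation
  \<open>main_map\<close>, and there \<open>generic_nondegenerate\<close> applies.\<close>

lemma generic_good:
  fixes r :: nat
  assumes m: "m < CARD('n) * CARD('n)" "1 \<le> m" and r: "r < CARD('n)"
  shows "generic m (good m r :: (nat \<Rightarrow> complex^'n^'n) \<Rightarrow> bool)"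
proof (rule generic_mono[OF generic_conj[OF generic_leading_coefficient[OF m(1) less_imp_le[OF r]]
      generic_nondegenerate[OF m r]]], elim conjE)
  fix A :: "nat \<Rightarrow> complex^'n^'n"
  assume A: "sym_frame m A"
    and lead: "\<forall>X c. solution m r A X c \<longrightarrow> X \<noteq> 0 \<longrightarrow> (\<exists>q\<le>m. c q \<noteq> 0) \<longrightarrow> c m \<noteq> 0"
    and nd: "\<forall>J i j a. card J = r \<longrightarrow> i \<notin> J \<longrightarrow> j \<notin> J \<longrightarrow> sym_frame m a \<longrightarrow>
      (\<forall>q\<le>m. main_map m J i j a q = A q) \<longrightarrow>
      det (block J J (a m) + block_T J i j 1 (a m)) \<noteq> 0 \<and> trace (pair_X J i j (a m)) \<noteq> 0 \<and>
      immersive m (main_map m J i j) a"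
  show "good m r A"
    unfolding good_def
  proof (intro allI impI)
    fix X c assume sol: "solution m r A X c" "X \<noteq> 0" and nz: "\<exists>q\<le>m. c q \<noteq> 0"
    have cm: "c m \<noteq> 0" using lead sol nz by blast
    have XS: "X \<in> Sym" using sol by (simp add: solution_def)
    have mm: "m \<notin> {..<m - 1}" "m \<notin> {m - 1}" "{m - 1} \<subseteq> {..m}" "{m - 1} \<inter> {..<m - 1} = {}"
      using m by auto
    have rest: "c q = 0" if "q \<le> m" "q \<notin> {..<m - 1}" "q \<notin> {m - 1}" "q \<noteq> m" for q
      using that by auto
    have "\<exists>J i j a s. card J = r \<and> i \<notin> J \<and> j \<notin> J \<and> s \<noteq> 0 \<and> sym_frame m a \<and>
      (\<forall>q\<le>m. main_map m J i j a q = A q) \<and> pair_X J i j (a m) = cscale s X \<and>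
      (\<forall>q\<in>{..<m - 1}. a q $ i $ j = c q / c m) \<and> a m $ i $ j = (\<Sum>q\<in>{m - 1}. c q) / c m"
      by (rule solution_in_chart[OF sol A less_imp_le[OF r] order_refl mm(1,2) order_refl order_refl mm(3,4) cm])
        (rule rest)
    then obtain J i j a s where J: "card J = r" and iJ: "i \<notin> J" "j \<notin> J" and s: "s \<noteq> 0" and a: "sym_frame m a"
      and Aa: "\<forall>q\<le>m. main_map m J i j a q = A q" and pX: "pair_X J i j (a m) = cscale s X"
      and cf: "\<forall>q\<in>{..<m - 1}. a q $ i $ j = c q / c m" "a m $ i $ j = (\<Sum>q\<in>{m - 1}. c q) / c m"
      by (elim exE conjE)
    have coeff: "chart_coefficient m i j a q = c q / c m" if "q \<le> m" for q
    proof -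
      have "q < m - 1 \<or> q = m - 1 \<or> q = m" using that by linarith
      then show ?thesis using cf cm m by (auto simp: chart_coefficient_def)
    qed
    have n: "det (block J J (a m) + block_T J i j 1 (a m)) \<noteq> 0" "trace (pair_X J i j (a m)) \<noteq> 0"
      "immersive m (main_map m J i j) a" using nd J iJ a Aa by blast+
    have aS: "a m \<in> Sym" using a by (simp add: sym_frame_def)
    have Y: "pair_Y J (a m) = cscale (1 / c m) (combination m A c)"
      unfolding combination_main_map[OF m(2) Aa, symmetric] combination_scale[symmetric]
      by (rule combination_cong) (simp add: coeff)
    have "rank (pair_X J i j (a m)) = card (- J)" "rank (pair_Y J (a m)) = card J"
      unfolding pair_X_def pair_Y_def
      by (intro rank_chart_eq[OF supported_block supported_block_T block_T_Sym[OF aS]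
          supported_block block_Sym[OF aS] n(1)])+
    then have ranks: "rank X = CARD('n) - r" "rank (combination m A c) = r"
      using cm J by (simp_all add: pX Y rank_cscale[OF XS s] rank_cscale[OF combination_Sym[OF A]] card_complement)
    have reg': "regular m A (pair_X J i j (a m)) (chart_coefficient m i j a)"
      by (rule regular_of_immersive[OF m(2) iJ a Aa n(1,3)])
    have reg: "regular m A X c"
    proof -
      have "regular m A (cscale (1 / s) (pair_X J i j (a m))) c"
        by (rule regular_scale[OF reg', of _ "c m"]) (use s cm coeff in auto)
      then show ?thesis using s by (simp add: pX cscale_cscale)
    qed
    have T: "block_T J i j 1 (a m) \<noteq> 0"
    proof
      assume "block_T J i j 1 (a m) = 0"
      then have "pair_X J i j (a m) = 0" by (simp add: pair_X_def chart_X_def)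
      then show False using pair_X_entry[OF iJ, of "a m"] by simp
    qed
    have "combination m A (chart_coefficient m i j a) = chart_Y (block (- J) J (a m)) (block J J (a m))"
      unfolding combination_main_map[OF m(2) Aa] pair_Y_def ..
    moreover have "chart_coefficient m i j a m \<noteq> 0" using coeff[of m] cm by simp
    ultimately have pat: "(CARD('n) - r + 1) choose 2 \<le> m" "(r + 1) choose 2 \<le> ((CARD('n) + 1) choose 2) - m"
      using regular_imp_pataki[OF m(2) A J supported_block supported_block supported_block_T T] reg'
      unfolding pair_X_def by blast+
    have "trace X \<noteq> 0" using n(2) by (auto simp: pX trace_cscale)
    then show "c m \<noteq> 0 \<and> trace X \<noteq> 0 \<and> rank X = CARD('n) - r \<and> rank (combination m A c) = r \<and> regular m A X c \<and>
      (CARD('n) - r + 1) choose 2 \<le> m \<and> (r + 1) choose 2 \<le> ((CARD('n) + 1) choose 2) - m \<and>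
      (\<exists>J i j a s. i \<notin> J \<and> j \<notin> J \<and> card J = r \<and> s \<noteq> 0 \<and> sym_frame m a \<and> (\<forall>q\<le>m. main_map m J i j a q = A q) \<and>
        immersive m (main_map m J i j) a \<and> pair_X J i j (a m) = cscale s X \<and>
        (\<forall>q\<le>m. chart_coefficient m i j a q = c q / c m))"
      using cm ranks reg pat iJ J s a Aa n(3) pX coeff by blast
  qed
qed

lemma upper_index:
  assumes "m < (CARD('n::finite) + 1) choose 2"
  obtains \<iota> :: "nat \<Rightarrow> 'n::finite \<times> 'n" where "inj_on \<iota> {..m}" "\<iota> ` {..m} \<subseteq> upper UNIV"
proof -
  have "card {..m} \<le> card (upper (UNIV :: 'n set))" using assms by (simp add: card_upper)
  then show ?thesis using card_le_inj[of "{..m}" "upper (UNIV :: 'n set)"] that by auto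
qed

text \<open>The determinant of the entries of the frame at \<open>m + 1\<close> positions on or above the diagonal, padded
  to a square matrix by unit vectors, does not vanish at the corresponding coordinate vectors.\<close>

lemma generic_independent:
  assumes m: "m < (CARD('n::finite) + 1) choose 2"
  shows "generic m (\<lambda>A :: nat \<Rightarrow> complex^'n^'n. \<forall>c. combination m A c = 0 \<longrightarrow> (\<forall>q\<le>m. c q = 0))"
proof -
  obtain \<iota> :: "nat \<Rightarrow> 'n \<times> 'n" where \<iota>: "inj_on \<iota> {..m}" "\<iota> ` {..m} \<subseteq> upper UNIV" using upper_index[OF m] .
  define inv where "inv = inv_into {..m} \<iota>"
  have inv: "inv (\<iota> q) = q" if "q \<le> m" for q using \<iota>(1) that by (simp add: inv_def)
  define M :: "(nat \<Rightarrow> complex^'n^'n) \<Rightarrow> complex^('n \<times> 'n)^('n \<times> 'n)" where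
    "M A = (\<chi> p x. if x \<in> \<iota> ` {..m} then A (inv x) $ fst p $ snd p else (if p = x then 1 else 0))" for A
  define D :: "nat \<Rightarrow> complex^'n^'n" where "D q = elem_sym (fst (\<iota> q)) (snd (\<iota> q))" for q
  have "(\<lambda>A. det (M A)) \<in> poly_funs (frame_coords m)"
  proof (rule poly_funs_det)
    fix p x
    show "(\<lambda>A. M A $ p $ x) \<in> poly_funs (frame_coords m)"
    proof (cases "x \<in> \<iota> ` {..m}")
      case True
      then have "inv x \<le> m" using inv by auto
      then show ?thesis using True by (simp add: M_def frame_coord)
    qed (auto simp: M_def intro: poly_funs.const)
  qed
  moreover have "sym_frame m D" by (simp add: sym_frame_def D_def elem_sym_Sym)
  moreover have "det (M D) \<noteq> 0"
  proof -
    have "v = 0" if v: "M D *v v = 0" for v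
    proof -
      have comp: "(\<Sum>x\<in>UNIV. M D $ p $ x * v $ x) = 0" for p
      proof -
        have "(M D *v v) $ p = 0" by (simp add: v)
        then show ?thesis by (simp add: matrix_vector_mult_def)
      qed
      have 1: "v $ p = 0" if p: "p \<in> \<iota> ` {..m}" for p
      proof -
        have pu: "(fst p, snd p) \<in> upper UNIV" using p \<iota>(2) by auto
        have "M D $ p $ x * v $ x = (if x = p then elem_sym (fst p) (snd p) $ fst p $ snd p * v $ p else 0)" for x
        proof (cases "x \<in> \<iota> ` {..m}")
          case True
          then obtain q where q: "q \<le> m" "x = \<iota> q" by blast
          then have Mx: "M D $ p $ x = elem_sym (fst x) (snd x) $ fst p $ snd p" using True by (simp add: M_def D_def inv)
          have "(fst x, snd x) \<in> upper UNIV" using True \<iota>(2) by auto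
          then have "elem_sym (fst x) (snd x) $ fst p $ snd p = (0 :: complex)" if "x \<noteq> p"
            using elem_sym_upper[OF _ pu] that by (metis prod.collapse)
          then show ?thesis using Mx by auto
        qed (use p in \<open>auto simp: M_def\<close>)
        then have "elem_sym (fst p) (snd p) $ fst p $ snd p * v $ p = 0" using comp[of p] by simp
        then show ?thesis using elem_sym_entry[of "fst p" "snd p"] by simp
      qed
      have "v $ p = 0" if p: "p \<notin> \<iota> ` {..m}" for p
      proof -
        have "M D $ p $ x * v $ x = (if x = p then v $ p else 0)" for x
          using 1 p by (cases "x \<in> \<iota> ` {..m}") (auto simp: M_def)
        then show ?thesis using comp[of p] by simp
      qed
      then show "v = 0" unfolding vec_eq_iff zero_index using 1 by blast
    qed
    then show ?thesis
      using matrix_left_invertible_ker[of "M D"] invertible_left_inverse[of "M D"] by (auto simp: invertible_det_nz)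
  qed
  moreover have "c q = 0" if det: "det (M A) \<noteq> 0" and c0: "combination m A c = 0" and "q \<le> m" for A c q
  proof -
    define v where "v = (\<chi> x. if x \<in> \<iota> ` {..m} then c (inv x) else 0)"
    have "(M A *v v) $ p = 0" for p
    proof -
      have "(M A *v v) $ p = (\<Sum>x\<in>UNIV. M A $ p $ x * v $ x)" by (simp add: matrix_vector_mult_def)
      also have "\<dots> = (\<Sum>x\<in>\<iota> ` {..m}. c (inv x) * A (inv x) $ fst p $ snd p)"
        by (intro sum.mono_neutral_cong_right) (auto simp: M_def v_def)
      also have "\<dots> = (\<Sum>q\<le>m. c q * A q $ fst p $ snd p)"
        by (subst sum.reindex[OF \<iota>(1)]) (simp add: inv)
      also have "\<dots> = combination m A c $ fst p $ snd p" by (simp add: combination_def)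
      finally show ?thesis using c0 by simp
    qed
    then have "M A *v v = 0" by (simp add: vec_eq_iff)
    then have "v = 0"
      using det matrix_left_invertible_ker[of "M A"] invertible_left_inverse[of "M A"] by (auto simp: invertible_det_nz)
    then have "v $ \<iota> q = 0" by simp
    then show "c q = 0" using \<open>q \<le> m\<close> by (simp add: v_def inv)
  qed
  ultimately show ?thesis unfolding generic_def by (intro bexI[of _ "\<lambda>A. det (M A)"]) blast+
qed

section \<open>Constancy of the number of solutions\<close>

lemma inverse_tendsto:
  fixes x :: "'z::metric_space"
  assumes f: "\<And>k. dist (f k) x < inverse (real (Suc k))" shows "f \<longlonglongrightarrow> x"
proof (rule metric_tendsto_imp_tendsto[OF LIMSEQ_inverse_real_of_nat], intro always_eventually allI)
  show "dist (f k) x \<le> dist (inverse (real (Suc k))) 0" for k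
    using less_imp_le[OF f[of k]] by simp
qed

text \<open>A closed, locally bounded family of subsets of a Euclidean space whose members neither split
  nor disappear locally has constant finite cardinality over a connected base.\<close>

lemma card_family_constant:
  fixes S :: "complex \<Rightarrow> 'p::heine_borel set"
  assumes conn: "connected \<Omega>"
    and closed: "\<And>t T p q. \<lbrakk>t \<in> \<Omega>; \<And>k. T k \<in> \<Omega>; T \<longlonglongrightarrow> t; \<And>k. p k \<in> S (T k); p \<longlonglongrightarrow> q\<rbrakk> \<Longrightarrow> q \<in> S t"
    and bounded: "\<And>t T p. \<lbrakk>t \<in> \<Omega>; \<And>k. T k \<in> \<Omega>; T \<longlonglongrightarrow> t; \<And>k. p k \<in> S (T k)\<rbrakk> \<Longrightarrow> bounded (range p)"
    and unique: "\<And>t T p p' q. \<lbrakk>t \<in> \<Omega>; \<And>k. T k \<in> \<Omega>; T \<longlonglongrightarrow> t; \<And>k. p k \<in> S (T k); \<And>k. p' k \<in> S (T k);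
      \<And>k. p k \<noteq> p' k; p \<longlonglongrightarrow> q; p' \<longlonglongrightarrow> q\<rbrakk> \<Longrightarrow> False"
    and lift: "\<And>t q \<epsilon>. \<lbrakk>t \<in> \<Omega>; q \<in> S t; \<epsilon> > 0\<rbrakk> \<Longrightarrow>
      \<exists>\<delta>>0. \<forall>t'\<in>\<Omega>. dist t' t < \<delta> \<longrightarrow> (\<exists>q'\<in>S t'. dist q' q < \<epsilon>)"
    and t: "t0 \<in> \<Omega>" "t1 \<in> \<Omega>"
  shows "finite (S t0)" "card (S t0) = card (S t1)"
proof -
  have fin: "finite (S t)" if t: "t \<in> \<Omega>" for t
  proof (rule ccontr)
    assume "infinite (S t)"
    then obtain f :: "nat \<Rightarrow> 'p" where f: "inj f" "range f \<subseteq> S t"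
      using infinite_countable_subset by blast
    have "bounded (range f)" using bounded[of t "\<lambda>_. t" f] t f(2) by auto
    then obtain l and \<rho> :: "nat \<Rightarrow> nat" where \<rho>: "strict_mono \<rho>" "(f \<circ> \<rho>) \<longlonglongrightarrow> l"
      using bounded_imp_convergent_subsequence by blast
    have "(\<lambda>k. (f \<circ> \<rho>) (Suc k)) \<longlonglongrightarrow> l" using \<rho>(2) by (rule LIMSEQ_Suc)
    moreover have "(f \<circ> \<rho>) k \<noteq> (f \<circ> \<rho>) (Suc k)" for k
      using f(1) \<rho>(1) by (metis comp_apply inj_eq lessI nat_neq_iff strict_mono_less)
    ultimately show False
      using unique[of t "\<lambda>_. t" "f \<circ> \<rho>" "\<lambda>k. (f \<circ> \<rho>) (Suc k)" l] t f(2) \<rho>(2) by auto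
  qed
  have loc: "\<exists>\<delta>>0. \<forall>t'\<in>\<Omega>. dist t' t < \<delta> \<longrightarrow> card (S t') = card (S t)" if t: "t \<in> \<Omega>" for t
  proof -
    have one: "\<exists>\<epsilon>>0. \<forall>t'\<in>\<Omega>. dist t' t < \<epsilon> \<longrightarrow> (\<forall>p\<in>S t'. \<forall>p'\<in>S t'. dist p q < \<epsilon> \<longrightarrow> dist p' q < \<epsilon> \<longrightarrow> p = p')"
      if q: "q \<in> S t" for q
    proof (rule ccontr)
      assume neg: "\<not> ?thesis"
      have "\<exists>t' p p'. t' \<in> \<Omega> \<and> dist t' t < inverse (real (Suc k)) \<and> p \<in> S t' \<and> p' \<in> S t' \<and>
        dist p q < inverse (real (Suc k)) \<and> dist p' q < inverse (real (Suc k)) \<and> p \<noteq> p'" for k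
      proof -
        have "inverse (real (Suc k)) > 0" by simp
        then show ?thesis using neg by meson
      qed
      then obtain t' p p' where s: "\<And>k. t' k \<in> \<Omega>" "\<And>k. dist (t' k) t < inverse (real (Suc k))"
        "\<And>k. p k \<in> S (t' k)" "\<And>k. p' k \<in> S (t' k)" "\<And>k. dist (p k) q < inverse (real (Suc k))"
        "\<And>k. dist (p' k) q < inverse (real (Suc k))" "\<And>k. p k \<noteq> p' k" by metis
      show False by (rule unique[OF t s(1) inverse_tendsto[OF s(2)] s(3,4,7) inverse_tendsto[OF s(5)] inverse_tendsto[OF s(6)]])
    qed
    then obtain e where e: "\<And>q. q \<in> S t \<Longrightarrow> e q > 0"
      "\<And>q t' p p'. q \<in> S t \<Longrightarrow> t' \<in> \<Omega> \<Longrightarrow> dist t' t < e q \<Longrightarrow> p \<in> S t' \<Longrightarrow> p' \<in> S t' \<Longrightarrow>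
        dist p q < e q \<Longrightarrow> dist p' q < e q \<Longrightarrow> p = p'"
      by metis
    define \<epsilon> where "\<epsilon> = Min (insert 1 (e ` S t))"
    have \<epsilon>: "\<epsilon> > 0" "\<And>q. q \<in> S t \<Longrightarrow> \<epsilon> \<le> e q"
      using fin[OF t] e(1) by (auto simp: \<epsilon>_def)
    have sep: "q = q'" if "q \<in> S t" "q' \<in> S t" "dist q' q < \<epsilon>" for q q'
      by (rule e(2)[OF that(1) t]) (use that \<epsilon> e(1) in \<open>auto intro: less_le_trans\<close>)
    have near: "\<exists>\<delta>>0. \<forall>t'\<in>\<Omega>. dist t' t < \<delta> \<longrightarrow> (\<forall>p\<in>S t'. \<exists>q\<in>S t. dist p q < \<epsilon>)"
    proof (rule ccontr)
      assume neg: "\<not> ?thesis"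
      have "\<exists>t' p. t' \<in> \<Omega> \<and> dist t' t < inverse (real (Suc k)) \<and> p \<in> S t' \<and> (\<forall>q\<in>S t. \<not> dist p q < \<epsilon>)" for k
      proof -
        have "inverse (real (Suc k)) > 0" by simp
        then show ?thesis using neg by meson
      qed
      then obtain t' p where s: "\<And>k. t' k \<in> \<Omega>" "\<And>k. dist (t' k) t < inverse (real (Suc k))"
        "\<And>k. p k \<in> S (t' k)" "\<And>k. \<forall>q\<in>S t. \<not> dist (p k) q < \<epsilon>" by metis
      have "bounded (range p)" by (rule bounded[OF t s(1) inverse_tendsto[OF s(2)] s(3)])
      then obtain l and \<rho> :: "nat \<Rightarrow> nat" where \<rho>: "strict_mono \<rho>" "(p \<circ> \<rho>) \<longlonglongrightarrow> l"
        using bounded_imp_convergent_subsequence by blast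
      have "l \<in> S t"
        by (rule closed[OF t, of "t' \<circ> \<rho>" "p \<circ> \<rho>"])
          (use s \<rho> inverse_tendsto[OF s(2)] in \<open>auto intro: LIMSEQ_subseq_LIMSEQ\<close>)
      moreover obtain k where "dist ((p \<circ> \<rho>) k) l < \<epsilon>"
        using \<rho>(2) \<epsilon>(1) unfolding lim_sequentially by blast
      ultimately show False using s(4) by auto
    qed
    then obtain \<delta>1 where \<delta>1: "\<delta>1 > 0" "\<And>t' p. t' \<in> \<Omega> \<Longrightarrow> dist t' t < \<delta>1 \<Longrightarrow> p \<in> S t' \<Longrightarrow> \<exists>q\<in>S t. dist p q < \<epsilon>"
      by blast
    have "\<forall>q\<in>S t. \<exists>\<delta>>0. \<forall>t'\<in>\<Omega>. dist t' t < \<delta> \<longrightarrow> (\<exists>q'\<in>S t'. dist q' q < \<epsilon> / 2)"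
      by (intro ballI lift[OF t]) (use \<epsilon>(1) in simp_all)
    then obtain d where d: "\<And>q. q \<in> S t \<Longrightarrow> d q > 0"
      "\<And>q t'. q \<in> S t \<Longrightarrow> t' \<in> \<Omega> \<Longrightarrow> dist t' t < d q \<Longrightarrow> \<exists>q'\<in>S t'. dist q' q < \<epsilon> / 2" by metis
    define \<delta> where "\<delta> = Min (insert \<delta>1 (insert \<epsilon> (d ` S t)))"
    have \<delta>: "\<delta> > 0" "\<delta> \<le> \<delta>1" "\<delta> \<le> \<epsilon>" "\<And>q. q \<in> S t \<Longrightarrow> \<delta> \<le> d q"
    proof -
      have f: "finite (insert \<delta>1 (insert \<epsilon> (d ` S t)))" using fin[OF t] by simp
      show "\<delta> > 0" using \<delta>1(1) \<epsilon>(1) d(1) f unfolding \<delta>_def by (subst Min_gr_iff) auto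
      show "\<delta> \<le> \<delta>1" "\<delta> \<le> \<epsilon>" "\<And>q. q \<in> S t \<Longrightarrow> \<delta> \<le> d q"
        unfolding \<delta>_def by (rule Min_le[OF f], blast)+
    qed
    have "card (S t') = card (S t)" if t': "t' \<in> \<Omega>" "dist t' t < \<delta>" for t'
    proof (rule antisym)
      have "\<exists>g. \<forall>p\<in>S t'. g p \<in> S t \<and> dist p (g p) < \<epsilon>"
        using \<delta>1(2)[OF t'(1)] t'(2) \<delta>(2) by (intro bchoice) fastforce
      then obtain g where g: "\<And>p. p \<in> S t' \<Longrightarrow> g p \<in> S t" "\<And>p. p \<in> S t' \<Longrightarrow> dist p (g p) < \<epsilon>" by blast
      have "inj_on g (S t')"
      proof (rule inj_onI)
        fix p p' assume p: "p \<in> S t'" "p' \<in> S t'" "g p = g p'"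
        have "\<epsilon> \<le> e (g p)" using \<epsilon>(2) g(1) p(1) by blast
        then show "p = p'"
          using e(2)[OF g(1)[OF p(1)] t'(1) _ p(1,2)] g(2)[OF p(1)] g(2)[OF p(2)] p(3) t'(2) \<delta>(3) by auto
      qed
      then show "card (S t') \<le> card (S t)"
        using g(1) by (intro card_inj_on_le[OF _ _ fin[OF t]]) auto
      have "\<exists>g. \<forall>q\<in>S t. g q \<in> S t' \<and> dist (g q) q < \<epsilon> / 2"
      proof (intro bchoice ballI)
        fix q assume q: "q \<in> S t"
        then have "dist t' t < d q" using t'(2) \<delta>(4) by fastforce
        then show "\<exists>y. y \<in> S t' \<and> dist y q < \<epsilon> / 2" using d(2)[OF q t'(1)] by blast
      qed
      then obtain g where g: "\<And>q. q \<in> S t \<Longrightarrow> g q \<in> S t'" "\<And>q. q \<in> S t \<Longrightarrow> dist (g q) q < \<epsilon> / 2" by blast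
      have "inj_on g (S t)"
      proof (rule inj_onI)
        fix q q' assume q: "q \<in> S t" "q' \<in> S t" "g q = g q'"
        have "dist q' q \<le> dist (g q') q' + dist (g q) q"
          using dist_triangle3[of q' q "g q"] q(3) by (simp add: dist_commute)
        then have "dist q' q < \<epsilon>" using g(2)[OF q(1)] g(2)[OF q(2)] by linarith
        then show "q = q'" by (rule sep[OF q(1,2)])
      qed
      then show "card (S t) \<le> card (S t')"
        using g(1) by (intro card_inj_on_le[OF _ _ fin[OF t'(1)]]) auto
    qed
    then show ?thesis using \<delta>(1) by blast
  qed
  show "finite (S t0)" by (rule fin[OF t(1)])
  show "card (S t0) = card (S t1)"
  proof (rule connected_local_const[OF conn t, of "\<lambda>t. card (S t)"], intro ballI)
    fix t assume "t \<in> \<Omega>"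
    then obtain \<delta> where \<delta>: "\<delta> > 0" "\<forall>t'\<in>\<Omega>. dist t' t < \<delta> \<longrightarrow> card (S t') = card (S t)" using loc by blast
    then show "\<forall>\<^sub>F t' in at t within \<Omega>. card (S t) = card (S t')"
      unfolding eventually_at by (intro exI[of _ \<delta>]) auto
  qed
qed

section \<open>Limits of solutions\<close>

lemma matrix_tendstoI:
  "(\<And>i j. ((\<lambda>x. M x $ i $ j) \<longlongrightarrow> N $ i $ j) F) \<Longrightarrow> (M \<longlongrightarrow> (N :: complex^'n^'n)) F"
  by (intro vec_tendstoI)

lemma tendsto_cscale:
  assumes "(f \<longlongrightarrow> c) F" "(M \<longlongrightarrow> N) F" shows "((\<lambda>x. cscale (f x) (M x)) \<longlongrightarrow> cscale c N) F"
  by (rule matrix_tendstoI) (use assms in \<open>auto intro!: tendsto_intros\<close>)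

lemma tendsto_matrix_mult:
  assumes "(M \<longlongrightarrow> (A :: complex^'n^'n)) F" "(N \<longlongrightarrow> (B :: complex^'n^'n)) F" shows "((\<lambda>x. M x ** N x) \<longlongrightarrow> A ** B) F"
  by (rule matrix_tendstoI)
    (unfold matrix_matrix_mult_def vec_lambda_beta, intro tendsto_intros assms)

lemma tendsto_trace: "(M \<longlongrightarrow> A) F \<Longrightarrow> ((\<lambda>x. trace (M x)) \<longlongrightarrow> trace (A :: complex^'n^'n)) F"
  unfolding trace_def by (intro tendsto_intros)

lemma tendsto_det: "(M \<longlongrightarrow> A) F \<Longrightarrow> ((\<lambda>x. det (M x)) \<longlongrightarrow> det (A :: complex^'n^'n)) F"
  unfolding det_def by (intro tendsto_intros)

lemma tendsto_combination:
  assumes "\<And>q. q \<le> m \<Longrightarrow> ((\<lambda>x. A x q) \<longlongrightarrow> A0 q) F" "\<And>q. q \<le> m \<Longrightarrow> ((\<lambda>x. c x q) \<longlongrightarrow> c0 q) F"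
  shows "((\<lambda>x. combination m (A x) (c x)) \<longlongrightarrow> combination m A0 c0) F"
  unfolding combination_def by (intro tendsto_sum tendsto_cscale assms) auto

lemma Sym_limit:
  assumes "(M \<longlongrightarrow> A) F" "F \<noteq> bot" "\<And>x. M x \<in> Sym" shows "A \<in> Sym"
  unfolding Sym_iff
proof (intro allI)
  fix i j
  have "((\<lambda>x. M x $ i $ j) \<longlongrightarrow> A $ i $ j) F" "((\<lambda>x. M x $ j $ i) \<longlongrightarrow> A $ j $ i) F"
    by (intro tendsto_intros assms(1))+
  moreover have "M x $ j $ i = M x $ i $ j" for x using assms(3) by (metis Sym_iff)
  ultimately show "A $ i $ j = A $ j $ i" using tendsto_unique[OF assms(2)] by simp
qed

lemma rank_limit:
  assumes "(M \<longlongrightarrow> A) F" "F \<noteq> bot" "\<And>x. M x \<in> Sym" "\<And>x. rank (M x) \<le> r" shows "rank A \<le> r"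
proof (rule ccontr)
  assume "\<not> rank A \<le> r"
  then have less: "vec.dim (range ((*v) (M x))) < vec.dim (range ((*v) A))" for x
    using rank_symmetric[OF assms(3)[of x]] rank_symmetric[OF Sym_limit[OF assms(1-3)]] assms(4)[of x] by linarith
  obtain D where D: "det (A + D) \<noteq> 0"
    "\<forall>X. vec.dim (range ((*v) X)) < vec.dim (range ((*v) A)) \<longrightarrow> det (X + D) = 0"
    using rank_detecting_determinant[of A] by blast
  have "((\<lambda>x. det (M x + D)) \<longlongrightarrow> det (A + D)) F" by (intro tendsto_det tendsto_intros assms(1))
  moreover have "det (M x + D) = 0" for x using D(2) less by blast
  ultimately have "det (A + D) = 0" using assms(2) by (simp add: tendsto_const_iff)
  then show False using D(1) by simp
qed

lemma solution_limit:
  fixes A0 :: "nat \<Rightarrow> complex^'n^'n"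
  assumes A: "\<And>q. q \<le> m \<Longrightarrow> ((\<lambda>x. A x q) \<longlongrightarrow> A0 q) F" and X: "(X \<longlongrightarrow> X0) F"
    and c: "\<And>q. q \<le> m \<Longrightarrow> ((\<lambda>x. c x q) \<longlongrightarrow> c0 q) F"
    and F: "F \<noteq> bot" and sol: "\<And>x. solution m r (A x) (X x) (c x)" and S: "\<And>x. sym_frame m (A x)"
  shows "solution m r A0 X0 c0"
  unfolding solution_def
proof (intro conjI allI impI)
  have s: "X x \<in> Sym" "\<forall>q<m - 1. trace (X x ** A x q) = 0" "X x ** combination m (A x) (c x) = 0"
    "rank (X x) \<le> CARD('n) - r" "rank (combination m (A x) (c x)) \<le> r" for x
    using sol[of x] by (auto simp: solution_def)
  note cl = tendsto_combination[OF A c]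
  show "X0 \<in> Sym" by (rule Sym_limit[OF X F s(1)])
  show "rank X0 \<le> CARD('n) - r" by (rule rank_limit[OF X F s(1,4)])
  show "rank (combination m A0 c0) \<le> r"
    by (rule rank_limit[OF cl F combination_Sym[OF S] s(5)])
  have "((\<lambda>x. X x ** combination m (A x) (c x)) \<longlongrightarrow> X0 ** combination m A0 c0) F"
    by (intro tendsto_matrix_mult X cl)
  then show "X0 ** combination m A0 c0 = 0"
    using F by (simp add: s(3) tendsto_const_iff)
  fix q assume q: "q < m - 1"
  have "((\<lambda>x. trace (X x ** A x q)) \<longlongrightarrow> trace (X0 ** A0 q)) F"
    by (intro tendsto_trace tendsto_matrix_mult X A) (use q in simp)
  moreover have "trace (X x ** A x q) = 0" for x using s(2) q by blast
  ultimately show "trace (X0 ** A0 q) = 0"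
    using F by (simp add: tendsto_const_iff)
qed

section \<open>The number of solutions is constant over the good frames\<close>

text \<open>Solutions with both factors normalised. The coefficients are stored in a vector, so that the
  solutions lie in a Euclidean space.\<close>

definition normal_solutions ::
    "(nat \<Rightarrow> 'n \<times> 'n) \<Rightarrow> nat \<Rightarrow> nat \<Rightarrow> (nat \<Rightarrow> complex^'n^'n) \<Rightarrow> ((complex^'n^'n) \<times> (complex^('n \<times> 'n))) set" where
  "normal_solutions \<iota> m r A = {(X, w). solution m r A X (\<lambda>q. w $ \<iota> q) \<and> trace X = 1 \<and> w $ \<iota> m = 1 \<and>
     (\<forall>p. p \<notin> \<iota> ` {..m} \<longrightarrow> w $ p = 0)}"

lemma normal_solutions_closed:
  assumes A: "\<And>q. q \<le> m \<Longrightarrow> (\<lambda>k. A k q) \<longlonglongrightarrow> A0 q" and S: "\<And>k. sym_frame m (A k)"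
    and p: "\<And>k. p k \<in> normal_solutions \<iota> m r (A k)" "p \<longlonglongrightarrow> p0"
  shows "p0 \<in> normal_solutions \<iota> m r A0"
proof -
  obtain X0 w0 where p0: "p0 = (X0, w0)" by (cases p0)
  define X w where "X k = fst (p k)" and "w k = snd (p k)" for k
  have s: "solution m r (A k) (X k) (\<lambda>q. w k $ \<iota> q)" "trace (X k) = 1" "w k $ \<iota> m = 1"
    "\<forall>z. z \<notin> \<iota> ` {..m} \<longrightarrow> w k $ z = 0" for k
    using p(1)[of k] by (auto simp: normal_solutions_def X_def w_def)
  have X: "X \<longlonglongrightarrow> X0" and w: "w \<longlonglongrightarrow> w0"
    unfolding X_def w_def using tendsto_fst[OF p(2)] tendsto_snd[OF p(2)] by (simp_all add: p0)
  have wz: "(\<lambda>k. w k $ z) \<longlonglongrightarrow> w0 $ z" for z by (intro tendsto_intros w)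
  have "solution m r A0 X0 (\<lambda>q. w0 $ \<iota> q)"
    by (rule solution_limit[OF A X wz sequentially_bot s(1) S])
  moreover have "trace X0 = 1"
    using LIMSEQ_unique[OF tendsto_trace[OF X]] by (simp add: s(2) LIMSEQ_const_iff)
  moreover have "w0 $ \<iota> m = 1" using LIMSEQ_unique[OF wz[of "\<iota> m"]] by (simp add: s(3) LIMSEQ_const_iff)
  moreover have "w0 $ z = 0" if "z \<notin> \<iota> ` {..m}" for z
  proof -
    have "w k $ z = 0" for k using s(4) that by blast
    then show ?thesis using wz[of z] by (simp add: LIMSEQ_const_iff)
  qed
  ultimately show ?thesis by (auto simp: normal_solutions_def p0)
qed

lemma unbounded_sequence:
  fixes p :: "nat \<Rightarrow> 'p::real_normed_vector"
  assumes "\<not> bounded (range p)"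
  obtains j :: "nat \<Rightarrow> nat" where "\<And>k. k \<le> j k" "\<And>k. real k < norm (p (j k))"
proof -
  have "\<exists>j\<ge>k. real k < norm (p j)" for k
  proof (rule ccontr)
    assume "\<not> ?thesis"
    then have "norm (p j) \<le> real k" if "j \<ge> k" for j using that by force
    then have "range p \<subseteq> p ` {..<k} \<union> cball 0 (real k)"
      by (auto simp: image_iff) (metis lessThan_iff not_le)
    then show False using assms bounded_subset[of "p ` {..<k} \<union> cball 0 (real k)"] finite_imp_bounded by auto
  qed
  then show ?thesis using that by metis
qed

lemma cscale_of_real: "cscale (of_real t) M = t *\<^sub>R (M :: complex^'n^'n)"
  unfolding vec_eq_iff cscale_nth vector_scaleR_component by (simp add: scaleR_conv_of_real)

lemma scaleR_complex_nth: "(t *\<^sub>R v) $ z = complex_of_real t * v $ z"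
  unfolding vector_scaleR_component by (simp add: scaleR_conv_of_real)

lemma norm_one_subsequence:
  fixes f :: "nat \<Rightarrow> 'p::{heine_borel, real_normed_vector}"
  assumes "\<And>k. norm (f k) = 1"
  obtains l and \<rho> :: "nat \<Rightarrow> nat" where "strict_mono \<rho>" "(f \<circ> \<rho>) \<longlonglongrightarrow> l" "norm l = 1"
proof -
  have "bounded (range f)" unfolding bounded_iff using assms by (intro exI[of _ 1]) auto
  then obtain l and \<rho> :: "nat \<Rightarrow> nat" where \<rho>: "strict_mono \<rho>" "(f \<circ> \<rho>) \<longlonglongrightarrow> l"
    using bounded_imp_convergent_subsequence by blast
  have "norm l = 1" using LIMSEQ_unique[OF tendsto_norm[OF \<rho>(2)]] by (simp add: assms LIMSEQ_const_iff)
  then show ?thesis using that \<rho> by blast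
qed

text \<open>If solutions of frames close to a good one were unbounded, rescaling them to norm one would
  produce in the limit a nonzero solution for which the normalised quantity vanishes.\<close>

lemma normal_solutions_bounded:
  fixes A :: "nat \<Rightarrow> nat \<Rightarrow> complex^'n^'n"
  assumes A: "\<And>q. q \<le> m \<Longrightarrow> (\<lambda>k. A k q) \<longlonglongrightarrow> A0 q" and S: "\<And>k. sym_frame m (A k)" and A0: "good m r A0"
    and p: "\<And>k. p k \<in> normal_solutions \<iota> m r (A k)"
  shows "bounded (range p)"
proof (rule ccontr)
  assume "\<not> bounded (range p)"
  then obtain j :: "nat \<Rightarrow> nat" where j: "\<And>k. k \<le> j k" "\<And>k. real k < norm (p (j k))"
    using unbounded_sequence by blast
  define X w where "X k = fst (p (j k))" and "w k = snd (p (j k))" for k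
  have s: "solution m r (A (j k)) (X k) (\<lambda>q. w k $ \<iota> q)" "trace (X k) = 1" "w k $ \<iota> m = 1"
    "\<forall>z. z \<notin> \<iota> ` {..m} \<longrightarrow> w k $ z = 0" for k
    using p[of "j k"] by (auto simp: normal_solutions_def X_def w_def)
  have X0: "X k \<noteq> 0" for k using s(2)[of k] by (auto simp: trace_def)
  have w0: "w k \<noteq> 0" for k using s(3)[of k] by auto
  let ?x = "\<lambda>k. inverse (norm (X k))" and ?v = "\<lambda>k. inverse (norm (w k))"
  obtain L and \<rho> :: "nat \<Rightarrow> nat" where L: "strict_mono \<rho>" "((\<lambda>k. ?x k *\<^sub>R X k) \<circ> \<rho>) \<longlonglongrightarrow> L" "norm L = 1"
    by (rule norm_one_subsequence[of "\<lambda>k. ?x k *\<^sub>R X k"]) (simp add: X0)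
  obtain l and \<sigma> :: "nat \<Rightarrow> nat" where l: "strict_mono \<sigma>" "((\<lambda>k. ?v (\<rho> k) *\<^sub>R w (\<rho> k)) \<circ> \<sigma>) \<longlonglongrightarrow> l" "norm l = 1"
    by (rule norm_one_subsequence[of "\<lambda>k. ?v (\<rho> k) *\<^sub>R w (\<rho> k)"]) (simp add: w0)
  define \<tau> where "\<tau> k = \<rho> (\<sigma> k)" for k
  have \<tau>: "strict_mono \<tau>" using L(1) l(1) by (simp add: \<tau>_def strict_mono_def)
  have LX: "(\<lambda>k. ?x (\<tau> k) *\<^sub>R X (\<tau> k)) \<longlonglongrightarrow> L"
    using LIMSEQ_subseq_LIMSEQ[OF L(2) l(1)] by (simp add: o_def \<tau>_def)
  have lw: "(\<lambda>k. ?v (\<tau> k) *\<^sub>R w (\<tau> k)) \<longlonglongrightarrow> l" using l(2) by (simp add: o_def \<tau>_def)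
  have "filterlim (\<lambda>k. j (\<tau> k)) sequentially sequentially"
    by (rule filterlim_at_top_mono[OF filterlim_ident])
      (use order_trans[OF seq_suble[OF \<tau>] j(1)] in auto)
  then have Aj: "(\<lambda>k. A (j (\<tau> k)) q) \<longlonglongrightarrow> A0 q" if "q \<le> m" for q
    by (rule filterlim_compose[OF A[OF that]])
  have lz: "(\<lambda>k. (?v (\<tau> k) *\<^sub>R w (\<tau> k)) $ z) \<longlonglongrightarrow> l $ z" for z by (intro tendsto_intros lw)
  have sol: "solution m r (A (j (\<tau> k))) (?x (\<tau> k) *\<^sub>R X (\<tau> k)) (\<lambda>q. (?v (\<tau> k) *\<^sub>R w (\<tau> k)) $ \<iota> q)" for k
    using solution_scale[OF s(1) S, of "of_real (?x (\<tau> k))" "of_real (?v (\<tau> k))" "\<tau> k"] X0 w0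
    unfolding cscale_of_real scaleR_complex_nth using X0 w0 by simp
  have "solution m r A0 L (\<lambda>q. l $ \<iota> q)"
    by (rule solution_limit[OF Aj LX lz sequentially_bot sol S])
  moreover have "L \<noteq> 0" using L(3) by auto
  moreover have "\<exists>q\<le>m. l $ \<iota> q \<noteq> 0"
  proof (rule ccontr)
    assume neg: "\<not> ?thesis"
    have "l $ z = 0" for z
    proof (cases "z \<in> \<iota> ` {..m}")
      case False
      then have "w (\<tau> k) $ z = 0" for k using s(4) by blast
      then have z0: "(?v (\<tau> k) *\<^sub>R w (\<tau> k)) $ z = 0" for k by simp
      show ?thesis using lz[of z] unfolding z0 by (simp add: LIMSEQ_const_iff)
    qed (use neg in auto)
    then have "l = 0" unfolding vec_eq_iff zero_index by blast
    then show False using l(3) by simp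
  qed
  ultimately have nz: "trace L \<noteq> 0" "l $ \<iota> m \<noteq> 0" using A0 unfolding good_def by blast+
  have tr: "trace (?x (\<tau> k) *\<^sub>R X (\<tau> k)) = of_real (?x (\<tau> k))" for k
    unfolding cscale_of_real[symmetric] trace_cscale s(2) by simp
  have "(\<lambda>k. norm (complex_of_real (?x (\<tau> k)))) \<longlonglongrightarrow> norm (trace L)"
    using tendsto_norm[OF tendsto_trace[OF LX]] unfolding tr .
  then have "(\<lambda>k. ?x (\<tau> k)) \<longlonglongrightarrow> norm (trace L)" unfolding norm_of_real by simp
  from tendsto_inverse[OF this] have nX: "(\<lambda>k. norm (X (\<tau> k))) \<longlonglongrightarrow> inverse (norm (trace L))" using nz by simp
  have vm: "(?v (\<tau> k) *\<^sub>R w (\<tau> k)) $ \<iota> m = of_real (?v (\<tau> k))" for k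
    unfolding scaleR_complex_nth s(3) by simp
  have "(\<lambda>k. norm (complex_of_real (?v (\<tau> k)))) \<longlonglongrightarrow> norm (l $ \<iota> m)"
    using tendsto_norm[OF lz[of "\<iota> m"]] unfolding vm .
  then have "(\<lambda>k. ?v (\<tau> k)) \<longlonglongrightarrow> norm (l $ \<iota> m)" unfolding norm_of_real by simp
  from tendsto_inverse[OF this] have nw: "(\<lambda>k. norm (w (\<tau> k))) \<longlonglongrightarrow> inverse (norm (l $ \<iota> m))" using nz by simp
  have "Bseq (\<lambda>k. norm (X (\<tau> k)) + norm (w (\<tau> k)))"
    using convergent_imp_Bseq[OF convergentI[OF tendsto_add[OF nX nw]]] .
  then obtain K where K: "\<And>k. norm (norm (X (\<tau> k)) + norm (w (\<tau> k))) \<le> K" unfolding Bseq_def by blast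
  obtain k where k: "K < real k" using reals_Archimedean2 by blast
  have "real k \<le> real (\<tau> k)" using seq_suble[OF \<tau>] by simp
  also have "\<dots> < norm (X (\<tau> k), w (\<tau> k))" using j(2)[of "\<tau> k"] by (simp add: X_def w_def)
  also have "\<dots> \<le> norm (X (\<tau> k)) + norm (w (\<tau> k))" by (rule norm_Pair_le)
  also have "\<dots> \<le> K" using K[of k] by simp
  finally show False using k by simp
qed

text \<open>The rescaled difference of two solutions that converge to the same limit converges, along a
  subsequence, to a tangent vector at the limit, which contradicts regularity.\<close>

lemma normal_solutions_separate:
  fixes A :: "nat \<Rightarrow> nat \<Rightarrow> complex^'n^'n"
  assumes A: "\<And>q. q \<le> m \<Longrightarrow> (\<lambda>k. A k q) \<longlonglongrightarrow> A0 q" and S: "\<And>k. sym_frame m (A k)" and A0: "good m r A0"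
    and p: "\<And>k. p k \<in> normal_solutions \<iota> m r (A k)" and p': "\<And>k. p' k \<in> normal_solutions \<iota> m r (A k)"
    and ne: "\<And>k. p k \<noteq> p' k" and lim: "p \<longlonglongrightarrow> p0" "p' \<longlonglongrightarrow> p0"
  shows False
proof -
  obtain X0 w0 where p0: "p0 = (X0, w0)" by (cases p0)
  have "p0 \<in> normal_solutions \<iota> m r A0" by (rule normal_solutions_closed[OF A S p lim(1)])
  then have s0: "solution m r A0 X0 (\<lambda>q. w0 $ \<iota> q)" "trace X0 = 1" "w0 $ \<iota> m = 1"
    by (auto simp: normal_solutions_def p0)
  then have "X0 \<noteq> 0" "\<exists>q\<le>m. w0 $ \<iota> q \<noteq> 0" by (auto simp: trace_def intro!: exI[of _ m])
  then have reg: "regular m A0 X0 (\<lambda>q. w0 $ \<iota> q)" using A0 s0(1) unfolding good_def by blast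
  define X w where "X k = fst (p k)" and "w k = snd (p k)" for k
  define X' w' where "X' k = fst (p' k)" and "w' k = snd (p' k)" for k
  have s: "solution m r (A k) (X k) (\<lambda>q. w k $ \<iota> q)" "trace (X k) = 1" "w k $ \<iota> m = 1"
    "\<forall>z. z \<notin> \<iota> ` {..m} \<longrightarrow> w k $ z = 0" for k
    using p[of k] by (auto simp: normal_solutions_def X_def w_def)
  have s': "solution m r (A k) (X' k) (\<lambda>q. w' k $ \<iota> q)" "trace (X' k) = 1" "w' k $ \<iota> m = 1"
    "\<forall>z. z \<notin> \<iota> ` {..m} \<longrightarrow> w' k $ z = 0" for k
    using p'[of k] by (auto simp: normal_solutions_def X'_def w'_def)
  have X: "X \<longlonglongrightarrow> X0" and w': "w' \<longlonglongrightarrow> w0"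
    unfolding X_def w'_def using tendsto_fst[OF lim(1)] tendsto_snd[OF lim(2)] by (simp_all add: p0)
  define d where "d k = p' k - p k" for k
  have d0: "d k \<noteq> 0" for k using ne[of k] by (auto simp: d_def)
  let ?n = "\<lambda>k. inverse (norm (d k))"
  obtain e and \<rho> :: "nat \<Rightarrow> nat" where e: "strict_mono \<rho>" "((\<lambda>k. ?n k *\<^sub>R d k) \<circ> \<rho>) \<longlonglongrightarrow> e" "norm e = 1"
    by (rule norm_one_subsequence[of "\<lambda>k. ?n k *\<^sub>R d k"]) (simp add: d0)
  obtain E v where E: "e = (E, v)" by (cases e)
  define t where "t k = complex_of_real (?n (\<rho> k))" for k
  define D where "D k = X' (\<rho> k) - X (\<rho> k)" for k
  define u where "u k = w' (\<rho> k) - w (\<rho> k)" for k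
  have "(\<lambda>k. cscale (t k) (D k)) = (\<lambda>k. fst (((\<lambda>k. ?n k *\<^sub>R d k) \<circ> \<rho>) k))"
    unfolding t_def cscale_of_real by (simp add: D_def X_def X'_def d_def)
  then have DE: "(\<lambda>k. cscale (t k) (D k)) \<longlonglongrightarrow> E" using tendsto_fst[OF e(2)] by (simp add: E)
  have "(\<lambda>k. t k * u k $ z) = (\<lambda>k. snd (((\<lambda>k. ?n k *\<^sub>R d k) \<circ> \<rho>) k) $ z)" for z
    unfolding o_def snd_scaleR scaleR_complex_nth by (simp add: t_def u_def w_def w'_def d_def)
  then have uv: "(\<lambda>k. t k * u k $ z) \<longlonglongrightarrow> v $ z" for z
    using tendsto_vec_nth[OF tendsto_snd[OF e(2)], of z] by (simp add: E)
  have A\<rho>: "(\<lambda>k. A (\<rho> k) q) \<longlonglongrightarrow> A0 q" if "q \<le> m" for q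
    using LIMSEQ_subseq_LIMSEQ[OF A[OF that] e(1)] by (simp add: o_def)
  have X\<rho>: "(\<lambda>k. X (\<rho> k)) \<longlonglongrightarrow> X0" using LIMSEQ_subseq_LIMSEQ[OF X e(1)] by (simp add: o_def)
  have w'\<rho>: "(\<lambda>k. w' (\<rho> k) $ z) \<longlonglongrightarrow> w0 $ z" for z
    using LIMSEQ_subseq_LIMSEQ[OF tendsto_vec_nth[OF w'] e(1)] by (simp add: o_def)
  have DS: "cscale (t k) (D k) \<in> Sym" for k
    using s(1)[of "\<rho> k"] s'(1)[of "\<rho> k"] by (auto simp: D_def solution_def intro!: Sym_cscale Sym_diff)
  have ES: "E \<in> Sym" by (rule Sym_limit[OF DE sequentially_bot DS])
  have Eq: "trace (E ** A0 q) = 0" if q: "q < m - 1" for q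
  proof -
    have "(\<lambda>k. trace (cscale (t k) (D k) ** A (\<rho> k) q)) \<longlonglongrightarrow> trace (E ** A0 q)"
      by (intro tendsto_trace tendsto_matrix_mult DE A\<rho>) (use q in simp)
    moreover have "trace (cscale (t k) (D k) ** A (\<rho> k) q) = 0" for k
      using s(1)[of "\<rho> k"] s'(1)[of "\<rho> k"] q
      by (simp add: D_def solution_def cscale_mult_left trace_cscale matrix_diff_rdistrib trace_sub)
    ultimately show ?thesis by (simp add: LIMSEQ_const_iff)
  qed
  have eq: "E ** combination m A0 (\<lambda>q. w0 $ \<iota> q) + X0 ** combination m A0 (\<lambda>q. v $ \<iota> q) = 0"
  proof -
    have "(\<lambda>k. cscale (t k) (D k) ** combination m (A (\<rho> k)) (\<lambda>q. w' (\<rho> k) $ \<iota> q)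
        + X (\<rho> k) ** combination m (A (\<rho> k)) (\<lambda>q. t k * u k $ \<iota> q))
      \<longlonglongrightarrow> E ** combination m A0 (\<lambda>q. w0 $ \<iota> q) + X0 ** combination m A0 (\<lambda>q. v $ \<iota> q)"
      by (intro tendsto_add tendsto_matrix_mult tendsto_combination DE X\<rho> A\<rho> w'\<rho> uv)
    moreover have "cscale (t k) (D k) ** combination m (A (\<rho> k)) (\<lambda>q. w' (\<rho> k) $ \<iota> q)
        + X (\<rho> k) ** combination m (A (\<rho> k)) (\<lambda>q. t k * u k $ \<iota> q) = 0" for k
    proof -
      let ?c = "combination m (A (\<rho> k))"
      have "?c (\<lambda>q. u k $ \<iota> q) = ?c (\<lambda>q. w' (\<rho> k) $ \<iota> q) - ?c (\<lambda>q. w (\<rho> k) $ \<iota> q)"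
        using combination_diff_scale[of m "A (\<rho> k)" _ 1] by (simp add: u_def)
      moreover have "X (\<rho> k) ** ?c (\<lambda>q. w (\<rho> k) $ \<iota> q) = 0" "X' (\<rho> k) ** ?c (\<lambda>q. w' (\<rho> k) $ \<iota> q) = 0"
        using s(1)[of "\<rho> k"] s'(1)[of "\<rho> k"] by (simp_all add: solution_def)
      ultimately have "D k ** ?c (\<lambda>q. w' (\<rho> k) $ \<iota> q) + X (\<rho> k) ** ?c (\<lambda>q. u k $ \<iota> q) = 0"
        by (simp add: D_def matrix_diff_rdistrib matrix_diff_ldistrib)
      then show ?thesis
        unfolding combination_scale cscale_mult_left cscale_mult_right mat.scale_right_distrib[symmetric] by simp
    qed
    ultimately show ?thesis by (simp add: LIMSEQ_const_iff)
  qed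
  obtain c1 c2 where c: "E = cscale c1 X0" "\<forall>q\<le>m. v $ \<iota> q = c2 * w0 $ \<iota> q"
    using reg ES Eq eq unfolding regular_def by blast
  have "trace E = 0"
  proof -
    have "trace (cscale (t k) (D k)) = 0" for k by (simp add: trace_cscale D_def trace_sub s(2) s'(2))
    then show ?thesis using tendsto_trace[OF DE] by (simp add: LIMSEQ_const_iff)
  qed
  then have E0: "E = 0" using c(1) s0(2) by (simp add: trace_cscale)
  have "v $ \<iota> m = 0" using uv[of "\<iota> m"] by (simp add: u_def s(3) s'(3) LIMSEQ_const_iff)
  then have c2: "c2 = 0" using c(2) s0(3) by simp
  have "v $ z = 0" for z
  proof (cases "z \<in> \<iota> ` {..m}")
    case False
    then have "w k $ z = 0" "w' k $ z = 0" for k using s(4) s'(4) by blast+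
    then have "u k $ z = 0" for k by (simp add: u_def)
    then show ?thesis using uv[of z] by (simp add: LIMSEQ_const_iff)
  qed (use c(2) c2 in auto)
  then have "v = 0" unfolding vec_eq_iff zero_index by blast
  then show False using e(3) E E0 by simp
qed

lemma solution_cong: "(\<And>q. q \<le> m \<Longrightarrow> c q = d q) \<Longrightarrow> solution m r A X c \<longleftrightarrow> solution m r A X d"
  using combination_cong[of m c d A] by (simp add: solution_def)

lemma solution_from_chart:
  assumes m: "1 \<le> m" and iJ: "i \<notin> J" "j \<notin> J" and J: "card J = r"
    and b: "sym_frame m b" "\<forall>q\<le>m. main_map m J i j b q = B q"
  shows "solution m r B (pair_X J i j (b m)) (chart_coefficient m i j b)"
proof -
  have bS: "b m \<in> Sym" using b by (simp add: sym_frame_def)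
  have "rank (pair_X J i j (b m)) \<le> card (- J)" "rank (pair_Y J (b m)) \<le> card J"
    unfolding pair_X_def pair_Y_def
    by (intro rank_chart_le[OF supported_block supported_block_T supported_block block_T_Sym[OF bS] block_Sym[OF bS]])+
  moreover have "trace (pair_X J i j (b m) ** B q) = 0" if q: "q < m - 1" for q
  proof -
    have "B q = project_perp (pair_X J i j (b m)) i j (b q)"
      using b(2) main_map_simps(1)[OF m q, of J i j b] q by (metis diff_le_self le_trans less_imp_le_nat)
    then show ?thesis using trace_project_perp[OF pair_X_Sym[OF bS] pair_X_entry[OF iJ]] by simp
  qed
  ultimately show ?thesis
    unfolding solution_def combination_main_map[OF m b(2)]
    using J by (simp add: pair_X_Sym[OF bS] pair_product_zero card_complement)
qed

text \<open>A solution of a good frame is encoded by an immersive point of a chart. The parametrisation is open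
  there, so nearby frames are values at nearby points, and these encode nearby solutions.\<close>

lemma normal_solutions_lift:
  fixes A :: "nat \<Rightarrow> complex^'n^'n"
  assumes m: "m < CARD('n) * CARD('n)" "1 \<le> m" and \<iota>: "inj_on \<iota> {..m}"
    and A: "good m r A" and p: "p \<in> normal_solutions \<iota> m r A" and "\<epsilon> > 0"
  shows "\<exists>\<delta>>0. \<forall>B. sym_frame m B \<and> (\<forall>q\<le>m. norm (B q - A q) < \<delta>) \<longrightarrow>
    (\<exists>p'\<in>normal_solutions \<iota> m r B. dist p' p < \<epsilon>)"
proof -
  obtain X w where pXw: "p = (X, w)" by (cases p)
  have s: "solution m r A X (\<lambda>q. w $ \<iota> q)" "trace X = 1" "w $ \<iota> m = 1" "\<forall>z. z \<notin> \<iota> ` {..m} \<longrightarrow> w $ z = 0"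
    using p by (auto simp: normal_solutions_def pXw)
  have "X \<noteq> 0" "\<exists>q\<le>m. w $ \<iota> q \<noteq> 0" using s by (auto simp: trace_def intro!: exI[of _ m])
  then have "\<exists>J i j a s. i \<notin> J \<and> j \<notin> J \<and> card J = r \<and> s \<noteq> 0 \<and> sym_frame m a \<and> (\<forall>q\<le>m. main_map m J i j a q = A q) \<and>
        immersive m (main_map m J i j) a \<and> pair_X J i j (a m) = cscale s X \<and>
        (\<forall>q\<le>m. chart_coefficient m i j a q = w $ \<iota> q / w $ \<iota> m)"
    using A s(1) unfolding good_def by blast
  then obtain J i j a s' where iJ: "i \<notin> J" "j \<notin> J" and J: "card J = r" and s': "s' \<noteq> 0" and a: "sym_frame m a"
    and Aa: "\<forall>q\<le>m. main_map m J i j a q = A q" and imm: "immersive m (main_map m J i j) a"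
    and pX: "pair_X J i j (a m) = cscale s' X"
    and cf: "\<forall>q\<le>m. chart_coefficient m i j a q = w $ \<iota> q / w $ \<iota> m" by (elim exE conjE)
  define \<Phi> where "\<Phi> b = (cscale (inverse (trace (pair_X J i j (b m)))) (pair_X J i j (b m)),
    (\<chi> z. if z \<in> \<iota> ` {..m} then chart_coefficient m i j b (inv_into {..m} \<iota> z) else 0))" for b
  have \<Phi>a: "\<Phi> a = p"
  proof -
    have "(\<chi> z. if z \<in> \<iota> ` {..m} then chart_coefficient m i j a (inv_into {..m} \<iota> z) else 0) $ z = w $ z" for z
    proof (cases "z \<in> \<iota> ` {..m}")
      case True
      then show ?thesis using cf s(3) by (auto simp: inv_into_f_f[OF \<iota>])
    next
      case False
      then have "w $ z = 0" using s(4) by blast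
      then show ?thesis using False by simp
    qed
    then have "(\<chi> z. if z \<in> \<iota> ` {..m} then chart_coefficient m i j a (inv_into {..m} \<iota> z) else 0) = w"
      unfolding vec_eq_iff by blast
    then show ?thesis using s' s(2) unfolding \<Phi>_def pX pXw by (simp add: trace_cscale cscale_cscale)
  qed
  have tra: "trace (pair_X J i j (a m)) \<noteq> 0" using s' s(2) by (simp add: pX trace_cscale)
  have lim: "(\<lambda>k. \<Phi> (b k)) \<longlonglongrightarrow> \<Phi> a" "(\<lambda>k. trace (pair_X J i j (b k m))) \<longlonglongrightarrow> trace (pair_X J i j (a m))"
    if b: "\<And>q. q \<le> m \<Longrightarrow> (\<lambda>k. b k q) \<longlonglongrightarrow> a q" for b
  proof -
    have pl: "(\<lambda>k. pair_X J i j (b k m)) \<longlonglongrightarrow> pair_X J i j (a m)"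
    proof (rule matrix_tendstoI)
      fix k l
      show "(\<lambda>x. pair_X J i j (b x m) $ k $ l) \<longlonglongrightarrow> pair_X J i j (a m) $ k $ l"
        by (rule poly_funs_frame_tendsto[OF poly_matrix_entry[OF poly_matrix_pair(1)[OF poly_matrix_frame[OF order_refl]]] b])
    qed
    then show tl: "(\<lambda>k. trace (pair_X J i j (b k m))) \<longlonglongrightarrow> trace (pair_X J i j (a m))" by (rule tendsto_trace)
    have cl: "(\<lambda>k. chart_coefficient m i j (b k) q) \<longlonglongrightarrow> chart_coefficient m i j a q" if "q \<le> m" for q
      using b[OF that] b[of m] unfolding chart_coefficient_def by (auto intro!: tendsto_intros)
    have zl: "(\<lambda>k. if z \<in> \<iota> ` {..m} then chart_coefficient m i j (b k) (inv_into {..m} \<iota> z) else 0)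
        \<longlonglongrightarrow> (if z \<in> \<iota> ` {..m} then chart_coefficient m i j a (inv_into {..m} \<iota> z) else 0)" for z
    proof (cases "z \<in> \<iota> ` {..m}")
      case True
      then have "inv_into {..m} \<iota> z \<le> m" using inv_into_into[of z \<iota> "{..m}"] by simp
      then show ?thesis using True cl by simp
    qed simp
    show "(\<lambda>k. \<Phi> (b k)) \<longlonglongrightarrow> \<Phi> a"
      unfolding \<Phi>_def by (intro tendsto_Pair tendsto_cscale tendsto_inverse tl pl tra tendsto_vec_lambda zl)
  qed
  have "\<exists>\<epsilon>'>0. \<forall>b. sym_frame m b \<and> (\<forall>q\<le>m. norm (b q - a q) < \<epsilon>') \<longrightarrow>
    trace (pair_X J i j (b m)) \<noteq> 0 \<and> dist (\<Phi> b) p < \<epsilon>"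
  proof (rule ccontr)
    assume neg: "\<not> ?thesis"
    have "\<exists>b. (\<forall>q\<le>m. norm (b q - a q) < inverse (real (Suc k))) \<and>
        \<not> (trace (pair_X J i j (b m)) \<noteq> 0 \<and> dist (\<Phi> b) p < \<epsilon>)" for k
    proof -
      have "inverse (real (Suc k)) > 0" by simp
      then show ?thesis using neg by meson
    qed
    then obtain b where b: "\<And>k. \<forall>q\<le>m. norm (b k q - a q) < inverse (real (Suc k))"
      "\<And>k. \<not> (trace (pair_X J i j (b k m)) \<noteq> 0 \<and> dist (\<Phi> (b k)) p < \<epsilon>)" by metis
    have bl: "(\<lambda>k. b k q) \<longlonglongrightarrow> a q" if "q \<le> m" for q
      by (rule inverse_tendsto) (use b(1) that in \<open>simp add: dist_norm\<close>)
    have "\<forall>\<^sub>F k in sequentially. dist (\<Phi> (b k)) p < \<epsilon>"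
      using tendstoD[OF lim(1)[OF bl] \<open>\<epsilon> > 0\<close>] unfolding \<Phi>a .
    moreover have "\<forall>\<^sub>F k in sequentially. trace (pair_X J i j (b k m)) \<noteq> 0"
      by (rule tendsto_imp_eventually_ne[OF lim(2)[OF bl] tra])
    ultimately have "\<forall>\<^sub>F k in sequentially. False"
      by eventually_elim (use b(2) in blast)
    then show False by simp
  qed
  then obtain \<epsilon>' where \<epsilon>': "\<epsilon>' > 0" "\<And>b. sym_frame m b \<Longrightarrow> \<forall>q\<le>m. norm (b q - a q) < \<epsilon>' \<Longrightarrow>
    trace (pair_X J i j (b m)) \<noteq> 0 \<and> dist (\<Phi> b) p < \<epsilon>" by blast
  obtain \<delta> where \<delta>: "\<delta> > 0" "\<forall>B. sym_frame m B \<and> (\<forall>q\<le>m. norm (B q - main_map m J i j a q) < \<delta>) \<longrightarrow>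
    (\<exists>b. sym_frame m b \<and> (\<forall>q\<le>m. norm (b q - a q) < \<epsilon>') \<and> (\<forall>q\<le>m. main_map m J i j b q = B q))"
    using immersive_open_image[OF m(1) poly_frame_map_main[OF m(2)] a imm \<epsilon>'(1)] by (elim exE conjE)
  show ?thesis
  proof (intro exI[of _ \<delta>] conjI allI impI \<delta>(1), elim conjE)
    fix B assume B: "sym_frame m B" "\<forall>q\<le>m. norm (B q - A q) < \<delta>"
    then have "\<forall>q\<le>m. norm (B q - main_map m J i j a q) < \<delta>" using Aa by auto
    then obtain b where b: "sym_frame m b" "\<forall>q\<le>m. norm (b q - a q) < \<epsilon>'" "\<forall>q\<le>m. main_map m J i j b q = B q"
      using \<delta>(2) B(1) by meson
    have tb: "trace (pair_X J i j (b m)) \<noteq> 0" and db: "dist (\<Phi> b) p < \<epsilon>" using \<epsilon>'(2)[OF b(1,2)] by blast+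
    have "solution m r B (cscale (inverse (trace (pair_X J i j (b m)))) (pair_X J i j (b m)))
      (\<lambda>q. 1 * chart_coefficient m i j b q)"
      by (rule solution_scale[OF solution_from_chart[OF m(2) iJ J b(1,3)] B(1)]) (use tb in auto)
    then have "solution m r B (fst (\<Phi> b)) (\<lambda>q. snd (\<Phi> b) $ \<iota> q)"
      by (subst solution_cong[where d = "\<lambda>q. 1 * chart_coefficient m i j b q"])
        (simp_all add: \<Phi>_def inv_into_f_f[OF \<iota>])
    then have "\<Phi> b \<in> normal_solutions \<iota> m r B"
      using tb m(2) by (auto simp: normal_solutions_def \<Phi>_def trace_cscale inv_into_f_f[OF \<iota>] chart_coefficient_def)
    then show "\<exists>p'\<in>normal_solutions \<iota> m r B. dist p' p < \<epsilon>" using db by blast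
  qed
qed

lemma frame_line_near:
  fixes A D :: "nat \<Rightarrow> complex^'n^'n" and m :: nat
  assumes "\<delta> > 0"
  shows "\<exists>e>0. \<forall>t'. dist t' t < e \<longrightarrow>
    (\<forall>q\<le>m. norm ((A q + cscale t' (D q)) - (A q + cscale t (D q))) < \<delta>)"
proof -
  have "((\<lambda>t'. A q + cscale t' (D q)) \<longlongrightarrow> A q + cscale t (D q)) (nhds t)" for q
    by (intro tendsto_intros tendsto_cscale filterlim_ident)
  then have "\<forall>\<^sub>F t' in nhds t. \<forall>q\<in>{..m}. dist (A q + cscale t' (D q)) (A q + cscale t (D q)) < \<delta>"
    by (intro eventually_ball_finite ballI tendstoD assms) auto
  then show ?thesis unfolding eventually_nhds_metric dist_norm Ball_def atMost_iff by blast
qed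

text \<open>The two frames are joined by a complex line. The zeros of \<open>h\<close> on it are finite in number, and they
  do not disconnect it because it has real dimension two.\<close>

lemma card_normal_solutions_constant:
  fixes A0 A1 :: "nat \<Rightarrow> complex^'n^'n"
  assumes m: "m < CARD('n) * CARD('n)" "1 \<le> m" and \<iota>: "inj_on \<iota> {..m}"
    and h: "h \<in> poly_funs (frame_coords m)" "\<And>A :: nat \<Rightarrow> complex^'n^'n. sym_frame m A \<Longrightarrow> h A \<noteq> 0 \<Longrightarrow> good m r A"
    and A: "sym_frame m A0" "h A0 \<noteq> 0" "sym_frame m A1" "h A1 \<noteq> 0"
  shows "finite (normal_solutions \<iota> m r A0)" "card (normal_solutions \<iota> m r A0) = card (normal_solutions \<iota> m r A1)"
proof -
  define L where "L t q = A0 q + cscale t (A1 q - A0 q)" for t q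
  have L: "L 0 = A0" "L 1 = A1" by (auto simp: L_def vec_eq_iff)
  have LS: "sym_frame m (L t)" for t
    using A(1,3) unfolding sym_frame_def L_def by (blast intro: Sym_add Sym_cscale Sym_diff)
  define \<Omega> where "\<Omega> = {t. h (L t) \<noteq> 0}"
  have gd: "good m r (L t)" if "t \<in> \<Omega>" for t using h(2)[OF LS] that by (simp add: \<Omega>_def)
  have "finite {t. h (\<lambda>q. A0 q + cscale t (A1 q - A0 q)) = 0}"
    by (rule finite_zeros_along_line[of h "frame_coords m" _ 0, OF h(1) frame_coords_line]) (use A(2) in simp_all)
  then have "countable {t. h (L t) = 0}" unfolding L_def[abs_def] by (rule countable_finite)
  moreover have "\<Omega> = UNIV - {t. h (L t) = 0}" by (auto simp: \<Omega>_def)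
  ultimately have conn: "connected \<Omega>"
    using connected_open_diff_countable[of "UNIV :: complex set" "{t. h (L t) = 0}"] connected_UNIV by simp
  have Llim: "(\<lambda>k. L (T k) q) \<longlonglongrightarrow> L t q" if "T \<longlonglongrightarrow> t" for T t q
    unfolding L_def by (intro tendsto_intros tendsto_cscale that)
  have in\<Omega>: "0 \<in> \<Omega>" "1 \<in> \<Omega>" using A L by (auto simp: \<Omega>_def)
  have "finite (normal_solutions \<iota> m r (L 0)) \<and>
    card (normal_solutions \<iota> m r (L 0)) = card (normal_solutions \<iota> m r (L 1))"
  proof (rule conjI)
    note fam = card_family_constant[where S = "\<lambda>t. normal_solutions \<iota> m r (L t)", OF conn _ _ _ _ in\<Omega>]
    have closed: "q \<in> normal_solutions \<iota> m r (L t)" if "T \<longlonglongrightarrow> t" "\<And>k. p k \<in> normal_solutions \<iota> m r (L (T k))" "p \<longlonglongrightarrow> q"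
      for t T p q by (rule normal_solutions_closed[OF Llim[OF that(1)] LS that(2,3)])
    have bounded: "bounded (range p)" if "t \<in> \<Omega>" "T \<longlonglongrightarrow> t" "\<And>k. p k \<in> normal_solutions \<iota> m r (L (T k))" for t T p
      by (rule normal_solutions_bounded[OF Llim[OF that(2)] LS gd[OF that(1)] that(3)])
    have unique: False if "t \<in> \<Omega>" "T \<longlonglongrightarrow> t" "\<And>k. p k \<in> normal_solutions \<iota> m r (L (T k))"
      "\<And>k. p' k \<in> normal_solutions \<iota> m r (L (T k))" "\<And>k. p k \<noteq> p' k" "p \<longlonglongrightarrow> q" "p' \<longlonglongrightarrow> q" for t T p p' q
      by (rule normal_solutions_separate[OF Llim[OF that(2)] LS gd[OF that(1)] that(3-7)])
    have lift: "\<exists>\<delta>>0. \<forall>t'\<in>\<Omega>. dist t' t < \<delta> \<longrightarrow> (\<exists>q'\<in>normal_solutions \<iota> m r (L t'). dist q' q < \<epsilon>)"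
      if t: "t \<in> \<Omega>" and q: "q \<in> normal_solutions \<iota> m r (L t)" and \<epsilon>: "\<epsilon> > 0" for t q and \<epsilon> :: real
    proof -
      obtain \<delta> where \<delta>: "\<delta> > 0" "\<forall>B. sym_frame m B \<and> (\<forall>q\<le>m. norm (B q - L t q) < \<delta>) \<longrightarrow>
        (\<exists>p'\<in>normal_solutions \<iota> m r B. dist p' q < \<epsilon>)"
        using normal_solutions_lift[OF m \<iota> gd[OF t] q \<epsilon>] by (elim exE conjE)
      obtain e where e: "e > 0" "\<forall>t'. dist t' t < e \<longrightarrow> (\<forall>q\<le>m. norm (L t' q - L t q) < \<delta>)"
        using frame_line_near[OF \<delta>(1), of t m A0 "\<lambda>q. A1 q - A0 q"] unfolding L_def by (elim exE conjE)
      show ?thesis using \<delta>(2) e LS by blast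
    qed
    show "finite (normal_solutions \<iota> m r (L 0))"
      by (rule fam(1)) (rule closed bounded unique lift; assumption)+
    show "card (normal_solutions \<iota> m r (L 0)) = card (normal_solutions \<iota> m r (L 1))"
      by (rule fam(2)) (rule closed bounded unique lift; assumption)+
  qed
  then show "finite (normal_solutions \<iota> m r A0)"
    "card (normal_solutions \<iota> m r A0) = card (normal_solutions \<iota> m r A1)" unfolding L by auto
qed

text \<open>An immersive point of a chart yields a solution for all frames near its image, and the good
  frames are dense.\<close>

lemma normal_solutions_nonempty:
  fixes r m :: nat
  assumes r: "1 \<le> r" "r < CARD('n::finite)" and m: "1 \<le> m" "m < (CARD('n) + 1) choose 2" "m < CARD('n) * CARD('n)"
    and pataki: "(CARD('n) - r + 1) choose 2 \<le> m" "(r + 1) choose 2 \<le> ((CARD('n) + 1) choose 2) - m"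
    and \<iota>: "inj_on \<iota> {..m}"
    and h: "h \<in> poly_funs (frame_coords m)" "\<And>A :: nat \<Rightarrow> complex^'n^'n. sym_frame m A \<Longrightarrow> h A \<noteq> 0 \<Longrightarrow> good m r A"
    and A1: "sym_frame m A1" "h A1 \<noteq> 0"
  shows "\<exists>A :: nat \<Rightarrow> complex^'n^'n. sym_frame m A \<and> h A \<noteq> 0 \<and> normal_solutions \<iota> m r A \<noteq> {}"
proof -
  obtain J :: "'n set" and i a where J: "card J = r" and i: "i \<notin> J" and a: "sym_frame m a"
    and imm: "immersive m (main_map m J i i) a"
    using immersive_point_exists[OF r m(1,2) pataki] by blast
  define A0 where "A0 = main_map m J i i a"
  have A0: "sym_frame m A0"
    using poly_frame_map_main[OF m(1), of J i i] a unfolding poly_frame_map_def A0_def by blast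
  obtain \<delta> where \<delta>: "\<delta> > 0" "\<forall>B. sym_frame m B \<and> (\<forall>q\<le>m. norm (B q - A0 q) < \<delta>) \<longrightarrow>
    (\<exists>b. sym_frame m b \<and> (\<forall>q\<le>m. norm (b q - a q) < 1) \<and> (\<forall>q\<le>m. main_map m J i i b q = B q))"
    using immersive_open_image[OF m(3) poly_frame_map_main[OF m(1)] a imm zero_less_one] unfolding A0_def
    by (elim exE conjE)
  define L where "L t q = A0 q + cscale t (A1 q - A0 q)" for t q
  have LS: "sym_frame m (L t)" for t
    using A0 A1(1) unfolding sym_frame_def L_def by (blast intro: Sym_add Sym_cscale Sym_diff)
  have "L 1 = A1" "L 0 = A0" by (auto simp: L_def vec_eq_iff)
  obtain e where e: "e > 0" "\<forall>t'. dist t' 0 < e \<longrightarrow> (\<forall>q\<le>m. norm (L t' q - L 0 q) < \<delta>)"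
    using frame_line_near[OF \<delta>(1), of 0 m A0 "\<lambda>q. A1 q - A0 q"] unfolding L_def by (elim exE conjE)
  have "finite {t. h (\<lambda>q. A0 q + cscale t (A1 q - A0 q)) = 0}"
    by (rule finite_zeros_along_line[of h "frame_coords m" _ 1, OF h(1) frame_coords_line])
      (use A1(2) \<open>L 1 = A1\<close> in \<open>simp_all add: L_def[abs_def]\<close>)
  then have fin: "finite {t. h (L t) = 0}" unfolding L_def[abs_def] .
  have "infinite (ball (0 :: complex) e)"
    using uncountable_ball[OF e(1), of "0 :: complex"] countable_finite by blast
  then obtain t where t: "t \<in> ball 0 e" "h (L t) \<noteq> 0"
    using finite_subset[OF _ fin, of "ball 0 e"] by blast
  then have "\<forall>q\<le>m. norm (L t q - A0 q) < \<delta>" using e(2) \<open>L 0 = A0\<close> by (simp add: dist_commute)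
  then obtain b where b: "sym_frame m b" "\<forall>q\<le>m. main_map m J i i b q = L t q" using \<delta>(2) LS by meson
  have sol: "solution m r (L t) (pair_X J i i (b m)) (chart_coefficient m i i b)"
    by (rule solution_from_chart[OF m(1) i i J b])
  have "pair_X J i i (b m) $ i $ i = 1" by (rule pair_X_entry[OF i i])
  then have "pair_X J i i (b m) \<noteq> 0" by auto
  moreover have cm: "chart_coefficient m i i b m = 1" by (simp add: chart_coefficient_def)
  ultimately have tr: "trace (pair_X J i i (b m)) \<noteq> 0"
    using h(2)[OF LS t(2)] sol unfolding good_def by (metis order_refl zero_neq_one)
  define w where "w = (\<chi> z. if z \<in> \<iota> ` {..m} then chart_coefficient m i i b (inv_into {..m} \<iota> z) else 0)"
  have "solution m r (L t) (cscale (inverse (trace (pair_X J i i (b m)))) (pair_X J i i (b m)))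
      (\<lambda>q. 1 * chart_coefficient m i i b q)"
    by (rule solution_scale[OF sol LS]) (use tr in auto)
  then have "solution m r (L t) (cscale (inverse (trace (pair_X J i i (b m)))) (pair_X J i i (b m))) (\<lambda>q. w $ \<iota> q)"
    by (subst solution_cong[where d = "\<lambda>q. 1 * chart_coefficient m i i b q"])
      (simp_all add: w_def inv_into_f_f[OF \<iota>])
  then have "(cscale (inverse (trace (pair_X J i i (b m)))) (pair_X J i i (b m)), w) \<in> normal_solutions \<iota> m r (L t)"
    using tr cm by (auto simp: normal_solutions_def w_def trace_cscale inv_into_f_f[OF \<iota>])
  then show ?thesis using LS t(2) by blast
qed

section \<open>Frames, flags and lines\<close>

lemma mat_same_line:
  assumes "mat.span {X} = mat.span {X'}" obtains k where "X = cscale k X'"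
proof -
  have "X \<in> mat.span {X'}" using assms mat.span_base[of X "{X}"] by simp
  then show ?thesis using that by (auto simp: mat.span_singleton)
qed

lemma span_cscale: "k \<noteq> 0 \<Longrightarrow> mat.span {cscale k X} = mat.span {X}"
proof (intro equalityI mat.span_minimal mat.subspace_span)
  assume "k \<noteq> 0"
  show "{cscale k X} \<subseteq> mat.span {X}" by (simp add: mat.span_scale mat.span_base)
  have "cscale (1 / k) (cscale k X) \<in> mat.span {cscale k X}" by (intro mat.span_scale mat.span_base) simp
  then show "{X} \<subseteq> mat.span {cscale k X}" using \<open>k \<noteq> 0\<close> by (simp add: cscale_cscale)
qed

lemma span_coefficients:
  assumes "inj_on A {..<k :: nat}" "X \<in> mat.span (A ` {..<k})"
  obtains c where "X = (\<Sum>q<k. cscale (c q) (A q))"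
proof -
  have "X \<in> range (\<lambda>u. \<Sum>v\<in>A ` {..<k}. cscale (u v) v)"
    using assms(2) mat.span_finite[of "A ` {..<k}"] by simp
  then obtain u where "X = (\<Sum>v\<in>A ` {..<k}. cscale (u v) v)" by blast
  then have "X = (\<Sum>q<k. cscale (u (A q)) (A q))" by (simp add: sum.reindex[OF assms(1)])
  then show ?thesis by (rule that)
qed

lemma combination_in_span: "combination m A c \<in> mat.span (A ` {..m})"
  unfolding combination_def by (intro mat.span_sum mat.span_scale mat.span_base) auto

lemma span_frame:
  assumes "inj_on A {..m}" "X \<in> mat.span (A ` {..m})" obtains c where "X = combination m A c"
proof -
  have *: "{..m} = {..<Suc m}" by (simp add: lessThan_Suc_atMost)
  obtain c where "X = (\<Sum>q<Suc m. cscale (c q) (A q))"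
    using span_coefficients[of A "Suc m" X] assms unfolding * by blast
  then show ?thesis using that unfolding combination_def * by blast
qed

definition independent_frame :: "nat \<Rightarrow> (nat \<Rightarrow> complex^'n^'n) \<Rightarrow> bool" where
  "independent_frame m A \<longleftrightarrow> (\<forall>c. combination m A c = 0 \<longrightarrow> (\<forall>q\<le>m. c q = 0))"

lemma framesD:
  assumes "A \<in> frames m"
  shows "sym_frame m A" "inj_on A {..m}" "mat.independent (A ` {..m})"
  using assms by (auto simp: frames_def sym_frame_def PiE_def)

lemma frames_independent_frame:
  assumes "A \<in> frames m" shows "independent_frame m A"
  unfolding independent_frame_def
proof (intro allI impI)
  fix c q assume c: "combination m A c = 0" and q: "q \<le> m"
  note A = framesD[OF assms]
  let ?u = "\<lambda>v. c (inv_into {..m} A v)"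
  have "(\<Sum>v\<in>A ` {..m}. cscale (?u v) v) = combination m A c"
    unfolding combination_def sum.reindex[OF A(2)] by (intro sum.cong) (simp_all add: inv_into_f_f[OF A(2)])
  then have "?u (A q) = 0"
    using mat.independentD[OF A(3), of "A ` {..m}" ?u "A q"] c q by simp
  then show "c q = 0" using q by (simp add: inv_into_f_f[OF A(2)])
qed

text \<open>The elements of \<open>frames\<close> are extensional functions, so that a frame is determined by its matrices.\<close>

lemma independent_frame_frames:
  assumes ind: "independent_frame m A" and S: "sym_frame m A" and ext: "A \<in> extensional {..m}"
  shows "A \<in> frames m"
proof -
  have inj: "inj_on A {..m}"
  proof (rule inj_onI, rule ccontr)
    fix p q assume pq: "p \<in> {..m}" "q \<in> {..m}" "A p = A q" "p \<noteq> q"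
    let ?c = "\<lambda>k. if k = p then 1 else if k = q then -1 else (0 :: complex)"
    have "combination m A ?c = (\<Sum>k\<in>{p, q}. cscale (?c k) (A k))"
      unfolding combination_def by (rule sum.mono_neutral_right) (use pq in auto)
    also have "\<dots> = 0" using pq by (simp add: vec_eq_iff)
    finally have "?c p = 0" using ind pq(1) unfolding independent_frame_def by blast
    then show False by simp
  qed
  have "mat.independent (A ` {..m})"
  proof
    assume "mat.dependent (A ` {..m})"
    then obtain u v where u: "v \<in> A ` {..m}" "u v \<noteq> 0" "(\<Sum>v\<in>A ` {..m}. cscale (u v) v) = 0"
      using mat.dependent_finite[of "A ` {..m}"] by auto
    then have "combination m A (\<lambda>q. u (A q)) = 0" by (simp add: combination_def sum.reindex[OF inj])
    then show False using u(1,2) ind unfolding independent_frame_def by blast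
  qed
  then show ?thesis using inj S ext by (auto simp: frames_def sym_frame_def PiE_def)
qed

lemma flag_of_flags:
  assumes "A \<in> frames m" shows "flag_of m A \<in> flags m"
proof -
  note A = framesD[OF assms]
  have sub: "{..<m - 1} \<subseteq> {..m}" by auto
  have "mat.span (A ` {..<m - 1}) \<subseteq> mat.span (A ` {..m})" by (intro mat.span_mono image_mono sub)
  moreover have "mat.span (A ` {..m}) \<subseteq> Sym"
    using A(1) by (intro mat.span_minimal subspace_Sym) (auto simp: sym_frame_def)
  moreover have "mat.dim (A ` {..<m - 1}) = m - 1"
    using mat.dim_eq_card_independent[OF mat.independent_mono[OF A(3) image_mono[OF sub]]]
      card_image[OF inj_on_subset[OF A(2) sub]] by simp
  moreover have "mat.dim (A ` {..m}) = m + 1"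
    using mat.dim_eq_card_independent[OF A(3)] card_image[OF A(2)] by simp
  ultimately show ?thesis
    by (simp add: flags_def flag_of_def mat.subspace_span)
qed

lemma span_eq_of_card:
  assumes "mat.independent S" "finite T" "S \<subseteq> mat.span T" "card S = card T" shows "mat.span S = mat.span T"
proof
  show "mat.span S \<subseteq> mat.span T" by (rule mat.span_minimal[OF assms(3) mat.subspace_span])
  have "t \<in> mat.span S" if t: "t \<in> T" for t
  proof (rule ccontr)
    assume nt: "t \<notin> mat.span S"
    then have "mat.independent (insert t S)" by (rule mat.independent_insertI[OF _ assms(1)])
    moreover have "insert t S \<subseteq> mat.span T" using assms(3) mat.span_base[OF t] by simp
    ultimately have "finite (insert t S) \<and> card (insert t S) \<le> card T"
      by (rule mat.independent_span_bound[OF assms(2)])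
    moreover have "t \<notin> S" using nt mat.span_base[of t S] by satx
    ultimately show False using assms(4) by (elim conjE) (simp add: card_insert_disjoint)
  qed
  then show "mat.span T \<subseteq> mat.span S" by (intro mat.span_minimal mat.subspace_span) blast
qed

text \<open>If two frames define the same flag, one is obtained from the other by a matrix \<open>g\<close> of block
  triangular shape. The frames \<open>B\<close> for which \<open>g B\<close> lies in a given principal open set form a
  principal open set as well, and \<open>B\<close> and \<open>g B\<close> define the same flag. So the union of
  the fibres of the flag map over the image of a principal open set is open.\<close>

lemma zariski_open_flags_image:
  assumes R: "R \<in> poly_funs (frame_coords m)" "\<And>A. sym_frame m A \<Longrightarrow> R A \<noteq> 0 \<Longrightarrow> independent_frame m A"
  shows "zariski_open_flags m (flag_of m ` {A \<in> frames m. R A \<noteq> 0})"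
  unfolding zariski_open_flags_def
proof (intro conjI)
  let ?G = "flag_of m ` {A \<in> frames m. R A \<noteq> 0}"
  let ?T = "zariski (frame_coords m) (frames m)"
  show "?G \<subseteq> flags m" using flag_of_flags by auto
  have "\<exists>W. openin ?T W \<and> A \<in> W \<and> W \<subseteq> {A \<in> frames m. flag_of m A \<in> ?G}"
    if "A \<in> {A \<in> frames m. flag_of m A \<in> ?G}" for A
  proof -
    have A: "A \<in> frames m" using that by blast
    have "flag_of m A \<in> ?G" using that by blast
    then obtain A' where "flag_of m A = flag_of m A'" "A' \<in> {A \<in> frames m. R A \<noteq> 0}" by (rule imageE)
    then have A': "A' \<in> frames m" "R A' \<noteq> 0" "flag_of m A = flag_of m A'" by auto
    note fA = framesD[OF A] and fA' = framesD[OF A'(1)]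
    have sub: "{..<m - 1} \<subseteq> {..m}" by auto
    have "\<exists>c. A' q = combination m A c \<and> (q < m - 1 \<longrightarrow> (\<forall>p. m - 1 \<le> p \<longrightarrow> c p = 0))" if q: "q \<le> m" for q
    proof (cases "q < m - 1")
      case True
      then have "A' q \<in> mat.span (A ` {..<m - 1})"
        using A'(3) mat.span_base[of "A' q" "A' ` {..<m - 1}"] by (auto simp: flag_of_def)
      then obtain c where "A' q = (\<Sum>q<m - 1. cscale (c q) (A q))"
        using span_coefficients[OF inj_on_subset[OF fA(2) sub]] by blast
      also have "\<dots> = combination m A (\<lambda>p. if p < m - 1 then c p else 0)"
        unfolding combination_def by (rule sum.mono_neutral_cong_left) auto
      finally show ?thesis by (intro exI[of _ "\<lambda>p. if p < m - 1 then c p else 0"]) auto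
    next
      case False
      have "A' q \<in> mat.span (A ` {..m})"
        using A'(3) mat.span_base[of "A' q" "A' ` {..m}"] q by (auto simp: flag_of_def)
      then show ?thesis using span_frame[OF fA(2)] False by metis
    qed
    then have "\<forall>q\<in>{..m}. \<exists>c. A' q = combination m A c \<and> (q < m - 1 \<longrightarrow> (\<forall>p. m - 1 \<le> p \<longrightarrow> c p = 0))" by simp
    from bchoice[OF this] obtain g where
      g': "\<forall>q\<in>{..m}. A' q = combination m A (g q) \<and> (q < m - 1 \<longrightarrow> (\<forall>p. m - 1 \<le> p \<longrightarrow> g q p = 0))" ..
    have g: "A' q = combination m A (g q)" if "q \<le> m" for q using g' that by blast
    have g0: "g q p = 0" if "q < m - 1" "m - 1 \<le> p" for q p
    proof -
      have "q \<in> {..m}" using that by simp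
      then show ?thesis using g' that by blast
    qed
    define g' where "g' B = restrict (\<lambda>q. combination m B (g q)) {..m}" for B :: "nat \<Rightarrow> complex^'a^'a"
    have poly: "(\<lambda>B. R (g' B)) \<in> poly_funs (frame_coords m)"
    proof (rule poly_funs_pullback[OF R(1)])
      fix h :: "(nat \<Rightarrow> complex^'a^'a) \<Rightarrow> complex" assume "h \<in> frame_coords m"
      then obtain q i j where h: "q \<le> m" "h = (\<lambda>A. A q $ i $ j)" by (auto simp: frame_coords_def)
      have "(\<lambda>B. \<Sum>p\<le>m. g q p * B p $ i $ j) \<in> poly_funs (frame_coords m)"
        by (intro poly_funs_sum poly_funs_cmult frame_coord) simp
      then show "(\<lambda>B. h (g' B)) \<in> poly_funs (frame_coords m)"
        using h by (simp add: g'_def combination_def)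
    qed
    let ?W = "{B \<in> frames m. R (g' B) \<noteq> 0}"
    have "openin ?T ?W"
      unfolding zariski_def by (rule topology_generated_by_Basis, rule CollectI, rule exI[of _ "\<lambda>B. R (g' B)"])
        (intro conjI refl poly)
    moreover have "A \<in> ?W"
    proof -
      have "R (g' A) = R A'" by (rule poly_funs_frame_cong[OF R(1)]) (simp add: g'_def g)
      then show ?thesis using A A'(2) by simp
    qed
    moreover have "?W \<subseteq> {A \<in> frames m. flag_of m A \<in> ?G}"
    proof
      fix B assume "B \<in> ?W"
      then have B: "B \<in> frames m" "R (g' B) \<noteq> 0" by auto
      note fB = framesD[OF B(1)]
      have S: "sym_frame m (g' B)" using combination_Sym[OF fB(1)] by (simp add: sym_frame_def g'_def)
      have C: "g' B \<in> frames m"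
        by (rule independent_frame_frames[OF R(2)[OF S B(2)] S]) (simp add: g'_def)
      note fC = framesD[OF C]
      have "mat.span (g' B ` {..m}) = mat.span (B ` {..m})"
      proof (rule span_eq_of_card[OF fC(3)])
        show "card (g' B ` {..m}) = card (B ` {..m})" unfolding card_image[OF fC(2)] card_image[OF fB(2)] ..
        show "g' B ` {..m} \<subseteq> mat.span (B ` {..m})" by (rule image_subsetI) (simp add: g'_def combination_in_span)
      qed simp
      moreover have "mat.span (g' B ` {..<m - 1}) = mat.span (B ` {..<m - 1})"
      proof (rule span_eq_of_card)
        show "mat.independent (g' B ` {..<m - 1})" by (rule mat.independent_mono[OF fC(3) image_mono[OF sub]])
        show "card (g' B ` {..<m - 1}) = card (B ` {..<m - 1})"
          unfolding card_image[OF inj_on_subset[OF fC(2) sub]] card_image[OF inj_on_subset[OF fB(2) sub]] ..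
        have "g' B q \<in> mat.span (B ` {..<m - 1})" if q: "q < m - 1" for q
        proof -
          have "q \<le> m" using q by simp
          then have "g' B q = combination m B (g q)" by (simp add: g'_def)
          also have "\<dots> = (\<Sum>p<m - 1. cscale (g q p) (B p))"
            unfolding combination_def by (rule sum.mono_neutral_right) (use g0[OF q] in auto)
          also have "\<dots> \<in> mat.span (B ` {..<m - 1})"
            by (intro mat.span_sum mat.span_scale mat.span_base) auto
          finally show ?thesis .
        qed
        then show "g' B ` {..<m - 1} \<subseteq> mat.span (B ` {..<m - 1})" by (intro image_subsetI) simp
      qed simp
      ultimately have "flag_of m B = flag_of m (g' B)" unfolding flag_of_def by (intro prod_eqI) simp_all
      moreover have "flag_of m (g' B) \<in> ?G" using B C by (intro imageI) simp
      ultimately show "B \<in> {A \<in> frames m. flag_of m A \<in> ?G}" using B by simp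
    qed
    ultimately show ?thesis by (intro exI[of _ ?W] conjI)
  qed
  then show "openin ?T {A \<in> frames m. flag_of m A \<in> ?G}" by (subst openin_subopen, intro ballI)
qed

section \<open>Points of the intersection\<close>

lemma annihilator_scale: "X \<in> annihilator W \<Longrightarrow> cscale k X \<in> annihilator W"
  by (simp add: annihilator_def Sym_cscale cscale_mult_left trace_cscale)

lemma annihilator_span: "X \<in> annihilator (mat.span W) \<longleftrightarrow> X \<in> Sym \<and> (\<forall>Y\<in>W. trace (X ** Y) = 0)"
proof
  assume "X \<in> annihilator (mat.span W)"
  then show "X \<in> Sym \<and> (\<forall>Y\<in>W. trace (X ** Y) = 0)" by (auto simp: annihilator_def mat.span_base)
next
  assume X: "X \<in> Sym \<and> (\<forall>Y\<in>W. trace (X ** Y) = 0)"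
  have "mat.span W \<subseteq> {Y. trace (X ** Y) = 0}"
  proof (rule mat.span_minimal)
    show "mat.subspace {Y. trace (X ** Y) = 0}"
      by (rule mat.subspaceI)
        (simp_all add: matrix_add_ldistrib trace_add cscale_mult_right trace_cscale, simp add: trace_def)
  qed (use X in auto)
  then show "X \<in> annihilator (mat.span W)" using X by (auto simp: annihilator_def)
qed

lemma XY_zero_line:
  assumes "(mat.span {X}, mat.span {Y}) \<in> XY_zero r" "X \<noteq> 0" "Y \<noteq> (0 :: complex^'n^'n)"
  shows "X \<in> Sym" "Y \<in> Sym" "X ** Y = 0" "rank X \<le> CARD('n) - r" "rank Y \<le> r"
proof -
  obtain X' Y' where S: "X' \<in> Sym" "Y' \<in> Sym" and e: "mat.span {X} = mat.span {X'}" "mat.span {Y} = mat.span {Y'}"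
    and p: "X' ** Y' = 0" "rank X' \<le> CARD('n) - r" "rank Y' \<le> r" using assms(1) unfolding XY_zero_def by blast
  obtain k l where X: "X = cscale k X'" and Y: "Y = cscale l Y'"
    using mat_same_line[OF e(1)] mat_same_line[OF e(2)] by metis
  have "k \<noteq> 0" "l \<noteq> 0" using assms(2,3) X Y by auto
  then show "X \<in> Sym" "Y \<in> Sym" "X ** Y = 0" "rank X \<le> CARD('n) - r" "rank Y \<le> r"
    using S p unfolding X Y by (simp_all add: Sym_cscale cscale_mult_left cscale_mult_right rank_cscale)
qed

lemma linear_section_line:
  assumes "(mat.span {X}, mat.span {Y}) \<in> linear_section V (mat.span U)"
  shows "X \<in> annihilator V" "Y \<in> mat.span U"
proof -
  obtain X' Y' where e: "mat.span {X} = mat.span {X'}" "mat.span {Y} = mat.span {Y'}"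
    and p: "X' \<in> annihilator V" "Y' \<in> mat.span U" using assms by (auto simp: linear_section_def proj_def)
  obtain k l where X: "X = cscale k X'" and Y: "Y = cscale l Y'"
    using mat_same_line[OF e(1)] mat_same_line[OF e(2)] by metis
  show "X \<in> annihilator V" "Y \<in> mat.span U" unfolding X Y
    by (intro annihilator_scale p mat.span_scale)+
qed

definition intersection :: "nat \<Rightarrow> nat \<Rightarrow> (nat \<Rightarrow> complex^'n^'n) \<Rightarrow> ((complex^'n^'n) set \<times> (complex^'n^'n) set) set" where
  "intersection m r A = XY_zero r \<inter> linear_section (mat.span (A ` {..<m - 1})) (mat.span (A ` {..m}))"

lemma intersection_iff:
  fixes A :: "nat \<Rightarrow> complex^'n^'n"
  assumes "A \<in> frames m"
  shows "z \<in> intersection m r A \<longleftrightarrow> (\<exists>X c. solution m r A X c \<and> X \<noteq> 0 \<and> (\<exists>q\<le>m. c q \<noteq> 0) \<and>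
    z = (mat.span {X}, mat.span {combination m A c}))"
proof
  note A = framesD[OF assms]
  assume "z \<in> intersection m r A"
  then have z: "z \<in> XY_zero r" "z \<in> linear_section (mat.span (A ` {..<m - 1})) (mat.span (A ` {..m}))"
    by (auto simp: intersection_def)
  obtain X Y where XY: "z = (mat.span {X}, mat.span {Y})" "X \<noteq> 0" "Y \<noteq> 0" using z(1) by (auto simp: XY_zero_def)
  note p = XY_zero_line[OF z(1)[unfolded XY(1)] XY(2,3)] and l = linear_section_line[OF z(2)[unfolded XY(1)]]
  obtain c where c: "Y = combination m A c" using span_frame[OF A(2) l(2)] .
  have "solution m r A X c"
    using p l(1) unfolding c by (auto simp: solution_def annihilator_span)
  moreover have "\<exists>q\<le>m. c q \<noteq> 0"
  proof (rule ccontr)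
    assume "\<not> ?thesis"
    then have "Y = 0" unfolding c combination_def by (intro sum.neutral) auto
    then show False using XY(3) by simp
  qed
  ultimately show "\<exists>X c. solution m r A X c \<and> X \<noteq> 0 \<and> (\<exists>q\<le>m. c q \<noteq> 0) \<and>
    z = (mat.span {X}, mat.span {combination m A c})" using XY c by blast
next
  note A = framesD[OF assms]
  assume "\<exists>X c. solution m r A X c \<and> X \<noteq> 0 \<and> (\<exists>q\<le>m. c q \<noteq> 0) \<and>
    z = (mat.span {X}, mat.span {combination m A c})"
  then obtain X c where sol: "solution m r A X c" "X \<noteq> 0" "\<exists>q\<le>m. c q \<noteq> 0"
    and z: "z = (mat.span {X}, mat.span {combination m A c})" by blast
  have Y0: "combination m A c \<noteq> 0"
    using frames_independent_frame[OF assms] sol(3) unfolding independent_frame_def by blast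
  have "z \<in> XY_zero r"
    unfolding XY_zero_def z using sol Y0 combination_Sym[OF A(1)] by (auto simp: solution_def)
  moreover have "X \<in> annihilator (mat.span (A ` {..<m - 1}))"
    using sol(1) by (auto simp: annihilator_span solution_def)
  then have "z \<in> linear_section (mat.span (A ` {..<m - 1})) (mat.span (A ` {..m}))"
    unfolding linear_section_def proj_def z using sol(2) Y0 combination_in_span[of m A c] by blast
  ultimately show "z \<in> intersection m r A" by (simp add: intersection_def)
qed

text \<open>Trace one and leading coefficient one select a unique spanning vector in each of the two lines.\<close>

lemma intersection_normal_solutions:
  fixes A :: "nat \<Rightarrow> complex^'n^'n"
  assumes A: "A \<in> frames m" and gd: "good m r A" and \<iota>: "inj_on \<iota> {..m}"
  shows "bij_betw (\<lambda>(X, w). (mat.span {X}, mat.span {combination m A (\<lambda>q. w $ \<iota> q)}))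
    (normal_solutions \<iota> m r A) (intersection m r A)"
  unfolding bij_betw_def
proof
  let ?f = "\<lambda>(X, w). (mat.span {X}, mat.span {combination m A (\<lambda>q. w $ \<iota> q)})"
  note fA = framesD[OF A]
  show "inj_on ?f (normal_solutions \<iota> m r A)"
  proof (rule inj_onI)
    fix p p' assume "p \<in> normal_solutions \<iota> m r A" "p' \<in> normal_solutions \<iota> m r A" "?f p = ?f p'"
    moreover obtain X w X' w' where p: "p = (X, w)" "p' = (X', w')" by (cases p; cases p')
    ultimately have t: "trace X = 1" "trace X' = 1" "w $ \<iota> m = 1" "w' $ \<iota> m = 1"
      and z: "\<forall>z. z \<notin> \<iota> ` {..m} \<longrightarrow> w $ z = 0" "\<forall>z. z \<notin> \<iota> ` {..m} \<longrightarrow> w' $ z = 0"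
      and e: "mat.span {X} = mat.span {X'}"
      "mat.span {combination m A (\<lambda>q. w $ \<iota> q)} = mat.span {combination m A (\<lambda>q. w' $ \<iota> q)}"
      unfolding normal_solutions_def by auto
    obtain k where k: "X = cscale k X'" using mat_same_line[OF e(1)] .
    then have X: "X = X'" using t(1,2) by (simp add: trace_cscale)
    obtain l where "combination m A (\<lambda>q. w $ \<iota> q) = cscale l (combination m A (\<lambda>q. w' $ \<iota> q))"
      using mat_same_line[OF e(2)] .
    then have "combination m A (\<lambda>q. w $ \<iota> q - l * w' $ \<iota> q) = 0" unfolding combination_diff_scale by simp
    then have wl: "w $ \<iota> q = l * w' $ \<iota> q" if "q \<le> m" for q
      using frames_independent_frame[OF A] that unfolding independent_frame_def by force
    then have l: "l = 1" using t(3,4) wl[of m] by simp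
    have "w $ z = w' $ z" for z
    proof (cases "z \<in> \<iota> ` {..m}")
      case False
      then have "w $ z = 0" "w' $ z = 0" using z by blast+
      then show ?thesis by simp
    qed (use wl l in auto)
    then have "w = w'" unfolding vec_eq_iff by blast
    then show "p = p'" using p X by simp
  qed
  show "?f ` normal_solutions \<iota> m r A = intersection m r A"
  proof (intro equalityI subsetI)
    fix z assume "z \<in> ?f ` normal_solutions \<iota> m r A"
    then obtain X w where p: "(X, w) \<in> normal_solutions \<iota> m r A" and z: "z = ?f (X, w)" by auto
    then have s: "solution m r A X (\<lambda>q. w $ \<iota> q)" "trace X = 1" "w $ \<iota> m = 1" by (auto simp: normal_solutions_def)
    then have "X \<noteq> 0" "\<exists>q\<le>m. w $ \<iota> q \<noteq> 0" by (auto simp: trace_def intro!: exI[of _ m])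
    then show "z \<in> intersection m r A" unfolding intersection_iff[OF A] using s(1) z by auto
  next
    fix z assume "z \<in> intersection m r A"
    then obtain X c where sol: "solution m r A X c" "X \<noteq> 0" "\<exists>q\<le>m. c q \<noteq> 0"
      and z: "z = (mat.span {X}, mat.span {combination m A c})" unfolding intersection_iff[OF A] by blast
    have nz: "trace X \<noteq> 0" "c m \<noteq> 0" using gd sol unfolding good_def by blast+
    define w where "w = (\<chi> z. if z \<in> \<iota> ` {..m} then inverse (c m) * c (inv_into {..m} \<iota> z) else 0)"
    have w: "w $ \<iota> q = inverse (c m) * c q" if "q \<le> m" for q using that by (simp add: w_def inv_into_f_f[OF \<iota>])
    have "solution m r A (cscale (inverse (trace X)) X) (\<lambda>q. inverse (c m) * c q)"
      by (rule solution_scale[OF sol(1) fA(1)]) (use nz in auto)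
    then have "solution m r A (cscale (inverse (trace X)) X) (\<lambda>q. w $ \<iota> q)"
      by (subst solution_cong[where d = "\<lambda>q. inverse (c m) * c q"]) (simp_all add: w)
    then have "(cscale (inverse (trace X)) X, w) \<in> normal_solutions \<iota> m r A"
      using nz w[of m] by (auto simp: normal_solutions_def trace_cscale w_def)
    moreover have "combination m A (\<lambda>q. w $ \<iota> q) = cscale (inverse (c m)) (combination m A c)"
      unfolding combination_scale[symmetric] by (rule combination_cong) (simp add: w)
    then have "z = ?f (cscale (inverse (trace X)) X, w)" using nz by (simp add: z span_cscale)
    ultimately show "z \<in> ?f ` normal_solutions \<iota> m r A" by blast
  qed
qed

lemma intersection_ranks:
  fixes A :: "nat \<Rightarrow> complex^'n^'n"
  assumes A: "A \<in> frames m" and gd: "good m r A"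
    and z: "(mat.span {X}, mat.span {Y}) \<in> intersection m r A"
  shows "rank X = CARD('n) - r" "rank Y = r"
proof -
  obtain X' c where sol: "solution m r A X' c" "X' \<noteq> 0" "\<exists>q\<le>m. c q \<noteq> 0"
    and e: "mat.span {X} = mat.span {X'}" "mat.span {Y} = mat.span {combination m A c}"
    using z unfolding intersection_iff[OF A] by blast
  have rk: "rank X' = CARD('n) - r" "rank (combination m A c) = r" using gd sol unfolding good_def by blast+
  have "combination m A c \<noteq> 0"
    using frames_independent_frame[OF A] sol(3) unfolding independent_frame_def by blast
  moreover obtain k l where k: "X = cscale k X'" and l: "Y = cscale l (combination m A c)"
    using mat_same_line[OF e(1)] mat_same_line[OF e(2)] by metis
  moreover have "k \<noteq> 0"
  proof
    assume "k = 0"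
    have "X' \<in> mat.span {X}" unfolding e(1) by (rule mat.span_base) simp
    then show False using sol(2) k \<open>k = 0\<close> by (auto simp: mat.span_singleton)
  qed
  moreover have "l \<noteq> 0"
  proof
    assume "l = 0"
    have "combination m A c \<in> mat.span {Y}" unfolding e(2) by (rule mat.span_base) simp
    then show False using calculation(1) l \<open>l = 0\<close> by (auto simp: mat.span_singleton)
  qed
  moreover have "X' \<in> Sym" using sol(1) by (simp add: solution_def)
  ultimately show "rank X = CARD('n) - r" "rank Y = r"
    using rk combination_Sym[OF framesD(1)[OF A]] by (simp_all add: rank_cscale)
qed

section \<open>Finite subsets have dimension zero\<close>

text \<open>Every subset is closed, so the irreducible closed sets are the points.\<close>

lemma krull_dim_finite_discrete:
  assumes Z: "finite (topspace T)" "topspace T \<noteq> {}" and cl: "\<And>z. z \<in> topspace T \<Longrightarrow> closedin T {z}"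
  shows "krull_dim T = 0"
proof -
  have sub: "closedin T S" if "S \<subseteq> topspace T" for S
  proof -
    have "closedin T (\<Union>z\<in>S. {z})"
      using that finite_subset[OF that Z(1)] cl by (intro closedin_Union) auto
    then show ?thesis by simp
  qed
  have sing: "\<exists>z. S = {z}" if S: "irreducible_closed T S" for S
  proof -
    have S': "S \<subseteq> topspace T" "S \<noteq> {}" using S closedin_subset by (auto simp: irreducible_closed_def)
    then obtain z where z: "z \<in> S" by blast
    have "closedin T {z}" "closedin T (S - {z})" "S = {z} \<union> (S - {z})"
      by (rule sub, use S'(1) z in blast)+ (use z in blast)
    then have "S = {z} \<or> S = S - {z}" using S unfolding irreducible_closed_def by blast
    then show ?thesis using z by blast
  qed
  have "k = 0" if C: "\<forall>i\<le>k. irreducible_closed T (C i)" "\<forall>i<k. C i \<subset> C (Suc i)" for k :: nat and C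
  proof (rule ccontr)
    assume "k \<noteq> 0"
    then have "irreducible_closed T (C 0)" "irreducible_closed T (C 1)" "C 0 \<subset> C 1" using C by auto
    moreover obtain x y where "C 0 = {x}" "C 1 = {y}" using calculation(1,2) sing by metis
    ultimately show False by auto
  qed
  moreover obtain z where z: "z \<in> topspace T" using Z(2) by blast
  have "irreducible_closed T {z}" unfolding irreducible_closed_def using cl[OF z] by blast
  ultimately have "{ereal (real k) | k. \<exists>C :: nat \<Rightarrow> 'a set.
     (\<forall>i\<le>k. irreducible_closed T (C i)) \<and> (\<forall>i<k. C i \<subset> C (Suc i))} = {0}"
    by (auto simp: zero_ereal_def intro!: exI[of _ "0 :: nat"] exI[of _ "\<lambda>_. {z}"])
  then show ?thesis by (simp add: krull_dim_def)
qed

lemma pair_coord: "(\<lambda>p. fst p $ i $ j) \<in> poly_funs pair_coords" "(\<lambda>p. snd p $ i $ j) \<in> poly_funs pair_coords"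
  by (rule poly_funs.coord, force simp: pair_coords_def)+

definition basic_open ::
    "((complex^'n^'n) \<times> (complex^'n^'n) \<Rightarrow> complex) \<Rightarrow> ((complex^'n^'n) set \<times> (complex^'n^'n) set) set" where
  "basic_open f = {(mat.span {X}, mat.span {Y}) | X Y. X \<in> Sym - {0} \<and> Y \<in> Sym - {0} \<and> f (X, Y) \<noteq> 0}"

lemma openin_basic_open: "bihomogeneous f \<Longrightarrow> openin biproj_topology (basic_open f)"
  unfolding biproj_topology_def basic_open_def by (rule topology_generated_by_Basis) blast

lemma proportional_of_minors:
  assumes "X0 \<noteq> (0 :: complex^'n^'n)" "\<And>a b c d. X $ a $ b * X0 $ c $ d = X $ c $ d * X0 $ a $ b"
  shows "\<exists>k. X = cscale k X0"
proof -
  obtain c d where "X0 $ c $ d \<noteq> 0" using assms(1) unfolding vec_eq_iff zero_index by blast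
  then have "X = cscale (X $ c $ d / X0 $ c $ d) X0"
    using assms(2)[of _ _ c d] by (simp add: vec_eq_iff field_simps)
  then show ?thesis by blast
qed

text \<open>A point of the product of projective spaces is cut out by the two by two minors that express
  proportionality in each factor.\<close>

lemma biproj_point_complement_open:
  assumes "X0 \<noteq> 0" "Y0 \<noteq> (0 :: complex^'n^'n)"
  shows "\<exists>W. openin biproj_topology W \<and> (mat.span {X0}, mat.span {Y0}) \<notin> W \<and>
    (\<forall>X Y. X \<in> Sym - {0} \<longrightarrow> Y \<in> Sym - {0} \<longrightarrow> (mat.span {X}, mat.span {Y}) \<noteq> (mat.span {X0}, mat.span {Y0}) \<longrightarrow>
      (mat.span {X}, mat.span {Y}) \<in> W)"
proof -
  define f g :: "'n \<times> 'n \<times> 'n \<times> 'n \<Rightarrow> (complex^'n^'n) \<times> (complex^'n^'n) \<Rightarrow> complex" where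
    "f = (\<lambda>(a, b, c, d) p. fst p $ a $ b * X0 $ c $ d - fst p $ c $ d * X0 $ a $ b)" and
    "g = (\<lambda>(a, b, c, d) p. snd p $ a $ b * Y0 $ c $ d - snd p $ c $ d * Y0 $ a $ b)"
  have "bihomogeneous (f x)" for x
  proof -
    obtain a b c d where x: "x = (a, b, c, d)" by (cases x)
    have "f x \<in> poly_funs pair_coords"
      unfolding x f_def prod.case by (intro poly_funs_diff poly_funs.mult pair_coord poly_funs.const)
    then show ?thesis unfolding bihomogeneous_def
      by (intro conjI exI[of _ 1] exI[of _ 0]) (simp_all add: x f_def algebra_simps)
  qed
  moreover have "bihomogeneous (g x)" for x
  proof -
    obtain a b c d where x: "x = (a, b, c, d)" by (cases x)
    have "g x \<in> poly_funs pair_coords"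
      unfolding x g_def prod.case by (intro poly_funs_diff poly_funs.mult pair_coord poly_funs.const)
    then show ?thesis unfolding bihomogeneous_def
      by (intro conjI exI[of _ 0] exI[of _ 1]) (simp_all add: x g_def algebra_simps)
  qed
  ultimately have "openin biproj_topology ((\<Union>x. basic_open (f x)) \<union> (\<Union>x. basic_open (g x)))"
    by (intro openin_Un openin_Union) (auto intro: openin_basic_open)
  moreover have "(mat.span {X0}, mat.span {Y0}) \<notin> (\<Union>x. basic_open (f x)) \<union> (\<Union>x. basic_open (g x))"
  proof
    assume "(mat.span {X0}, mat.span {Y0}) \<in> (\<Union>x. basic_open (f x)) \<union> (\<Union>x. basic_open (g x))"
    then obtain X Y x where e: "mat.span {X0} = mat.span {X}" "mat.span {Y0} = mat.span {Y}"
      and nz: "f x (X, Y) \<noteq> 0 \<or> g x (X, Y) \<noteq> 0"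
      by (simp only: basic_open_def Un_iff UN_iff mem_Collect_eq prod.inject) blast
    obtain k l where "X = cscale k X0" "Y = cscale l Y0"
      using mat_same_line[OF e(1)[symmetric]] mat_same_line[OF e(2)[symmetric]] by metis
    then show False using nz by (cases x) (simp add: f_def g_def)
  qed
  moreover have "(mat.span {X}, mat.span {Y}) \<in> (\<Union>x. basic_open (f x)) \<union> (\<Union>x. basic_open (g x))"
    if X: "X \<in> Sym - {0}" and Y: "Y \<in> Sym - {0}"
      and ne: "(mat.span {X}, mat.span {Y}) \<noteq> (mat.span {X0}, mat.span {Y0})" for X Y
  proof (rule ccontr)
    assume neg: "\<not> ?thesis"
    have f0: "f x (X, Y) = 0" for x using neg X Y unfolding basic_open_def by blast
    have g0: "g x (X, Y) = 0" for x using neg X Y unfolding basic_open_def by blast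
    have "X $ a $ b * X0 $ c $ d = X $ c $ d * X0 $ a $ b" for a b c d using f0[of "(a, b, c, d)"] by (simp add: f_def)
    then obtain k where k: "X = cscale k X0" using proportional_of_minors[OF assms(1)] by blast
    have "Y $ a $ b * Y0 $ c $ d = Y $ c $ d * Y0 $ a $ b" for a b c d using g0[of "(a, b, c, d)"] by (simp add: g_def)
    then obtain l where l: "Y = cscale l Y0" using proportional_of_minors[OF assms(2)] by blast
    have "k \<noteq> 0" "l \<noteq> 0" using X Y k l by auto
    then show False using ne by (simp add: k l span_cscale)
  qed
  ultimately show ?thesis by blast
qed

lemma krull_dim_intersection:
  assumes "finite Z" "Z \<noteq> {}" "Z \<subseteq> XY_zero r"
  shows "krull_dim (subtopology biproj_topology Z) = 0"
proof -
  have pt: "\<exists>X Y. z = (mat.span {X}, mat.span {Y}) \<and> X \<in> Sym - {0} \<and> Y \<in> Sym - {0}" if "z \<in> Z" for z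
    using that assms(3) unfolding XY_zero_def by blast
  have "bihomogeneous (\<lambda>_. 1)"
    unfolding bihomogeneous_def by (intro conjI exI[of _ 0] poly_funs.const) simp
  then have "basic_open (\<lambda>_. 1) \<subseteq> topspace biproj_topology" by (intro openin_subset openin_basic_open)
  moreover have "Z \<subseteq> basic_open (\<lambda>_. 1)" using pt unfolding basic_open_def by fastforce
  ultimately have top: "topspace (subtopology biproj_topology Z) = Z" by auto
  show ?thesis
  proof (rule krull_dim_finite_discrete; (unfold top)?)
    fix z assume z: "z \<in> Z"
    obtain X0 Y0 where z0: "z = (mat.span {X0}, mat.span {Y0})" "X0 \<noteq> 0" "Y0 \<noteq> 0" using pt[OF z] by blast
    obtain W where W: "openin biproj_topology W" "z \<notin> W"
      "\<forall>X Y. X \<in> Sym - {0} \<longrightarrow> Y \<in> Sym - {0} \<longrightarrow> (mat.span {X}, mat.span {Y}) \<noteq> z \<longrightarrow> (mat.span {X}, mat.span {Y}) \<in> W"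
      using biproj_point_complement_open[OF z0(2,3)] unfolding z0(1) by blast
    have "z' \<in> W" if "z' \<in> Z" "z' \<noteq> z" for z' using pt[OF that(1)] that(2) W(3) by metis
    then have "Z - {z} = W \<inter> Z" using W(2) by blast
    then have "openin (subtopology biproj_topology Z) (Z - {z})" using W(1) by (auto simp: openin_subtopology)
    then show "closedin (subtopology biproj_topology Z) {z}"
      unfolding closedin_def top using z by blast
  qed (use assms in simp_all)
qed

section \<open>Reducedness\<close>

text \<open>A linear subspace is the zero set of linear forms in the matrix entries; these are polynomials.\<close>

lemma separating_functional:
  fixes Y :: "complex^'n^'n"
  assumes B: "mat.independent B" and Y: "Y \<notin> mat.span B"
  shows "\<exists>e. (\<forall>M\<in>mat.span B. (\<Sum>a\<in>UNIV. \<Sum>b\<in>UNIV. e a b * M $ a $ b) = 0) \<and>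
    (\<Sum>a\<in>UNIV. \<Sum>b\<in>UNIV. e a b * Y $ a $ b) \<noteq> 0"
proof -
  interpret P: vector_space_pair "cscale :: complex \<Rightarrow> complex^'n^'n \<Rightarrow> complex^'n^'n" "(*) :: complex \<Rightarrow> complex \<Rightarrow> complex"
    by unfold_locales (simp_all add: algebra_simps)
  obtain g where g: "Vector_Spaces.linear cscale (*) g" and gB: "\<forall>M\<in>insert Y B. g M = (if M = Y then 1 else 0)"
    using P.linear_independent_extend[OF mat.independent_insertI[OF Y B], of "\<lambda>M. if M = Y then 1 else 0"]
    by blast
  have "g M = 0" if "M \<in> B" for M using gB that Y mat.span_base[OF that] by auto
  then have gs: "g M = 0" if "M \<in> mat.span B" for M
    using P.linear_eq_0_on_span[OF g _ that] by blast
  define e where "e a b = g (\<chi> k l. if k = a \<and> l = b then 1 else 0)" for a b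
  have "g M = (\<Sum>a\<in>UNIV. \<Sum>b\<in>UNIV. e a b * M $ a $ b)" for M
  proof -
    have "(\<Sum>a\<in>UNIV. \<Sum>b\<in>UNIV. M $ a $ b * (if k = a \<and> l = b then 1 else 0)) = M $ k $ l" for k l
    proof -
      have "(\<Sum>b\<in>UNIV. M $ a $ b * (if k = a \<and> l = b then 1 else 0)) = (if k = a then M $ a $ l else 0)" for a
        by (cases "k = a") (simp_all add: mult_delta_right)
      then show ?thesis by simp
    qed
    then have "M = (\<Sum>a\<in>UNIV. \<Sum>b\<in>UNIV. cscale (M $ a $ b) (\<chi> k l. if k = a \<and> l = b then 1 else 0))"
      by (simp add: vec_eq_iff)
    then have "g M = g (\<Sum>a\<in>UNIV. \<Sum>b\<in>UNIV. cscale (M $ a $ b) (\<chi> k l. if k = a \<and> l = b then 1 else 0))"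
      by (rule arg_cong)
    also have "\<dots> = (\<Sum>a\<in>UNIV. \<Sum>b\<in>UNIV. M $ a $ b * e a b)"
      unfolding P.linear_sum[OF g] P.linear_scale[OF g] e_def ..
    finally show ?thesis by (simp add: mult.commute)
  qed
  then show ?thesis using gs gB by (intro exI[of _ e]) auto
qed

definition pair_crd :: "bool \<times> 'n \<times> 'n \<Rightarrow> (complex^'n^'n) \<times> (complex^'n^'n) \<Rightarrow> complex" where
  "pair_crd k p = (if fst k then fst p else snd p) $ fst (snd k) $ snd (snd k)"

definition pair_line ::
    "(complex^'n^'n) \<times> (complex^'n^'n) \<Rightarrow> (bool \<times> 'n \<times> 'n \<Rightarrow> complex) \<Rightarrow> complex
      \<Rightarrow> (complex^'n^'n) \<times> (complex^'n^'n)" where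
  "pair_line p w s = (fst p + cscale s (\<chi> a b. w (True, a, b)), snd p + cscale s (\<chi> a b. w (False, a, b)))"

lemma range_pair_crd: "range (pair_crd :: bool \<times> 'n::finite \<times> 'n \<Rightarrow> _) = pair_coords" (is "?L = ?R")
proof
  show "?L \<subseteq> ?R"
  proof (rule image_subsetI)
    fix k :: "bool \<times> 'n \<times> 'n"
    obtain b i j where k: "k = (b, i, j)" by (cases k)
    show "pair_crd k \<in> pair_coords"
      unfolding k pair_crd_def[abs_def] pair_coords_def by (cases b) auto
  qed
  show "?R \<subseteq> ?L"
  proof
    fix f :: "(complex^'n^'n) \<times> (complex^'n^'n) \<Rightarrow> complex" assume "f \<in> pair_coords"
    then obtain i j where "f = (\<lambda>p. fst p $ i $ j) \<or> f = (\<lambda>p. snd p $ i $ j)" by (auto simp: pair_coords_def)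
    then have "f = pair_crd (True, i, j) \<or> f = pair_crd (False, i, j)" by (auto simp: pair_crd_def)
    then show "f \<in> range pair_crd" by blast
  qed
qed

lemma poly_ideal_vanishing_sum: "poly_ideal C (ideal_sum (vanishing_ideal C S) (vanishing_ideal C T))"
  unfolding poly_ideal_def
proof (intro conjI ballI)
  show "ideal_sum (vanishing_ideal C S) (vanishing_ideal C T) \<subseteq> poly_funs C"
    by (auto simp: ideal_sum_def vanishing_ideal_def intro: poly_funs.add)
  show "(\<lambda>x. 0) \<in> ideal_sum (vanishing_ideal C S) (vanishing_ideal C T)"
    unfolding ideal_sum_def vanishing_ideal_def
    by (intro CollectI exI[of _ "\<lambda>_. 0"]) (simp add: poly_funs.const)
  fix f assume "f \<in> ideal_sum (vanishing_ideal C S) (vanishing_ideal C T)"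
  then obtain f1 f2 where f: "f = (\<lambda>x. f1 x + f2 x)" "f1 \<in> vanishing_ideal C S" "f2 \<in> vanishing_ideal C T"
    by (auto simp: ideal_sum_def)
  show "(\<lambda>x. g x * f x) \<in> ideal_sum (vanishing_ideal C S) (vanishing_ideal C T)" if "g \<in> poly_funs C" for g
    unfolding ideal_sum_def
    by (intro CollectI exI[of _ "\<lambda>x. g x * f1 x"] exI[of _ "\<lambda>x. g x * f2 x"] conjI)
      (use f that in \<open>auto simp: vanishing_ideal_def distrib_left intro: poly_funs.mult\<close>)
  fix g assume "g \<in> ideal_sum (vanishing_ideal C S) (vanishing_ideal C T)"
  then obtain g1 g2 where g: "g = (\<lambda>x. g1 x + g2 x)" "g1 \<in> vanishing_ideal C S" "g2 \<in> vanishing_ideal C T"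
    by (auto simp: ideal_sum_def)
  show "(\<lambda>x. f x + g x) \<in> ideal_sum (vanishing_ideal C S) (vanishing_ideal C T)"
    unfolding ideal_sum_def
    by (intro CollectI exI[of _ "\<lambda>x. f1 x + g1 x"] exI[of _ "\<lambda>x. f2 x + g2 x"] conjI)
      (use f g in \<open>auto simp: vanishing_ideal_def algebra_simps intro: poly_funs.add\<close>)
qed

lemma vanishing_in_sum:
  assumes "f \<in> poly_funs C" "(\<forall>x\<in>S. f x = 0) \<or> (\<forall>x\<in>T. f x = 0)"
  shows "f \<in> ideal_sum (vanishing_ideal C S) (vanishing_ideal C T)"
  using assms(2)
proof
  assume "\<forall>x\<in>S. f x = 0"
  then show ?thesis unfolding ideal_sum_def vanishing_ideal_def using assms(1)
    by (intro CollectI exI[of _ f] exI[of _ "\<lambda>_. 0"]) (simp add: poly_funs.const)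
next
  assume "\<forall>x\<in>T. f x = 0"
  then show ?thesis unfolding ideal_sum_def vanishing_ideal_def using assms(1)
    by (intro CollectI exI[of _ "\<lambda>_. 0"] exI[of _ f]) (simp add: poly_funs.const)
qed

text \<open>On an affine chart the two ideals contain the equations of a solution, so a common zero is a
  solution and a tangent vector there satisfies the linearised equations. Regularity leaves only the
  two scaling directions, and the normalisation of the chart excludes these.\<close>

lemma reduced_intersection_good:
  fixes A :: "nat \<Rightarrow> complex^'n^'n"
  assumes A: "A \<in> frames m" and gd: "good m r A"
  shows "reduced_intersection (XY_zero r) (linear_section (mat.span (A ` {..<m - 1})) (mat.span (A ` {..m})))"
  unfolding reduced_intersection_def
proof (intro allI)
  fix i j k l :: 'n
  note fA = framesD[OF A]
  let ?S = "affine_part i j k l (XY_zero r)"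
  let ?T = "affine_part i j k l (linear_section (mat.span (A ` {..<m - 1})) (mat.span (A ` {..m})))"
  let ?J = "ideal_sum (vanishing_ideal pair_coords ?S) (vanishing_ideal pair_coords ?T)"
  have S: "fst q \<in> Sym" "snd q \<in> Sym" "fst q $ i $ j = 1" "snd q $ k $ l = 1" "fst q ** snd q = 0"
    "rank (fst q) \<le> CARD('n) - r" "rank (snd q) \<le> r" if "q \<in> ?S" for q
  proof -
    have q: "fst q \<in> Sym" "snd q \<in> Sym" "fst q $ i $ j = 1" "snd q $ k $ l = 1"
      "(mat.span {fst q}, mat.span {snd q}) \<in> XY_zero r" using that by (auto simp: affine_part_def)
    then have "fst q \<noteq> 0" "snd q \<noteq> 0" by auto
    from XY_zero_line[OF q(5) this] show "fst q \<in> Sym" "snd q \<in> Sym" "fst q $ i $ j = 1" "snd q $ k $ l = 1"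
      "fst q ** snd q = 0" "rank (fst q) \<le> CARD('n) - r" "rank (snd q) \<le> r" using q by blast+
  qed
  have T: "\<forall>n<m - 1. trace (fst q ** A n) = 0" "snd q \<in> mat.span (A ` {..m})" if "q \<in> ?T" for q
  proof -
    have q: "(mat.span {fst q}, mat.span {snd q}) \<in> linear_section (mat.span (A ` {..<m - 1})) (mat.span (A ` {..m}))"
      using that by (auto simp: affine_part_def)
    show "\<forall>n<m - 1. trace (fst q ** A n) = 0" "snd q \<in> mat.span (A ` {..m})"
      using linear_section_line[OF q] by (auto simp: annihilator_span)
  qed
  have "radical_ideal (range pair_crd) ?J"
  proof (rule jacobian_criterion_radical[where line = pair_line])
    show "pair_crd \<kappa> (pair_line p w s) = pair_crd \<kappa> p + s * w \<kappa>" for \<kappa> p w s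
      by (cases \<kappa>) (simp add: pair_crd_def pair_line_def)
    show "poly_ideal (range pair_crd) ?J" unfolding range_pair_crd by (rule poly_ideal_vanishing_sum)
    fix p and w :: "bool \<times> 'n \<times> 'n \<Rightarrow> complex"
    assume zero: "\<And>f. f \<in> ?J \<Longrightarrow> f p = 0"
      and deriv: "\<And>f. f \<in> ?J \<Longrightarrow> ((\<lambda>s. f (pair_line p w s)) has_field_derivative 0) (at 0)"
    define X Y where "X = fst p" and "Y = snd p"
    define X' Y' :: "complex^'n^'n" where "X' = (\<chi> a b. w (True, a, b))" and "Y' = (\<chi> a b. w (False, a, b))"
    let ?X = "\<lambda>s. X + cscale s X'" and ?Y = "\<lambda>s. Y + cscale s Y'"
    have line: "pair_line p w s = (?X s, ?Y s)" for s by (simp add: pair_line_def X_def Y_def X'_def Y'_def)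
    have p: "p = (X, Y)" by (simp add: X_def Y_def)
    have fJ: "f (X, Y) = 0" "((\<lambda>s. f (?X s, ?Y s)) has_field_derivative 0) (at 0)"
      if "f \<in> poly_funs pair_coords" "(\<forall>q\<in>?S. f q = 0) \<or> (\<forall>q\<in>?T. f q = 0)" for f
    proof -
      show "f (X, Y) = 0" using zero[OF vanishing_in_sum[OF that]] unfolding p .
      show "((\<lambda>s. f (?X s, ?Y s)) has_field_derivative 0) (at 0)"
        using deriv[OF vanishing_in_sum[OF that]] unfolding line .
    qed
    have MJ: "M (X, Y) = 0" "mat_deriv (\<lambda>s. M (?X s, ?Y s)) 0"
      if M: "poly_matrix pair_coords M" "\<forall>q\<in>?S. M q = 0" for M :: "_ \<Rightarrow> complex^'n^'n"
    proof -
      have c: "(\<forall>q\<in>?S. M q $ a $ b = 0) \<or> (\<forall>q\<in>?T. M q $ a $ b = 0)" for a b using M(2) by simp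
      show "M (X, Y) = 0"
        unfolding vec_eq_iff zero_index using fJ(1)[OF poly_matrix_entry[OF M(1)] c] by blast
      show "mat_deriv (\<lambda>s. M (?X s, ?Y s)) 0"
        unfolding mat_deriv_def zero_index using fJ(2)[OF poly_matrix_entry[OF M(1)] c] by blast
    qed
    have pm: "poly_matrix pair_coords fst" "poly_matrix pair_coords snd"
      by (simp_all add: poly_matrix_def pair_coord)
    have mX: "mat_deriv ?X X'" and mY: "mat_deriv ?Y Y'" by (rule mat_deriv_line)+
    have symX: "\<forall>q\<in>?S. fst q - transpose (fst q) = 0" and symY: "\<forall>q\<in>?S. snd q - transpose (snd q) = 0"
      using S(1,2) Sym_transpose by fastforce+
    have X: "X \<in> Sym" "X' \<in> Sym"
      using MJ(1)[OF poly_matrix_diff[OF pm(1) poly_matrix_transpose[OF pm(1)]] symX]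
        mat_deriv_unique[OF mat_deriv_diff[OF mX mat_deriv_transpose[OF mX]]
          MJ(2)[OF poly_matrix_diff[OF pm(1) poly_matrix_transpose[OF pm(1)]] symX, unfolded fst_conv]]
      by (simp_all add: Sym_def)
    have Y: "Y \<in> Sym" "Y' \<in> Sym"
      using MJ(1)[OF poly_matrix_diff[OF pm(2) poly_matrix_transpose[OF pm(2)]] symY]
        mat_deriv_unique[OF mat_deriv_diff[OF mY mat_deriv_transpose[OF mY]]
          MJ(2)[OF poly_matrix_diff[OF pm(2) poly_matrix_transpose[OF pm(2)]] symY, unfolded snd_conv]]
      by (simp_all add: Sym_def)
    have entry: "((\<lambda>s. M s $ a $ b - 1) has_field_derivative M' $ a $ b) (at 0)" if "mat_deriv M M'" for M M' a b
      using DERIV_diff[OF _ DERIV_const, of "\<lambda>s. M s $ a $ b" "M' $ a $ b"] that unfolding mat_deriv_def by simp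
    have nX: "X $ i $ j = 1" "X' $ i $ j = 0"
    proof -
      have f: "(\<lambda>q. fst q $ i $ j - 1) \<in> poly_funs pair_coords"
        by (intro poly_funs_diff pair_coord poly_funs.const)
      have z: "(\<forall>q\<in>?S. fst q $ i $ j - 1 = 0) \<or> (\<forall>q\<in>?T. fst q $ i $ j - 1 = 0)" using S(3) by simp
      show "X $ i $ j = 1" using fJ(1)[OF f z] by simp
      show "X' $ i $ j = 0" using DERIV_unique[OF entry[OF mX] fJ(2)[OF f z, unfolded fst_conv]] .
    qed
    have nY: "Y $ k $ l = 1" "Y' $ k $ l = 0"
    proof -
      have f: "(\<lambda>q. snd q $ k $ l - 1) \<in> poly_funs pair_coords"
        by (intro poly_funs_diff pair_coord poly_funs.const)
      have z: "(\<forall>q\<in>?S. snd q $ k $ l - 1 = 0) \<or> (\<forall>q\<in>?T. snd q $ k $ l - 1 = 0)" using S(4) by simp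
      show "Y $ k $ l = 1" using fJ(1)[OF f z] by simp
      show "Y' $ k $ l = 0" using DERIV_unique[OF entry[OF mY] fJ(2)[OF f z, unfolded snd_conv]] .
    qed
    have XY: "X ** Y = 0" "X' ** Y + X ** Y' = 0"
    proof -
      have z: "\<forall>q\<in>?S. fst q ** snd q = 0" using S(5) by blast
      show "X ** Y = 0" using MJ(1)[OF poly_matrix_mult[OF pm] z] by simp
      show "X' ** Y + X ** Y' = 0"
        using mat_deriv_unique[OF mat_deriv_mult[OF mX mY]
            MJ(2)[OF poly_matrix_mult[OF pm] z, unfolded fst_conv snd_conv]] by simp
    qed
    have rank: "rank (M (X, Y)) \<le> t"
      if M: "poly_matrix pair_coords M" "\<And>q. q \<in> ?S \<Longrightarrow> M q \<in> Sym" "\<And>q. q \<in> ?S \<Longrightarrow> rank (M q) \<le> t"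
        "M (X, Y) \<in> Sym" for M :: "_ \<Rightarrow> complex^'n^'n" and t
    proof (rule ccontr)
      assume "\<not> rank (M (X, Y)) \<le> t"
      then have less: "vec.dim (range ((*v) (M q))) < vec.dim (range ((*v) (M (X, Y))))" if "q \<in> ?S" for q
        using rank_symmetric[OF M(2)[OF that]] rank_symmetric[OF M(4)] M(3)[OF that] by linarith
      obtain D where D: "det (M (X, Y) + D) \<noteq> 0"
        "\<forall>N. vec.dim (range ((*v) N)) < vec.dim (range ((*v) (M (X, Y)))) \<longrightarrow> det (N + D) = 0"
        using rank_detecting_determinant[of "M (X, Y)"] by blast
      have "det (M (X, Y) + D) = 0"
        by (rule fJ(1)[OF poly_matrix_det[OF poly_matrix_add[OF M(1) poly_matrix_const]]])
          (use D(2) less in blast)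
      then show False using D(1) by blast
    qed
    have rk: "rank X \<le> CARD('n) - r" "rank Y \<le> r"
      using rank[OF pm(1) S(1) S(6)] rank[OF pm(2) S(2) S(7)] X Y by simp_all
    have perp: "trace (X ** A n) = 0" "trace (X' ** A n) = 0" if n: "n < m - 1" for n
    proof -
      have f: "(\<lambda>q. trace (fst q ** A n)) \<in> poly_funs pair_coords"
        by (intro poly_matrix_trace poly_matrix_mult poly_matrix_const pm)
      have z: "(\<forall>q\<in>?S. trace (fst q ** A n) = 0) \<or> (\<forall>q\<in>?T. trace (fst q ** A n) = 0)" using T(1) n by blast
      show "trace (X ** A n) = 0" using fJ(1)[OF f z] by simp
      show "trace (X' ** A n) = 0"
        using DERIV_unique[OF mat_deriv_trace[OF mat_deriv_mult[OF mX mat_deriv_const]] fJ(2)[OF f z, unfolded fst_conv]]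
        by simp
    qed
    have span: "Y \<in> mat.span (A ` {..m})" "Y' \<in> mat.span (A ` {..m})"
    proof -
      have e0: "(\<Sum>a\<in>UNIV. \<Sum>b\<in>UNIV. e a b * Y $ a $ b) = 0" "(\<Sum>a\<in>UNIV. \<Sum>b\<in>UNIV. e a b * Y' $ a $ b) = 0"
        if e: "\<forall>M\<in>mat.span (A ` {..m}). (\<Sum>a\<in>UNIV. \<Sum>b\<in>UNIV. e a b * M $ a $ b) = 0" for e
      proof -
        have f: "(\<lambda>q. \<Sum>a\<in>UNIV. \<Sum>b\<in>UNIV. e a b * snd q $ a $ b) \<in> poly_funs pair_coords"
          by (intro poly_funs_sum poly_funs_cmult pair_coord)
        have z: "(\<forall>q\<in>?S. (\<Sum>a\<in>UNIV. \<Sum>b\<in>UNIV. e a b * snd q $ a $ b) = 0) \<or>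
            (\<forall>q\<in>?T. (\<Sum>a\<in>UNIV. \<Sum>b\<in>UNIV. e a b * snd q $ a $ b) = 0)" using T(2) e by blast
        show "(\<Sum>a\<in>UNIV. \<Sum>b\<in>UNIV. e a b * Y $ a $ b) = 0" using fJ(1)[OF f z] by simp
        have "((\<lambda>s. \<Sum>a\<in>UNIV. \<Sum>b\<in>UNIV. e a b * ?Y s $ a $ b) has_field_derivative
            (\<Sum>a\<in>UNIV. \<Sum>b\<in>UNIV. e a b * Y' $ a $ b)) (at 0)"
          using mY unfolding mat_deriv_def by (intro DERIV_sum DERIV_cmult) blast
        then show "(\<Sum>a\<in>UNIV. \<Sum>b\<in>UNIV. e a b * Y' $ a $ b) = 0"
          by (rule DERIV_unique[OF _ fJ(2)[OF f z, unfolded snd_conv]])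
      qed
      show "Y \<in> mat.span (A ` {..m})" "Y' \<in> mat.span (A ` {..m})"
        using separating_functional[OF fA(3)] e0 by blast+
    qed
    obtain c where c: "Y = combination m A c" using span_frame[OF fA(2) span(1)] .
    obtain b where b: "Y' = combination m A b" using span_frame[OF fA(2) span(2)] .
    have sol: "solution m r A X c" using X(1) perp(1) XY(1) rk c by (simp add: solution_def)
    have "X \<noteq> 0" using nX by auto
    moreover have "\<exists>q\<le>m. c q \<noteq> 0"
    proof (rule ccontr)
      assume "\<not> ?thesis"
      then have "Y = 0" unfolding c combination_def by (intro sum.neutral) auto
      then show False using nY by simp
    qed
    ultimately have "regular m A X c" using gd sol unfolding good_def by blast
    then obtain s u where s: "X' = cscale s X" and u: "\<forall>q\<le>m. b q = u * c q"
      using X(2) perp(2) XY(2) unfolding regular_def b c by blast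
    have "s = 0" using nX s by simp
    then have X0: "X' = 0" using s by simp
    have "Y' = cscale u Y" unfolding b c combination_scale[symmetric] by (rule combination_cong) (use u in simp)
    moreover from this have "u = 0" using nY by simp
    ultimately have Y0: "Y' = 0" by simp
    have "w \<kappa> = 0" for \<kappa>
    proof -
      obtain t a b where \<kappa>: "\<kappa> = (t, a, b)" by (cases \<kappa>)
      have "X' $ a $ b = 0" "Y' $ a $ b = 0" by (simp_all add: X0 Y0)
      then show ?thesis by (cases t) (simp_all add: \<kappa> X'_def Y'_def)
    qed
    then show "w = (\<lambda>_. 0)" by blast
  qed
  then show "radical_ideal pair_coords ?J" unfolding range_pair_crd .
qed

section \<open>The intersection for a generic flag\<close>

lemma choose_two_le_square: "(n + 1) choose 2 \<le> n * n" if "1 \<le> n" for n :: nat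
proof -
  have "n \<le> n * n" by (rule le_square)
  then have "(n + 1) * n \<le> 2 * (n * n)" by simp
  from div_le_mono[OF this, of 2] show ?thesis unfolding choose_two by simp
qed

theorem theorem7:
  fixes n r m :: nat
  assumes "n = CARD('n::finite)"
    and "2 \<le> n"
    and "1 \<le> r" and "r \<le> n - 1"
    and "1 \<le> m" and "m \<le> ((n + 1) choose 2) - 1"
  shows "\<exists>(G :: ((complex^'n^'n) set \<times> (complex^'n^'n) set) set) (d :: nat).
    zariski_open_flags m G \<and> G \<noteq> {} \<and>
    (\<forall>(V, U) \<in> G.
       let Z = XY_zero r \<inter> linear_section V U;
           pataki = ((n - r + 1) choose 2 \<le> m \<and> (r + 1) choose 2 \<le> ((n + 1) choose 2) - m)
       in (\<not> pataki \<longrightarrow> Z = {}) \<and>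
          (pataki \<longrightarrow>
             reduced_intersection (XY_zero r) (linear_section V U) \<and>
             Z \<noteq> {} \<and>
             krull_dim (subtopology biproj_topology Z) = 0 \<and>
             (\<forall>X Y. (mat.span {X}, mat.span {Y}) \<in> Z \<longrightarrow> rank X = n - r \<and> rank Y = r)) \<and>
          finite Z \<and> card Z = d)"
proof -
  have n: "CARD('n) = n" using assms(1) by simp
  have r: "1 \<le> r" "r < CARD('n)" using assms(2-4) n by linarith+
  have m: "1 \<le> m" "m < (CARD('n) + 1) choose 2" using assms(5,6) unfolding n by linarith+
  have m2: "m < CARD('n) * CARD('n)" using m(2) choose_two_le_square[of "CARD('n)"] by simp
  have "generic m (\<lambda>A :: nat \<Rightarrow> complex^'n^'n. good m r A \<and> independent_frame m A)"
    unfolding independent_frame_def by (intro generic_conj generic_good generic_independent m m2 r)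
  then obtain R and A1 :: "nat \<Rightarrow> complex^'n^'n" where R: "R \<in> poly_funs (frame_coords m)"
    and A1: "sym_frame m A1" "R A1 \<noteq> 0"
    and RA: "\<forall>A. sym_frame m A \<and> R A \<noteq> 0 \<longrightarrow> good m r A \<and> independent_frame m A"
    unfolding generic_def by blast
  have gd: "good m r A" and ind: "independent_frame m A" if "sym_frame m A" "R A \<noteq> 0" for A
    using RA that by blast+
  obtain \<iota> :: "nat \<Rightarrow> 'n \<times> 'n" where \<iota>: "inj_on \<iota> {..m}" using frame_index[OF m2] .
  let ?H = "{A \<in> frames m. R A \<noteq> 0}"
  let ?N = "normal_solutions \<iota> m r"
  define pataki where "pataki \<longleftrightarrow> (n - r + 1) choose 2 \<le> m \<and> (r + 1) choose 2 \<le> ((n + 1) choose 2) - m"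
  have const: "finite (?N A)" "card (?N A) = card (?N B)"
    if "sym_frame m A" "R A \<noteq> 0" "sym_frame m B" "R B \<noteq> 0" for A B
    using card_normal_solutions_constant[OF m2 m(1) \<iota> R gd that] by blast+
  have "flag_of m (restrict A1 {..m}) \<in> flag_of m ` ?H"
  proof -
    have S: "sym_frame m (restrict A1 {..m})" using A1(1) by (simp add: sym_frame_def)
    have "R (restrict A1 {..m}) = R A1" by (rule poly_funs_frame_cong[OF R]) simp
    then have "R (restrict A1 {..m}) \<noteq> 0" using A1(2) by simp
    moreover from independent_frame_frames[OF ind[OF S this] S]
    have "restrict A1 {..m} \<in> frames m" by simp
    ultimately show ?thesis by simp
  qed
  then have ne: "flag_of m ` ?H \<noteq> {}" by blast
  have main: "(\<not> pataki \<longrightarrow> intersection m r A = {}) \<and>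
      (pataki \<longrightarrow>
         reduced_intersection (XY_zero r) (linear_section (mat.span (A ` {..<m - 1})) (mat.span (A ` {..m}))) \<and>
         intersection m r A \<noteq> {} \<and>
         krull_dim (subtopology biproj_topology (intersection m r A)) = 0 \<and>
         (\<forall>X Y. (mat.span {X}, mat.span {Y}) \<in> intersection m r A \<longrightarrow> rank X = n - r \<and> rank Y = r)) \<and>
      finite (intersection m r A) \<and> card (intersection m r A) = card (?N A1)"
    if "A \<in> ?H" for A
  proof -
    have A: "A \<in> frames m" "R A \<noteq> 0" using that by auto
    note S = framesD(1)[OF A(1)]
    note g = gd[OF S A(2)]
    note bij = intersection_normal_solutions[OF A(1) g \<iota>]
    have fin: "finite (intersection m r A)" using bij_betw_finite[OF bij] const(1)[OF S A(2) A1] by blast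
    have card: "card (intersection m r A) = card (?N A1)"
      using bij_betw_same_card[OF bij] const(2)[OF S A(2) A1] by simp
    have empty: "intersection m r A = {}" if "\<not> pataki"
    proof (rule ccontr)
      assume "intersection m r A \<noteq> {}"
      then obtain z where "z \<in> intersection m r A" by blast
      then obtain X c where "solution m r A X c" "X \<noteq> 0" "\<exists>q\<le>m. c q \<noteq> 0" unfolding intersection_iff[OF A(1)] by blast
      then have pataki using g unfolding good_def pataki_def n by blast
      then show False using that by blast
    qed
    have nonempty: "intersection m r A \<noteq> {}" if pataki
    proof -
      have "\<exists>B :: nat \<Rightarrow> complex^'n^'n. sym_frame m B \<and> R B \<noteq> 0 \<and> ?N B \<noteq> {}"
        by (rule normal_solutions_nonempty[OF r m m2 _ _ \<iota> R gd A1]) (use that in \<open>simp_all add: pataki_def n\<close>)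
      then obtain B :: "nat \<Rightarrow> complex^'n^'n" where B: "sym_frame m B" "R B \<noteq> 0" "?N B \<noteq> {}" by blast
      have "card (?N B) \<noteq> 0" using B(3) const(1)[OF B(1,2) A1] by simp
      then have "card (intersection m r A) \<noteq> 0" using const(2)[OF B(1,2) A1] card by simp
      then show ?thesis by auto
    qed
    have "krull_dim (subtopology biproj_topology (intersection m r A)) = 0" if pataki
      by (rule krull_dim_intersection[OF fin nonempty[OF that]]) (auto simp: intersection_def)
    moreover have "rank X = n - r \<and> rank Y = r" if "(mat.span {X}, mat.span {Y}) \<in> intersection m r A" for X Y
      using intersection_ranks[OF A(1) g that] unfolding n by blast
    ultimately show ?thesis using empty nonempty fin card reduced_intersection_good[OF A(1) g] by blast
  qed
  show ?thesis
  proof (intro exI[of _ "flag_of m ` ?H"] exI[of _ "card (?N A1)"] conjI ne)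
    show "zariski_open_flags m (flag_of m ` ?H)" by (rule zariski_open_flags_image[OF R ind])
    show "\<forall>(V, U) \<in> flag_of m ` ?H.
       let Z = XY_zero r \<inter> linear_section V U;
           pataki = ((n - r + 1) choose 2 \<le> m \<and> (r + 1) choose 2 \<le> ((n + 1) choose 2) - m)
       in (\<not> pataki \<longrightarrow> Z = {}) \<and>
          (pataki \<longrightarrow>
             reduced_intersection (XY_zero r) (linear_section V U) \<and>
             Z \<noteq> {} \<and>
             krull_dim (subtopology biproj_topology Z) = 0 \<and>
             (\<forall>X Y. (mat.span {X}, mat.span {Y}) \<in> Z \<longrightarrow> rank X = n - r \<and> rank Y = r)) \<and>
          finite Z \<and> card Z = card (?N A1)"
    proof (rule ballI)
      fix F assume "F \<in> flag_of m ` ?H"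
      then obtain A where F: "F = flag_of m A" and A: "A \<in> ?H" by (rule imageE)
      show "case F of (V, U) \<Rightarrow> let Z = XY_zero r \<inter> linear_section V U;
           pataki = ((n - r + 1) choose 2 \<le> m \<and> (r + 1) choose 2 \<le> ((n + 1) choose 2) - m)
       in (\<not> pataki \<longrightarrow> Z = {}) \<and>
          (pataki \<longrightarrow>
             reduced_intersection (XY_zero r) (linear_section V U) \<and>
             Z \<noteq> {} \<and>
             krull_dim (subtopology biproj_topology Z) = 0 \<and>
             (\<forall>X Y. (mat.span {X}, mat.span {Y}) \<in> Z \<longrightarrow> rank X = n - r \<and> rank Y = r)) \<and>
          finite Z \<and> card Z = card (?N A1)"
        using main[OF A] unfolding F flag_of_def prod.case Let_def intersection_def pataki_def .
    qed
  qed
qed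

end
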